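(* Let $\Sigma$ be a (one-sorted symmetric monoidal) signature. Then there is an isomorphism of PROPs $$\mathbf{FTerm}_\Sigma \;\cong\; \mathbf{S}_\Sigma + \mathbf{Frob},$$ where $+$ denotes the coproduct in the category $\mathbf{PROP}$ of PROPs.
   Context: Composition is written in diagrammatic order: $f;g\colon a\to c$ for $f\colon a\to b$, $g\colon b\to c$. PROPs. A PROP is a symmetric strict monoidal category whose objects are the natural numbers, with monoidal product $\oplus$ given on objects by addition; $\sigma_{n,m}\colon n+m\to m+n$ are the symmetries. Morphisms of PROPs are identity-on-objects strict symmetric monoidal functors; this gives the category $\mathbf{PROP}$. A signature $\Sigma$ is a set of generators $o\colon n\to m$, each with an arity $n\in\mathbb{N}$ and a coarity $m\in\mathbb{N}$. $\mathbf{S}_\Sigma$ is the PROP freely generated by $\Sigma$ with no equations: arrows $n\to m$ are $\Sigma$-terms $n\to m$ (built from generators, identities and symmetries with $;$ and $\oplus$) modulo the laws of symmetric strict monoidal categories. $\mathbf{Frob}$ is the PROP freely generated by $\mu\colon 2\to 1$, $\eta\colon 0\to 1$, $\delta\colon 1\to 2$, $\varepsilon\colon 1\to 0$ subject to the equations of special (commutative) Frobenius monoids: $(\mu,\eta)$ is a commutative monoid, $(\delta,\varepsilon)$ is a cocommutative comonoid, $(\delta\oplus \mathrm{id}_1);(\mathrm{id}_1\oplus\mu)=\mu;\delta=(\mathrm{id}_1\oplus\delta);(\mu\oplus\mathrm{id}_1)$ (Frobenius law), and $\delta;\mu=\mathrm{id}_1$ (special law). Hypergraphs. A (finite directed) hypergraph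 $G$ has a finite set $N_G$ of nodes and a finite set $E_G$ of hyperedges; each hyperedge $h$ has, for some $k,l\in\mathbb{N}$, an ordered list of $k$ source nodes and an ordered list of $l$ target nodes (repetitions allowed). Homomorphisms are pairs of functions on nodes and hyperedges preserving the numbers $k,l$ and all sources and targets. A $\Sigma$-hypergraph is a hypergraph in which each hyperedge with $k$ sources and $l$ targets is labelled by a generator $k\to l$ of $\Sigma$; $\mathbf{Hyp}_\Sigma$ is the category of $\Sigma$-hypergraphs and label-preserving homomorphisms. It has pushouts, computed pointwise. A hypergraph is discrete if it has no hyperedges; $n\in\mathbb{N}$ is identified with the discrete hypergraph with node set $\{0,\dots,n-1\}$. $\mathbf{FTerm}_\Sigma$ is the PROP whose arrows $n\to m$ are isomorphism classes of cospans $n\to G\leftarrow m$ in $\mathbf{Hyp}_\Sigma$ with $n,m$ discrete (that is, the full subcategory on discrete hypergraphs of the category of cospans in $\mathbf{Hyp}_\Sigma$); composition is by pushout and $\oplus$ is disjoint union. *)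

theory Defs
  imports Main "HOL-Library.FuncSet" "HOL-Library.Nat_Bijection"
begin

section \<open>PROPs\<close>

text \<open>
  A PROP is given by its hom-sets \<open>arr P n m\<close> (the objects being the natural numbers, with
  addition as the monoidal product on objects), its identities, composition in diagrammatic
  order, monoidal product of arrows, and symmetries \<open>braid P n m : n + m \<rightarrow> m + n\<close>.
  Hom-sets are required to be disjoint, so that an arrow has a domain and a codomain.
\<close>

record 'a prop_struct =
  arr :: "nat \<Rightarrow> nat \<Rightarrow> 'a set"
  ident :: "nat \<Rightarrow> 'a"
  seq :: "'a \<Rightarrow> 'a \<Rightarrow> 'a"  (infixl "\<Zsemi>\<index>" 60)
  par :: "'a \<Rightarrow> 'a \<Rightarrow> 'a"  (infixl "\<oplus>\<index>" 65)
  braid :: "nat \<Rightarrow> nat \<Rightarrow> 'a"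

locale is_prop =
  fixes P :: "'a prop_struct" (structure)
  assumes arr_disjoint: "f \<in> arr P n m \<Longrightarrow> f \<in> arr P n' m' \<Longrightarrow> n = n' \<and> m = m'"
    and ident_arr: "ident P n \<in> arr P n n"
    and seq_arr: "f \<in> arr P n m \<Longrightarrow> g \<in> arr P m k \<Longrightarrow> f \<Zsemi> g \<in> arr P n k"
    and par_arr: "f \<in> arr P n m \<Longrightarrow> g \<in> arr P n' m' \<Longrightarrow> f \<oplus> g \<in> arr P (n + n') (m + m')"
    and braid_arr: "braid P n m \<in> arr P (n + m) (m + n)"
    and seq_assoc: "f \<in> arr P n m \<Longrightarrow> g \<in> arr P m k \<Longrightarrow> h \<in> arr P k l
      \<Longrightarrow> (f \<Zsemi> g) \<Zsemi> h = f \<Zsemi> (g \<Zsemi> h)"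
    and ident_seq: "f \<in> arr P n m \<Longrightarrow> ident P n \<Zsemi> f = f"
    and seq_ident: "f \<in> arr P n m \<Longrightarrow> f \<Zsemi> ident P m = f"
    and par_assoc: "f \<in> arr P n m \<Longrightarrow> g \<in> arr P n' m' \<Longrightarrow> h \<in> arr P n'' m''
      \<Longrightarrow> (f \<oplus> g) \<oplus> h = f \<oplus> (g \<oplus> h)"
    and ident_par: "f \<in> arr P n m \<Longrightarrow> ident P 0 \<oplus> f = f"
    and par_ident: "f \<in> arr P n m \<Longrightarrow> f \<oplus> ident P 0 = f"
    and interchange: "f \<in> arr P n m \<Longrightarrow> f' \<in> arr P m k \<Longrightarrow> g \<in> arr P n' m' \<Longrightarrow> g' \<in> arr P m' k'
      \<Longrightarrow> (f \<oplus> g) \<Zsemi> (f' \<oplus> g') = (f \<Zsemi> f') \<oplus> (g \<Zsemi> g')"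
    and ident_par_ident: "ident P n \<oplus> ident P m = ident P (n + m)"
    and braid_natural: "f \<in> arr P n m \<Longrightarrow> g \<in> arr P n' m'
      \<Longrightarrow> (f \<oplus> g) \<Zsemi> braid P m m' = braid P n n' \<Zsemi> (g \<oplus> f)"
    and braid_braid: "braid P n m \<Zsemi> braid P m n = ident P (n + m)"
    and braid_hexagon:
      "braid P n (m + k) = (braid P n m \<oplus> ident P k) \<Zsemi> (ident P m \<oplus> braid P n k)"
    and braid_unit: "braid P n 0 = ident P n"

text \<open>
  Morphisms of PROPs: identity-on-objects strict symmetric monoidal functors. Only their values on
  arrows of the domain matter.
\<close>

definition prop_morphism :: "'a prop_struct \<Rightarrow> 'b prop_struct \<Rightarrow> ('a \<Rightarrow> 'b) \<Rightarrow> bool" where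
  "prop_morphism P Q F \<longleftrightarrow>
     is_prop P \<and> is_prop Q \<and>
     (\<forall>n m. \<forall>f \<in> arr P n m. F f \<in> arr Q n m) \<and>
     (\<forall>n. F (ident P n) = ident Q n) \<and>
     (\<forall>n m k. \<forall>f \<in> arr P n m. \<forall>g \<in> arr P m k. F (f \<Zsemi>\<^bsub>P\<^esub> g) = F f \<Zsemi>\<^bsub>Q\<^esub> F g) \<and>
     (\<forall>n m n' m'. \<forall>f \<in> arr P n m. \<forall>g \<in> arr P n' m'. F (f \<oplus>\<^bsub>P\<^esub> g) = F f \<oplus>\<^bsub>Q\<^esub> F g) \<and>
     (\<forall>n m. F (braid P n m) = braid Q n m)"

definition eq_on_arrows :: "'a prop_struct \<Rightarrow> ('a \<Rightarrow> 'b) \<Rightarrow> ('a \<Rightarrow> 'b) \<Rightarrow> bool" where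
  "eq_on_arrows P F G \<longleftrightarrow> (\<forall>n m. \<forall>f \<in> arr P n m. F f = G f)"

definition isomorphic_props :: "'a prop_struct \<Rightarrow> 'b prop_struct \<Rightarrow> bool"  (infix "\<cong>\<^sub>P" 50) where
  "P \<cong>\<^sub>P Q \<longleftrightarrow> (\<exists>F G. prop_morphism P Q F \<and> prop_morphism Q P G \<and>
     eq_on_arrows P (G \<circ> F) id \<and> eq_on_arrows Q (F \<circ> G) id)"

text \<open>
  The universal property of a coproduct \<open>C\<close> of \<open>P\<close> and \<open>Q\<close> with injections \<open>i\<close> and \<open>j\<close>, tested on
  PROPs whose arrows are elements of the type given by the first argument.
\<close>

definition is_prop_coproduct ::
  "'d itself \<Rightarrow> 'a prop_struct \<Rightarrow> 'b prop_struct \<Rightarrow> 'c prop_struct \<Rightarrow> ('a \<Rightarrow> 'c) \<Rightarrow> ('b \<Rightarrow> 'c) \<Rightarrow> bool"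
where
  "is_prop_coproduct _ P Q C i j \<longleftrightarrow>
     prop_morphism P C i \<and> prop_morphism Q C j \<and>
     (\<forall>(R :: 'd prop_struct) F G. prop_morphism P R F \<and> prop_morphism Q R G \<longrightarrow>
        (\<exists>H. prop_morphism C R H \<and> eq_on_arrows P (H \<circ> i) F \<and> eq_on_arrows Q (H \<circ> j) G \<and>
          (\<forall>H'. prop_morphism C R H' \<and> eq_on_arrows P (H' \<circ> i) F \<and> eq_on_arrows Q (H' \<circ> j) G
             \<longrightarrow> eq_on_arrows C H' H)))"


section \<open>PROPs presented by generators and equations\<close>

record 'g signature =
  gens :: "'g set"
  arity :: "'g \<Rightarrow> nat"
  coarity :: "'g \<Rightarrow> nat"

datatype 'g sterm =
    Gen 'g
  | Idn nat
  | Swap nat nat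
  | Seq "'g sterm" "'g sterm"  (infixl "\<^bold>;" 60)
  | Par "'g sterm" "'g sterm"  (infixl "\<^bold>\<oplus>" 65)

inductive has_type :: "'g signature \<Rightarrow> 'g sterm \<Rightarrow> nat \<Rightarrow> nat \<Rightarrow> bool" for \<Sigma> where
  Gen: "g \<in> gens \<Sigma> \<Longrightarrow> has_type \<Sigma> (Gen g) (arity \<Sigma> g) (coarity \<Sigma> g)"
| Idn: "has_type \<Sigma> (Idn n) n n"
| Swap: "has_type \<Sigma> (Swap n m) (n + m) (m + n)"
| Seq: "has_type \<Sigma> s n m \<Longrightarrow> has_type \<Sigma> t m k \<Longrightarrow> has_type \<Sigma> (s \<^bold>; t) n k"
| Par: "has_type \<Sigma> s n m \<Longrightarrow> has_type \<Sigma> t n' m' \<Longrightarrow> has_type \<Sigma> (s \<^bold>\<oplus> t) (n + n') (m + m')"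

text \<open>
  \<open>term_eq \<Sigma> E n m s t\<close>: the \<open>\<Sigma>\<close>-terms \<open>s, t : n \<rightarrow> m\<close> are identified by the congruence generated by the
  laws of symmetric strict monoidal categories and the equations in \<open>E\<close> (of which only the
  well-typed ones count).
\<close>

inductive term_eq ::
  "'g signature \<Rightarrow> ('g sterm \<times> 'g sterm) set \<Rightarrow> nat \<Rightarrow> nat \<Rightarrow> 'g sterm \<Rightarrow> 'g sterm \<Rightarrow> bool"
  for \<Sigma> E
where
  refl: "has_type \<Sigma> t n m \<Longrightarrow> term_eq \<Sigma> E n m t t"
| sym: "term_eq \<Sigma> E n m s t \<Longrightarrow> term_eq \<Sigma> E n m t s"
| trans: "term_eq \<Sigma> E n m s t \<Longrightarrow> term_eq \<Sigma> E n m t u \<Longrightarrow> term_eq \<Sigma> E n m s u"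
| seq_cong: "term_eq \<Sigma> E n m s s' \<Longrightarrow> term_eq \<Sigma> E m k t t' \<Longrightarrow> term_eq \<Sigma> E n k (s \<^bold>; t) (s' \<^bold>; t')"
| par_cong: "term_eq \<Sigma> E n m s s' \<Longrightarrow> term_eq \<Sigma> E n' m' t t'
    \<Longrightarrow> term_eq \<Sigma> E (n + n') (m + m') (s \<^bold>\<oplus> t) (s' \<^bold>\<oplus> t')"
| equation: "(s, t) \<in> E \<Longrightarrow> has_type \<Sigma> s n m \<Longrightarrow> has_type \<Sigma> t n m \<Longrightarrow> term_eq \<Sigma> E n m s t"
| seq_assoc: "has_type \<Sigma> s n m \<Longrightarrow> has_type \<Sigma> t m k \<Longrightarrow> has_type \<Sigma> u k l
    \<Longrightarrow> term_eq \<Sigma> E n l ((s \<^bold>; t) \<^bold>; u) (s \<^bold>; (t \<^bold>; u))"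
| ident_seq: "has_type \<Sigma> t n m \<Longrightarrow> term_eq \<Sigma> E n m (Idn n \<^bold>; t) t"
| seq_ident: "has_type \<Sigma> t n m \<Longrightarrow> term_eq \<Sigma> E n m (t \<^bold>; Idn m) t"
| par_assoc: "has_type \<Sigma> s n m \<Longrightarrow> has_type \<Sigma> t n' m' \<Longrightarrow> has_type \<Sigma> u n'' m''
    \<Longrightarrow> term_eq \<Sigma> E (n + n' + n'') (m + m' + m'') ((s \<^bold>\<oplus> t) \<^bold>\<oplus> u) (s \<^bold>\<oplus> (t \<^bold>\<oplus> u))"
| ident_par: "has_type \<Sigma> t n m \<Longrightarrow> term_eq \<Sigma> E n m (Idn 0 \<^bold>\<oplus> t) t"
| par_ident: "has_type \<Sigma> t n m \<Longrightarrow> term_eq \<Sigma> E n m (t \<^bold>\<oplus> Idn 0) t"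
| interchange: "has_type \<Sigma> s n m \<Longrightarrow> has_type \<Sigma> s' m k \<Longrightarrow> has_type \<Sigma> t n' m' \<Longrightarrow> has_type \<Sigma> t' m' k'
    \<Longrightarrow> term_eq \<Sigma> E (n + n') (k + k') ((s \<^bold>\<oplus> t) \<^bold>; (s' \<^bold>\<oplus> t')) ((s \<^bold>; s') \<^bold>\<oplus> (t \<^bold>; t'))"
| ident_par_ident: "term_eq \<Sigma> E (n + m) (n + m) (Idn n \<^bold>\<oplus> Idn m) (Idn (n + m))"
| swap_natural: "has_type \<Sigma> s n m \<Longrightarrow> has_type \<Sigma> t n' m'
    \<Longrightarrow> term_eq \<Sigma> E (n + n') (m' + m) ((s \<^bold>\<oplus> t) \<^bold>; Swap m m') (Swap n n' \<^bold>; (t \<^bold>\<oplus> s))"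
| swap_swap: "term_eq \<Sigma> E (n + m) (n + m) (Swap n m \<^bold>; Swap m n) (Idn (n + m))"
| swap_hexagon: "term_eq \<Sigma> E (n + (m + k)) (m + k + n)
    (Swap n (m + k)) ((Swap n m \<^bold>\<oplus> Idn k) \<^bold>; (Idn m \<^bold>\<oplus> Swap n k))"
| swap_unit: "term_eq \<Sigma> E n n (Swap n 0) (Idn n)"

definition term_class ::
  "'g signature \<Rightarrow> ('g sterm \<times> 'g sterm) set \<Rightarrow> 'g sterm \<Rightarrow> 'g sterm set" where
  "term_class \<Sigma> E t = {s. \<exists>n m. term_eq \<Sigma> E n m t s}"

definition presented_prop ::
  "'g signature \<Rightarrow> ('g sterm \<times> 'g sterm) set \<Rightarrow> 'g sterm set prop_struct" where
  "presented_prop \<Sigma> E =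
     \<lparr>arr = (\<lambda>n m. {term_class \<Sigma> E t | t. has_type \<Sigma> t n m}),
      ident = (\<lambda>n. term_class \<Sigma> E (Idn n)),
      seq = (\<lambda>A B. \<Union>s \<in> A. \<Union>t \<in> B. term_class \<Sigma> E (s \<^bold>; t)),
      par = (\<lambda>A B. \<Union>s \<in> A. \<Union>t \<in> B. term_class \<Sigma> E (s \<^bold>\<oplus> t)),
      braid = (\<lambda>n m. term_class \<Sigma> E (Swap n m))\<rparr>"

definition S_prop :: "'g signature \<Rightarrow> 'g sterm set prop_struct" where
  "S_prop \<Sigma> = presented_prop \<Sigma> {}"

subsection \<open>Special commutative Frobenius monoids\<close>

datatype frob_gen = Mu | Eta | Delta | Eps

definition frob_sig :: "frob_gen signature" where
  "frob_sig =
     \<lparr>gens = UNIV,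
      arity = (\<lambda>g. case g of Mu \<Rightarrow> 2 | Eta \<Rightarrow> 0 | Delta \<Rightarrow> 1 | Eps \<Rightarrow> 1),
      coarity = (\<lambda>g. case g of Mu \<Rightarrow> 1 | Eta \<Rightarrow> 1 | Delta \<Rightarrow> 2 | Eps \<Rightarrow> 0)\<rparr>"

definition frob_eqs :: "(frob_gen sterm \<times> frob_gen sterm) set" where
  "frob_eqs = (let \<mu> = Gen Mu; \<eta> = Gen Eta; \<delta> = Gen Delta; \<epsilon> = Gen Eps; i = Idn 1 in
    {((\<mu> \<^bold>\<oplus> i) \<^bold>; \<mu>, (i \<^bold>\<oplus> \<mu>) \<^bold>; \<mu>),
     ((\<eta> \<^bold>\<oplus> i) \<^bold>; \<mu>, i),
     ((i \<^bold>\<oplus> \<eta>) \<^bold>; \<mu>, i),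
     (Swap 1 1 \<^bold>; \<mu>, \<mu>),
     (\<delta> \<^bold>; (\<delta> \<^bold>\<oplus> i), \<delta> \<^bold>; (i \<^bold>\<oplus> \<delta>)),
     (\<delta> \<^bold>; (\<epsilon> \<^bold>\<oplus> i), i),
     (\<delta> \<^bold>; (i \<^bold>\<oplus> \<epsilon>), i),
     (\<delta> \<^bold>; Swap 1 1, \<delta>),
     ((\<delta> \<^bold>\<oplus> i) \<^bold>; (i \<^bold>\<oplus> \<mu>), \<mu> \<^bold>; \<delta>),
     (\<mu> \<^bold>; \<delta>, (i \<^bold>\<oplus> \<delta>) \<^bold>; (\<mu> \<^bold>\<oplus> i)),
     (\<delta> \<^bold>; \<mu>, i)})"

definition Frob :: "frob_gen sterm set prop_struct" where
  "Frob = presented_prop frob_sig frob_eqs"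

subsection \<open>The coproduct of two PROPs\<close>

text \<open>
  The coproduct is presented by all arrows of both PROPs as generators, and the equations saying
  that the two insertions of generators are identity-on-objects strict symmetric monoidal functors.
  Lemma \<open>prop_coproduct\<close> below establishes its universal property.
\<close>

definition prop_dom :: "'a prop_struct \<Rightarrow> 'a \<Rightarrow> nat" where
  "prop_dom P f = (THE n. \<exists>m. f \<in> arr P n m)"

definition prop_cod :: "'a prop_struct \<Rightarrow> 'a \<Rightarrow> nat" where
  "prop_cod P f = (THE m. \<exists>n. f \<in> arr P n m)"

definition coproduct_sig :: "'a prop_struct \<Rightarrow> 'b prop_struct \<Rightarrow> ('a + 'b) signature" where
  "coproduct_sig P Q =
     \<lparr>gens = (\<Union>n m. arr P n m) <+> (\<Union>n m. arr Q n m),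
      arity = case_sum (prop_dom P) (prop_dom Q),
      coarity = case_sum (prop_cod P) (prop_cod Q)\<rparr>"

definition functoriality_eqs ::
  "'a prop_struct \<Rightarrow> ('a \<Rightarrow> 'g) \<Rightarrow> ('g sterm \<times> 'g sterm) set" where
  "functoriality_eqs P k =
     {(Gen (k (ident P n)), Idn n) | n. True} \<union>
     {(Gen (k (f \<Zsemi>\<^bsub>P\<^esub> g)), Gen (k f) \<^bold>; Gen (k g)) | f g n m l. f \<in> arr P n m \<and> g \<in> arr P m l} \<union>
     {(Gen (k (f \<oplus>\<^bsub>P\<^esub> g)), Gen (k f) \<^bold>\<oplus> Gen (k g)) | f g n m n' m'.
        f \<in> arr P n m \<and> g \<in> arr P n' m'} \<union>
     {(Gen (k (braid P n m)), Swap n m) | n m. True}"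

definition coproduct_eqs ::
  "'a prop_struct \<Rightarrow> 'b prop_struct \<Rightarrow> (('a + 'b) sterm \<times> ('a + 'b) sterm) set" where
  "coproduct_eqs P Q = functoriality_eqs P Inl \<union> functoriality_eqs Q Inr"

definition coproduct_prop ::
  "'a prop_struct \<Rightarrow> 'b prop_struct \<Rightarrow> ('a + 'b) sterm set prop_struct"  (infixl "+\<^sub>P" 65) where
  "P +\<^sub>P Q = presented_prop (coproduct_sig P Q) (coproduct_eqs P Q)"

definition coproduct_inl :: "'a prop_struct \<Rightarrow> 'b prop_struct \<Rightarrow> 'a \<Rightarrow> ('a + 'b) sterm set" where
  "coproduct_inl P Q f = term_class (coproduct_sig P Q) (coproduct_eqs P Q) (Gen (Inl f))"

definition coproduct_inr :: "'a prop_struct \<Rightarrow> 'b prop_struct \<Rightarrow> 'b \<Rightarrow> ('a + 'b) sterm set" where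
  "coproduct_inr P Q g = term_class (coproduct_sig P Q) (coproduct_eqs P Q) (Gen (Inr g))"


section \<open>Hypergraphs and cospans\<close>

text \<open>
  Nodes and hyperedges are drawn from \<open>nat\<close>; every finite hypergraph is isomorphic to one of this
  kind. The fields \<open>sources\<close>, \<open>targets\<close> and \<open>label\<close> are meaningful on \<open>hedges\<close> only.
\<close>

record 'g hypergraph =
  nodes :: "nat set"
  hedges :: "nat set"
  sources :: "nat \<Rightarrow> nat list"
  targets :: "nat \<Rightarrow> nat list"
  label :: "nat \<Rightarrow> 'g"

definition hypergraph_over :: "'g signature \<Rightarrow> 'g hypergraph \<Rightarrow> bool" where
  "hypergraph_over \<Sigma> G \<longleftrightarrow> finite (nodes G) \<and> finite (hedges G) \<and>
     (\<forall>h \<in> hedges G. set (sources G h) \<subseteq> nodes G \<and> set (targets G h) \<subseteq> nodes G \<and>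
        label G h \<in> gens \<Sigma> \<and>
        length (sources G h) = arity \<Sigma> (label G h) \<and> length (targets G h) = coarity \<Sigma> (label G h))"

text \<open>
  Homomorphisms are pairs of extensional functions, so that equality of homomorphisms with the same
  domain is equality in HOL. Preservation of the numbers of sources and targets is implied by
  preservation of the lists.
\<close>

type_synonym hmap = "(nat \<Rightarrow> nat) \<times> (nat \<Rightarrow> nat)"

definition hyp_hom :: "'g hypergraph \<Rightarrow> 'g hypergraph \<Rightarrow> hmap \<Rightarrow> bool" where
  "hyp_hom G H f \<longleftrightarrow>
     fst f \<in> nodes G \<rightarrow>\<^sub>E nodes H \<and> snd f \<in> hedges G \<rightarrow>\<^sub>E hedges H \<and>
     (\<forall>h \<in> hedges G. sources H (snd f h) = map (fst f) (sources G h) \<and>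
        targets H (snd f h) = map (fst f) (targets G h) \<and> label H (snd f h) = label G h)"

definition hyp_id :: "'g hypergraph \<Rightarrow> hmap" where
  "hyp_id G = (restrict id (nodes G), restrict id (hedges G))"

text \<open>\<open>hyp_seq G f g\<close> is \<open>f\<close> followed by \<open>g\<close>, where \<open>G\<close> is the domain of \<open>f\<close>.\<close>

definition hyp_seq :: "'g hypergraph \<Rightarrow> hmap \<Rightarrow> hmap \<Rightarrow> hmap" where
  "hyp_seq G f g = (compose (nodes G) (fst g) (fst f), compose (hedges G) (snd g) (snd f))"

definition is_pushout :: "'g signature \<Rightarrow> 'g hypergraph \<Rightarrow> 'g hypergraph \<Rightarrow> 'g hypergraph \<Rightarrow>
    hmap \<Rightarrow> hmap \<Rightarrow> 'g hypergraph \<Rightarrow> hmap \<Rightarrow> hmap \<Rightarrow> bool" where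
  "is_pushout \<Sigma> M G H f g K i j \<longleftrightarrow>
     hypergraph_over \<Sigma> M \<and> hypergraph_over \<Sigma> G \<and> hypergraph_over \<Sigma> H \<and> hypergraph_over \<Sigma> K \<and>
     hyp_hom M G f \<and> hyp_hom M H g \<and> hyp_hom G K i \<and> hyp_hom H K j \<and>
     hyp_seq M f i = hyp_seq M g j \<and>
     (\<forall>L p q. hypergraph_over \<Sigma> L \<and> hyp_hom G L p \<and> hyp_hom H L q \<and> hyp_seq M f p = hyp_seq M g q
        \<longrightarrow> (\<exists>!u. hyp_hom K L u \<and> hyp_seq G i u = p \<and> hyp_seq H j u = q))"

definition discrete :: "nat \<Rightarrow> 'g hypergraph" where
  "discrete n = \<lparr>nodes = {..<n}, hedges = {}, sources = (\<lambda>_. []), targets = (\<lambda>_. []),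
     label = (\<lambda>_. undefined)\<rparr>"

record 'g cospan =
  cdom :: nat
  ccod :: nat
  apex :: "'g hypergraph"
  in_leg :: hmap
  out_leg :: hmap

definition is_cospan :: "'g signature \<Rightarrow> 'g cospan \<Rightarrow> bool" where
  "is_cospan \<Sigma> c \<longleftrightarrow> hypergraph_over \<Sigma> (apex c) \<and>
     hyp_hom (discrete (cdom c)) (apex c) (in_leg c) \<and>
     hyp_hom (discrete (ccod c)) (apex c) (out_leg c)"

definition cospan_iso :: "'g signature \<Rightarrow> 'g cospan \<Rightarrow> 'g cospan \<Rightarrow> bool" where
  "cospan_iso \<Sigma> c d \<longleftrightarrow>
     is_cospan \<Sigma> c \<and> is_cospan \<Sigma> d \<and> cdom c = cdom d \<and> ccod c = ccod d \<and>
     (\<exists>u v. hyp_hom (apex c) (apex d) u \<and> hyp_hom (apex d) (apex c) v \<and>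
        hyp_seq (apex c) u v = hyp_id (apex c) \<and> hyp_seq (apex d) v u = hyp_id (apex d) \<and>
        hyp_seq (discrete (cdom c) :: 'g hypergraph) (in_leg c) u = in_leg d \<and>
        hyp_seq (discrete (ccod c) :: 'g hypergraph) (out_leg c) u = out_leg d)"

definition cospan_class :: "'g signature \<Rightarrow> 'g cospan \<Rightarrow> 'g cospan set" where
  "cospan_class \<Sigma> c = {d. cospan_iso \<Sigma> c d}"

text \<open>
  \<open>is_composite \<Sigma> a b c\<close>: the cospan \<open>c\<close> is obtained from \<open>a\<close> and \<open>b\<close> through some pushout
  in the category of \<open>\<Sigma>\<close>-hypergraphs; such \<open>c\<close> is determined up to isomorphism only.
\<close>

definition is_composite :: "'g signature \<Rightarrow> 'g cospan \<Rightarrow> 'g cospan \<Rightarrow> 'g cospan \<Rightarrow> bool" where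
  "is_composite \<Sigma> a b c \<longleftrightarrow>
     ccod a = cdom b \<and> cdom c = cdom a \<and> ccod c = ccod b \<and>
     (\<exists>i j. is_pushout \<Sigma> (discrete (ccod a)) (apex a) (apex b) (out_leg a) (in_leg b) (apex c) i j \<and>
        in_leg c = hyp_seq (discrete (cdom a) :: 'g hypergraph) (in_leg a) i \<and>
        out_leg c = hyp_seq (discrete (ccod b) :: 'g hypergraph) (out_leg b) j)"

definition hyp_union :: "'g hypergraph \<Rightarrow> 'g hypergraph \<Rightarrow> 'g hypergraph" where
  "hyp_union G H =
     \<lparr>nodes = sum_encode ` (nodes G <+> nodes H),
      hedges = sum_encode ` (hedges G <+> hedges H),
      sources = (\<lambda>h. case sum_decode h of Inl e \<Rightarrow> map (sum_encode \<circ> Inl) (sources G e)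
                                        | Inr e \<Rightarrow> map (sum_encode \<circ> Inr) (sources H e)),
      targets = (\<lambda>h. case sum_decode h of Inl e \<Rightarrow> map (sum_encode \<circ> Inl) (targets G e)
                                        | Inr e \<Rightarrow> map (sum_encode \<circ> Inr) (targets H e)),
      label = (\<lambda>h. case sum_decode h of Inl e \<Rightarrow> label G e | Inr e \<Rightarrow> label H e)\<rparr>"

text \<open>
  A homomorphism out of a discrete hypergraph is determined by its map of nodes; its map of
  hyperedges is the extensional function on the empty set.
\<close>

definition discrete_map :: "nat \<Rightarrow> (nat \<Rightarrow> nat) \<Rightarrow> hmap" where
  "discrete_map n f = (restrict f {..<n}, \<lambda>_. undefined)"

definition cospan_union :: "'g cospan \<Rightarrow> 'g cospan \<Rightarrow> 'g cospan" where
  "cospan_union a b =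
     \<lparr>cdom = cdom a + cdom b, ccod = ccod a + ccod b, apex = hyp_union (apex a) (apex b),
      in_leg = discrete_map (cdom a + cdom b) (\<lambda>x. sum_encode
        (if x < cdom a then Inl (fst (in_leg a) x) else Inr (fst (in_leg b) (x - cdom a)))),
      out_leg = discrete_map (ccod a + ccod b) (\<lambda>x. sum_encode
        (if x < ccod a then Inl (fst (out_leg a) x) else Inr (fst (out_leg b) (x - ccod a))))\<rparr>"

definition id_cospan :: "nat \<Rightarrow> 'g cospan" where
  "id_cospan n = \<lparr>cdom = n, ccod = n, apex = discrete n,
     in_leg = discrete_map n id, out_leg = discrete_map n id\<rparr>"

text \<open>
  The symmetry \<open>n + m \<rightarrow> m + n\<close> is carried by the block swap: the first \<open>m\<close> outputs are the last
  \<open>m\<close> inputs, and the last \<open>n\<close> outputs are the first \<open>n\<close> inputs.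
\<close>

definition swap_cospan :: "nat \<Rightarrow> nat \<Rightarrow> 'g cospan" where
  "swap_cospan n m = \<lparr>cdom = n + m, ccod = m + n, apex = discrete (n + m),
     in_leg = discrete_map (n + m) id,
     out_leg = discrete_map (m + n) (\<lambda>x. if x < m then n + x else x - m)\<rparr>"

definition FTerm :: "'g signature \<Rightarrow> 'g cospan set prop_struct" where
  "FTerm \<Sigma> =
     \<lparr>arr = (\<lambda>n m. {cospan_class \<Sigma> c | c. is_cospan \<Sigma> c \<and> cdom c = n \<and> ccod c = m}),
      ident = (\<lambda>n. cospan_class \<Sigma> (id_cospan n)),
      seq = (\<lambda>A B. {c. \<exists>a \<in> A. \<exists>b \<in> B. is_composite \<Sigma> a b c}),
      par = (\<lambda>A B. \<Union>a \<in> A. \<Union>b \<in> B. cospan_class \<Sigma> (cospan_union a b)),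
      braid = (\<lambda>n m. cospan_class \<Sigma> (swap_cospan n m))\<rparr>"


section \<open>Universal properties of presented PROPs and of the coproduct\<close>

lemma has_type_unique:
  "has_type \<Sigma> t n m \<Longrightarrow> has_type \<Sigma> t n' m' \<Longrightarrow> n = n' \<and> m = m'"
proof (induction t n m arbitrary: n' m' rule: has_type.induct)
  case (Par s n m t n1 m1)
  from Par.prems show ?case
    by (cases rule: has_type.cases) (use Par.IH in blast)+
next
  case (Seq s n m t k)
  from Seq.prems show ?case
    by (cases rule: has_type.cases) (use Seq.IH in blast)+
qed (auto elim: has_type.cases)

lemma term_eq_typed: "term_eq \<Sigma> E n m s t \<Longrightarrow> has_type \<Sigma> s n m \<and> has_type \<Sigma> t n m"
proof (induction rule: term_eq.induct)
  case (swap_natural s n m t n' m')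
  then show ?case
    by (auto intro: has_type.Seq[OF has_type.Par has_type.Swap]
        has_type.Seq[OF has_type.Swap has_type.Par])
next
  case (swap_hexagon n m k)
  have 1: "has_type \<Sigma> (Swap n m \<^bold>\<oplus> Idn k) (n + (m + k)) (m + (n + k))"
    using has_type.Par[OF has_type.Swap[of \<Sigma> n m] has_type.Idn[of \<Sigma> k]] by (simp add: ac_simps)
  have 2: "has_type \<Sigma> (Idn m \<^bold>\<oplus> Swap n k) (m + (n + k)) (m + k + n)"
    using has_type.Par[OF has_type.Idn[of \<Sigma> m] has_type.Swap[of \<Sigma> n k]] by (simp add: ac_simps)
  show ?case using has_type.Seq[OF 1 2] has_type.Swap[of \<Sigma> n "m + k"] by simp
next
  case (par_assoc s n m t n' m' u n'' m'')
  then show ?case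
    using has_type.Par[OF has_type.Par[OF par_assoc(1,2)] par_assoc(3)]
      has_type.Par[OF par_assoc(1) has_type.Par[OF par_assoc(2,3)]] by (simp add: add.assoc)
next
  case (ident_par t n m)
  then show ?case using has_type.Par[OF has_type.Idn[of \<Sigma> 0]] by fastforce
next
  case (par_ident t n m)
  then show ?case using has_type.Par[OF _ has_type.Idn[of \<Sigma> 0]] by fastforce
next
  case (swap_swap n m)
  then show ?case using has_type.Seq[OF has_type.Swap has_type.Swap] has_type.Idn by blast
next
  case (swap_unit n)
  then show ?case using has_type.Swap[of \<Sigma> n 0] has_type.Idn[of \<Sigma> n] by simp
qed (blast intro: has_type.intros)+

lemma term_class_self: "has_type \<Sigma> t n m \<Longrightarrow> t \<in> term_class \<Sigma> E t"
  by (auto simp: term_class_def intro: term_eq.refl)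

lemma term_class_member:
  assumes "has_type \<Sigma> t n m" and "s \<in> term_class \<Sigma> E t"
  shows "term_eq \<Sigma> E n m t s"
  using assms by (auto simp: term_class_def dest: term_eq_typed has_type_unique)

lemma term_class_eq:
  assumes "term_eq \<Sigma> E n m s t"
  shows "term_class \<Sigma> E s = term_class \<Sigma> E t"
proof -
  have "term_eq \<Sigma> E n m s u \<longleftrightarrow> term_eq \<Sigma> E n m t u" for u
    using assms by (blast intro: term_eq.sym term_eq.trans)
  moreover have "n' = n \<and> m' = m" if "term_eq \<Sigma> E n' m' s u \<or> term_eq \<Sigma> E n' m' t u" for n' m' u
    using that term_eq_typed[OF assms] term_eq_typed has_type_unique by metis
  ultimately show ?thesis
    by (auto simp: term_class_def) metis+
qed

lemma term_class_eq_iff: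
  assumes "has_type \<Sigma> s n m" and "has_type \<Sigma> t n m"
  shows "term_class \<Sigma> E s = term_class \<Sigma> E t \<longleftrightarrow> term_eq \<Sigma> E n m s t"
proof
  assume "term_class \<Sigma> E s = term_class \<Sigma> E t"
  then have "t \<in> term_class \<Sigma> E s" using term_class_self[OF assms(2)] by simp
  with assms(1) show "term_eq \<Sigma> E n m s t" by (rule term_class_member)
qed (rule term_class_eq)

lemma presented_arr_iff:
  "A \<in> arr (presented_prop \<Sigma> E) n m \<longleftrightarrow> (\<exists>t. A = term_class \<Sigma> E t \<and> has_type \<Sigma> t n m)"
  by (auto simp: presented_prop_def)

lemma presented_ident: "ident (presented_prop \<Sigma> E) n = term_class \<Sigma> E (Idn n)"
  by (simp add: presented_prop_def)

lemma presented_braid: "braid (presented_prop \<Sigma> E) n m = term_class \<Sigma> E (Swap n m)"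
  by (simp add: presented_prop_def)

lemma presented_seq:
  assumes s: "has_type \<Sigma> s n m" and t: "has_type \<Sigma> t m k"
  shows "term_class \<Sigma> E s \<Zsemi>\<^bsub>presented_prop \<Sigma> E\<^esub> term_class \<Sigma> E t = term_class \<Sigma> E (s \<^bold>; t)"
proof -
  have "term_class \<Sigma> E (s' \<^bold>; t') = term_class \<Sigma> E (s \<^bold>; t)"
    if "s' \<in> term_class \<Sigma> E s" "t' \<in> term_class \<Sigma> E t" for s' t'
    by (rule term_class_eq[OF term_eq.seq_cong[OF term_class_member[OF s that(1)]
          term_class_member[OF t that(2)]], symmetric])
  then have "(\<Union>s' \<in> term_class \<Sigma> E s. \<Union>t' \<in> term_class \<Sigma> E t. term_class \<Sigma> E (s' \<^bold>; t'))
      = (\<Union>s' \<in> term_class \<Sigma> E s. \<Union>t' \<in> term_class \<Sigma> E t. term_class \<Sigma> E (s \<^bold>; t))"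
    by (intro SUP_cong HOL.refl)
  also have "\<dots> = term_class \<Sigma> E (s \<^bold>; t)"
    using term_class_self[OF s] term_class_self[OF t] by blast
  finally show ?thesis by (simp add: presented_prop_def)
qed

lemma presented_par:
  assumes s: "has_type \<Sigma> s n m" and t: "has_type \<Sigma> t n' m'"
  shows "term_class \<Sigma> E s \<oplus>\<^bsub>presented_prop \<Sigma> E\<^esub> term_class \<Sigma> E t = term_class \<Sigma> E (s \<^bold>\<oplus> t)"
proof -
  have "term_class \<Sigma> E (s' \<^bold>\<oplus> t') = term_class \<Sigma> E (s \<^bold>\<oplus> t)"
    if "s' \<in> term_class \<Sigma> E s" "t' \<in> term_class \<Sigma> E t" for s' t'
    by (rule term_class_eq[OF term_eq.par_cong[OF term_class_member[OF s that(1)]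
          term_class_member[OF t that(2)]], symmetric])
  then have "(\<Union>s' \<in> term_class \<Sigma> E s. \<Union>t' \<in> term_class \<Sigma> E t. term_class \<Sigma> E (s' \<^bold>\<oplus> t'))
      = (\<Union>s' \<in> term_class \<Sigma> E s. \<Union>t' \<in> term_class \<Sigma> E t. term_class \<Sigma> E (s \<^bold>\<oplus> t))"
    by (intro SUP_cong HOL.refl)
  also have "\<dots> = term_class \<Sigma> E (s \<^bold>\<oplus> t)"
    using term_class_self[OF s] term_class_self[OF t] by blast
  finally show ?thesis by (simp add: presented_prop_def)
qed

lemma is_prop_presented_prop: "is_prop (presented_prop \<Sigma> E)"
proof
  let ?P = "presented_prop \<Sigma> E" and ?c = "term_class \<Sigma> E"
  note I = has_type.intros
  show "n = n' \<and> m = m'" if f: "f \<in> arr ?P n m" "f \<in> arr ?P n' m'" for f n m n' m'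
  proof -
    obtain s t where st: "f = ?c s" "has_type \<Sigma> s n m" "f = ?c t" "has_type \<Sigma> t n' m'"
      using f unfolding presented_arr_iff by blast
    then have "t \<in> ?c s" using term_class_self[OF st(4), of E] by simp
    from term_eq_typed[OF term_class_member[OF st(2) this]] show ?thesis
      using has_type_unique st(4) by blast
  qed
  show "ident ?P n \<in> arr ?P n n" for n
    by (auto simp: presented_arr_iff presented_ident intro: I)
  show "f \<Zsemi>\<^bsub>?P\<^esub> g \<in> arr ?P n k" if "f \<in> arr ?P n m" "g \<in> arr ?P m k" for f g n m k
    using that by (auto simp: presented_arr_iff presented_seq intro: has_type.Seq)
  show "f \<oplus>\<^bsub>?P\<^esub> g \<in> arr ?P (n + n') (m + m')" if "f \<in> arr ?P n m" "g \<in> arr ?P n' m'"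
    for f g n m n' m'
    using that by (auto simp: presented_arr_iff presented_par intro: has_type.Par)
  show "braid ?P n m \<in> arr ?P (n + m) (m + n)" for n m
    by (auto simp: presented_arr_iff presented_braid intro: I)
  show "(f \<Zsemi>\<^bsub>?P\<^esub> g) \<Zsemi>\<^bsub>?P\<^esub> h = f \<Zsemi>\<^bsub>?P\<^esub> (g \<Zsemi>\<^bsub>?P\<^esub> h)"
    if fgh: "f \<in> arr ?P n m" "g \<in> arr ?P m k" "h \<in> arr ?P k l" for f g h n m k l
  proof -
    obtain s t u where "f = ?c s" "g = ?c t" "h = ?c u"
      and ty: "has_type \<Sigma> s n m" "has_type \<Sigma> t m k" "has_type \<Sigma> u k l"
      using fgh unfolding presented_arr_iff by auto
    then show ?thesis
      using term_class_eq[OF term_eq.seq_assoc[OF ty]]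
      by (simp add: presented_seq[OF ty(1,2)] presented_seq[OF ty(2,3)]
          presented_seq[OF ty(1) has_type.Seq[OF ty(2,3)]]
          presented_seq[OF has_type.Seq[OF ty(1,2)] ty(3)])
  qed
  show "ident ?P n \<Zsemi>\<^bsub>?P\<^esub> f = f" if f: "f \<in> arr ?P n m" for f n m
  proof -
    obtain s where "f = ?c s" and ty: "has_type \<Sigma> s n m"
      using f unfolding presented_arr_iff by auto
    then show ?thesis
      using term_class_eq[OF term_eq.ident_seq[OF ty]]
      by (simp add: presented_ident presented_seq[OF has_type.Idn ty])
  qed
  show "f \<Zsemi>\<^bsub>?P\<^esub> ident ?P m = f" if f: "f \<in> arr ?P n m" for f n m
  proof -
    obtain s where "f = ?c s" and ty: "has_type \<Sigma> s n m"
      using f unfolding presented_arr_iff by auto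
    then show ?thesis
      using term_class_eq[OF term_eq.seq_ident[OF ty]]
      by (simp add: presented_ident presented_seq[OF ty has_type.Idn])
  qed
  show "(f \<oplus>\<^bsub>?P\<^esub> g) \<oplus>\<^bsub>?P\<^esub> h = f \<oplus>\<^bsub>?P\<^esub> (g \<oplus>\<^bsub>?P\<^esub> h)"
    if fgh: "f \<in> arr ?P n m" "g \<in> arr ?P n' m'" "h \<in> arr ?P n'' m''"
    for f g h n m n' m' n'' m''
  proof -
    obtain s t u where "f = ?c s" "g = ?c t" "h = ?c u"
      and ty: "has_type \<Sigma> s n m" "has_type \<Sigma> t n' m'" "has_type \<Sigma> u n'' m''"
      using fgh unfolding presented_arr_iff by auto
    then show ?thesis
      using term_class_eq[OF term_eq.par_assoc[OF ty]]
      by (simp add: presented_par[OF ty(1,2)] presented_par[OF ty(2,3)]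
          presented_par[OF ty(1) has_type.Par[OF ty(2,3)]]
          presented_par[OF has_type.Par[OF ty(1,2)] ty(3)])
  qed
  show "ident ?P 0 \<oplus>\<^bsub>?P\<^esub> f = f" if f: "f \<in> arr ?P n m" for f n m
  proof -
    obtain s where "f = ?c s" and ty: "has_type \<Sigma> s n m"
      using f unfolding presented_arr_iff by auto
    then show ?thesis
      using term_class_eq[OF term_eq.ident_par[OF ty]]
      by (simp add: presented_ident presented_par[OF has_type.Idn ty])
  qed
  show "f \<oplus>\<^bsub>?P\<^esub> ident ?P 0 = f" if f: "f \<in> arr ?P n m" for f n m
  proof -
    obtain s where "f = ?c s" and ty: "has_type \<Sigma> s n m"
      using f unfolding presented_arr_iff by auto
    then show ?thesis
      using term_class_eq[OF term_eq.par_ident[OF ty]]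
      by (simp add: presented_ident presented_par[OF ty has_type.Idn])
  qed
  show "(f \<oplus>\<^bsub>?P\<^esub> g) \<Zsemi>\<^bsub>?P\<^esub> (f' \<oplus>\<^bsub>?P\<^esub> g') = (f \<Zsemi>\<^bsub>?P\<^esub> f') \<oplus>\<^bsub>?P\<^esub> (g \<Zsemi>\<^bsub>?P\<^esub> g')"
    if fg: "f \<in> arr ?P n m" "f' \<in> arr ?P m k" "g \<in> arr ?P n' m'" "g' \<in> arr ?P m' k'"
    for f f' g g' n m k n' m' k'
  proof -
    obtain s s' t t' where "f = ?c s" "f' = ?c s'" "g = ?c t" "g' = ?c t'"
      and ty: "has_type \<Sigma> s n m" "has_type \<Sigma> s' m k" "has_type \<Sigma> t n' m'" "has_type \<Sigma> t' m' k'"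
      using fg unfolding presented_arr_iff by auto
    then show ?thesis
      using term_class_eq[OF term_eq.interchange[OF ty]]
      by (simp add: presented_par[OF ty(1,3)] presented_par[OF ty(2,4)]
          presented_seq[OF ty(1,2)] presented_seq[OF ty(3,4)]
          presented_seq[OF has_type.Par[OF ty(1,3)] has_type.Par[OF ty(2,4)]]
          presented_par[OF has_type.Seq[OF ty(1,2)] has_type.Seq[OF ty(3,4)]])
  qed
  show "ident ?P n \<oplus>\<^bsub>?P\<^esub> ident ?P m = ident ?P (n + m)" for n m
    using term_class_eq[OF term_eq.ident_par_ident[of \<Sigma> E n m]]
    by (simp add: presented_ident presented_par[OF has_type.Idn has_type.Idn])
  show "(f \<oplus>\<^bsub>?P\<^esub> g) \<Zsemi>\<^bsub>?P\<^esub> braid ?P m m' = braid ?P n n' \<Zsemi>\<^bsub>?P\<^esub> (g \<oplus>\<^bsub>?P\<^esub> f)"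
    if fg: "f \<in> arr ?P n m" "g \<in> arr ?P n' m'" for f g n m n' m'
  proof -
    obtain s t where "f = ?c s" "g = ?c t"
      and ty: "has_type \<Sigma> s n m" "has_type \<Sigma> t n' m'"
      using fg unfolding presented_arr_iff by auto
    then show ?thesis
      using term_class_eq[OF term_eq.swap_natural[OF ty]]
      by (simp add: presented_braid presented_par[OF ty] presented_par[OF ty(2,1)]
          presented_seq[OF has_type.Par[OF ty] has_type.Swap]
          presented_seq[OF has_type.Swap has_type.Par[OF ty(2,1)]])
  qed
  show "braid ?P n m \<Zsemi>\<^bsub>?P\<^esub> braid ?P m n = ident ?P (n + m)" for n m
    using term_class_eq[OF term_eq.swap_swap[of \<Sigma> E n m]]
    by (simp add: presented_ident presented_braid presented_seq[OF has_type.Swap has_type.Swap])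
  show "braid ?P n (m + k)
      = (braid ?P n m \<oplus>\<^bsub>?P\<^esub> ident ?P k) \<Zsemi>\<^bsub>?P\<^esub> (ident ?P m \<oplus>\<^bsub>?P\<^esub> braid ?P n k)" for n m k
  proof -
    have 1: "has_type \<Sigma> (Swap n m \<^bold>\<oplus> Idn k) (n + (m + k)) (m + (n + k))"
      using has_type.Par[OF has_type.Swap[of \<Sigma> n m] has_type.Idn[of \<Sigma> k]] by (simp add: ac_simps)
    have 2: "has_type \<Sigma> (Idn m \<^bold>\<oplus> Swap n k) (m + (n + k)) (m + k + n)"
      using has_type.Par[OF has_type.Idn[of \<Sigma> m] has_type.Swap[of \<Sigma> n k]] by (simp add: ac_simps)
    show ?thesis
      using term_class_eq[OF term_eq.swap_hexagon[of \<Sigma> E n m k]]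
      by (simp add: presented_ident presented_braid presented_par[OF has_type.Swap has_type.Idn]
          presented_par[OF has_type.Idn has_type.Swap] presented_seq[OF 1 2])
  qed
  show "braid ?P n 0 = ident ?P n" for n
    using term_class_eq[OF term_eq.swap_unit[of \<Sigma> E n]]
    by (simp add: presented_ident presented_braid)
qed

primrec eval_term :: "'b prop_struct \<Rightarrow> ('g \<Rightarrow> 'b) \<Rightarrow> 'g sterm \<Rightarrow> 'b" where
  "eval_term R v (Gen g) = v g"
| "eval_term R v (Idn n) = ident R n"
| "eval_term R v (Swap n m) = braid R n m"
| "eval_term R v (s \<^bold>; t) = eval_term R v s \<Zsemi>\<^bsub>R\<^esub> eval_term R v t"
| "eval_term R v (s \<^bold>\<oplus> t) = eval_term R v s \<oplus>\<^bsub>R\<^esub> eval_term R v t"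

lemma eval_term_arr:
  assumes "is_prop R" and "\<And>g. g \<in> gens \<Sigma> \<Longrightarrow> v g \<in> arr R (arity \<Sigma> g) (coarity \<Sigma> g)"
    and "has_type \<Sigma> t n m"
  shows "eval_term R v t \<in> arr R n m"
proof -
  interpret is_prop R by fact
  from assms(3) show ?thesis
    by (induction rule: has_type.induct)
      (auto intro: assms(2) ident_arr braid_arr seq_arr par_arr)
qed

lemma eval_term_eq:
  assumes "is_prop R" and v: "\<And>g. g \<in> gens \<Sigma> \<Longrightarrow> v g \<in> arr R (arity \<Sigma> g) (coarity \<Sigma> g)"
    and E: "\<And>s t n m. (s, t) \<in> E \<Longrightarrow> has_type \<Sigma> s n m \<Longrightarrow> has_type \<Sigma> t n m
      \<Longrightarrow> eval_term R v s = eval_term R v t"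
    and "term_eq \<Sigma> E n m s t"
  shows "eval_term R v s = eval_term R v t"
proof -
  interpret is_prop R by fact
  have ev: "eval_term R v t \<in> arr R n m" if "has_type \<Sigma> t n m" for t n m
    using eval_term_arr[OF assms(1) v that] .
  from assms(4) show ?thesis
  proof (induction rule: term_eq.induct)
    case (equation s t n m)
    then show ?case by (rule E)
  next
    case (seq_assoc s n m t k u l)
    then show ?case using is_prop.seq_assoc[OF assms(1)
          ev[OF seq_assoc(1)] ev[OF seq_assoc(2)] ev[OF seq_assoc(3)]] by simp
  next
    case (ident_seq t n m)
    then show ?case using is_prop.ident_seq[OF assms(1)
          ev[OF ident_seq(1)]] by simp
  next
    case (seq_ident t n m)
    then show ?case using is_prop.seq_ident[OF assms(1)
          ev[OF seq_ident(1)]] by simp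
  next
    case (par_assoc s n m t n' m' u n'' m'')
    then show ?case using is_prop.par_assoc[OF assms(1)
          ev[OF par_assoc(1)] ev[OF par_assoc(2)] ev[OF par_assoc(3)]] by simp
  next
    case (ident_par t n m)
    then show ?case using is_prop.ident_par[OF assms(1)
          ev[OF ident_par(1)]] by simp
  next
    case (par_ident t n m)
    then show ?case using is_prop.par_ident[OF assms(1)
          ev[OF par_ident(1)]] by simp
  next
    case (interchange s n m s' k t n' m' t' k')
    then show ?case using is_prop.interchange[OF assms(1)
          ev[OF interchange(1)] ev[OF interchange(2)] ev[OF interchange(3)] ev[OF interchange(4)]] by simp
  next
    case (ident_par_ident n m)
    then show ?case using is_prop.ident_par_ident[OF assms(1)] by simp
  next
    case (swap_natural s n m t n' m')
    then show ?case using is_prop.braid_natural[OF assms(1)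
          ev[OF swap_natural(1)] ev[OF swap_natural(2)]] by simp
  next
    case (swap_swap n m)
    then show ?case using braid_braid by simp
  next
    case (swap_hexagon n m k)
    then show ?case using braid_hexagon by simp
  next
    case (swap_unit n)
    then show ?case using braid_unit by simp
  qed simp_all
qed

text \<open>
  Universal property of \<open>presented_prop \<Sigma> E\<close>: interpretations of the generators that satisfy \<open>E\<close>
  extend uniquely to morphisms of PROPs.
\<close>

lemma presented_prop_extend:
  assumes R: "is_prop R" and v: "\<And>g. g \<in> gens \<Sigma> \<Longrightarrow> v g \<in> arr R (arity \<Sigma> g) (coarity \<Sigma> g)"
    and E: "\<And>s t n m. (s, t) \<in> E \<Longrightarrow> has_type \<Sigma> s n m \<Longrightarrow> has_type \<Sigma> t n m
      \<Longrightarrow> eval_term R v s = eval_term R v t"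
  shows "\<exists>H. prop_morphism (presented_prop \<Sigma> E) R H \<and>
    (\<forall>g \<in> gens \<Sigma>. H (term_class \<Sigma> E (Gen g)) = v g)"
proof -
  define H where "H A = eval_term R v (SOME t. t \<in> A)" for A
  have H: "H (term_class \<Sigma> E t) = eval_term R v t" if ty: "has_type \<Sigma> t n m" for t n m
  proof -
    have "(SOME s. s \<in> term_class \<Sigma> E t) \<in> term_class \<Sigma> E t"
      using term_class_self[OF ty] by (rule someI)
    from eval_term_eq[OF R v E term_class_member[OF ty this]] show ?thesis
      unfolding H_def by (rule HOL.sym)
  qed
  note ev = eval_term_arr[OF R v]
  have "prop_morphism (presented_prop \<Sigma> E) R H"
    unfolding prop_morphism_def
  proof (intro conjI allI ballI)
    fix n m f assume "f \<in> arr (presented_prop \<Sigma> E) n m"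
    then show "H f \<in> arr R n m" by (auto simp: presented_arr_iff H intro: ev)
  next
    fix n m k f g assume "f \<in> arr (presented_prop \<Sigma> E) n m" "g \<in> arr (presented_prop \<Sigma> E) m k"
    then obtain s t where "f = term_class \<Sigma> E s" "g = term_class \<Sigma> E t"
      and ty: "has_type \<Sigma> s n m" "has_type \<Sigma> t m k" by (auto simp: presented_arr_iff)
    then show "H (f \<Zsemi>\<^bsub>presented_prop \<Sigma> E\<^esub> g) = H f \<Zsemi>\<^bsub>R\<^esub> H g"
      by (simp add: presented_seq[OF ty] H[OF has_type.Seq[OF ty]] H[OF ty(1)] H[OF ty(2)])
  next
    fix n m n' m' f g
    assume "f \<in> arr (presented_prop \<Sigma> E) n m" "g \<in> arr (presented_prop \<Sigma> E) n' m'"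
    then obtain s t where "f = term_class \<Sigma> E s" "g = term_class \<Sigma> E t"
      and ty: "has_type \<Sigma> s n m" "has_type \<Sigma> t n' m'" by (auto simp: presented_arr_iff)
    then show "H (f \<oplus>\<^bsub>presented_prop \<Sigma> E\<^esub> g) = H f \<oplus>\<^bsub>R\<^esub> H g"
      by (simp add: presented_par[OF ty] H[OF has_type.Par[OF ty]] H[OF ty(1)] H[OF ty(2)])
  qed (simp_all add: R is_prop_presented_prop presented_ident presented_braid
      H[OF has_type.Idn] H[OF has_type.Swap])
  then show ?thesis using H[OF has_type.Gen] by auto
qed

lemma presented_prop_ext:
  assumes H: "prop_morphism (presented_prop \<Sigma> E) R H" and H': "prop_morphism (presented_prop \<Sigma> E) R H'"
    and gen: "\<And>g. g \<in> gens \<Sigma> \<Longrightarrow> H (term_class \<Sigma> E (Gen g)) = H' (term_class \<Sigma> E (Gen g))"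
  shows "eq_on_arrows (presented_prop \<Sigma> E) H H'"
proof -
  have "H (term_class \<Sigma> E t) = H' (term_class \<Sigma> E t)" if "has_type \<Sigma> t n m" for t n m
    using that
  proof (induction rule: has_type.induct)
    case (Idn n)
    then show ?case using H H' by (simp add: prop_morphism_def flip: presented_ident)
  next
    case (Swap n m)
    then show ?case using H H' by (simp add: prop_morphism_def flip: presented_braid)
  next
    case (Seq s n m t k)
    have "term_class \<Sigma> E s \<in> arr (presented_prop \<Sigma> E) n m"
      and "term_class \<Sigma> E t \<in> arr (presented_prop \<Sigma> E) m k"
      using Seq.hyps by (auto simp: presented_arr_iff)
    with H H' Seq.IH show ?case
      unfolding presented_seq[OF Seq.hyps, symmetric] prop_morphism_def by metis
  next
    case (Par s n m t n' m')
    have "term_class \<Sigma> E s \<in> arr (presented_prop \<Sigma> E) n m"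
      and "term_class \<Sigma> E t \<in> arr (presented_prop \<Sigma> E) n' m'"
      using Par.hyps by (auto simp: presented_arr_iff)
    with H H' Par.IH show ?case
      unfolding presented_par[OF Par.hyps, symmetric] prop_morphism_def by metis
  qed (rule gen)
  then show ?thesis by (auto simp: eq_on_arrows_def presented_arr_iff)
qed

lemma prop_dom_eq:
  assumes "is_prop P" and "f \<in> arr P n m"
  shows "prop_dom P f = n" and "prop_cod P f = m"
  using assms is_prop.arr_disjoint[OF assms(1)] unfolding prop_dom_def prop_cod_def
  by (blast intro: the_equality)+

lemma functoriality_morphism:
  assumes P: "is_prop P"
    and gen: "\<And>f n m. f \<in> arr P n m \<Longrightarrow> has_type \<Sigma> (Gen (k f)) n m"
    and E: "functoriality_eqs P k \<subseteq> E"
  shows "prop_morphism P (presented_prop \<Sigma> E) (\<lambda>f. term_class \<Sigma> E (Gen (k f)))"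
  unfolding prop_morphism_def
proof (intro conjI allI ballI)
  interpret is_prop P by fact
  note eqn = term_class_eq[OF term_eq.equation]
  show "is_prop P" "is_prop (presented_prop \<Sigma> E)" by (fact P, rule is_prop_presented_prop)
  fix n m
  show "term_class \<Sigma> E (Gen (k (ident P n))) = ident (presented_prop \<Sigma> E) n"
    unfolding presented_ident
    by (rule eqn[OF _ gen[OF ident_arr] has_type.Idn])
      (rule subsetD[OF E], auto simp: functoriality_eqs_def)
  show "term_class \<Sigma> E (Gen (k (braid P n m))) = braid (presented_prop \<Sigma> E) n m"
    unfolding presented_braid
    by (rule eqn[OF _ gen[OF braid_arr] has_type.Swap])
      (rule subsetD[OF E], auto simp: functoriality_eqs_def)
  fix f assume f: "f \<in> arr P n m"
  then show "term_class \<Sigma> E (Gen (k f)) \<in> arr (presented_prop \<Sigma> E) n m"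
    using gen by (auto simp: presented_arr_iff)
  show "term_class \<Sigma> E (Gen (k (f \<Zsemi>\<^bsub>P\<^esub> g))) =
      term_class \<Sigma> E (Gen (k f)) \<Zsemi>\<^bsub>presented_prop \<Sigma> E\<^esub> term_class \<Sigma> E (Gen (k g))"
    if g: "g \<in> arr P m l" for g l
    unfolding presented_seq[OF gen[OF f] gen[OF g]]
    by (rule eqn[OF _ gen[OF seq_arr[OF f g]] has_type.Seq[OF gen[OF f] gen[OF g]]])
      (rule subsetD[OF E], use f g in \<open>unfold functoriality_eqs_def, blast\<close>)
  show "term_class \<Sigma> E (Gen (k (f \<oplus>\<^bsub>P\<^esub> g))) =
      term_class \<Sigma> E (Gen (k f)) \<oplus>\<^bsub>presented_prop \<Sigma> E\<^esub> term_class \<Sigma> E (Gen (k g))"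
    if g: "g \<in> arr P n' m'" for g n' m'
    unfolding presented_par[OF gen[OF f] gen[OF g]]
    by (rule eqn[OF _ gen[OF par_arr[OF f g]] has_type.Par[OF gen[OF f] gen[OF g]]])
      (rule subsetD[OF E], use f g in \<open>unfold functoriality_eqs_def, blast\<close>)
qed

lemma eval_functoriality_eqs:
  assumes F: "prop_morphism P R F" and v: "\<And>f. v (k f) = F f"
    and "(s, t) \<in> functoriality_eqs P k"
  shows "eval_term R v s = eval_term R v t"
  using assms(3) F unfolding functoriality_eqs_def prop_morphism_def by (auto simp: v)

lemma prop_coproduct:
  assumes P: "is_prop P" and Q: "is_prop Q"
  shows "is_prop_coproduct TYPE('d) P Q (P +\<^sub>P Q) (coproduct_inl P Q) (coproduct_inr P Q)"
  unfolding is_prop_coproduct_def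
proof (intro conjI allI impI)
  let ?S = "coproduct_sig P Q" and ?E = "coproduct_eqs P Q"
  have gl: "Inl f \<in> gens ?S" if "f \<in> arr P n m" for f n m
    using that by (auto simp: coproduct_sig_def)
  have gr: "Inr f \<in> gens ?S" if "f \<in> arr Q n m" for f n m
    using that by (auto simp: coproduct_sig_def)
  have l: "has_type ?S (Gen (Inl f)) n m" if "f \<in> arr P n m" for f n m
    using has_type.Gen[of "Inl f" ?S] that prop_dom_eq[OF P that]
    by (auto simp: coproduct_sig_def)
  have r: "has_type ?S (Gen (Inr f)) n m" if "f \<in> arr Q n m" for f n m
    using has_type.Gen[of "Inr f" ?S] that prop_dom_eq[OF Q that]
    by (auto simp: coproduct_sig_def)
  show "prop_morphism P (P +\<^sub>P Q) (coproduct_inl P Q)"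
    unfolding coproduct_prop_def coproduct_inl_def[abs_def]
    by (rule functoriality_morphism[OF P l]) (simp_all add: coproduct_eqs_def)
  show "prop_morphism Q (P +\<^sub>P Q) (coproduct_inr P Q)"
    unfolding coproduct_prop_def coproduct_inr_def[abs_def]
    by (rule functoriality_morphism[OF Q r]) (simp_all add: coproduct_eqs_def)
  fix R :: "'d prop_struct" and F G
  assume FG: "prop_morphism P R F \<and> prop_morphism Q R G"
  then have R: "is_prop R" by (simp add: prop_morphism_def)
  have v: "case_sum F G g \<in> arr R (arity ?S g) (coarity ?S g)" if "g \<in> gens ?S" for g
    using that FG prop_dom_eq[OF P] prop_dom_eq[OF Q]
    by (auto simp: coproduct_sig_def prop_morphism_def)
  have E: "eval_term R (case_sum F G) s = eval_term R (case_sum F G) t"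
    if "(s, t) \<in> ?E" for s t
    using that FG eval_functoriality_eqs[of P R F "case_sum F G" Inl s t]
      eval_functoriality_eqs[of Q R G "case_sum F G" Inr s t]
    by (auto simp: coproduct_eqs_def)
  obtain H where H: "prop_morphism (P +\<^sub>P Q) R H"
    "\<And>g. g \<in> gens ?S \<Longrightarrow> H (term_class ?S ?E (Gen g)) = case_sum F G g"
    using presented_prop_extend[OF R v E] unfolding coproduct_prop_def by blast
  have Hl: "eq_on_arrows P (H \<circ> coproduct_inl P Q) F"
    and Hr: "eq_on_arrows Q (H \<circ> coproduct_inr P Q) G"
    using H(2)[OF gl] H(2)[OF gr]
    by (simp_all add: eq_on_arrows_def coproduct_inl_def coproduct_inr_def)
  have "eq_on_arrows (P +\<^sub>P Q) H' H"
    if H': "prop_morphism (P +\<^sub>P Q) R H'" "eq_on_arrows P (H' \<circ> coproduct_inl P Q) F"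
      "eq_on_arrows Q (H' \<circ> coproduct_inr P Q) G" for H'
    unfolding coproduct_prop_def
  proof (rule presented_prop_ext)
    show "prop_morphism (presented_prop ?S ?E) R H'" "prop_morphism (presented_prop ?S ?E) R H"
      using H(1) H'(1) by (simp_all add: coproduct_prop_def)
    show "H' (term_class ?S ?E (Gen g)) = H (term_class ?S ?E (Gen g))" if g: "g \<in> gens ?S" for g
    proof -
      have "H' (term_class ?S ?E (Gen g)) = case_sum F G g"
      proof (cases g)
        case (Inl f)
        then obtain n m where "f \<in> arr P n m" using g by (auto simp: coproduct_sig_def)
        with H'(2) Inl show ?thesis by (simp add: eq_on_arrows_def coproduct_inl_def)
      next
        case (Inr f)
        then obtain n m where "f \<in> arr Q n m" using g by (auto simp: coproduct_sig_def)
        with H'(3) Inr show ?thesis by (simp add: eq_on_arrows_def coproduct_inr_def)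
      qed
      then show ?thesis using H(2)[OF g] by simp
    qed
  qed
  then show "\<exists>H. prop_morphism (P +\<^sub>P Q) R H \<and> eq_on_arrows P (H \<circ> coproduct_inl P Q) F \<and>
      eq_on_arrows Q (H \<circ> coproduct_inr P Q) G \<and>
      (\<forall>H'. prop_morphism (P +\<^sub>P Q) R H' \<and> eq_on_arrows P (H' \<circ> coproduct_inl P Q) F \<and>
        eq_on_arrows Q (H' \<circ> coproduct_inr P Q) G \<longrightarrow> eq_on_arrows (P +\<^sub>P Q) H' H)"
    using H(1) Hl Hr by blast
qed

end

theory Submission
  imports Defs "HOL-Library.Multiset"
begin

text \<open>
  In a PROP with a special commutative Frobenius monoid, every function \<open>f\<close> between finite sets acts
  covariantly, by the monoid, as \<open>star f\<close>, and contravariantly, by the comonoid, as \<open>costar f\<close>, and the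
  Frobenius and special laws give the Beck--Chevalley condition \<open>costar f ; star g = star p ; costar q\<close>
  for pushouts. A hyperedge with sources \<open>s\<close> and targets \<open>t\<close> among \<open>v\<close> nodes becomes the endomorphism
  \<open>costar [id, s] ; (id \<oplus> \<gamma>) ; star [id, t]\<close> of \<open>v\<close>. These endomorphisms commute with each other and slide
  past \<open>star f\<close> and \<open>costar f\<close> with \<open>s\<close> and \<open>t\<close> renamed along \<open>f\<close>, so a cospan with legs \<open>i\<close> and \<open>j\<close> has a
  well-defined value \<open>star i ; edges ; costar j\<close>, which turns pushouts into composites and disjoint unions
  into monoidal products. Every arrow of \<open>S_prop \<Sigma> +\<^sub>P Frob\<close> is such a value.

  For faithfulness, every hypergraph \<open>X\<close> defines a morphism from \<open>S_prop \<Sigma> +\<^sub>P Frob\<close> to matrices of natural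
  numbers that sends the value of a cospan to the numbers of homomorphisms into \<open>X\<close> with prescribed
  restrictions to the legs. By an argument of Lovasz these numbers determine the cospan up to
  isomorphism. The PROP laws of \<open>FTerm \<Sigma>\<close> are then reflected from \<open>S_prop \<Sigma> +\<^sub>P Frob\<close>.
\<close>

section \<open>PROPs with domains and codomains\<close>

text \<open>The comparison map \<open>den\<close> runs from cospans to the coproduct. A morphism in
  the other direction would presuppose that \<open>FTerm \<Sigma>\<close> is a PROP, hence a pasting
  calculus for pushouts; along \<open>den\<close> that structure is inherited once
  \<open>den\<close> is injective up to isomorphism. Injectivity needs invariants of arrows in a
  quotient by a generated congruence. The universal property supplies them, given a target that is
  visibly a PROP. In the matrices a wire carries a label, namely a node of \<open>X\<close>; the
  Frobenius monoid forces labels to agree, and a generator is weighted by the number of hyperedges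
  of \<open>X\<close> over given labels. The resulting sum over labellings is a number of
  homomorphisms. Counts lead to isomorphism because subtraction over proper subhypergraphs isolates
  the surjective homomorphisms. The identity of \<open>d\<close> is a surjection onto
  \<open>d\<close> that respects the legs, so equal counts give one from \<open>c\<close> to
  \<open>d\<close>, and likewise one from \<open>d\<close> to \<open>c\<close>; finiteness makes
  them bijective.\<close>

lemma (in is_prop) arr_dom_cod: "f \<in> arr P n m \<Longrightarrow> prop_dom P f = n \<and> prop_cod P f = m"
  using prop_dom_eq[OF is_prop_axioms] by blast

context is_prop
begin

text \<open>Splitting membership in a hom-set into \<open>is_arr\<close> and a computed domain and
  codomain turns the typing premises of the PROP laws into side conditions for the simplifier, with
  no intermediate objects to guess.\<close>

definition is_arr :: "'a \<Rightarrow> bool" where "is_arr f \<longleftrightarrow> f \<in> arr P (prop_dom P f) (prop_cod P f)"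

abbreviation "dm \<equiv> prop_dom P"
abbreviation "cd \<equiv> prop_cod P"

lemma arr_iff: "f \<in> arr P n m \<longleftrightarrow> is_arr f \<and> dm f = n \<and> cd f = m"
  unfolding is_arr_def using arr_dom_cod by blast

lemma ty_ident [simp]: "is_arr (ident P n)" "dm (ident P n) = n" "cd (ident P n) = n"
  using ident_arr[of n] by (auto simp: arr_iff)

lemma ty_braid [simp]: "is_arr (braid P n m)" "dm (braid P n m) = n + m" "cd (braid P n m) = m + n"
  using braid_arr[of n m] by (auto simp: arr_iff)

lemma ty_seq [simp]:
  assumes "is_arr f" "is_arr g" "cd f = dm g"
  shows "is_arr (f \<Zsemi> g)" "dm (f \<Zsemi> g) = dm f" "cd (f \<Zsemi> g) = cd g"
  using seq_arr[of f "dm f" "cd f" g "cd g"] assms by (auto simp: arr_iff)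

lemma ty_par [simp]:
  assumes "is_arr f" "is_arr g"
  shows "is_arr (f \<oplus> g)" "dm (f \<oplus> g) = dm f + dm g" "cd (f \<oplus> g) = cd f + cd g"
  using par_arr[of f "dm f" "cd f" g "dm g" "cd g"] assms by (auto simp: arr_iff)

lemma seq_assoc':
  assumes "is_arr f" "is_arr g" "is_arr h" "cd f = dm g" "cd g = dm h"
  shows "(f \<Zsemi> g) \<Zsemi> h = f \<Zsemi> (g \<Zsemi> h)"
  using seq_assoc[of f "dm f" "cd f" g "cd g" h "cd h"] assms by (simp add: arr_iff)

lemma par_assoc':
  assumes "is_arr f" "is_arr g" "is_arr h"
  shows "(f \<oplus> g) \<oplus> h = f \<oplus> (g \<oplus> h)"
  using par_assoc[of f "dm f" "cd f" g "dm g" "cd g" h "dm h" "cd h"] assms by (simp add: arr_iff)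

lemma ident_seq' [simp]: "is_arr f \<Longrightarrow> dm f = n \<Longrightarrow> ident P n \<Zsemi> f = f"
  using ident_seq[of f n "cd f"] by (simp add: arr_iff)

lemma seq_ident' [simp]: "is_arr f \<Longrightarrow> cd f = n \<Longrightarrow> f \<Zsemi> ident P n = f"
  using seq_ident[of f "dm f" n] by (simp add: arr_iff)

lemma ident_par' [simp]: "is_arr f \<Longrightarrow> ident P 0 \<oplus> f = f"
  using ident_par[of f "dm f" "cd f"] by (simp add: arr_iff)

lemma par_ident' [simp]: "is_arr f \<Longrightarrow> f \<oplus> ident P 0 = f"
  using par_ident[of f "dm f" "cd f"] by (simp add: arr_iff)

lemma interchange':
  assumes "is_arr f" "is_arr f'" "is_arr g" "is_arr g'" "cd f = dm f'" "cd g = dm g'"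
  shows "(f \<oplus> g) \<Zsemi> (f' \<oplus> g') = (f \<Zsemi> f') \<oplus> (g \<Zsemi> g')"
  using interchange[of f "dm f" "cd f" f' "cd f'" g "dm g" "cd g" g' "cd g'"] assms
  by (simp add: arr_iff)

lemma id_par_id [simp]: "ident P n \<oplus> ident P m = ident P (n + m)"
  by (rule ident_par_ident)

lemma id_par_id_par: "is_arr f \<Longrightarrow> ident P n \<oplus> (ident P m \<oplus> f) = ident P (n + m) \<oplus> f"
  by (simp flip: par_assoc')

lemma braid_natural':
  assumes "is_arr f" "is_arr g"
  shows "(f \<oplus> g) \<Zsemi> braid P (cd f) (cd g) = braid P (dm f) (dm g) \<Zsemi> (g \<oplus> f)"
  using braid_natural[of f "dm f" "cd f" g "dm g" "cd g"] assms by (simp add: arr_iff)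

lemma braid_0_left [simp]: "braid P 0 n = ident P n"
  using braid_braid[of n 0] braid_unit[of n] by simp

text \<open>The second hexagon is the inverse of the first.\<close>

lemma hexagon2:
  "braid P (n + m) k = (ident P n \<oplus> braid P m k) \<Zsemi> (braid P n k \<oplus> ident P m)" (is "_ = ?r")
proof -
  let ?l = "braid P k (n + m)"
  have 1: "?l = (braid P k n \<oplus> ident P m) \<Zsemi> (ident P n \<oplus> braid P k m)" by (rule braid_hexagon)
  have "?l \<Zsemi> ?r = (braid P k n \<oplus> ident P m) \<Zsemi> ((ident P n \<oplus> braid P k m)
      \<Zsemi> (ident P n \<oplus> braid P m k)) \<Zsemi> (braid P n k \<oplus> ident P m)"
    unfolding 1 by (simp add: seq_assoc' ac_simps)
  also have "\<dots> = ident P (k + (n + m))"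
    by (simp add: interchange' braid_braid ac_simps)
  finally have 2: "?l \<Zsemi> ?r = ident P (k + (n + m))" .
  have "braid P (n + m) k = braid P (n + m) k \<Zsemi> (?l \<Zsemi> ?r)"
    unfolding 2 by (simp add: ac_simps)
  also have "\<dots> = (braid P (n + m) k \<Zsemi> ?l) \<Zsemi> ?r" by (simp add: seq_assoc' ac_simps)
  also have "\<dots> = ?r" by (simp add: braid_braid ac_simps)
  finally show ?thesis .
qed

end

section \<open>Commutative monoids and the action of finite functions\<close>

text \<open>Reversing arrows turns a comonoid into a monoid, so that everything proved about
  \<open>star\<close> yields its dual about \<open>costar\<close>. The indices of the braid are
  exchanged because reversal exchanges its domain and codomain.\<close>

definition op_prop :: "'a prop_struct \<Rightarrow> 'a prop_struct" where
  "op_prop P = \<lparr>arr = (\<lambda>n m. arr P m n), ident = ident P, seq = (\<lambda>f g. g \<Zsemi>\<^bsub>P\<^esub> f), par = par P,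
     braid = (\<lambda>n m. braid P m n)\<rparr>"

lemma op_prop_simps [simp]:
  "arr (op_prop P) n m = arr P m n" "ident (op_prop P) = ident P" "f \<Zsemi>\<^bsub>op_prop P\<^esub> g = g \<Zsemi>\<^bsub>P\<^esub> f"
  "par (op_prop P) = par P" "braid (op_prop P) n m = braid P m n"
  by (simp_all add: op_prop_def)

lemma op_prop_op_prop [simp]: "op_prop (op_prop P) = P"
  by (simp add: op_prop_def)

lemma prop_dom_op [simp]: "prop_dom (op_prop P) f = prop_cod P f" "prop_cod (op_prop P) f = prop_dom P f"
  by (simp_all add: prop_dom_def prop_cod_def)

context is_prop
begin

lemma is_prop_op: "is_prop (op_prop P)"
proof
  fix n m k :: nat
  \<comment> \<open>Read in \<open>P\<close>, the hexagon of the opposite PROP is the second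
    hexagon.\<close>
  show "braid (op_prop P) n (m + k) = (braid (op_prop P) n m \<oplus>\<^bsub>op_prop P\<^esub> ident (op_prop P) k)
      \<Zsemi>\<^bsub>op_prop P\<^esub> (ident (op_prop P) m \<oplus>\<^bsub>op_prop P\<^esub> braid (op_prop P) n k)"
    by (simp add: hexagon2)
qed (auto simp: arr_iff seq_assoc' par_assoc' interchange' braid_braid braid_natural'[symmetric]
    ac_simps)

lemma is_arr_op [simp]: "is_prop.is_arr (op_prop P) f = is_arr f"
  by (simp add: is_prop.is_arr_def[OF is_prop_op] is_arr_def)

abbreviation "w \<equiv> ident P (Suc 0)"
abbreviation "sw \<equiv> braid P (Suc 0) (Suc 0)"

lemma id_Suc_par: "is_arr f \<Longrightarrow> ident P (Suc m) \<oplus> f = ident P m \<oplus> (w \<oplus> f)"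
  by (simp add: id_par_id_par)

text \<open>Naturality of the braid of two wires past one, applied to the crossing \<open>sw\<close>
  of the two wires; the braid itself expands into crossings by the second hexagon.\<close>

lemma yang_baxter:
  "(sw \<oplus> w) \<Zsemi> ((w \<oplus> sw) \<Zsemi> (sw \<oplus> w)) = (w \<oplus> sw) \<Zsemi> ((sw \<oplus> w) \<Zsemi> (w \<oplus> sw))"
proof -
  have h: "braid P (Suc (Suc 0)) (Suc 0) = (w \<oplus> sw) \<Zsemi> (sw \<oplus> w)"
    using hexagon2[of "Suc 0" "Suc 0" "Suc 0"] by simp
  have "(sw \<oplus> w) \<Zsemi> braid P (Suc (Suc 0)) (Suc 0) = braid P (Suc (Suc 0)) (Suc 0) \<Zsemi> (w \<oplus> sw)"
    using braid_natural'[of sw w] by simp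
  then show ?thesis unfolding h by (simp add: seq_assoc')
qed

lemma sw_sw: "sw \<Zsemi> sw = ident P (Suc (Suc 0))"
  using braid_braid[of "Suc 0" "Suc 0"] by simp

end

text \<open>Total functions on \<open>nat\<close> stand for functions between finite ordinals. Their
  values from \<open>n\<close> on are arbitrary, hence the congruence lemmas for everything indexed
  by such a function.\<close>

definition maps :: "nat \<Rightarrow> nat \<Rightarrow> (nat \<Rightarrow> nat) \<Rightarrow> bool" where
  "maps n m f \<longleftrightarrow> (\<forall>x < n. f x < m)"

lemma maps_Suc: "maps (Suc n) m f \<longleftrightarrow> maps n m f \<and> f n < m"
  by (auto simp: maps_def less_Suc_eq)

definition par_fun :: "nat \<Rightarrow> nat \<Rightarrow> (nat \<Rightarrow> nat) \<Rightarrow> (nat \<Rightarrow> nat) \<Rightarrow> nat \<Rightarrow> nat" where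
  "par_fun n m f g x = (if x < n then f x else m + g (x - n))"

definition swap_fun :: "nat \<Rightarrow> nat \<Rightarrow> nat \<Rightarrow> nat" where
  "swap_fun n m x = (if x < n then m + x else x - n)"

locale comm_monoid_prop = is_prop P for P :: "'a prop_struct" (structure) +
  fixes mu eta :: 'a
  assumes mu_arr: "mu \<in> arr P 2 1" and eta_arr: "eta \<in> arr P 0 1"
    and mu_assoc: "(mu \<oplus> ident P 1) \<Zsemi> mu = (ident P 1 \<oplus> mu) \<Zsemi> mu"
    and mu_unit_left: "(eta \<oplus> ident P 1) \<Zsemi> mu = ident P 1"
    and mu_unit_right: "(ident P 1 \<oplus> eta) \<Zsemi> mu = ident P 1"
    and mu_comm: "braid P 1 1 \<Zsemi> mu = mu"
begin

lemma ty_mu [simp]: "is_arr mu" "dm mu = Suc (Suc 0)" "cd mu = Suc 0"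
  and ty_eta [simp]: "is_arr eta" "dm eta = 0" "cd eta = Suc 0"
  using mu_arr eta_arr by (auto simp: arr_iff)

lemma mu_comm2: "(w \<oplus> sw) \<Zsemi> ((mu \<oplus> w) \<Zsemi> mu) = (mu \<oplus> w) \<Zsemi> mu"
proof -
  have "(w \<oplus> sw) \<Zsemi> ((mu \<oplus> w) \<Zsemi> mu) = ((w \<oplus> sw) \<Zsemi> (w \<oplus> mu)) \<Zsemi> mu"
    using mu_assoc by (simp add: seq_assoc')
  also have "\<dots> = (w \<oplus> mu) \<Zsemi> mu" using mu_comm by (simp add: interchange')
  also have "\<dots> = (mu \<oplus> w) \<Zsemi> mu" using mu_assoc by simp
  finally show ?thesis .
qed

lemma mu_sw: "(mu \<oplus> w) \<Zsemi> sw = (w \<oplus> sw) \<Zsemi> ((sw \<oplus> w) \<Zsemi> (w \<oplus> mu))"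
  using braid_natural'[of mu w] hexagon2[of "Suc 0" "Suc 0" "Suc 0"] by (simp add: seq_assoc')

text \<open>\<open>mult_at m x\<close> multiplies the last of \<open>m + 1\<close> wires into wire \<open>x\<close>; junk unless \<open>x < m\<close>.\<close>

primrec mult_at :: "nat \<Rightarrow> nat \<Rightarrow> 'a" where
  "mult_at 0 x = mu"
| "mult_at (Suc m) x = (if x = m then ident P m \<oplus> mu else (ident P m \<oplus> sw) \<Zsemi> (mult_at m x \<oplus> w))"

lemma ty_mult_at [simp]: "x < m \<Longrightarrow> is_arr (mult_at m x)" "x < m \<Longrightarrow> dm (mult_at m x) = Suc m"
    "x < m \<Longrightarrow> cd (mult_at m x) = m"
proof (induction m)
  case (Suc m)
  { case 1 with Suc show ?case by auto }
  { case 2 with Suc show ?case by auto }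
  { case 3 with Suc show ?case by auto }
qed auto

lemma mult_at_last: "mult_at (Suc m) m = ident P m \<oplus> mu" by simp
lemma mult_at_less: "x < m \<Longrightarrow> mult_at (Suc m) x = (ident P m \<oplus> sw) \<Zsemi> (mult_at m x \<oplus> w)" by simp

declare mult_at.simps [simp del]

text \<open>The mixed case of \<open>mult_at_comm\<close>: one target is the last wire, so the
  product \<open>mu\<close> formed there has to slide through the crossing that leads to wire
  \<open>y\<close>.\<close>

lemma mult_at_comm_last:
  assumes y: "y < m"
  shows "(mult_at (Suc m) m \<oplus> w) \<Zsemi> mult_at (Suc m) y
    = (ident P (Suc m) \<oplus> sw) \<Zsemi> ((mult_at (Suc m) y \<oplus> w) \<Zsemi> mult_at (Suc m) m)"
proof -
  let ?z = "(ident P m \<oplus> ((w \<oplus> sw) \<Zsemi> (sw \<oplus> w))) \<Zsemi> (mult_at m y \<oplus> mu)"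
  have 1: "(ident P m \<oplus> (w \<oplus> mu)) \<Zsemi> (mult_at m y \<oplus> w) = mult_at m y \<oplus> mu"
    using y interchange'[of "ident P (Suc m)" "mult_at m y" mu w] by (simp add: id_Suc_par[where m = m])
  have "(mult_at (Suc m) m \<oplus> w) \<Zsemi> mult_at (Suc m) y
      = (ident P m \<oplus> ((mu \<oplus> w) \<Zsemi> sw)) \<Zsemi> (mult_at m y \<oplus> w)"
    using y by (simp add: mult_at_last mult_at_less par_assoc' interchange' flip: seq_assoc')
  also have "\<dots> = (ident P m \<oplus> ((w \<oplus> sw) \<Zsemi> (sw \<oplus> w))) \<Zsemi> ((ident P m \<oplus> (w \<oplus> mu)) \<Zsemi> (mult_at m y \<oplus> w))"
    using y by (simp add: mu_sw par_assoc' interchange' flip: seq_assoc')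
  finally have 2: "(mult_at (Suc m) m \<oplus> w) \<Zsemi> mult_at (Suc m) y = ?z" unfolding 1 .
  have 3: "(mult_at m y \<oplus> ident P (Suc (Suc 0))) \<Zsemi> (ident P m \<oplus> mu) = mult_at m y \<oplus> mu"
    using y by (simp add: interchange')
  have "(ident P (Suc m) \<oplus> sw) \<Zsemi> ((mult_at (Suc m) y \<oplus> w) \<Zsemi> mult_at (Suc m) m)
    = (ident P m \<oplus> (w \<oplus> sw)) \<Zsemi> (((ident P m \<oplus> (sw \<oplus> w)) \<Zsemi> (mult_at m y \<oplus> ident P (Suc (Suc 0))))
        \<Zsemi> (ident P m \<oplus> mu))"
    using y interchange'[of "ident P m \<oplus> sw" "mult_at m y \<oplus> w" w w]
    by (simp add: mult_at_last mult_at_less id_Suc_par[where m = m] par_assoc')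
  also have "\<dots> = ((ident P m \<oplus> (w \<oplus> sw)) \<Zsemi> (ident P m \<oplus> (sw \<oplus> w))) \<Zsemi>
      ((mult_at m y \<oplus> ident P (Suc (Suc 0))) \<Zsemi> (ident P m \<oplus> mu))"
    using y by (simp add: seq_assoc')
  also have "\<dots> = ?z" unfolding 3 by (simp add: interchange')
  finally show ?thesis unfolding 2 ..
qed

text \<open>Neither product touches wire \<open>m\<close>, so both incoming wires can cross it
  beforehand, and the two products then take place on \<open>m\<close> wires with wire
  \<open>m\<close> as a spectator. This is the induction step for \<open>mult_at_comm\<close> and
  \<open>mult_at_mu\<close>.\<close>

lemma mult_at_twice:
  assumes ab: "a < m" "b < m"
  shows "(mult_at (Suc m) a \<oplus> w) \<Zsemi> mult_at (Suc m) b = ((ident P m \<oplus> (sw \<oplus> w)) \<Zsemi> (ident P m \<oplus> (w \<oplus> sw)))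
    \<Zsemi> (((mult_at m a \<oplus> w) \<Zsemi> mult_at m b) \<oplus> w)" (is "_ = (?s1 \<Zsemi> ?s2) \<Zsemi> _")
proof -
  let ?u = "ident P (Suc (Suc 0))"
  have 1: "(mult_at m a \<oplus> ?u) \<Zsemi> (ident P m \<oplus> sw) = ?s2 \<Zsemi> (mult_at m a \<oplus> ?u)"
    using ab interchange'[of "mult_at m a" "ident P m" ?u sw]
        interchange'[of "ident P (Suc m)" "mult_at m a" sw ?u]
    by (simp add: id_Suc_par[where m = m])
  have 2: "mult_at (Suc m) a \<oplus> w = ?s1 \<Zsemi> (mult_at m a \<oplus> ?u)"
    using ab interchange'[of "ident P m \<oplus> sw" "mult_at m a \<oplus> w" w w]
        by (simp add: mult_at_less par_assoc')
  have 3: "((mult_at m a \<oplus> w) \<Zsemi> mult_at m b) \<oplus> w = (mult_at m a \<oplus> ?u) \<Zsemi> (mult_at m b \<oplus> w)"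
    using ab interchange'[of "mult_at m a \<oplus> w" "mult_at m b" w w] by (simp add: par_assoc')
  have "(mult_at (Suc m) a \<oplus> w) \<Zsemi> mult_at (Suc m) b
    = ?s1 \<Zsemi> (((mult_at m a \<oplus> ?u) \<Zsemi> (ident P m \<oplus> sw)) \<Zsemi> (mult_at m b \<oplus> w))"
    using ab unfolding 2 by (simp add: mult_at_less seq_assoc')
  then show ?thesis using ab unfolding 1 3 by (simp add: seq_assoc')
qed

text \<open>Commutativity on several wires. It allows inputs to be multiplied in an order other than
  the one fixed by \<open>star\<close>, which functoriality of \<open>star\<close> requires.\<close>

lemma mult_at_comm:
  assumes "x < m" "y < m"
  shows "(mult_at m x \<oplus> w) \<Zsemi> mult_at m y = (ident P m \<oplus> sw) \<Zsemi> ((mult_at m y \<oplus> w) \<Zsemi> mult_at m x)"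
  using assms
proof (induction m)
  case (Suc m)
  show ?case
  proof (cases "x = m"; cases "y = m")
    assume xy: "x = m" "y = m"
    then show ?thesis
      by (simp add: mult_at_last id_Suc_par[where m = m] par_assoc' interchange' mu_comm2)
  next
    assume "x = m" "y \<noteq> m" then show ?thesis using Suc.prems mult_at_comm_last[of y m] by simp
  next
    assume xy: "x \<noteq> m" "y = m"
    then have x: "x < m" using Suc.prems by simp
    have "(ident P (Suc m) \<oplus> sw) \<Zsemi> ((mult_at (Suc m) y \<oplus> w) \<Zsemi> mult_at (Suc m) x) =
      ((ident P (Suc m) \<oplus> sw) \<Zsemi> (ident P (Suc m) \<oplus> sw)) \<Zsemi> ((mult_at (Suc m) x \<oplus> w) \<Zsemi> mult_at (Suc m) y)"
      using x xy(2) mult_at_comm_last[OF x] by (simp add: seq_assoc')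
    also have "\<dots> = (mult_at (Suc m) x \<oplus> w) \<Zsemi> mult_at (Suc m) y"
      using Suc.prems by (simp add: interchange' sw_sw)
    finally show ?thesis ..
  next
    assume xy: "x \<noteq> m" "y \<noteq> m"
    then have l: "x < m" "y < m" using Suc.prems by auto
    let ?s1 = "ident P m \<oplus> (sw \<oplus> w)" and ?s2 = "ident P m \<oplus> (w \<oplus> sw)" and ?u = "ident P (Suc (Suc 0))"
    note A = mult_at_twice
    \<comment> \<open>The induction hypothesis produces a crossing of the two incoming wires after
      they have crossed wire \<open>m\<close>; Yang--Baxter moves it in front of these
      crossings.\<close>
    have yb: "(?s1 \<Zsemi> ?s2) \<Zsemi> ?s1 = ?s2 \<Zsemi> (?s1 \<Zsemi> ?s2)"
      using yang_baxter by (simp add: seq_assoc' interchange')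
    have 4: "((ident P m \<oplus> sw) \<Zsemi> ((mult_at m y \<oplus> w) \<Zsemi> mult_at m x)) \<oplus> w
        = ?s1 \<Zsemi> (((mult_at m y \<oplus> w) \<Zsemi> mult_at m x) \<oplus> w)"
      using l interchange'[of "ident P m \<oplus> sw" "(mult_at m y \<oplus> w) \<Zsemi> mult_at m x" w w]
          by (simp add: par_assoc')
    have "(mult_at (Suc m) x \<oplus> w) \<Zsemi> mult_at (Suc m) y
        = (?s1 \<Zsemi> ?s2) \<Zsemi> (?s1 \<Zsemi> (((mult_at m y \<oplus> w) \<Zsemi> mult_at m x) \<oplus> w))"
      unfolding A[OF l] Suc.IH[OF l] 4 ..
    also have "\<dots> = ((?s1 \<Zsemi> ?s2) \<Zsemi> ?s1) \<Zsemi> (((mult_at m y \<oplus> w) \<Zsemi> mult_at m x) \<oplus> w)"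
      using l by (simp add: seq_assoc')
    also have "\<dots> = ?s2 \<Zsemi> ((?s1 \<Zsemi> ?s2) \<Zsemi> (((mult_at m y \<oplus> w) \<Zsemi> mult_at m x) \<oplus> w))"
      unfolding yb using l by (simp add: seq_assoc')
    also have "\<dots> = ?s2 \<Zsemi> ((mult_at (Suc m) y \<oplus> w) \<Zsemi> mult_at (Suc m) x)"
      unfolding A[OF l(2,1)] ..
    finally show ?thesis by (simp add: id_Suc_par[where m = m])
  qed
qed simp

lemma mu_sw2: "(w \<oplus> mu) \<Zsemi> sw = (sw \<oplus> w) \<Zsemi> ((w \<oplus> sw) \<Zsemi> (mu \<oplus> w))"
  using braid_natural'[of w mu] braid_hexagon[of "Suc 0" "Suc 0" "Suc 0"] by (simp add: seq_assoc')

text \<open>Associativity if \<open>x\<close> is the last wire; otherwise \<open>mu\<close> slides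
  through the crossing with the last wire by naturality.\<close>

lemma mult_at_mu:
  assumes "x < m"
  shows "(ident P m \<oplus> mu) \<Zsemi> mult_at m x = (mult_at m x \<oplus> w) \<Zsemi> mult_at m x"
  using assms
proof (induction m)
  case (Suc m)
  show ?case
  proof (cases "x = m")
    case True
    then show ?thesis
      using mu_assoc by (simp add: mult_at_last id_Suc_par[where m = m] par_assoc' interchange')
  next
    case False
    then have l: "x < m" using Suc.prems by simp
    let ?s1 = "ident P m \<oplus> (sw \<oplus> w)" and ?s2 = "ident P m \<oplus> (w \<oplus> sw)"
    have 1: "(w \<oplus> mu) \<Zsemi> sw = ((sw \<oplus> w) \<Zsemi> (w \<oplus> sw)) \<Zsemi> (mu \<oplus> w)"
      by (simp add: mu_sw2 seq_assoc')
    have 2: "((ident P m \<oplus> mu) \<Zsemi> mult_at m x) \<oplus> w = (ident P m \<oplus> (mu \<oplus> w)) \<Zsemi> (mult_at m x \<oplus> w)"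
      using l interchange'[of "ident P m \<oplus> mu" "mult_at m x" w w] by (simp add: par_assoc')
    have "(ident P (Suc m) \<oplus> mu) \<Zsemi> mult_at (Suc m) x
      = (ident P m \<oplus> ((w \<oplus> mu) \<Zsemi> sw)) \<Zsemi> (mult_at m x \<oplus> w)"
      using l by (simp add: mult_at_less id_Suc_par[where m = m] interchange' flip: seq_assoc')
    also have "\<dots> = (?s1 \<Zsemi> ?s2) \<Zsemi> (((ident P m \<oplus> mu) \<Zsemi> mult_at m x) \<oplus> w)"
      unfolding 1 2 using l by (simp add: interchange' flip: seq_assoc')
    also have "\<dots> = (mult_at (Suc m) x \<oplus> w) \<Zsemi> mult_at (Suc m) x"
      unfolding Suc.IH[OF l] mult_at_twice[OF l l] ..
    finally show ?thesis .
  qed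
qed simp

lemma eta_sw: "(eta \<oplus> w) \<Zsemi> sw = w \<oplus> eta" "(w \<oplus> eta) \<Zsemi> sw = eta \<oplus> w"
  using braid_natural'[of eta w] braid_natural'[of w eta] by (simp_all add: braid_unit)

lemma eta_mult_at: "x < m \<Longrightarrow> (ident P m \<oplus> eta) \<Zsemi> mult_at m x = ident P m"
proof (induction m)
  case (Suc m)
  show ?case
  proof (cases "x = m")
    case True
    then show ?thesis
      using mu_unit_right by (simp add: mult_at_last id_Suc_par[where m = m] par_assoc' interchange')
  next
    case False
    then have l: "x < m" using Suc.prems by simp
    have "(ident P (Suc m) \<oplus> eta) \<Zsemi> mult_at (Suc m) x
        = (ident P m \<oplus> ((w \<oplus> eta) \<Zsemi> sw)) \<Zsemi> (mult_at m x \<oplus> w)"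
      using l by (simp add: mult_at_less id_Suc_par[where m = m] interchange' flip: seq_assoc')
    also have "\<dots> = ((ident P m \<oplus> eta) \<Zsemi> mult_at m x) \<oplus> w"
      using l interchange'[of "ident P m \<oplus> eta" "mult_at m x" w w] by (simp add: eta_sw par_assoc')
    finally show ?thesis using Suc.IH[OF l] by simp
  qed
qed simp

lemma mult_at_add: "x < k \<Longrightarrow> mult_at (m + k) (m + x) = ident P m \<oplus> mult_at k x"
proof (induction k)
  case (Suc k)
  show ?case
  proof (cases "x = k")
    case True
    then show ?thesis by (simp add: mult_at_last id_par_id_par)
  next
    case False
    with Suc have l: "x < k" and IH: "mult_at (m + k) (m + x) = ident P m \<oplus> mult_at k x" by auto
    show ?thesis
      using l interchange'[of "ident P m" "ident P m" "ident P k \<oplus> sw" "mult_at k x \<oplus> w"]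
      by (simp add: mult_at_less IH id_par_id_par par_assoc')
  qed
qed simp

section \<open>The action of finite functions: functoriality, sums, permutations\<close>

primrec etas :: "nat \<Rightarrow> 'a" where
  "etas 0 = ident P 0"
| "etas (Suc m) = etas m \<oplus> eta"

lemma ty_etas [simp]: "is_arr (etas m)" "dm (etas m) = 0" "cd (etas m) = m"
proof (induction m)
  case (Suc m)
  { case 1 with Suc show ?case by simp }
  { case 2 with Suc show ?case by simp }
  { case 3 with Suc show ?case by simp }
qed simp_all

text \<open>The action on arrows of the functor from finite sets to \<open>P\<close> that the commutative monoid induces.\<close>

primrec star :: "nat \<Rightarrow> nat \<Rightarrow> (nat \<Rightarrow> nat) \<Rightarrow> 'a" where
  "star 0 m f = etas m"
| "star (Suc n) m f = (star n m f \<oplus> w) \<Zsemi> mult_at m (f n)"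

lemma ty_star [simp]:
  "maps n m f \<Longrightarrow> is_arr (star n m f)" "maps n m f \<Longrightarrow> dm (star n m f) = n"
  "maps n m f \<Longrightarrow> cd (star n m f) = m"
proof (induction n)
  case (Suc n)
  { case 1 with Suc show ?case by (simp add: maps_Suc) }
  { case 2 with Suc show ?case by (simp add: maps_Suc) }
  { case 3 with Suc show ?case by (simp add: maps_Suc) }
qed simp_all

lemma star_cong: "(\<And>x. x < n \<Longrightarrow> f x = g x) \<Longrightarrow> star n m f = star n m g"
  by (induction n) auto

text \<open>The one-wire case of functoriality, \<open>mult_at n x\<close> being the function that
  sends an extra point to \<open>x\<close>. If \<open>x\<close> is the last wire this is
  associativity at \<open>g x\<close>; otherwise the extra wire has to overtake the contribution of
  the last wire, by \<open>mult_at_comm\<close>.\<close>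

lemma mult_at_star:
  assumes "x < n" "maps n m g"
  shows "mult_at n x \<Zsemi> star n m g = (star n m g \<oplus> w) \<Zsemi> mult_at m (g x)"
  using assms
proof (induction n)
  case (Suc n)
  let ?z = "g n" and ?u = "ident P (Suc (Suc 0))"
  have g: "maps n m g" and z: "?z < m" using Suc.prems by (simp_all add: maps_Suc)
  have 0: "star (Suc n) m g \<oplus> w = (star n m g \<oplus> ?u) \<Zsemi> (mult_at m ?z \<oplus> w)"
    using g z interchange'[of "star n m g \<oplus> w" "mult_at m ?z" w w] by (simp add: par_assoc')
  show ?case
  proof (cases "x = n")
    case True
    have "mult_at (Suc n) x \<Zsemi> star (Suc n) m g = (star n m g \<oplus> mu) \<Zsemi> mult_at m ?z"
      using True g z by (simp add: mult_at_last interchange' flip: seq_assoc')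
    also have "\<dots> = (star n m g \<oplus> ?u) \<Zsemi> ((ident P m \<oplus> mu) \<Zsemi> mult_at m ?z)"
      using g z by (simp add: interchange' flip: seq_assoc')
    also have "\<dots> = (star (Suc n) m g \<oplus> w) \<Zsemi> mult_at m (g x)"
      unfolding mult_at_mu[OF z] 0 using True g z by (simp add: seq_assoc')
    finally show ?thesis .
  next
    case False
    then have x: "x < n" using Suc.prems by simp
    then have y: "g x < m" using g by (simp add: maps_def)
    have 1: "(mult_at n x \<Zsemi> star n m g) \<oplus> w = (star n m g \<oplus> ?u) \<Zsemi> (mult_at m (g x) \<oplus> w)"
      unfolding Suc.IH[OF x g]
      using x g y interchange'[of "star n m g \<oplus> w" "mult_at m (g x)" w w] by (simp add: par_assoc')
    have "mult_at (Suc n) x \<Zsemi> star (Suc n) m g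
      = (ident P n \<oplus> sw) \<Zsemi> (((mult_at n x \<Zsemi> star n m g) \<oplus> w) \<Zsemi> mult_at m ?z)"
      using x g z interchange'[of "mult_at n x" "star n m g" w w]
          by (simp add: mult_at_less seq_assoc' flip: seq_assoc'[of "mult_at n x \<oplus> w"])
    also have "\<dots> = ((ident P n \<oplus> sw) \<Zsemi> (star n m g \<oplus> ?u)) \<Zsemi> ((mult_at m (g x) \<oplus> w) \<Zsemi> mult_at m ?z)"
      unfolding 1 using x g y z by (simp add: seq_assoc')
    also have "(ident P n \<oplus> sw) \<Zsemi> (star n m g \<oplus> ?u) = (star n m g \<oplus> ?u) \<Zsemi> (ident P m \<oplus> sw)"
      using g by (simp add: interchange')
    also have "\<dots> \<Zsemi> ((mult_at m (g x) \<oplus> w) \<Zsemi> mult_at m ?z)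
      = (star n m g \<oplus> ?u) \<Zsemi> ((ident P m \<oplus> sw) \<Zsemi> ((mult_at m (g x) \<oplus> w) \<Zsemi> mult_at m ?z))"
      using g y z by (simp add: seq_assoc')
    also have "\<dots> = (star (Suc n) m g \<oplus> w) \<Zsemi> mult_at m (g x)"
      unfolding mult_at_comm[OF z y, symmetric] 0 using g y z by (simp add: seq_assoc')
    finally show ?thesis .
  qed
qed simp

lemma etas_star: "maps n m g \<Longrightarrow> etas n \<Zsemi> star n m g = etas m"
proof (induction n)
  case (Suc n)
  then have g: "maps n m g" and z: "g n < m" by (simp_all add: maps_Suc)
  have "etas (Suc n) \<Zsemi> star (Suc n) m g = ((etas n \<Zsemi> star n m g) \<oplus> eta) \<Zsemi> mult_at m (g n)"
    using g z by (simp add: interchange' flip: seq_assoc')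
  also have "\<dots> = etas m \<Zsemi> ((ident P m \<oplus> eta) \<Zsemi> mult_at m (g n))"
    unfolding Suc.IH[OF g] using z interchange'[of "etas m" "ident P m" "ident P 0" eta]
    by (simp flip: seq_assoc')
  finally show ?case using z by (simp add: eta_mult_at)
qed simp

lemma star_comp:
  assumes "maps n m f" "maps m k g"
  shows "star n m f \<Zsemi> star m k g = star n k (\<lambda>x. g (f x))"
  using assms(1)
proof (induction n)
  case 0
  show ?case using assms(2) by (simp add: etas_star)
next
  case (Suc n)
  then have f: "maps n m f" and z: "f n < m" by (simp_all add: maps_Suc)
  then have gz: "g (f n) < k" using assms(2) by (simp add: maps_def)
  have "star (Suc n) m f \<Zsemi> star m k g = (star n m f \<oplus> w) \<Zsemi> ((star m k g \<oplus> w) \<Zsemi> mult_at k (g (f n)))"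
    using f z assms(2) by (simp add: seq_assoc' mult_at_star)
  also have "\<dots> = ((star n m f \<Zsemi> star m k g) \<oplus> w) \<Zsemi> mult_at k (g (f n))"
    using f gz assms(2) by (simp add: interchange' flip: seq_assoc')
  finally show ?case using Suc.IH[OF f] by simp
qed

lemma star_Suc_right: "maps n m f \<Longrightarrow> star n (Suc m) f = star n m f \<oplus> eta"
proof (induction n)
  case (Suc n)
  then have f: "maps n m f" and z: "f n < m" by (simp_all add: maps_Suc)
  have "star (Suc n) (Suc m) f = ((star n m f \<oplus> (eta \<oplus> w)) \<Zsemi> (ident P m \<oplus> sw)) \<Zsemi> (mult_at m (f n) \<oplus> w)"
    using f z Suc.IH[OF f] by (simp add: mult_at_less par_assoc' seq_assoc')
  also have "\<dots> = (star n m f \<oplus> (w \<oplus> eta)) \<Zsemi> (mult_at m (f n) \<oplus> w)"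
    using f by (simp add: interchange' eta_sw)
  also have "\<dots> = star (Suc n) m f \<oplus> eta"
    using f z interchange'[of "star n m f \<oplus> w" "mult_at m (f n)" eta w] by (simp add: par_assoc')
  finally show ?case .
qed simp

text \<open>The new output wire starts as a unit, by \<open>star_Suc_right\<close>, and the last
  input is multiplied into it: this is the left unit law.\<close>

lemma star_id: "star n n (\<lambda>x. x) = ident P n"
proof (induction n)
  case (Suc n)
  have "maps n n (\<lambda>x. x)" by (simp add: maps_def)
  then show ?case
    using Suc mu_unit_left by (simp add: star_Suc_right mult_at_last par_assoc' interchange')
qed simp

lemma star_add_right: "maps n m f \<Longrightarrow> star n (m + k) f = star n m f \<oplus> etas k"
proof (induction k)
  case (Suc k)
  then have "maps n (m + k) f" by (auto simp: maps_def trans_less_add1)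
  then show ?case using Suc by (simp add: star_Suc_right par_assoc')
qed simp

lemma star_par:
  assumes "maps n m f" "maps n' m' g"
  shows "star n m f \<oplus> star n' m' g = star (n + n') (m + m') (par_fun n m f g)"
  using assms(2)
proof (induction n')
  case 0
  have "star n (m + m') (par_fun n m f g) = star n (m + m') f"
    by (rule star_cong) (simp add: par_fun_def)
  then show ?case using assms(1) by (simp add: star_add_right)
next
  case (Suc n')
  then have g: "maps n' m' g" and z: "g n' < m'" by (simp_all add: maps_Suc)
  have "star n m f \<oplus> star (Suc n') m' g
    = (star n m f \<oplus> (star n' m' g \<oplus> w)) \<Zsemi> (ident P m \<oplus> mult_at m' (g n'))"
    using assms(1) g z by (simp add: interchange')
  also have "\<dots> = (star (n + n') (m + m') (par_fun n m f g) \<oplus> w) \<Zsemi> mult_at (m + m') (m + g n')"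
    using assms(1) g z by (simp add: Suc.IH[symmetric] par_assoc' mult_at_add)
  moreover have "par_fun n m f g (n + n') = m + g n'" by (simp add: par_fun_def)
  ultimately show ?case by simp
qed

lemma star_swap_1_1: "star 2 2 (swap_fun 1 1) = sw"
proof -
  have 1: "mult_at (Suc 0) 0 = mu" using mult_at_last[of 0] by simp
  have 2: "mult_at (Suc (Suc 0)) 0 = (w \<oplus> sw) \<Zsemi> (mu \<oplus> w)" by (simp add: mult_at_less 1)
  have 3: "((eta \<oplus> eta) \<oplus> w) \<Zsemi> (w \<oplus> mu) = eta \<oplus> w"
    using mu_unit_left by (simp add: par_assoc' interchange')
  have "star 2 2 (swap_fun 1 1) = ((((eta \<oplus> eta) \<oplus> w) \<Zsemi> (w \<oplus> mu)) \<oplus> w) \<Zsemi> ((w \<oplus> sw) \<Zsemi> (mu \<oplus> w))"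
    by (simp add: numeral_2_eq_2 swap_fun_def mult_at_last 2)
  also have "\<dots> = (((eta \<oplus> w) \<oplus> w) \<Zsemi> (w \<oplus> sw)) \<Zsemi> (mu \<oplus> w)" unfolding 3 by (simp add: seq_assoc')
  also have "\<dots> = (eta \<oplus> sw) \<Zsemi> (mu \<oplus> w)" by (simp add: par_assoc' interchange')
  also have "\<dots> = sw \<Zsemi> ((eta \<oplus> (w \<oplus> w)) \<Zsemi> (mu \<oplus> w))"
    using interchange'[of "ident P 0" eta sw "ident P (Suc (Suc 0))"] by (simp flip: seq_assoc')
  also have "(eta \<oplus> (w \<oplus> w)) \<Zsemi> (mu \<oplus> w) = ident P (Suc (Suc 0))"
    using mu_unit_left interchange'[of "eta \<oplus> w" mu w w] by (simp add: par_assoc')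
  finally show ?thesis by simp
qed

declare star.simps [simp del]

text \<open>Both sides decompose alike: the hexagons build a block swap from crossings of single
  wires, and the matching functions compose to \<open>swap_fun\<close>. One wire past
  \<open>m\<close> wires comes first, then induction on \<open>n\<close>.\<close>

lemma star_swap: "star (n + m) (m + n) (swap_fun n m) = braid P n m"
proof -
  have id: "maps k k (\<lambda>x. x)" for k by (simp add: maps_def)
  have sf: "maps (k + l) (l + k) (swap_fun k l)" for k l by (auto simp: maps_def swap_fun_def)
  have one: "star (Suc m) (Suc m) (swap_fun 1 m) = braid P (Suc 0) m" for m
  proof (induction m)
    case 0
    have "star (Suc 0) (Suc 0) (swap_fun 1 0) = star (Suc 0) (Suc 0) (\<lambda>x. x)"
      by (rule star_cong) (simp add: swap_fun_def)
    then show ?case by (simp only: star_id braid_unit)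
  next
    case (Suc m)
    let ?f = "par_fun (Suc m) (Suc m) (swap_fun 1 m) (\<lambda>x. x)"
    let ?g = "par_fun m m (\<lambda>x. x) (swap_fun 1 1)"
    have 1: "braid P (Suc 0) m \<oplus> w = star (Suc (Suc m)) (Suc (Suc m)) ?f"
      using star_par[of "Suc m" "Suc m" "swap_fun 1 m" 1 1 "\<lambda>x. x"] id sf[of 1 m] Suc
      by (simp only: star_id) simp
    have 2: "ident P m \<oplus> sw = star (Suc (Suc m)) (Suc (Suc m)) ?g"
      using star_par[of m m "\<lambda>x. x" 2 2 "swap_fun 1 1"] id[of m] sf[of 1 1]
      by (simp only: star_id star_swap_1_1) (simp add: numeral_2_eq_2)
    have maps: "maps (Suc (Suc m)) (Suc (Suc m)) ?f" "maps (Suc (Suc m)) (Suc (Suc m)) ?g"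
      by (auto simp: maps_def par_fun_def swap_fun_def)
    have "braid P (Suc 0) (Suc m) = (braid P (Suc 0) m \<oplus> w) \<Zsemi> (ident P m \<oplus> sw)"
      using braid_hexagon[of "Suc 0" m "Suc 0"] by simp
    also have "\<dots> = star (Suc (Suc m)) (Suc (Suc m)) (\<lambda>x. ?g (?f x))"
      unfolding 1 2 by (rule star_comp[OF maps])
    also have "\<dots> = star (Suc (Suc m)) (Suc (Suc m)) (swap_fun 1 (Suc m))"
      by (rule star_cong) (auto simp: par_fun_def swap_fun_def)
    finally show ?case ..
  qed
  show ?thesis
  proof (induction n)
    case 0
    have "star m m (swap_fun 0 m) = star m m (\<lambda>x. x)"
      by (rule star_cong) (simp add: swap_fun_def)
    then show ?case by (simp add: star_id)
  next
    case (Suc n)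
    let ?f = "par_fun n n (\<lambda>x. x) (swap_fun 1 m)"
    let ?g = "par_fun (n + m) (m + n) (swap_fun n m) (\<lambda>x. x)"
    have 1: "ident P n \<oplus> braid P (Suc 0) m = star (Suc (n + m)) (Suc (n + m)) ?f"
      using star_par[of n n "\<lambda>x. x" "Suc m" "Suc m" "swap_fun 1 m"] id[of n] sf[of 1 m]
      by (simp only: star_id one) simp
    have 2: "braid P n m \<oplus> w = star (Suc (n + m)) (Suc (m + n)) ?g"
      using star_par[of "n + m" "m + n" "swap_fun n m" 1 1 "\<lambda>x. x"] id sf[of n m] Suc
      by (simp only: star_id) simp
    have maps: "maps (Suc (n + m)) (Suc (n + m)) ?f" "maps (Suc (n + m)) (Suc (m + n)) ?g"
      by (auto simp: maps_def par_fun_def swap_fun_def)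
    have "braid P (Suc n) m = (ident P n \<oplus> braid P (Suc 0) m) \<Zsemi> (braid P n m \<oplus> w)"
      using hexagon2[of n "Suc 0" m] by simp
    also have "\<dots> = star (Suc (n + m)) (Suc (m + n)) (\<lambda>x. ?g (?f x))"
      unfolding 1 2 by (rule star_comp[OF maps])
    also have "\<dots> = star (Suc (n + m)) (Suc (m + n)) (swap_fun (Suc n) m)"
      by (rule star_cong) (auto simp: par_fun_def swap_fun_def)
    finally show ?case by simp
  qed
qed

text \<open>Insertion sort: \<open>g\<close> is \<open>f\<close> without its last point, with the
  values above \<open>x\<close> moved down by one, and the braid carries the last wire to position
  \<open>x\<close>. A permutation written with braids is visibly invertible, for the monoid and the
  comonoid alike.\<close>

lemma star_bij_Suc:
  assumes f: "bij_betw f {..<Suc n} {..<Suc n}" and x: "x = f n"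
    and g: "g = (\<lambda>y. if f y < x then f y else f y - 1)"
  shows "bij_betw g {..<n} {..<n}"
    and "star (Suc n) (Suc n) f = (star n n g \<oplus> w) \<Zsemi> (ident P x \<oplus> braid P (n - x) (Suc 0))"
proof -
  have fS: "f y < Suc n" if "y < Suc n" for y
    using bij_betw_apply[OF f, of y] that by simp
  have xn: "x \<le> n" using fS[of n] x by simp
  have fx: "f y < Suc n" "f y \<noteq> x" if "y < n" for y
    using fS[of y] f x that by (auto simp: bij_betw_def inj_on_def)
  have gm: "maps n n g" using fx xn by (fastforce simp: g maps_def)
  have "inj_on g {..<n}"
  proof (rule inj_onI)
    fix y z assume yz: "y \<in> {..<n}" "z \<in> {..<n}" "g y = g z"
    then have "f y = f z" using fx[of y] fx[of z] by (auto simp: g split: if_splits)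
    then show "y = z" using f yz by (auto simp: bij_betw_def inj_on_def)
  qed
  moreover have "g ` {..<n} \<subseteq> {..<n}" using gm by (auto simp: maps_def)
  ultimately show "bij_betw g {..<n} {..<n}"
    by (simp add: bij_betw_def endo_inj_surj)
  have id: "maps k k (\<lambda>x. x)" for k by (simp add: maps_def)
  let ?a = "par_fun n n g (\<lambda>x. x)" and ?b = "par_fun x x (\<lambda>x. x) (swap_fun (n - x) 1)"
  have 1: "star n n g \<oplus> w = star (Suc n) (Suc n) ?a"
    using star_par[OF gm id, of 1] by (simp only: star_id) simp
  have 2: "ident P x \<oplus> braid P (n - x) (Suc 0) = star (Suc n) (Suc n) ?b"
    using star_par[OF id, of "n - x + 1" "1 + (n - x)" "swap_fun (n - x) 1" x] xn
    by (simp only: star_id star_swap) (simp add: maps_def swap_fun_def)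
  have maps: "maps (Suc n) (Suc n) ?a" "maps (Suc n) (Suc n) ?b"
    using gm xn by (auto simp: maps_def par_fun_def swap_fun_def less_Suc_eq)
  have "star (Suc n) (Suc n) (\<lambda>y. ?b (?a y)) = star (Suc n) (Suc n) f"
  proof (rule star_cong)
    fix y assume "y < Suc n"
    then consider "y < n" | "y = n" by linarith
    then show "?b (?a y) = f y"
    proof cases
      case 1 then show ?thesis using fx[OF 1] xn by (auto simp: par_fun_def swap_fun_def g)
    next
      case 2 then show ?thesis using x xn by (auto simp: par_fun_def swap_fun_def)
    qed
  qed
  then show "star (Suc n) (Suc n) f = (star n n g \<oplus> w) \<Zsemi> (ident P x \<oplus> braid P (n - x) (Suc 0))"
    unfolding 1 2 star_comp[OF maps] ..
qed

end

section \<open>Frobenius monoids\<close>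

locale frob_prop = comm_monoid_prop P mu eta + com: comm_monoid_prop "op_prop P" delta eps
  for P :: "'a prop_struct" (structure) and mu eta delta eps +
  assumes frob_left: "(delta \<oplus> ident P 1) \<Zsemi> (ident P 1 \<oplus> mu) = mu \<Zsemi> delta"
    and frob_right: "mu \<Zsemi> delta = (ident P 1 \<oplus> delta) \<Zsemi> (mu \<oplus> ident P 1)"
    and special: "delta \<Zsemi> mu = ident P 1"
begin

text \<open>The axioms are self-dual, the two Frobenius equations being exchanged, so every lemma of
  this locale has a dual instance.\<close>

lemma frob_op: "frob_prop (op_prop P) delta eps mu eta"
proof (intro frob_prop.intro frob_prop_axioms.intro)
  show "comm_monoid_prop (op_prop P) delta eps" by (rule com.comm_monoid_prop_axioms)
  show "comm_monoid_prop (op_prop (op_prop P)) mu eta"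
    by (simp add: comm_monoid_prop_axioms)
qed (use frob_left frob_right special in simp_all)

lemmas op_simps = op_prop_op_prop op_prop_simps prop_dom_op is_arr_op

abbreviation "costar \<equiv> com.star"
abbreviation "comult_at \<equiv> com.mult_at"

lemmas ty_delta [simp] = com.ty_mu[unfolded op_simps]
lemmas ty_eps [simp] = com.ty_eta[unfolded op_simps]
lemmas ty_comult_at [simp] = com.ty_mult_at[unfolded op_simps]
lemmas ty_costar [simp] = com.ty_star[unfolded op_simps]
lemmas ty_epss [simp] = com.ty_etas[unfolded op_simps]
lemmas comult_at_last = com.mult_at_last[unfolded op_simps]
lemmas comult_at_less = com.mult_at_less[unfolded op_simps]
lemmas costar_comp = com.star_comp[unfolded op_simps]
lemmas costar_par = com.star_par[unfolded op_simps]
lemmas costar_id = com.star_id[unfolded op_simps]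
lemmas costar_swap = com.star_swap[unfolded op_simps]

lemma sw_delta: "sw \<Zsemi> (w \<oplus> delta) = (delta \<oplus> w) \<Zsemi> ((w \<oplus> sw) \<Zsemi> (sw \<oplus> w))"
  using braid_natural'[of delta w] hexagon2[of "Suc 0" "Suc 0" "Suc 0"] by simp

lemma sw_delta2: "(w \<oplus> delta) \<Zsemi> (sw \<oplus> w) = sw \<Zsemi> ((delta \<oplus> w) \<Zsemi> (w \<oplus> sw))"
proof -
  have "sw \<Zsemi> (delta \<oplus> w) = (w \<oplus> delta) \<Zsemi> ((sw \<oplus> w) \<Zsemi> (w \<oplus> sw))"
    using braid_natural'[of w delta] braid_hexagon[of "Suc 0" "Suc 0" "Suc 0"] by simp
  then have "sw \<Zsemi> ((delta \<oplus> w) \<Zsemi> (w \<oplus> sw))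
      = (w \<oplus> delta) \<Zsemi> (((sw \<oplus> w) \<Zsemi> (w \<oplus> sw)) \<Zsemi> (w \<oplus> sw))"
    by (simp flip: seq_assoc')
  then show ?thesis by (simp add: seq_assoc' interchange' sw_sw)
qed

lemma delta_sw: "delta \<Zsemi> sw = delta"
  using com.mu_comm by simp

text \<open>The Frobenius law in the shape that generalises to \<open>mult_comult\<close>: the
  target wire is copied, the copy crosses the incoming wire, and then the product is taken.
  Commutativity of \<open>delta\<close> absorbs the extra crossing.\<close>

lemma mu_delta: "mu \<Zsemi> delta = (delta \<oplus> w) \<Zsemi> ((w \<oplus> sw) \<Zsemi> (mu \<oplus> w))"
proof -
  have 1: "(delta \<oplus> w) \<Zsemi> (sw \<oplus> w) = delta \<oplus> w" by (simp add: interchange' delta_sw)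
  have "mu \<Zsemi> delta = ((delta \<oplus> w) \<Zsemi> (w \<oplus> mu)) \<Zsemi> sw"
    using frob_left by (simp add: seq_assoc' delta_sw)
  also have "\<dots> = ((delta \<oplus> w) \<Zsemi> (sw \<oplus> w)) \<Zsemi> ((w \<oplus> sw) \<Zsemi> (mu \<oplus> w))"
    by (simp add: seq_assoc' mu_sw2)
  finally show ?thesis unfolding 1 .
qed

text \<open>Beck--Chevalley for single wires. For \<open>a \<noteq> b\<close> the two operations
  touch different wires; for \<open>a = b\<close> it is the Frobenius law in the form
  \<open>mu_delta\<close>. The crossing separates the incoming from the outgoing wire.\<close>

lemma mult_comult:
  assumes "a < m" "b < m"
  shows "mult_at m a \<Zsemi> comult_at m b = (comult_at m b \<oplus> w) \<Zsemi> ((ident P m \<oplus> sw) \<Zsemi> (mult_at m a \<oplus> w))"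
  using assms
proof (induction m)
  case (Suc m)
  let ?u = "ident P (Suc (Suc 0))"
  let ?s1 = "ident P m \<oplus> (sw \<oplus> w)" and ?s2 = "ident P m \<oplus> (w \<oplus> sw)"
  have I: "mult_at (Suc m) a \<oplus> w = ?s1 \<Zsemi> (mult_at m a \<oplus> ?u)" if "a < m"
    using that interchange'[of "ident P m \<oplus> sw" "mult_at m a \<oplus> w" w w]
        by (simp add: mult_at_less par_assoc')
  have C: "comult_at (Suc m) b \<oplus> w = (comult_at m b \<oplus> ?u) \<Zsemi> ?s1" if "b < m"
    using that interchange'[of "comult_at m b \<oplus> w" "ident P m \<oplus> sw" w w]
        by (simp add: comult_at_less par_assoc')
  show ?case
  proof (cases "a = m"; cases "b = m")
    assume ab: "a = m" "b = m"
    then show ?thesis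
      by (simp add: mult_at_last comult_at_last id_Suc_par[where m = m] par_assoc' interchange' mu_delta)
  next
    assume "a = m" "b \<noteq> m"
    then have b: "b < m" and a: "a = m" using Suc.prems by auto
    have "mult_at (Suc m) a \<Zsemi> comult_at (Suc m) b
        = ((ident P m \<oplus> mu) \<Zsemi> (comult_at m b \<oplus> w)) \<Zsemi> (ident P m \<oplus> sw)"
      using a b by (simp add: mult_at_last comult_at_less seq_assoc')
    also have "(ident P m \<oplus> mu) \<Zsemi> (comult_at m b \<oplus> w) = (comult_at m b \<oplus> ?u) \<Zsemi> (ident P (Suc m) \<oplus> mu)"
      using b by (simp add: interchange')
    also have "\<dots> \<Zsemi> (ident P m \<oplus> sw) = (comult_at m b \<oplus> ?u) \<Zsemi> (ident P m \<oplus> ((w \<oplus> mu) \<Zsemi> sw))"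
      using b by (simp add: seq_assoc' interchange' id_Suc_par[where m = m])
    also have "\<dots> = (comult_at m b \<oplus> ?u) \<Zsemi> (?s1 \<Zsemi> (?s2 \<Zsemi> (ident P m \<oplus> (mu \<oplus> w))))"
      by (simp add: mu_sw2 interchange')
    also have "\<dots> = (comult_at (Suc m) b \<oplus> w) \<Zsemi> (?s2 \<Zsemi> (ident P m \<oplus> (mu \<oplus> w)))"
      unfolding C[OF b] using b by (simp add: seq_assoc')
    finally show ?thesis using a by (simp add: id_Suc_par[where m = m] mult_at_last par_assoc')
  next
    assume "a \<noteq> m" "b = m"
    then have a: "a < m" and b: "b = m" using Suc.prems by auto
    have "mult_at (Suc m) a \<Zsemi> comult_at (Suc m) b
        = (ident P m \<oplus> sw) \<Zsemi> ((mult_at m a \<oplus> w) \<Zsemi> (ident P m \<oplus> delta))"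
      using a b by (simp add: comult_at_last mult_at_less seq_assoc')
    also have "(mult_at m a \<oplus> w) \<Zsemi> (ident P m \<oplus> delta) = (ident P (Suc m) \<oplus> delta) \<Zsemi> (mult_at m a \<oplus> ?u)"
      using a by (simp add: interchange')
    also have "(ident P m \<oplus> sw) \<Zsemi> \<dots> = (ident P m \<oplus> (sw \<Zsemi> (w \<oplus> delta))) \<Zsemi> (mult_at m a \<oplus> ?u)"
      using a by (simp add: interchange' id_Suc_par[where m = m] flip: seq_assoc')
    also have "\<dots> = ((ident P m \<oplus> (delta \<oplus> w)) \<Zsemi> (?s2 \<Zsemi> ?s1)) \<Zsemi> (mult_at m a \<oplus> ?u)"
      by (simp add: sw_delta interchange')
    also have "\<dots> = (ident P m \<oplus> (delta \<oplus> w)) \<Zsemi> (?s2 \<Zsemi> (mult_at (Suc m) a \<oplus> w))"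
      unfolding I[OF a] using a by (simp add: seq_assoc')
    finally show ?thesis using b by (simp add: id_Suc_par[where m = m] comult_at_last par_assoc')
  next
    assume "a \<noteq> m" "b \<noteq> m"
    then have a: "a < m" and b: "b < m" using Suc.prems by auto
    have 1: "(mult_at m a \<Zsemi> comult_at m b) \<oplus> w = (comult_at m b \<oplus> ?u) \<Zsemi> (?s1 \<Zsemi> (mult_at m a \<oplus> ?u))"
    proof -
      have "(mult_at m a \<Zsemi> comult_at m b) \<oplus> w
          = ((comult_at m b \<oplus> w) \<oplus> w) \<Zsemi> (((ident P m \<oplus> sw) \<oplus> w) \<Zsemi> ((mult_at m a \<oplus> w) \<oplus> w))"
        unfolding Suc.IH[OF a b] using a b
          interchange'[of "comult_at m b \<oplus> w" "(ident P m \<oplus> sw) \<Zsemi> (mult_at m a \<oplus> w)" w w]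
          interchange'[of "ident P m \<oplus> sw" "mult_at m a \<oplus> w" w w] by simp
      then show ?thesis using a b by (simp add: par_assoc')
    qed
    have 2: "(ident P m \<oplus> sw) \<Zsemi> (comult_at m b \<oplus> ?u) = (comult_at m b \<oplus> ?u) \<Zsemi> ?s2"
      using b interchange'[of "ident P m" "comult_at m b" sw ?u]
          interchange'[of "comult_at m b" "ident P (Suc m)" ?u sw]
      by (simp add: id_Suc_par[where m = m])
    have 3: "(mult_at m a \<oplus> ?u) \<Zsemi> (ident P m \<oplus> sw) = ?s2 \<Zsemi> (mult_at m a \<oplus> ?u)"
      using a interchange'[of "mult_at m a" "ident P m" ?u sw]
          interchange'[of "ident P (Suc m)" "mult_at m a" sw ?u]
      by (simp add: id_Suc_par[where m = m])
    have yb: "?s2 \<Zsemi> (?s1 \<Zsemi> ?s2) = ?s1 \<Zsemi> (?s2 \<Zsemi> ?s1)"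
      using yang_baxter by (simp add: interchange')
    have "mult_at (Suc m) a \<Zsemi> comult_at (Suc m) b
      = (ident P m \<oplus> sw) \<Zsemi> ((((mult_at m a \<oplus> w) \<Zsemi> (comult_at m b \<oplus> w))) \<Zsemi> (ident P m \<oplus> sw))"
      using a b by (simp add: mult_at_less comult_at_less seq_assoc')
    also have "(mult_at m a \<oplus> w) \<Zsemi> (comult_at m b \<oplus> w) = (mult_at m a \<Zsemi> comult_at m b) \<oplus> w"
      using a b by (simp add: interchange')
    also have "(ident P m \<oplus> sw) \<Zsemi> (\<dots> \<Zsemi> (ident P m \<oplus> sw))
      = ((ident P m \<oplus> sw) \<Zsemi> (comult_at m b \<oplus> ?u)) \<Zsemi> (?s1 \<Zsemi> ((mult_at m a \<oplus> ?u) \<Zsemi> (ident P m \<oplus> sw)))"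
      unfolding 1 using a b by (simp add: seq_assoc')
    also have "\<dots> = (comult_at m b \<oplus> ?u) \<Zsemi> ((?s2 \<Zsemi> (?s1 \<Zsemi> ?s2)) \<Zsemi> (mult_at m a \<oplus> ?u))"
      unfolding 2 3 using a b by (simp add: seq_assoc')
    also have "\<dots> = ((comult_at m b \<oplus> ?u) \<Zsemi> ?s1) \<Zsemi> (?s2 \<Zsemi> (?s1 \<Zsemi> (mult_at m a \<oplus> ?u)))"
      unfolding yb using a b by (simp add: seq_assoc')
    finally show ?thesis unfolding I[OF a] C[OF b] by (simp add: id_Suc_par[where m = m])
  qed
qed simp

text \<open>The other Frobenius equation: on the same wire the copy may be taken from the incoming
  wire instead of the target wire. This form has no crossing of the target wire with its copy, as
  \<open>star_comult\<close> and \<open>comult_mult_merges\<close> require.\<close>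

lemma mult_comult_same:
  assumes "a < m"
  shows "mult_at m a \<Zsemi> comult_at m a = (ident P m \<oplus> delta) \<Zsemi> (mult_at m a \<oplus> w)"
  using assms
proof (induction m)
  case (Suc m)
  let ?u = "ident P (Suc (Suc 0))"
  show ?case
  proof (cases "a = m")
    case True
    then show ?thesis
      using frob_right by (simp add: mult_at_last comult_at_last id_Suc_par[where m = m] par_assoc'
          interchange')
  next
    case False
    then have a: "a < m" using Suc.prems by auto
    have 1: "(mult_at m a \<Zsemi> comult_at m a) \<oplus> w = (ident P m \<oplus> (delta \<oplus> w)) \<Zsemi> (mult_at m a \<oplus> ?u)"
      unfolding Suc.IH[OF a] using a interchange'[of "ident P m \<oplus> delta" "mult_at m a \<oplus> w" w w]
      by (simp add: par_assoc')
    have 2: "(mult_at m a \<oplus> ?u) \<Zsemi> (ident P m \<oplus> sw) = (ident P m \<oplus> (w \<oplus> sw)) \<Zsemi> (mult_at m a \<oplus> ?u)"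
      using a interchange'[of "mult_at m a" "ident P m" ?u sw]
          interchange'[of "ident P (Suc m)" "mult_at m a" sw ?u]
      by (simp add: id_Suc_par[where m = m])
    have 3: "mult_at (Suc m) a \<oplus> w = (ident P m \<oplus> (sw \<oplus> w)) \<Zsemi> (mult_at m a \<oplus> ?u)"
      using a interchange'[of "ident P m \<oplus> sw" "mult_at m a \<oplus> w" w w]
          by (simp add: mult_at_less par_assoc')
    have "mult_at (Suc m) a \<Zsemi> comult_at (Suc m) a
      = (ident P m \<oplus> sw) \<Zsemi> (((mult_at m a \<oplus> w) \<Zsemi> (comult_at m a \<oplus> w)) \<Zsemi> (ident P m \<oplus> sw))"
      using a by (simp add: mult_at_less comult_at_less seq_assoc')
    also have "(mult_at m a \<oplus> w) \<Zsemi> (comult_at m a \<oplus> w) = (mult_at m a \<Zsemi> comult_at m a) \<oplus> w"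
      using a by (simp add: interchange')
    also have "(ident P m \<oplus> sw) \<Zsemi> (\<dots> \<Zsemi> (ident P m \<oplus> sw))
      = ((ident P m \<oplus> sw) \<Zsemi> ((ident P m \<oplus> (delta \<oplus> w)) \<Zsemi> (ident P m \<oplus> (w \<oplus> sw)))) \<Zsemi> (mult_at m a \<oplus> ?u)"
      unfolding 1 using a by (simp add: seq_assoc' 2)
    also have "(ident P m \<oplus> sw) \<Zsemi> ((ident P m \<oplus> (delta \<oplus> w)) \<Zsemi> (ident P m \<oplus> (w \<oplus> sw)))
      = ident P m \<oplus> (sw \<Zsemi> ((delta \<oplus> w) \<Zsemi> (w \<oplus> sw)))" by (simp add: interchange')
    also have "\<dots> = (ident P m \<oplus> (w \<oplus> delta)) \<Zsemi> (ident P m \<oplus> (sw \<oplus> w))"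
      by (simp add: interchange' flip: sw_delta2)
    also have "\<dots> \<Zsemi> (mult_at m a \<oplus> ?u) = (ident P (Suc m) \<oplus> delta) \<Zsemi> (mult_at (Suc m) a \<oplus> w)"
      unfolding 3 using a by (simp add: id_Suc_par[where m = m] seq_assoc')
    finally show ?thesis .
  qed
qed simp

lemmas mult_comult_same_dual = frob_prop.mult_comult_same[OF frob_op, unfolded op_simps]

lemma comult_mult_same: "a < m \<Longrightarrow> comult_at m a \<Zsemi> mult_at m a = ident P m"
proof (induction m)
  case (Suc m)
  show ?case
  proof (cases "a = m")
    case True
    then show ?thesis using special by (simp add: mult_at_last comult_at_last interchange')
  next
    case False
    then have a: "a < m" using Suc.prems by auto
    have "comult_at (Suc m) a \<Zsemi> mult_at (Suc m) a
      = (comult_at m a \<oplus> w) \<Zsemi> (((ident P m \<oplus> sw) \<Zsemi> (ident P m \<oplus> sw)) \<Zsemi> (mult_at m a \<oplus> w))"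
      using a by (simp add: mult_at_less comult_at_less seq_assoc')
    also have "(ident P m \<oplus> sw) \<Zsemi> (ident P m \<oplus> sw) = ident P (Suc (Suc m))"
      by (simp add: interchange' sw_sw)
    finally show ?thesis using Suc.IH[OF a] a by (simp add: interchange')
  qed
qed simp

text \<open>The counterpart of \<open>mult_at_star\<close> for copying: by the Frobenius law, a copy
  of an image wire may be taken from any input wire that feeds into it.\<close>

lemma star_comult:
  assumes "x < n" "maps n m p"
  shows "star n m p \<Zsemi> comult_at m (p x) = comult_at n x \<Zsemi> (star n m p \<oplus> w)"
  using assms
proof (induction n)
  case (Suc n)
  let ?z = "p n" and ?u = "ident P (Suc (Suc 0))"
  have p: "maps n m p" and z: "?z < m" using Suc.prems by (simp_all add: maps_Suc)
  have 0: "star (Suc n) m p \<oplus> w = (star n m p \<oplus> ?u) \<Zsemi> (mult_at m ?z \<oplus> w)"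
    using p z interchange'[of "star n m p \<oplus> w" "mult_at m ?z" w w] by (simp add: par_assoc' star.simps)
  have px: "p x < m" using Suc.prems by (simp add: maps_def)
  show ?case
  proof (cases "x = n")
    case True
    have "star (Suc n) m p \<Zsemi> comult_at m (p x)
      = (star n m p \<oplus> w) \<Zsemi> ((ident P m \<oplus> delta) \<Zsemi> (mult_at m ?z \<oplus> w))"
      using True p z by (simp add: star.simps seq_assoc' mult_comult_same)
    also have "\<dots> = ((ident P n \<oplus> delta) \<Zsemi> (star n m p \<oplus> ?u)) \<Zsemi> (mult_at m ?z \<oplus> w)"
      using p z by (simp add: interchange' flip: seq_assoc')
    finally show ?thesis unfolding 0 using True p z by (simp add: comult_at_last seq_assoc')
  next
    case False
    then have x: "x < n" using Suc.prems by simp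
    have 1: "(star n m p \<oplus> w) \<Zsemi> (comult_at m (p x) \<oplus> w) = (comult_at n x \<oplus> w) \<Zsemi> (star n m p \<oplus> ?u)"
      using p px x interchange'[of "comult_at n x" "star n m p \<oplus> w" w w]
      by (simp add: interchange' Suc.IH par_assoc')
    have 2: "(star n m p \<oplus> ?u) \<Zsemi> (ident P m \<oplus> sw) = (ident P n \<oplus> sw) \<Zsemi> (star n m p \<oplus> ?u)"
      using p by (simp add: interchange')
    have "star (Suc n) m p \<Zsemi> comult_at m (p x)
      = ((star n m p \<oplus> w) \<Zsemi> (comult_at m (p x) \<oplus> w)) \<Zsemi> ((ident P m \<oplus> sw) \<Zsemi> (mult_at m ?z \<oplus> w))"
      using p z px by (simp add: star.simps seq_assoc' mult_comult)
    also have "\<dots> = (comult_at n x \<oplus> w) \<Zsemi> (((star n m p \<oplus> ?u) \<Zsemi> (ident P m \<oplus> sw)) \<Zsemi> (mult_at m ?z \<oplus> w))"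
      unfolding 1 using p z x by (simp add: seq_assoc')
    also have "\<dots> = comult_at (Suc n) x \<Zsemi> (star (Suc n) m p \<oplus> w)"
      unfolding 2 0 using p z x by (simp add: seq_assoc' comult_at_less)
    finally show ?thesis .
  qed
qed simp

end

section \<open>The Beck--Chevalley condition\<close>

lemma maps_id [simp]: "maps n n (\<lambda>x. x)" by (simp add: maps_def)

lemma maps_comp: "maps n m f \<Longrightarrow> maps m k g \<Longrightarrow> maps n k (\<lambda>x. g (f x))"
  by (simp add: maps_def)

lemma maps_par_fun: "maps n m f \<Longrightarrow> maps n' m' g \<Longrightarrow> maps (n + n') (m + m') (par_fun n m f g)"
  by (auto simp: maps_def par_fun_def trans_less_add1)

text \<open>The coequaliser of two distinct points \<open>u\<close> and \<open>v\<close>, without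
  commitment to a numbering of the quotient.\<close>

definition merges :: "nat \<Rightarrow> nat \<Rightarrow> nat \<Rightarrow> (nat \<Rightarrow> nat) \<Rightarrow> bool" where
  "merges m u v e \<longleftrightarrow> maps (Suc m) m e \<and> (\<forall>z < m. \<exists>x < Suc m. e x = z) \<and>
     (\<forall>x < Suc m. \<forall>y < Suc m. e x = e y \<longleftrightarrow> x = y \<or> {x, y} = {u, v})"

lemma merges_factor:
  assumes e: "merges m u v e" and \<alpha>: "\<alpha> u = \<alpha> v"
  shows "\<exists>\<gamma>. \<forall>x < Suc m. \<gamma> (e x) = \<alpha> x"
proof (intro exI allI impI)
  fix x assume x: "x < Suc m"
  let ?y = "SOME y. y < Suc m \<and> e y = e x"
  have "?y < Suc m \<and> e ?y = e x" by (rule someI[of _ x]) (use x in simp)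
  then have "?y = x \<or> {?y, x} = {u, v}" using e x unfolding merges_def by blast
  then show "\<alpha> ?y = \<alpha> x" using \<alpha> by (auto simp: doubleton_eq_iff)
qed

text \<open>Uniqueness of the factoring map is encoded as joint surjectivity, which is easier to
  verify and to use. Cocones with values in \<open>nat\<close> suffice as tests, since all sets
  involved are finite ordinals.\<close>

definition fun_pushout :: "nat \<Rightarrow> nat \<Rightarrow> nat \<Rightarrow> nat \<Rightarrow>
    (nat \<Rightarrow> nat) \<Rightarrow> (nat \<Rightarrow> nat) \<Rightarrow> (nat \<Rightarrow> nat) \<Rightarrow> (nat \<Rightarrow> nat) \<Rightarrow> bool" where
  "fun_pushout k a b c f g p q \<longleftrightarrow> maps k a f \<and> maps k b g \<and> maps a c p \<and> maps b c q \<and>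
     (\<forall>j < k. p (f j) = q (g j)) \<and> (\<forall>z < c. (\<exists>x < a. p x = z) \<or> (\<exists>y < b. q y = z)) \<and>
     (\<forall>(\<alpha> :: nat \<Rightarrow> nat) \<beta>. (\<forall>j < k. \<alpha> (f j) = \<beta> (g j)) \<longrightarrow>
        (\<exists>u. (\<forall>x < a. u (p x) = \<alpha> x) \<and> (\<forall>y < b. u (q y) = \<beta> y)))"

lemma fun_pushout_factor:
  fixes \<alpha> \<beta> :: "nat \<Rightarrow> nat"
  assumes "fun_pushout k a b c f g p q" "\<And>j. j < k \<Longrightarrow> \<alpha> (f j) = \<beta> (g j)"
  shows "\<exists>u. (\<forall>x < a. u (p x) = \<alpha> x) \<and> (\<forall>y < b. u (q y) = \<beta> y)"
  using assms unfolding fun_pushout_def by blast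

lemma fun_pushout_unique:
  assumes "fun_pushout k a b c f g p q" "fun_pushout k a b c' f g p' q'"
  obtains h h' where "maps c c' h" "maps c' c h'" "\<And>z. z < c \<Longrightarrow> h' (h z) = z" "\<And>z. z < c' \<Longrightarrow> h (h' z) = z"
    "\<And>x. x < a \<Longrightarrow> h (p x) = p' x" "\<And>y. y < b \<Longrightarrow> h (q y) = q' y"
proof -
  have eq: "\<And>j. j < k \<Longrightarrow> p (f j) = q (g j)" "\<And>j. j < k \<Longrightarrow> p' (f j) = q' (g j)"
    and js: "\<And>z. z < c \<Longrightarrow> (\<exists>x < a. p x = z) \<or> (\<exists>y < b. q y = z)"
    "\<And>z. z < c' \<Longrightarrow> (\<exists>x < a. p' x = z) \<or> (\<exists>y < b. q' y = z)"
    and mp: "maps a c p" "maps b c q" "maps a c' p'" "maps b c' q'"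
    using assms unfolding fun_pushout_def by blast+
  obtain h where h: "\<And>x. x < a \<Longrightarrow> h (p x) = p' x" "\<And>y. y < b \<Longrightarrow> h (q y) = q' y"
    using fun_pushout_factor[OF assms(1), of p' q'] eq by blast
  obtain h' where h': "\<And>x. x < a \<Longrightarrow> h' (p' x) = p x" "\<And>y. y < b \<Longrightarrow> h' (q' y) = q y"
    using fun_pushout_factor[OF assms(2), of p q] eq by blast
  have "maps c c' h" "maps c' c h'"
    unfolding maps_def using js h h' mp by (fastforce simp: maps_def)+
  moreover have "\<And>z. z < c \<Longrightarrow> h' (h z) = z" "\<And>z. z < c' \<Longrightarrow> h (h' z) = z"
    using js h h' by fastforce+
  ultimately show thesis using that h by blast
qed

context frob_prop
begin

text \<open>By \<open>star_bij_Suc\<close> and its dual, \<open>star\<close> and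
  \<open>costar\<close> of a permutation decompose into mutually inverse braids, one for each
  wire.\<close>

lemma star_costar_bij:
  "bij_betw f {..<n} {..<n} \<Longrightarrow> star n n f \<Zsemi> costar n n f = ident P n"
  "bij_betw f {..<n} {..<n} \<Longrightarrow> costar n n f \<Zsemi> star n n f = ident P n"
proof (induction n arbitrary: f)
  case 0
  { case 1 show ?case by (simp add: star.simps com.star.simps) }
  { case 2 show ?case by (simp add: star.simps com.star.simps) }
next
  case (Suc n)
  have bij_maps: "maps k k g" if "bij_betw g {..<k} {..<k}" for k g
    using that by (auto simp: bij_betw_def maps_def)
  define x where "x f = f n" for f :: "nat \<Rightarrow> nat"
  define g where "g f = (\<lambda>y. if f y < x f then f y else f y - 1)" for f
  note facts = star_bij_Suc[OF _ x_def g_def] com.star_bij_Suc[OF _ x_def g_def, unfolded op_simps]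
  { case 1
    note f = facts[OF 1]
    have x: "x f \<le> n" using bij_maps[OF 1] by (auto simp: maps_def x_def)
    have m: "maps n n (g f)" using f(1) bij_maps by blast
    let ?b = "ident P (x f) \<oplus> braid P (n - x f) (Suc 0)" and ?c =
        "ident P (x f) \<oplus> braid P (Suc 0) (n - x f)"
    have "star (Suc n) (Suc n) f \<Zsemi> costar (Suc n) (Suc n) f
      = (star n n (g f) \<oplus> w) \<Zsemi> ((?b \<Zsemi> ?c) \<Zsemi> (costar n n (g f) \<oplus> w))"
      unfolding f(2,4) using m x by (simp add: seq_assoc')
    also have "?b \<Zsemi> ?c = ident P (Suc n)" using x by (simp add: interchange' braid_braid)
    finally show ?case using m Suc.IH(1)[OF f(1)] by (simp add: interchange') }
  { case 2
    note f = facts[OF 2]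
    have x: "x f \<le> n" using bij_maps[OF 2] by (auto simp: maps_def x_def)
    have m: "maps n n (g f)" using f(1) bij_maps by blast
    let ?b = "ident P (x f) \<oplus> braid P (n - x f) (Suc 0)" and ?c =
        "ident P (x f) \<oplus> braid P (Suc 0) (n - x f)"
    have "costar (Suc n) (Suc n) f \<Zsemi> star (Suc n) (Suc n) f
      = ?c \<Zsemi> (((costar n n (g f) \<oplus> w) \<Zsemi> (star n n (g f) \<oplus> w)) \<Zsemi> ?b)"
      unfolding f(2,4) using m x by (simp add: seq_assoc')
    also have "(costar n n (g f) \<oplus> w) \<Zsemi> (star n n (g f) \<oplus> w) = ident P (Suc n)"
      using m Suc.IH(2)[OF f(1)] by (simp add: interchange')
    finally show ?case using x by (simp add: interchange' braid_braid) }
qed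

lemma star_costar_inverse:
  assumes "maps n m f" "maps m n g" "\<And>x. x < n \<Longrightarrow> g (f x) = x" "\<And>x. x < m \<Longrightarrow> f (g x) = x"
  shows "star n m f \<Zsemi> costar n m f = ident P n" "costar n m f \<Zsemi> star n m f = ident P m"
proof -
  have bij: "bij_betw f {..<n} {..<m}"
    by (rule bij_betwI[where g = g]) (use assms in \<open>auto simp: maps_def\<close>)
  then have "n = m" using bij_betw_same_card by fastforce
  then show "star n m f \<Zsemi> costar n m f = ident P n" "costar n m f \<Zsemi> star n m f = ident P m"
    using star_costar_bij bij by blast+
qed

text \<open>If \<open>u\<close> or \<open>v\<close> is the last wire, the Frobenius law applies
  after commutativity has absorbed a crossing; otherwise the last wire is a spectator and the
  quotient map is extended by the identity. The result says that joining two wires amounts to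
  merging and splitting them again.\<close>

lemma comult_mult_merges:
  assumes "u < Suc m" "v < Suc m" "u \<noteq> v"
  shows "\<exists>e. merges m u v e \<and>
    comult_at (Suc m) u \<Zsemi> mult_at (Suc m) v = star (Suc m) m e \<Zsemi> costar (Suc m) m e"
  using assms
proof (induction m)
  case (Suc m)
  let ?m = "Suc m"
  have last: "\<exists>e. merges ?m u v e \<and> mult_at ?m a \<Zsemi> comult_at ?m a
      = star (Suc ?m) ?m e \<Zsemi> costar (Suc ?m) ?m e"
    if a: "a < ?m" "{u, v} = {a, ?m}" for a
  proof (intro exI conjI)
    \<comment> \<open>Only the last point is renamed, so on the remaining points \<open>e\<close> is
      the identity and \<open>star\<close> of it is the single product
      \<open>mult_at\<close>.\<close>
    define e where "e x = (if x = ?m then a else x)" for x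
    show "merges ?m u v e"
      unfolding merges_def a(2)
    proof (intro conjI allI impI)
      show "maps (Suc ?m) ?m e" using a(1) by (auto simp: maps_def e_def)
      show "\<exists>x < Suc ?m. e x = z" if "z < ?m" for z
        using that by (intro exI[of _ z]) (simp add: e_def)
      show "(e x = e y) = (x = y \<or> {x, y} = {a, ?m})" if "x < Suc ?m" "y < Suc ?m" for x y
        using a(1) by (auto simp: e_def doubleton_eq_iff)
    qed
    have "star ?m ?m e = star ?m ?m (\<lambda>x. x)" "costar ?m ?m e = costar ?m ?m (\<lambda>x. x)"
      by (rule star_cong com.star_cong, simp add: e_def)+
    then have "star (Suc ?m) ?m e = mult_at ?m a" "costar (Suc ?m) ?m e = comult_at ?m a"
      using a by (simp_all add: star.simps(2)[of ?m] com.star.simps(2)[of ?m] star_id costar_id e_def)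
    then show "mult_at ?m a \<Zsemi> comult_at ?m a = star (Suc ?m) ?m e \<Zsemi> costar (Suc ?m) ?m e" by simp
  qed
  show ?case
  proof (cases "u = ?m"; cases "v = ?m")
    assume uv: "u = ?m" "v \<noteq> ?m"
    then have v: "v < ?m" using Suc.prems by simp
    have "comult_at (Suc ?m) u \<Zsemi> mult_at (Suc ?m) v
      = ((ident P ?m \<oplus> delta) \<Zsemi> (ident P ?m \<oplus> sw)) \<Zsemi> (mult_at ?m v \<oplus> w)"
      using uv v by (simp add: comult_at_last mult_at_less[of v ?m] seq_assoc')
    also have "\<dots> = mult_at ?m v \<Zsemi> comult_at ?m v"
      using v by (simp add: interchange' delta_sw mult_comult_same)
    finally show ?thesis using last[of v] uv v by auto
  next
    assume uv: "u \<noteq> ?m" "v = ?m"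
    then have u: "u < ?m" using Suc.prems by simp
    have "comult_at (Suc ?m) u \<Zsemi> mult_at (Suc ?m) v
      = (comult_at ?m u \<oplus> w) \<Zsemi> ((ident P ?m \<oplus> sw) \<Zsemi> (ident P ?m \<oplus> mu))"
      using uv u by (simp add: mult_at_last comult_at_less[of u ?m] seq_assoc')
    also have "\<dots> = mult_at ?m u \<Zsemi> comult_at ?m u"
      using u mu_comm by (simp add: interchange' mult_comult_same_dual)
    finally show ?thesis using last[of u] uv u by auto
  next
    assume "u \<noteq> ?m" "v \<noteq> ?m"
    then have uv: "u < ?m" "v < ?m" using Suc.prems by auto
    from Suc.IH[OF this Suc.prems(3)] obtain e where e: "merges m u v e"
      and ce: "comult_at ?m u \<Zsemi> mult_at ?m v = star ?m m e \<Zsemi> costar ?m m e" by blast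
    have me: "maps ?m m e" using e by (simp add: merges_def)
    let ?e = "par_fun ?m m e (\<lambda>x. x)"
    have "comult_at (Suc ?m) u \<Zsemi> mult_at (Suc ?m) v
      = (comult_at ?m u \<oplus> w) \<Zsemi> (((ident P ?m \<oplus> sw) \<Zsemi> (ident P ?m \<oplus> sw)) \<Zsemi> (mult_at ?m v \<oplus> w))"
      using uv by (simp add: mult_at_less[of _ ?m] comult_at_less[of _ ?m] seq_assoc')
    also have "(ident P ?m \<oplus> sw) \<Zsemi> (ident P ?m \<oplus> sw) = ident P (Suc (Suc ?m))"
      by (simp add: interchange' sw_sw)
    also have "(comult_at ?m u \<oplus> w) \<Zsemi> (\<dots> \<Zsemi> (mult_at ?m v \<oplus> w)) = (star ?m m e \<Zsemi> costar ?m m e) \<oplus> w"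
      using uv by (simp add: interchange' ce)
    also have "\<dots> = (star ?m m e \<oplus> star 1 1 (\<lambda>x. x)) \<Zsemi> (costar ?m m e \<oplus> costar 1 1 (\<lambda>x. x))"
      using me by (simp only: star_id costar_id op_prop_simps) (simp add: interchange')
    also have "\<dots> = star (Suc ?m) ?m ?e \<Zsemi> costar (Suc ?m) ?m ?e"
      using star_par[OF me maps_id[of 1]] costar_par[OF me maps_id[of 1]] by simp
    finally have 1: "comult_at (Suc ?m) u \<Zsemi> mult_at (Suc ?m) v
        = star (Suc ?m) ?m ?e \<Zsemi> costar (Suc ?m) ?m ?e" .
    have "merges ?m u v ?e"
      unfolding merges_def
    proof (intro conjI allI impI)
      show "maps (Suc ?m) ?m ?e" using maps_par_fun[OF me maps_id[of 1]] by simp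
      fix z assume z: "z < ?m"
      show "\<exists>x < Suc ?m. ?e x = z"
      proof (cases "z = m")
        case True then show ?thesis by (intro exI[of _ ?m]) (simp add: par_fun_def)
      next
        case False
        then obtain x where "x < ?m" "e x = z" using e z unfolding merges_def by (metis less_antisym)
        then show ?thesis by (intro exI[of _ x]) (simp add: par_fun_def)
      qed
    next
      fix x y assume xy: "x < Suc ?m" "y < Suc ?m"
      have el: "e x < m" if "x < ?m" for x using me that by (simp add: maps_def)
      show "(?e x = ?e y) = (x = y \<or> {x, y} = {u, v})"
        using e xy uv el[of x] el[of y]
        by (cases "x = ?m"; cases "y = ?m") (auto simp: par_fun_def merges_def doubleton_eq_iff)
    qed
    then show ?thesis using 1 by blast
  qed (use Suc.prems in simp)
qed simp

text \<open>The pushout is built from the disjoint union by adding the points of \<open>k\<close>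
  one at a time. A further pair \<open>f k\<close>, \<open>g k\<close> either lies in one class
  already, and then the special law removes the loop, or is merged by
  \<open>comult_mult_merges\<close>. Besides the equation this supplies the existence of pushouts of
  finite sets.\<close>

lemma costar_star_ex:
  assumes "maps k a f" "maps k b g"
  shows "\<exists>c p q. fun_pushout k a b c f g p q \<and> costar k a f \<Zsemi> star k b g = star a c p \<Zsemi> costar b c q"
  using assms
proof (induction k)
  case 0
  let ?q = "\<lambda>y. a + y"
  have q: "maps b (a + b) ?q" and p: "maps a (a + b) (\<lambda>x. x)" by (auto simp: maps_def)
  have 1: "star a (a + b) (\<lambda>x. x) = ident P a \<oplus> etas b"
    using star_add_right[OF maps_id, of a b] by (simp add: star_id)
  have "com.etas a \<oplus> ident P b = costar 0 a (\<lambda>x. x) \<oplus> costar b b (\<lambda>x. x)"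
    by (simp add: com.star.simps costar_id)
  also have "\<dots> = costar (0 + b) (a + b) (par_fun 0 a (\<lambda>x. x) (\<lambda>x. x))"
    by (rule costar_par) (simp_all add: maps_def)
  also have "\<dots> = costar b (a + b) ?q" by (simp, rule com.star_cong) (simp add: par_fun_def)
  finally have 2: "costar b (a + b) ?q = com.etas a \<oplus> ident P b" ..
  have "costar 0 a f \<Zsemi> star 0 b g = star a (a + b) (\<lambda>x. x) \<Zsemi> costar b (a + b) ?q"
    unfolding 1 2 using interchange'[of "ident P a" "com.etas a" "etas b" "ident P b"]
      interchange'[of "com.etas a" "ident P 0" "ident P 0" "etas b"]
    by (simp add: com.star.simps star.simps)
  moreover have "fun_pushout 0 a b (a + b) f g (\<lambda>x. x) ?q"
    unfolding fun_pushout_def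
  proof (intro conjI allI impI)
    fix z assume "z < a + b"
    then show "(\<exists>x < a. x = z) \<or> (\<exists>y < b. a + y = z)" by presburger
  next
    fix \<alpha> \<beta> :: "nat \<Rightarrow> nat"
    show "\<exists>u. (\<forall>x < a. u x = \<alpha> x) \<and> (\<forall>y < b. u (a + y) = \<beta> y)"
      by (intro exI[of _ "\<lambda>z. if z < a then \<alpha> z else \<beta> (z - a)"]) simp
  qed (use p q in \<open>simp_all add: maps_def\<close>)
  ultimately show ?case by blast
next
  case (Suc k)
  let ?x = "f k" and ?y = "g k"
  have f: "maps k a f" "?x < a" and g: "maps k b g" "?y < b" using Suc.prems by (simp_all add: maps_Suc)
  obtain c p q where po: "fun_pushout k a b c f g p q"
    and eq: "costar k a f \<Zsemi> star k b g = star a c p \<Zsemi> costar b c q" using Suc.IH[OF f(1) g(1)] by blast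
  have p: "maps a c p" and q: "maps b c q" using po by (simp_all add: fun_pushout_def)
  have u: "p ?x < c" and v: "q ?y < c" using p q f g by (simp_all add: maps_def)
  have d: "(costar b c q \<oplus> w) \<Zsemi> mult_at b ?y = mult_at c (q ?y) \<Zsemi> costar b c q"
    using frob_prop.star_comult[OF frob_op, unfolded op_simps, OF g(2) q] ..
  have "costar (Suc k) a f \<Zsemi> star (Suc k) b g
    = comult_at a ?x \<Zsemi> (((costar k a f \<oplus> w) \<Zsemi> (star k b g \<oplus> w)) \<Zsemi> mult_at b ?y)"
    using f g by (simp add: star.simps com.star.simps seq_assoc')
  also have "(costar k a f \<oplus> w) \<Zsemi> (star k b g \<oplus> w) = (star a c p \<oplus> w) \<Zsemi> (costar b c q \<oplus> w)"
    using f g p q by (simp add: interchange' eq)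
  also have "comult_at a ?x \<Zsemi> (\<dots> \<Zsemi> mult_at b ?y)
    = (comult_at a ?x \<Zsemi> (star a c p \<oplus> w)) \<Zsemi> ((costar b c q \<oplus> w) \<Zsemi> mult_at b ?y)"
    using f g p q by (simp add: seq_assoc')
  also have "\<dots> = (star a c p \<Zsemi> comult_at c (p ?x)) \<Zsemi> (mult_at c (q ?y) \<Zsemi> costar b c q)"
    unfolding d using star_comult[OF f(2) p] by simp
  also have "\<dots> = star a c p \<Zsemi> ((comult_at c (p ?x) \<Zsemi> mult_at c (q ?y)) \<Zsemi> costar b c q)"
    using p q u v by (simp add: seq_assoc')
  finally have eq2: "costar (Suc k) a f \<Zsemi> star (Suc k) b g
    = star a c p \<Zsemi> ((comult_at c (p ?x) \<Zsemi> mult_at c (q ?y)) \<Zsemi> costar b c q)" .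
  show ?case
  proof (cases "p ?x = q ?y")
    case True
    then have "fun_pushout (Suc k) a b c f g p q"
      using po Suc.prems unfolding fun_pushout_def by (auto simp: less_Suc_eq)
    then show ?thesis using eq2 True p q v by (auto simp: comult_mult_same)
  next
    case False
    then obtain c' where c: "c = Suc c'" using u by (cases c) auto
    obtain e where e: "merges c' (p ?x) (q ?y) e"
      and ce: "comult_at c (p ?x) \<Zsemi> mult_at c (q ?y) = star c c' e \<Zsemi> costar c c' e"
      using comult_mult_merges[of "p ?x" c' "q ?y"] u v False unfolding c by blast
    have em: "maps c c' e" using e by (simp add: merges_def c)
    have "costar (Suc k) a f \<Zsemi> star (Suc k) b g
      = (star a c p \<Zsemi> star c c' e) \<Zsemi> (costar c c' e \<Zsemi> costar b c q)"
      unfolding eq2 ce using em p q by (simp add: seq_assoc')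
    also have "\<dots> = star a c' (\<lambda>x. e (p x)) \<Zsemi> costar b c' (\<lambda>x. e (q x))"
      by (simp add: star_comp[OF p em] costar_comp[OF q em])
    moreover have "fun_pushout (Suc k) a b c' f g (\<lambda>x. e (p x)) (\<lambda>x. e (q x))"
      unfolding fun_pushout_def
    proof (intro conjI allI impI)
      show "maps (Suc k) a f" "maps (Suc k) b g" by fact+
      show "maps a c' (\<lambda>x. e (p x))" "maps b c' (\<lambda>x. e (q x))"
        using maps_comp[OF p em] maps_comp[OF q em] by simp_all
      have pq: "p (f j) = q (g j)" if "j < k" for j using po that by (simp add: fun_pushout_def)
      have "e (p ?x) = e (q ?y)" using e u v unfolding merges_def c by auto
      with pq show "e (p (f j)) = e (q (g j))" if "j < Suc k" for j
        using that by (cases "j = k") auto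
      fix z assume "z < c'"
      then obtain z' where z': "z' < c" "e z' = z" using e unfolding merges_def c by blast
      then have "(\<exists>x < a. p x = z') \<or> (\<exists>y < b. q y = z')" using po by (simp add: fun_pushout_def)
      then show "(\<exists>x < a. e (p x) = z) \<or> (\<exists>y < b. e (q y) = z)" using z' by blast
    next
      fix \<alpha> \<beta> :: "nat \<Rightarrow> nat" assume ab: "\<forall>j < Suc k. \<alpha> (f j) = \<beta> (g j)"
      then obtain h where h: "\<forall>x < a. h (p x) = \<alpha> x" "\<forall>y < b. h (q y) = \<beta> y"
        using fun_pushout_factor[OF po, of \<alpha> \<beta>] by auto
      have "h (p ?x) = h (q ?y)" using h ab f g by simp
      from merges_factor[OF e this] obtain h' where h': "\<forall>x < Suc c'. h' (e x) = h x" by blast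
      show "\<exists>h. (\<forall>x < a. h (e (p x)) = \<alpha> x) \<and> (\<forall>y < b. h (e (q y)) = \<beta> y)"
        by (intro exI[of _ h']) (use h h' p q in \<open>auto simp: maps_def c\<close>)
    qed
    ultimately show ?thesis by auto
  qed
qed

text \<open>The pushout built in \<open>costar_star_ex\<close> differs from the given one by a
  bijection \<open>h\<close>, and \<open>star\<close> of \<open>h\<close> cancels against its
  \<open>costar\<close>.\<close>

lemma costar_star:
  assumes "fun_pushout k a b c f g p q"
  shows "costar k a f \<Zsemi> star k b g = star a c p \<Zsemi> costar b c q"
proof -
  have m: "maps k a f" "maps k b g" "maps a c p" "maps b c q" using assms
      by (simp_all add: fun_pushout_def)
  obtain c' p' q' where po: "fun_pushout k a b c' f g p' q'"
    and eq: "costar k a f \<Zsemi> star k b g = star a c' p' \<Zsemi> costar b c' q'"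
    using costar_star_ex[OF m(1,2)] by blast
  have m': "maps a c' p'" "maps b c' q'" using po by (simp_all add: fun_pushout_def)
  obtain h h' where h: "maps c' c h" "maps c c' h'" "\<And>z. z < c' \<Longrightarrow> h' (h z) = z"
      "\<And>z. z < c \<Longrightarrow> h (h' z) = z"
    "\<And>x. x < a \<Longrightarrow> h (p' x) = p x" "\<And>y. y < b \<Longrightarrow> h (q' y) = q y"
    using fun_pushout_unique[OF po assms] by metis
  have "star a c p = star a c (\<lambda>x. h (p' x))" by (rule star_cong) (simp add: h)
  then have 1: "star a c p = star a c' p' \<Zsemi> star c' c h" using star_comp[OF m'(1) h(1)] by simp
  have "costar b c q = costar b c (\<lambda>x. h (q' x))" by (rule com.star_cong) (simp add: h)
  then have 2: "costar b c q = costar c' c h \<Zsemi> costar b c' q'" using costar_comp[OF m'(2) h(1)] by simp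
  have "star a c p \<Zsemi> costar b c q = star a c' p' \<Zsemi> ((star c' c h \<Zsemi> costar c' c h) \<Zsemi> costar b c' q')"
    unfolding 1 2 using m' h by (simp add: seq_assoc')
  also have "star c' c h \<Zsemi> costar c' c h = ident P c'" by (rule star_costar_inverse[OF h(1-4)])
  finally show ?thesis using eq m' by simp
qed

end

section \<open>Normal forms of cospans\<close>

definition copair :: "nat \<Rightarrow> nat list \<Rightarrow> nat \<Rightarrow> nat" where
  "copair v s x = (if x < v then x else s ! (x - v))"

lemma maps_copair [simp]: "set s \<subseteq> {..<v} \<Longrightarrow> maps (v + length s) v (copair v s)"
  by (auto simp: maps_def copair_def subset_eq)

lemma maps_list: "maps v u f \<Longrightarrow> set s \<subseteq> {..<v} \<Longrightarrow> f ` set s \<subseteq> {..<u}"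
  by (auto simp: maps_def)

text \<open>Since \<open>copair u\<close> is the identity on \<open>u\<close>, the component
  \<open>\<beta>\<close> of a cocone is itself the factoring map. Beck--Chevalley for this square
  renames nodes along \<open>f\<close> while a list of them is being copied off.\<close>

lemma fun_pushout_copair:
  assumes f: "maps v u f" and s: "set s \<subseteq> {..<v}"
  shows "fun_pushout (v + length s) v (u + length s) u (copair v s) (par_fun v u f (\<lambda>x. x))
    f (copair u (map f s))"
  unfolding fun_pushout_def
proof (intro conjI allI impI)
  show "maps (u + length s) u (copair u (map f s))"
    using maps_copair[of "map f s" u] maps_list[OF f s] by simp
  show "f (copair v s j) = copair u (map f s) (par_fun v u f (\<lambda>x. x) j)" if "j < v + length s" for j
    using that f by (auto simp: copair_def par_fun_def maps_def)
  show "(\<exists>x < v. f x = z) \<or> (\<exists>y < u + length s. copair u (map f s) y = z)" if "z < u" for z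
    using that by (intro disjI2 exI[of _ z]) (simp add: copair_def)
next
  fix \<alpha> \<beta> :: "nat \<Rightarrow> nat"
  assume ab: "\<forall>j < v + length s. \<alpha> (copair v s j) = \<beta> (par_fun v u f (\<lambda>x. x) j)"
  have 1: "\<beta> (f x) = \<alpha> x" if "x < v" for x
    using ab[rule_format, of x] that by (simp add: copair_def par_fun_def)
  have 2: "\<beta> (u + j) = \<alpha> (s ! j)" if "j < length s" for j
    using ab[rule_format, of "v + j"] that by (simp add: copair_def par_fun_def)
  have "\<beta> (copair u (map f s) y) = \<beta> y" if "y < u + length s" for y
  proof (cases "y < u")
    case False
    then have "y - u < length s" using that by simp
    moreover from this s have "s ! (y - u) < v" by (auto simp: subset_eq)
    ultimately show ?thesis using 1[of "s ! (y - u)"] 2[of "y - u"] False by (simp add: copair_def)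
  qed (simp add: copair_def)
  then show "\<exists>h. (\<forall>x < v. h (f x) = \<alpha> x) \<and> (\<forall>y < u + length s. h (copair u (map f s) y) = \<beta> y)"
    using 1 by blast
qed (use assms maps_par_fun[OF f maps_id] in simp_all)

fun edge_map :: "(nat \<Rightarrow> nat) \<Rightarrow> nat list \<times> 'a \<times> nat list \<Rightarrow> nat list \<times> 'a \<times> nat list" where
  "edge_map f (s, \<gamma>, t) = (map f s, \<gamma>, map f t)"

context frob_prop
begin

text \<open>
  \<open>attach v s \<gamma> t\<close> is the cospan \<open>v \<rightarrow> G \<leftarrow> v\<close> with identity legs on nodes, where \<open>G\<close> has \<open>v\<close> nodes
  and a single hyperedge \<open>\<gamma>\<close> with sources \<open>s\<close> and targets \<open>t\<close>.
\<close>

definition attach :: "nat \<Rightarrow> nat list \<Rightarrow> 'a \<Rightarrow> nat list \<Rightarrow> 'a" where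
  "attach v s \<gamma> t = costar (v + length s) v (copair v s) \<Zsemi>
     ((ident P v \<oplus> \<gamma>) \<Zsemi> star (v + length t) v (copair v t))"

fun edge_ok :: "nat \<Rightarrow> nat list \<times> 'a \<times> nat list \<Rightarrow> bool" where
  "edge_ok v (s, \<gamma>, t) \<longleftrightarrow> is_arr \<gamma> \<and> dm \<gamma> = length s \<and> cd \<gamma> = length t \<and> set s \<subseteq> {..<v} \<and> set t \<subseteq> {..<v}"

lemma edge_ok_map: "edge_ok v e \<Longrightarrow> maps v u f \<Longrightarrow> edge_ok u (edge_map f e)"
  by (cases e) (auto dest: maps_list)

lemma edge_ok_add: "edge_ok v e \<Longrightarrow> edge_ok (v + u) e"
  by (cases e) auto

lemma ty_attach [simp]:
  assumes "edge_ok v (s, \<gamma>, t)"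
  shows "is_arr (attach v s \<gamma> t)" "dm (attach v s \<gamma> t) = v" "cd (attach v s \<gamma> t) = v"
  using assms by (simp_all add: attach_def)

lemma attach_op:
  assumes "edge_ok v (s, \<gamma>, t)"
  shows "frob_prop.attach (op_prop P) delta eps mu eta v t \<gamma> s = attach v s \<gamma> t"
  using assms by (simp add: frob_prop.attach_def[OF frob_op] attach_def seq_assoc')

lemma star_costar_copair:
  assumes f: "maps v u f" and s: "set s \<subseteq> {..<v}"
  shows "star v u f \<Zsemi> costar (u + length s) u (copair u (map f s))
    = costar (v + length s) v (copair v s) \<Zsemi> (star v u f \<oplus> ident P (length s))"
  using costar_star[OF fun_pushout_copair[OF assms]] star_par[OF f maps_id, of "length s"]
  by (simp add: star_id)

lemmas copair_star_costar = frob_prop.star_costar_copair[OF frob_op, unfolded op_simps]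

text \<open>The copying half slides by Beck--Chevalley in the square
  \<open>fun_pushout_copair\<close>. The multiplying half slides by functoriality: applying
  \<open>f\<close> after \<open>copair v t\<close> is the same as applying
  \<open>copair u (map f t)\<close> after \<open>f\<close> on the nodes.\<close>

lemma attach_star:
  assumes f: "maps v u f" and e: "edge_ok v (s, \<gamma>, t)"
  shows "attach v s \<gamma> t \<Zsemi> star v u f = star v u f \<Zsemi> attach u (map f s) \<gamma> (map f t)"
proof -
  have m: "maps (u + length s) u (copair u (map f s))" "maps (u + length t) u (copair u (map f t))"
    using maps_copair[of "map f s" u] maps_copair[of "map f t" u] maps_list[OF f] e by simp_all
  have "star v u f \<oplus> ident P (length t) = star (v + length t) (u + length t) (par_fun v u f (\<lambda>x. x))"
    using star_par[OF f maps_id, of "length t"] by (simp add: star_id)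
  then have "(star v u f \<oplus> ident P (length t)) \<Zsemi> star (u + length t) u (copair u (map f t))
    = star (v + length t) u (\<lambda>x. copair u (map f t) (par_fun v u f (\<lambda>x. x) x))"
    using star_comp[OF maps_par_fun[OF f maps_id] m(2)] by simp
  also have "\<dots> = star (v + length t) u (\<lambda>x. f (copair v t x))"
    by (rule star_cong) (use f in \<open>auto simp: maps_def copair_def par_fun_def\<close>)
  also have "\<dots> = star (v + length t) v (copair v t) \<Zsemi> star v u f"
    using star_comp[OF maps_copair f] e by simp
  finally have 1: "(star v u f \<oplus> ident P (length t)) \<Zsemi> star (u + length t) u (copair u (map f t))
    = star (v + length t) v (copair v t) \<Zsemi> star v u f" .
  have 2: "(star v u f \<oplus> ident P (length s)) \<Zsemi> (ident P u \<oplus> \<gamma>)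
      = (ident P v \<oplus> \<gamma>) \<Zsemi> (star v u f \<oplus> ident P (length t))"
    using e f by (simp add: interchange')
  have "star v u f \<Zsemi> attach u (map f s) \<gamma> (map f t)
      = (star v u f \<Zsemi> costar (u + length s) u (copair u (map f s)))
    \<Zsemi> ((ident P u \<oplus> \<gamma>) \<Zsemi> star (u + length t) u (copair u (map f t)))"
    using e f m by (simp add: attach_def seq_assoc')
  also have "\<dots> = costar (v + length s) v (copair v s) \<Zsemi>
    (((star v u f \<oplus> ident P (length s)) \<Zsemi> (ident P u \<oplus> \<gamma>)) \<Zsemi> star (u + length t) u (copair u (map f t)))"
    using e f m by (simp add: star_costar_copair seq_assoc')
  also have "\<dots> = costar (v + length s) v (copair v s) \<Zsemi>
    ((ident P v \<oplus> \<gamma>) \<Zsemi> ((star v u f \<oplus> ident P (length t)) \<Zsemi> star (u + length t) u (copair u (map f t))))"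
    unfolding 2 using e f m by (simp add: seq_assoc')
  also have "\<dots> = attach v s \<gamma> t \<Zsemi> star v u f"
    unfolding 1 using e f by (simp add: attach_def seq_assoc')
  finally show ?thesis ..
qed

text \<open>Dual to \<open>attach_star\<close>: in the opposite PROP the hyperedge has its sources
  and targets exchanged.\<close>

lemma costar_attach:
  assumes f: "maps v u f" and e: "edge_ok v (s, \<gamma>, t)"
  shows "costar v u f \<Zsemi> attach v s \<gamma> t = attach u (map f s) \<gamma> (map f t) \<Zsemi> costar v u f"
proof -
  have e': "frob_prop.edge_ok (op_prop P) v (t, \<gamma>, s)"
    using e by (simp add: frob_prop.edge_ok.simps[OF frob_op])
  have "edge_ok u (map f s, \<gamma>, map f t)" using edge_ok_map[OF e f] by simp
  then show ?thesis
    using frob_prop.attach_star[OF frob_op f e', unfolded op_simps]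
        by (simp add: attach_op[OF e] attach_op)
qed

lemma par_attach:
  assumes e: "edge_ok v (s, \<gamma>, t)"
  shows "ident P u \<oplus> attach v s \<gamma> t = attach (u + v) (map ((+) u) s) \<gamma> (map ((+) u) t)"
proof -
  have c: "par_fun u u (\<lambda>x. x) (copair v s) x = copair (u + v) (map ((+) u) s) x"
    if "x < u + (v + length s)" for s x
  proof -
    have "(map ((+) u) s) ! (x - u - v) = u + s ! (x - u - v)" if "\<not> x < u" "\<not> x - u < v"
      by (rule nth_map) (use that \<open>x < u + (v + length s)\<close> in linarith)
    then show ?thesis using that by (auto simp: par_fun_def copair_def)
  qed
  have c1: "star (u + (v + length t)) (u + v) (par_fun u u (\<lambda>x. x) (copair v t))
      = star (u + (v + length t)) (u + v) (copair (u + v) (map ((+) u) t))"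
    by (rule star_cong[OF c])
  have c2: "costar (u + (v + length s)) (u + v) (par_fun u u (\<lambda>x. x) (copair v s))
      = costar (u + (v + length s)) (u + v) (copair (u + v) (map ((+) u) s))"
    by (rule com.star_cong[OF c])
  have 1: "ident P u \<oplus> star (v + length t) v (copair v t)
      = star (u + v + length t) (u + v) (copair (u + v) (map ((+) u) t))"
    using star_par[OF maps_id[of u] maps_copair[of t v]] e c1
    by (simp add: star_id add.assoc)
  have 2: "ident P u \<oplus> costar (v + length s) v (copair v s)
      = costar (u + v + length s) (u + v) (copair (u + v) (map ((+) u) s))"
    using costar_par[OF maps_id[of u] maps_copair[of s v]] e c2
    by (simp add: costar_id add.assoc)
  have "ident P u \<oplus> attach v s \<gamma> t = (ident P u \<oplus> costar (v + length s) v (copair v s)) \<Zsemi>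
    ((ident P u \<oplus> (ident P v \<oplus> \<gamma>)) \<Zsemi> (ident P u \<oplus> star (v + length t) v (copair v t)))"
    using e by (simp add: attach_def interchange')
  then show ?thesis unfolding 1 2 using e by (simp add: attach_def id_par_id_par)
qed

text \<open>Idle nodes on the right are idle nodes on the left conjugated by a block swap. The swap
  is \<open>star\<close> of a function, so \<open>attach_star\<close> relabels the nodes
  back.\<close>

lemma attach_par:
  assumes e: "edge_ok v (s, \<gamma>, t)"
  shows "attach v s \<gamma> t \<oplus> ident P u = attach (v + u) s \<gamma> t"
proof -
  let ?A = "attach v s \<gamma> t" and ?B = "attach (u + v) (map ((+) u) s) \<gamma> (map ((+) u) t)"
  have B: "edge_ok (u + v) (map ((+) u) s, \<gamma>, map ((+) u) t)"
    using edge_ok_map[OF e, of "u + v" "(+) u"] by (simp add: maps_def)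
  have sf: "maps (u + v) (v + u) (swap_fun u v)" by (auto simp: maps_def swap_fun_def)
  have id: "map (swap_fun u v) (map ((+) u) s) = s" for s
    by (induction s) (simp_all add: swap_fun_def)
  have e': "edge_ok (v + u) (s, \<gamma>, t)" using e by auto
  have "?A \<oplus> ident P u = ((?A \<oplus> ident P u) \<Zsemi> braid P v u) \<Zsemi> braid P u v"
    using e by (simp add: seq_assoc' braid_braid)
  also have "\<dots> = braid P v u \<Zsemi> (?B \<Zsemi> braid P u v)"
    using braid_natural'[of ?A "ident P u"] e B by (simp add: seq_assoc' par_attach)
  also have "\<dots> = braid P v u \<Zsemi> (braid P u v \<Zsemi> attach (v + u) s \<gamma> t)"
    using attach_star[OF sf B] by (simp only: star_swap id)
  also have "\<dots> = attach (v + u) s \<gamma> t"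
    using e' by (simp add: braid_braid flip: seq_assoc')
  finally show ?thesis .
qed

text \<open>The second hyperedge is pulled through the constituents of the first: past
  \<open>star\<close> and \<open>costar\<close> of the maps \<open>copair\<close>, which fix the
  \<open>v\<close> nodes and hence do not relabel it, and past \<gamma> because the two then act on
  different wires.\<close>

lemma attach_commute:
  assumes e: "edge_ok v (s, \<gamma>, t)" and e': "edge_ok v (s', \<gamma>', t')"
  shows "attach v s \<gamma> t \<Zsemi> attach v s' \<gamma>' t' = attach v s' \<gamma>' t' \<Zsemi> attach v s \<gamma> t"
proof -
  let ?B = "attach v s' \<gamma>' t'"
  have c: "map (copair v r) l = l" if "set l \<subseteq> {..<v}" for l r
    using that by (induction l) (simp_all add: copair_def)
  have f: "edge_ok (v + n) (s', \<gamma>', t')" for n using e' by auto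
  have 1: "star (v + length t) v (copair v t) \<Zsemi> ?B
      = (?B \<oplus> ident P (length t)) \<Zsemi> star (v + length t) v (copair v t)"
    using attach_star[OF maps_copair[of t v] f] e e' by (simp add: attach_par c)
  have 2: "costar (v + length s) v (copair v s) \<Zsemi> (?B \<oplus> ident P (length s))
      = ?B \<Zsemi> costar (v + length s) v (copair v s)"
    using costar_attach[OF maps_copair[of s v] f] e e' by (simp add: attach_par c)
  have "attach v s \<gamma> t \<Zsemi> ?B = costar (v + length s) v (copair v s) \<Zsemi>
    ((ident P v \<oplus> \<gamma>) \<Zsemi> (star (v + length t) v (copair v t) \<Zsemi> ?B))"
    using e e' by (simp add: attach_def[of v s] seq_assoc')
  also have "\<dots> = costar (v + length s) v (copair v s) \<Zsemi>
    (((ident P v \<oplus> \<gamma>) \<Zsemi> (?B \<oplus> ident P (length t))) \<Zsemi> star (v + length t) v (copair v t))"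
    unfolding 1 using e e' by (simp add: seq_assoc')
  also have "(ident P v \<oplus> \<gamma>) \<Zsemi> (?B \<oplus> ident P (length t)) = (?B \<oplus> ident P (length s)) \<Zsemi> (ident P v \<oplus> \<gamma>)"
    using e e' by (simp add: interchange')
  also have "costar (v + length s) v (copair v s) \<Zsemi> (\<dots> \<Zsemi> star (v + length t) v (copair v t))
    = (costar (v + length s) v (copair v s) \<Zsemi> (?B \<oplus> ident P (length s))) \<Zsemi>
      ((ident P v \<oplus> \<gamma>) \<Zsemi> star (v + length t) v (copair v t))"
    using e e' by (simp add: seq_assoc')
  also have "\<dots> = ?B \<Zsemi> attach v s \<gamma> t"
    unfolding 2 using e e' by (simp add: attach_def[of v s] seq_assoc')
  finally show ?thesis .
qed

declare edge_ok.simps [simp del]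

section \<open>Lists of hyperedges and normal forms\<close>

primrec attaches :: "nat \<Rightarrow> (nat list \<times> 'a \<times> nat list) list \<Rightarrow> 'a" where
  "attaches v [] = ident P v"
| "attaches v (e # es) = attach v (fst e) (fst (snd e)) (snd (snd e)) \<Zsemi> attaches v es"

abbreviation "edges_ok v es \<equiv> \<forall>e \<in> set es. edge_ok v e"

lemma ty_attach' [simp]:
  assumes "edge_ok v e"
  shows "is_arr (attach v (fst e) (fst (snd e)) (snd (snd e)))"
    "dm (attach v (fst e) (fst (snd e)) (snd (snd e))) = v"
    "cd (attach v (fst e) (fst (snd e)) (snd (snd e))) = v"
  using assms ty_attach[of v "fst e" "fst (snd e)" "snd (snd e)"] by simp_all

lemma ty_attaches [simp]:
  assumes "edges_ok v es"
  shows "is_arr (attaches v es)" "dm (attaches v es) = v" "cd (attaches v es) = v"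
proof -
  have "is_arr (attaches v es) \<and> dm (attaches v es) = v \<and> cd (attaches v es) = v"
    using assms by (induction es) auto
  then show "is_arr (attaches v es)" "dm (attaches v es) = v" "cd (attaches v es) = v" by auto
qed

lemma attaches_append:
    "edges_ok v es \<Longrightarrow> edges_ok v es' \<Longrightarrow> attaches v (es @ es') = attaches v es \<Zsemi> attaches v es'"
  by (induction es) (simp_all add: seq_assoc')

lemma attaches_star:
  assumes f: "maps v u f"
  shows "edges_ok v es \<Longrightarrow> attaches v es \<Zsemi> star v u f = star v u f \<Zsemi> attaches u (map (edge_map f) es)"
proof (induction es)
  case (Cons e es)
  obtain s \<gamma> t where e: "e = (s, \<gamma>, t)" by (cases e)
  have ok: "edge_ok v (s, \<gamma>, t)" "edges_ok v es" using Cons.prems by (simp_all add: e)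
  have ok': "edge_ok u (map f s, \<gamma>, map f t)" "edges_ok u (map (edge_map f) es)"
    using edge_ok_map[OF ok(1) f] edge_ok_map[OF _ f] ok(2) by auto
  have "attaches v (e # es) \<Zsemi> star v u f = attach v s \<gamma> t \<Zsemi> (attaches v es \<Zsemi> star v u f)"
    using f ok by (simp add: e seq_assoc')
  also have "\<dots> = (attach v s \<gamma> t \<Zsemi> star v u f) \<Zsemi> attaches u (map (edge_map f) es)"
    using f ok ok' Cons.IH by (simp add: seq_assoc')
  also have "\<dots> = star v u f \<Zsemi> attaches u (map (edge_map f) (e # es))"
    using f ok ok' by (simp add: e attach_star seq_assoc')
  finally show ?case .
qed (use f in simp)

lemma costar_attaches:
  assumes f: "maps v u f"
  shows "edges_ok v es \<Longrightarrow> costar v u f \<Zsemi> attaches v es = attaches u (map (edge_map f) es) \<Zsemi> costar v u f"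
proof (induction es)
  case (Cons e es)
  obtain s \<gamma> t where e: "e = (s, \<gamma>, t)" by (cases e)
  have ok: "edge_ok v (s, \<gamma>, t)" "edges_ok v es" using Cons.prems by (simp_all add: e)
  have ok': "edge_ok u (map f s, \<gamma>, map f t)" "edges_ok u (map (edge_map f) es)"
    using edge_ok_map[OF ok(1) f] edge_ok_map[OF _ f] ok(2) by auto
  have "costar v u f \<Zsemi> attaches v (e # es) = (costar v u f \<Zsemi> attach v s \<gamma> t) \<Zsemi> attaches v es"
    using f ok by (simp add: e seq_assoc')
  also have "\<dots> = attach u (map f s) \<gamma> (map f t) \<Zsemi> (costar v u f \<Zsemi> attaches v es)"
    using f ok ok' by (simp add: costar_attach seq_assoc')
  also have "\<dots> = attaches u (map (edge_map f) (e # es)) \<Zsemi> costar v u f"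
    using f ok ok' Cons.IH by (simp add: e seq_assoc')
  finally show ?case .
qed (use f in simp)

lemma attaches_remove1:
  assumes "e \<in> set es" "edges_ok v es"
  shows "attaches v es = attaches v (e # remove1 e es)"
  using assms
proof (induction es)
  case (Cons e' es)
  show ?case
  proof (cases "e' = e")
    case False
    then have e: "e \<in> set es" and ok: "edge_ok v e" "edge_ok v e'" "edges_ok v es"
        "edges_ok v (remove1 e es)"
      using Cons.prems set_remove1_subset[of e es] by auto
    let ?a = "\<lambda>e. attach v (fst e) (fst (snd e)) (snd (snd e))"
    have "attaches v (e' # es) = (?a e' \<Zsemi> ?a e) \<Zsemi> attaches v (remove1 e es)"
      using ok Cons.IH[OF e ok(3)] by (simp add: seq_assoc')
    also have "?a e' \<Zsemi> ?a e = ?a e \<Zsemi> ?a e'"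
      by (rule attach_commute) (use ok in simp_all)
    finally show ?thesis using ok False by (simp add: seq_assoc')
  qed simp
qed simp

text \<open>The hyperedges of a hypergraph carry no order, so only the multiset of the list may
  matter; \<open>attach_commute\<close> provides the transpositions.\<close>

lemma attaches_mset: "mset es = mset es' \<Longrightarrow> edges_ok v es \<Longrightarrow> attaches v es = attaches v es'"
proof (induction es arbitrary: es')
  case (Cons e es)
  have e: "e \<in> set es'" and ok': "edges_ok v es'"
    using Cons.prems mset_eq_setD[OF Cons.prems(1)] by auto
  have "mset es = mset (remove1 e es')" using Cons.prems(1) e
      by (metis mset_remove1 mset.simps(2) add_mset_remove_trivial)
  then have "attaches v es = attaches v (remove1 e es')" using Cons.IH Cons.prems(2) by simp
  then show ?case using attaches_remove1[OF e ok'] by simp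
qed simp

lemma attaches_par:
  assumes "edges_ok v es"
  shows "attaches v es \<oplus> ident P u = attaches (v + u) es"
  using assms
proof (induction es)
  case (Cons e es)
  obtain s \<gamma> t where e: "e = (s, \<gamma>, t)" by (cases e)
  have ok: "edge_ok v (s, \<gamma>, t)" "edges_ok v es" using Cons.prems by (simp_all add: e)
  show ?case using Cons.IH[OF ok(2)] ok
      interchange'[of "attach v s \<gamma> t" "attaches v es" "ident P u" "ident P u"]
    by (simp add: e attach_par[OF ok(1)])
qed simp

lemma par_attaches:
  assumes "edges_ok v es"
  shows "ident P u \<oplus> attaches v es = attaches (u + v) (map (edge_map ((+) u)) es)"
  using assms
proof (induction es)
  case (Cons e es)
  obtain s \<gamma> t where e: "e = (s, \<gamma>, t)" by (cases e)
  have ok: "edge_ok v (s, \<gamma>, t)" "edges_ok v es" using Cons.prems by (simp_all add: e)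
  show ?case using Cons.IH[OF ok(2)] ok
      interchange'[of "ident P u" "ident P u" "attach v s \<gamma> t" "attaches v es"]
    by (simp add: e par_attach[OF ok(1)])
qed simp

text \<open>
  The normal form of the cospan \<open>n \<rightarrow> G \<leftarrow> m\<close> with legs \<open>i\<close> and \<open>j\<close>, where \<open>G\<close> has \<open>v\<close> nodes and
  hyperedges \<open>es\<close>.
\<close>

definition nf :: "nat \<Rightarrow> nat \<Rightarrow> nat \<Rightarrow> (nat \<Rightarrow> nat) \<Rightarrow> (nat list \<times> 'a \<times> nat list) list \<Rightarrow> (nat \<Rightarrow> nat) \<Rightarrow> 'a"
    where
  "nf n m v i es j = star n v i \<Zsemi> (attaches v es \<Zsemi> costar m v j)"

lemma ty_nf [simp]:
  assumes "maps n v i" "maps m v j" "edges_ok v es"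
  shows "is_arr (nf n m v i es j)" "dm (nf n m v i es j) = n" "cd (nf n m v i es j) = m"
  using assms by (simp_all add: nf_def)

lemma nf_cong:
  assumes "\<And>x. x < n \<Longrightarrow> i x = i' x" "\<And>x. x < m \<Longrightarrow> j x = j' x"
  shows "nf n m v i es j = nf n m v i' es j'"
  unfolding nf_def using star_cong[of n i i'] com.star_cong[of m j j'] assms by simp

lemma nf_ident: "nf n n n (\<lambda>x. x) [] (\<lambda>x. x) = ident P n"
  by (simp add: nf_def star_id costar_id)

text \<open>The out-leg acts contravariantly, so the inverse block swap \<open>swap_fun m n\<close>
  is the one that gives \<open>braid P n m\<close>.\<close>

lemma nf_braid: "nf (n + m) (m + n) (n + m) (\<lambda>x. x) [] (swap_fun m n) = braid P n m"
  unfolding nf_def by (simp add: star_id costar_swap)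

text \<open>Renaming inserts \<open>star\<close> of \<open>h\<close> before the hyperedges and
  \<open>costar\<close> of \<open>h\<close> after them. Sliding the former through the hyperedges
  brings the two together, and they cancel.\<close>

lemma nf_iso:
  assumes ok: "maps n v i" "maps m v j" "edges_ok v es"
    and h: "maps v v' h" "maps v' v h'" "\<And>x. x < v \<Longrightarrow> h' (h x) = x" "\<And>x. x < v' \<Longrightarrow> h (h' x) = x"
    and es: "mset es' = mset (map (edge_map h) es)"
  shows "nf n m v' (\<lambda>x. h (i x)) es' (\<lambda>x. h (j x)) = nf n m v i es j"
proof -
  have ok': "edges_ok v' (map (edge_map h) es)" using ok(3) edge_ok_map[OF _ h(1)] by auto
  have es': "attaches v' es' = attaches v' (map (edge_map h) es)"
    using attaches_mset[OF es[symmetric] ok'] by simp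
  have "nf n m v' (\<lambda>x. h (i x)) es' (\<lambda>x. h (j x))
    = (star n v i \<Zsemi> star v v' h) \<Zsemi> (attaches v' (map (edge_map h) es) \<Zsemi> (costar v v' h \<Zsemi> costar m v j))"
    unfolding nf_def es' star_comp[OF ok(1) h(1)] costar_comp[OF ok(2) h(1)] ..
  also have "\<dots> = star n v i \<Zsemi> ((star v v' h \<Zsemi> attaches v' (map (edge_map h) es))
      \<Zsemi> (costar v v' h \<Zsemi> costar m v j))"
    using ok h(1) ok' by (simp add: seq_assoc')
  also have "\<dots> = star n v i \<Zsemi> (attaches v es \<Zsemi> ((star v v' h \<Zsemi> costar v v' h) \<Zsemi> costar m v j))"
    unfolding attaches_star[OF h(1) ok(3), symmetric] using ok h(1) ok' by (simp add: seq_assoc')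
  also have "star v v' h \<Zsemi> costar v v' h = ident P v" by (rule star_costar_inverse[OF h])
  finally show ?thesis using ok by (simp add: nf_def)
qed

text \<open>Beck--Chevalley replaces the two middle legs by \<open>star\<close> of \<open>p\<close>
  and \<open>costar\<close> of \<open>q\<close>; these then move outwards through the hyperedges,
  renaming them, and are absorbed by the outer legs.\<close>

lemma nf_seq:
  assumes ok: "maps n v i" "maps m v j" "edges_ok v es"
    and ok': "maps m v' i'" "maps k v' j'" "edges_ok v' es'"
    and po: "fun_pushout m v v' c j i' p q"
  shows "nf n m v i es j \<Zsemi> nf m k v' i' es' j'
    = nf n k c (\<lambda>x. p (i x)) (map (edge_map p) es @ map (edge_map q) es') (\<lambda>x. q (j' x))"
proof -
  have p: "maps v c p" and q: "maps v' c q" using po by (simp_all add: fun_pushout_def)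
  have okp: "edges_ok c (map (edge_map p) es)" and okq: "edges_ok c (map (edge_map q) es')"
    using ok ok' edge_ok_map[OF _ p] edge_ok_map[OF _ q] by auto
  have "nf n m v i es j \<Zsemi> nf m k v' i' es' j'
    = star n v i \<Zsemi>
        (attaches v es \<Zsemi> ((costar m v j \<Zsemi> star m v' i') \<Zsemi> (attaches v' es' \<Zsemi> costar k v' j')))"
    using ok ok' by (simp add: nf_def seq_assoc')
  also have "\<dots> = star n v i \<Zsemi> ((attaches v es \<Zsemi> star v c p) \<Zsemi> ((costar v' c q \<Zsemi> attaches v' es')
      \<Zsemi> costar k v' j'))"
    unfolding costar_star[OF po] using ok ok' p q by (simp add: seq_assoc')
  also have "\<dots> = (star n v i \<Zsemi> star v c p)
      \<Zsemi> ((attaches c (map (edge_map p) es) \<Zsemi> attaches c (map (edge_map q) es'))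
      \<Zsemi> (costar v' c q \<Zsemi> costar k v' j'))"
    unfolding attaches_star[OF p ok(3)] costar_attaches[OF q ok'(3)]
    using ok ok' p q okp okq by (simp add: seq_assoc')
  also have "\<dots> = nf n k c (\<lambda>x. p (i x)) (map (edge_map p) es @ map (edge_map q) es') (\<lambda>x. q (j' x))"
    unfolding nf_def star_comp[OF ok(1) p] costar_comp[OF ok'(2) q] attaches_append[OF okp okq] ..
  finally show ?thesis .
qed

lemma nf_par:
  assumes ok: "maps n v i" "maps m v j" "edges_ok v es"
    and ok': "maps n' v' i'" "maps m' v' j'" "edges_ok v' es'"
  shows "nf n m v i es j \<oplus> nf n' m' v' i' es' j'
    = nf (n + n') (m + m') (v + v') (par_fun n v i i') (es @ map (edge_map ((+) v)) es')
        (par_fun m v j j')"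
proof -
  have okl: "edges_ok (v + v') es"
    using ok(3) edge_ok_add by blast
  have okr: "edges_ok (v + v') (map (edge_map ((+) v)) es')"
    using ok'(3) edge_ok_map[of v' _ "v + v'" "(+) v"] by (auto simp: maps_def)
  have 1: "attaches v es \<oplus> attaches v' es' = attaches (v + v') (es @ map (edge_map ((+) v)) es')"
    unfolding attaches_append[OF okl okr] attaches_par[OF ok(3), symmetric]
        par_attaches[OF ok'(3), symmetric]
    using ok ok' by (simp add: interchange')
  show ?thesis
    unfolding nf_def 1[symmetric] star_par[OF ok(1) ok'(1), symmetric]
        costar_par[OF ok(2) ok'(2), symmetric]
    using ok ok' by (simp add: interchange')
qed

lemma nf_mu: "nf 2 1 1 (\<lambda>_. 0) [] (\<lambda>x. x) = mu"
proof -
  have "star 2 1 (\<lambda>_. 0) = mu"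
    using mu_unit_left mult_at_last[of 0] by (simp add: numeral_2_eq_2 star.simps interchange')
  then show ?thesis using costar_id[of 1] by (simp add: nf_def)
qed

lemma nf_eta: "nf 0 1 1 (\<lambda>x. x) [] (\<lambda>x. x) = eta"
  using costar_id[of 1] by (simp add: nf_def star.simps)

lemma nf_delta: "nf 1 2 1 (\<lambda>x. x) [] (\<lambda>_. 0) = delta"
proof -
  have "costar 2 1 (\<lambda>_. 0) = delta"
    using com.mu_unit_left comult_at_last[of 0] by (simp add: numeral_2_eq_2 com.star.simps interchange')
  then show ?thesis using star_id[of 1] by (simp add: nf_def)
qed

lemma nf_eps: "nf 1 0 1 (\<lambda>x. x) [] (\<lambda>x. x) = eps"
  using star_id[of 1] by (simp add: nf_def com.star.simps)

text \<open>Sliding the legs past the copying of sources and the multiplication into targets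
  confines these to the \<open>k\<close> input and \<open>l\<close> output wires, where the counits
  and units cancel them.\<close>

lemma nf_gen:
  assumes g: "is_arr \<gamma>" "dm \<gamma> = k" "cd \<gamma> = l"
  shows "nf k l (k + l) (\<lambda>x. x) [([0..<k], \<gamma>, [k..<k + l])] (\<lambda>x. k + x) = \<gamma>"
proof -
  let ?i = "star k (k + l) (\<lambda>x. x)" and ?j = "costar l (k + l) ((+) k)"
  have m: "maps k (k + l) (\<lambda>x. x)" "maps l (k + l) ((+) k)" by (simp_all add: maps_def)
  have s: "set [0..<n] \<subseteq> {..<n}" for n by auto
  have e: "edge_ok (k + l) ([0..<k], \<gamma>, [k..<k + l])" using g by (auto simp: edge_ok.simps)
  have c: "maps (n + n) n (copair n [0..<n])" for n using maps_copair[OF s, of n] by simp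
  have shift: "maps n (n + n) ((+) n)" "maps 0 n f" for n f by (simp_all add: maps_def)
  have cp: "copair n [0..<n] (n + x) = x" if "x < n" for n x using that by (simp add: copair_def)
  have i: "?i = ident P k \<oplus> etas l" using star_add_right[OF maps_id, of k l] by (simp add: star_id)
  have par0: "par_fun 0 n f (\<lambda>x. x) = (+) n" for n f by (simp add: par_fun_def fun_eq_iff)
  have eps: "com.etas n \<oplus> ident P l = costar l (n + l) ((+) n)" for n l
    using costar_par[OF shift(2)[of n "\<lambda>x. x"] maps_id[of l]]
        by (simp add: costar_id com.star.simps par0)
  have eta: "etas n \<oplus> ident P l = star l (n + l) ((+) n)" for n l
    using star_par[OF shift(2)[of n "\<lambda>x. x"] maps_id[of l]] by (simp add: star_id star.simps par0)
  have upt: "map ((+) k) [0..<l] = [k..<k + l]" by (rule nth_equalityI) simp_all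
  have 1: "?i \<Zsemi> costar (k + l + k) (k + l) (copair (k + l) [0..<k])
      = costar (k + k) k (copair k [0..<k]) \<Zsemi> (?i \<oplus> ident P k)"
    using star_costar_copair[OF m(1) s] by simp
  have 2: "star (k + l + l) (k + l) (copair (k + l) [k..<k + l]) \<Zsemi> ?j
      = (?j \<oplus> ident P l) \<Zsemi> star (l + l) l (copair l [0..<l])"
    using copair_star_costar[OF m(2) s] upt by simp
  \<comment> \<open>The strand of nodes reduces to \<open>k\<close> discarded sources and
    \<open>l\<close> newly created targets, with nothing passing between them.\<close>
  have 3: "(?i \<oplus> ident P k) \<Zsemi> ((ident P (k + l) \<oplus> \<gamma>) \<Zsemi> (?j \<oplus> ident P l))
      = (com.etas k \<oplus> ident P k) \<Zsemi> (\<gamma> \<Zsemi> (etas l \<oplus> ident P l))"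
  proof -
    have "?i \<Zsemi> ?j = com.etas k \<oplus> etas l" unfolding i eps[symmetric] by (simp add: interchange')
    also have "\<dots> = com.etas k \<Zsemi> etas l"
      using interchange'[of "com.etas k" "ident P 0" "ident P 0" "etas l"] by simp
    finally have "(?i \<oplus> ident P k) \<Zsemi> ((ident P (k + l) \<oplus> \<gamma>) \<Zsemi> (?j \<oplus> ident P l))
        = (com.etas k \<Zsemi> etas l) \<oplus> \<gamma>"
      using g m by (simp add: interchange')
    also have "\<dots> = (com.etas k \<oplus> \<gamma>) \<Zsemi> (etas l \<oplus> ident P l)" using g by (simp add: interchange')
    also have "com.etas k \<oplus> \<gamma> = (com.etas k \<oplus> ident P k) \<Zsemi> \<gamma>"
      using g interchange'[of "com.etas k" "ident P 0" "ident P k" \<gamma>] by simp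
    finally show ?thesis using g by (simp add: seq_assoc')
  qed
  have 4: "costar (k + k) k (copair k [0..<k]) \<Zsemi> (com.etas k \<oplus> ident P k) = ident P k"
    unfolding eps costar_comp[OF shift(1) c]
    using com.star_cong[of k "\<lambda>x. copair k [0..<k] (k + x)" "\<lambda>x. x"] cp[of _ k] by (simp add: costar_id)
  have 5: "(etas l \<oplus> ident P l) \<Zsemi> star (l + l) l (copair l [0..<l]) = ident P l"
    unfolding eta star_comp[OF shift(1) c]
    using star_cong[of l "\<lambda>x. copair l [0..<l] (l + x)" "\<lambda>x. x"] cp[of _ l] by (simp add: star_id)
  have cc: "maps (k + l + k) (k + l) (copair (k + l) [0..<k])"
      "maps (k + l + l) (k + l) (copair (k + l) [k..<k + l])"
    using maps_copair[of "[0..<k]" "k + l"] maps_copair[of "[k..<k + l]" "k + l"] by fastforce+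
  have "nf k l (k + l) (\<lambda>x. x) [([0..<k], \<gamma>, [k..<k + l])] (\<lambda>x. k + x)
    = (?i \<Zsemi> costar (k + l + k) (k + l) (copair (k + l) [0..<k])) \<Zsemi>
      ((ident P (k + l) \<oplus> \<gamma>) \<Zsemi> (star (k + l + l) (k + l) (copair (k + l) [k..<k + l]) \<Zsemi> ?j))"
    using g m cc e by (simp add: nf_def attach_def seq_assoc')
  also have "\<dots> = costar (k + k) k (copair k [0..<k]) \<Zsemi>
     (((?i \<oplus> ident P k) \<Zsemi> ((ident P (k + l) \<oplus> \<gamma>) \<Zsemi> (?j \<oplus> ident P l))) \<Zsemi> star (l + l) l (copair l
         [0..<l]))"
    unfolding 1 2 using g m c by (simp add: seq_assoc')
  also have "\<dots> = (costar (k + k) k (copair k [0..<k]) \<Zsemi> (com.etas k \<oplus> ident P k)) \<Zsemi>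
     (\<gamma> \<Zsemi> ((etas l \<oplus> ident P l) \<Zsemi> star (l + l) l (copair l [0..<l])))"
    unfolding 3 using g c by (simp add: seq_assoc')
  also have "\<dots> = \<gamma>" unfolding 4 5 using g by simp
  finally show ?thesis .
qed

end

section \<open>The category of hypergraphs and cospans\<close>

lemma hyp_hom_seq:
  assumes "hypergraph_over \<Sigma> G" "hyp_hom G H f" "hyp_hom H K g"
  shows "hyp_hom G K (hyp_seq G f g)"
proof -
  have n: "fst f x \<in> nodes H" if "x \<in> nodes G" for x using assms(2) that by (auto simp: hyp_hom_def)
  have e: "snd f x \<in> hedges H" if "x \<in> hedges G" for x using assms(2) that by (auto simp: hyp_hom_def)
  have s: "set (sources G h) \<subseteq> nodes G" "set (targets G h) \<subseteq> nodes G" if "h \<in> hedges G" for h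
    using assms(1) that by (auto simp: hypergraph_over_def)
  show ?thesis
    using assms(2,3) n e s unfolding hyp_hom_def hyp_seq_def
    by (auto simp: compose_def map_idI subset_eq PiE_iff)
qed

lemma hyp_seq_assoc:
  assumes "hyp_hom G H f"
  shows "hyp_seq G (hyp_seq G f g) h = hyp_seq G f (hyp_seq H g h)"
  using assms unfolding hyp_hom_def hyp_seq_def
      by (auto simp: compose_def fun_eq_iff PiE_iff restrict_def)

lemma hyp_seq_id: "hyp_hom G H f \<Longrightarrow> hyp_seq G f (hyp_id H) = f"
  unfolding hyp_hom_def hyp_seq_def hyp_id_def
  by (cases f) (auto simp: compose_def fun_eq_iff PiE_iff restrict_def extensional_def)

lemma hyp_id_seq: "hyp_hom G H f \<Longrightarrow> hyp_seq G (hyp_id G) f = f"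
  unfolding hyp_hom_def hyp_seq_def hyp_id_def
  by (cases f) (auto simp: compose_def fun_eq_iff PiE_iff restrict_def extensional_def)

lemma hyp_hom_id: "hypergraph_over \<Sigma> G \<Longrightarrow> hyp_hom G G (hyp_id G)"
  unfolding hyp_hom_def hyp_id_def hypergraph_over_def
  by (auto simp: subset_eq intro!: map_idI[symmetric])

definition hyp_inverse :: "'g hypergraph \<Rightarrow> 'g hypergraph \<Rightarrow> hmap \<Rightarrow> hmap \<Rightarrow> bool" where
  "hyp_inverse G H u v \<longleftrightarrow> hyp_hom G H u \<and> hyp_hom H G v \<and> hyp_seq G u v = hyp_id G \<and> hyp_seq H v u
      = hyp_id H"

lemma hyp_inverse_sym: "hyp_inverse G H u v \<Longrightarrow> hyp_inverse H G v u"
  by (simp add: hyp_inverse_def)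

lemma hyp_inverse_trans:
  assumes "hypergraph_over \<Sigma> G" "hypergraph_over \<Sigma> H" "hypergraph_over \<Sigma> K"
    and "hyp_inverse G H u v" "hyp_inverse H K u' v'"
  shows "hyp_inverse G K (hyp_seq G u u') (hyp_seq K v' v)"
proof -
  have h: "hyp_hom G H u" "hyp_hom H G v" "hyp_hom H K u'" "hyp_hom K H v'"
    and eq: "hyp_seq G u v = hyp_id G" "hyp_seq H v u = hyp_id H" "hyp_seq H u' v' = hyp_id H"
        "hyp_seq K v' u' = hyp_id K"
    using assms by (auto simp: hyp_inverse_def)
  have "hyp_seq G (hyp_seq G u u') (hyp_seq K v' v) = hyp_seq G u (hyp_seq H (hyp_seq H u' v') v)"
    by (simp add: hyp_seq_assoc[OF h(1)] hyp_seq_assoc[OF h(3)])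
  moreover have "hyp_seq K (hyp_seq K v' v) (hyp_seq G u u')
      = hyp_seq K v' (hyp_seq H (hyp_seq H v u) u')"
    by (simp add: hyp_seq_assoc[OF h(4)] hyp_seq_assoc[OF h(2)])
  ultimately show ?thesis
    using hyp_hom_seq[OF assms(1) h(1,3)] hyp_hom_seq[OF assms(3) h(4,2)]
    by (simp add: hyp_inverse_def eq hyp_id_seq[OF h(2)] hyp_id_seq[OF h(3)])
qed

lemma hypergraph_over_discrete [simp]: "hypergraph_over \<Sigma> (discrete n)"
  by (simp add: hypergraph_over_def discrete_def)

lemma discrete_simps [simp]: "nodes (discrete n) = {..<n}" "hedges (discrete n) = {}"
  by (simp_all add: discrete_def)

lemma hyp_hom_discrete:
  "hyp_hom (discrete n) G f \<longleftrightarrow> (\<exists>h. f = discrete_map n h \<and> (\<forall>x < n. h x \<in> nodes G))"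
proof
  assume "hyp_hom (discrete n) G f"
  then have f: "fst f \<in> {..<n} \<rightarrow>\<^sub>E nodes G" "snd f \<in> {} \<rightarrow>\<^sub>E hedges G" by (auto simp: hyp_hom_def)
  then have "f = discrete_map n (fst f)"
    by (cases f) (auto simp: discrete_map_def extensional_restrict PiE_iff)
  then show "\<exists>h. f = discrete_map n h \<and> (\<forall>x < n. h x \<in> nodes G)" using f(1) by blast
qed (auto simp: hyp_hom_def discrete_map_def restrict_def split: if_splits)

lemma hyp_seq_discrete:
  "hyp_seq (discrete n) (discrete_map n f) u = discrete_map n (\<lambda>x. fst u (f x))"
  by (auto simp: hyp_seq_def discrete_map_def compose_def fun_eq_iff)

lemma discrete_map_cong: "(\<And>x. x < n \<Longrightarrow> f x = g x) \<Longrightarrow> discrete_map n f = discrete_map n g"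
  by (auto simp: discrete_map_def)

lemma fst_discrete_map [simp]: "x < n \<Longrightarrow> fst (discrete_map n f) x = f x"
  by (simp add: discrete_map_def)

lemma cospan_iso_alt:
  "cospan_iso \<Sigma> c d \<longleftrightarrow> is_cospan \<Sigma> c \<and> is_cospan \<Sigma> d \<and> cdom c = cdom d \<and> ccod c = ccod d \<and>
     (\<exists>u v. hyp_inverse (apex c) (apex d) u v \<and>
        hyp_seq (discrete (cdom c) :: 'g hypergraph) (in_leg c) u = in_leg d \<and>
        hyp_seq (discrete (ccod c) :: 'g hypergraph) (out_leg c) u = out_leg d)"
  for c d :: "'g cospan"
  unfolding cospan_iso_def hyp_inverse_def by blast

lemma cospan_isoI:
  fixes c d :: "'g cospan"
  assumes "is_cospan \<Sigma> c" "is_cospan \<Sigma> d" "cdom c = cdom d" "ccod c = ccod d"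
      "hyp_inverse (apex c) (apex d) u v"
    and "hyp_seq (discrete (cdom c) :: 'g hypergraph) (in_leg c) u = in_leg d"
    and "hyp_seq (discrete (ccod c) :: 'g hypergraph) (out_leg c) u = out_leg d"
  shows "cospan_iso \<Sigma> c d"
  using assms unfolding cospan_iso_alt by blast

lemma cospan_iso_refl: "is_cospan \<Sigma> c \<Longrightarrow> cospan_iso \<Sigma> c c"
  unfolding cospan_iso_def is_cospan_def
  by (intro conjI exI[of _ "hyp_id (apex c)"])
    (auto simp: hyp_seq_id hyp_hom_id hyp_hom_id[THEN hyp_seq_id])

lemma cospan_iso_sym:
  fixes c d :: "'g cospan"
  assumes "cospan_iso \<Sigma> c d"
  shows "cospan_iso \<Sigma> d c"
proof -
  obtain u v where uv: "hyp_inverse (apex c) (apex d) u v"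
    and l: "hyp_seq (discrete (cdom c) :: 'g hypergraph) (in_leg c) u = in_leg d"
        "hyp_seq (discrete (ccod c) :: 'g hypergraph) (out_leg c) u = out_leg d"
    and c: "is_cospan \<Sigma> c" "is_cospan \<Sigma> d" "cdom c = cdom d" "ccod c = ccod d"
    using assms unfolding cospan_iso_alt by blast
  have h: "hyp_hom (discrete (cdom c)) (apex c) (in_leg c)"
      "hyp_hom (discrete (ccod c)) (apex c) (out_leg c)"
    using c by (simp_all add: is_cospan_def)
  have "hyp_seq (discrete (cdom c) :: 'g hypergraph) (in_leg d) v = in_leg c"
      "hyp_seq (discrete (ccod c) :: 'g hypergraph) (out_leg d) v = out_leg c"
    unfolding l[symmetric] using uv h
        by (simp_all add: hyp_seq_assoc[OF h(1)] hyp_seq_assoc[OF h(2)] hyp_inverse_def hyp_seq_id)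
  then show ?thesis using c by (intro cospan_isoI[OF _ _ _ _ hyp_inverse_sym[OF uv]]) simp_all
qed

lemma cospan_iso_trans:
  fixes c d e :: "'g cospan"
  assumes "cospan_iso \<Sigma> c d" "cospan_iso \<Sigma> d e"
  shows "cospan_iso \<Sigma> c e"
proof -
  obtain u v where uv: "hyp_inverse (apex c) (apex d) u v"
    and l: "hyp_seq (discrete (cdom c) :: 'g hypergraph) (in_leg c) u = in_leg d"
        "hyp_seq (discrete (ccod c) :: 'g hypergraph) (out_leg c) u = out_leg d"
    and c: "is_cospan \<Sigma> c" "is_cospan \<Sigma> d" "cdom c = cdom d" "ccod c = ccod d"
    using assms(1) unfolding cospan_iso_alt by blast
  obtain u' v' where uv': "hyp_inverse (apex d) (apex e) u' v'"
    and l': "hyp_seq (discrete (cdom d) :: 'g hypergraph) (in_leg d) u' = in_leg e"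
        "hyp_seq (discrete (ccod d) :: 'g hypergraph) (out_leg d) u' = out_leg e"
    and c': "is_cospan \<Sigma> e" "cdom d = cdom e" "ccod d = ccod e"
    using assms(2) unfolding cospan_iso_alt by blast
  have h: "hyp_hom (discrete (cdom c)) (apex c) (in_leg c)"
      "hyp_hom (discrete (ccod c)) (apex c) (out_leg c)"
    and o: "hypergraph_over \<Sigma> (apex c)" "hypergraph_over \<Sigma> (apex d)" "hypergraph_over \<Sigma> (apex e)"
    using c c' by (simp_all add: is_cospan_def)
  have "hyp_seq (discrete (cdom c) :: 'g hypergraph) (in_leg c) (hyp_seq (apex c) u u') = in_leg e"
    "hyp_seq (discrete (ccod c) :: 'g hypergraph) (out_leg c) (hyp_seq (apex c) u u') = out_leg e"
    unfolding hyp_seq_assoc[OF h(1), symmetric] hyp_seq_assoc[OF h(2), symmetric] l using l' c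
        by simp_all
  then show ?thesis using c c' by (intro cospan_isoI[OF _ _ _ _ hyp_inverse_trans[OF o uv uv']]) simp_all
qed

lemma cospan_class_self: "is_cospan \<Sigma> c \<Longrightarrow> c \<in> cospan_class \<Sigma> c"
  by (simp add: cospan_class_def cospan_iso_refl)

lemma cospan_class_eq: "cospan_iso \<Sigma> c d \<Longrightarrow> cospan_class \<Sigma> c = cospan_class \<Sigma> d"
  unfolding cospan_class_def using cospan_iso_sym cospan_iso_trans by blast

section \<open>Pushouts of hypergraphs\<close>

lemma pushout_unique:
  assumes p: "is_pushout \<Sigma> M G H f g K i j" and p': "is_pushout \<Sigma> M G H f g K' i' j'"
  shows "\<exists>u v. hyp_inverse K K' u v \<and> hyp_seq G i u = i' \<and> hyp_seq H j u = j'"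
proof -
  have o: "hypergraph_over \<Sigma> K" "hypergraph_over \<Sigma> K'" "hypergraph_over \<Sigma> G" "hypergraph_over \<Sigma> H"
    and h: "hyp_hom G K i" "hyp_hom H K j" "hyp_hom G K' i'" "hyp_hom H K' j'"
    and eq: "hyp_seq M f i = hyp_seq M g j" "hyp_seq M f i' = hyp_seq M g j'"
    using p p' by (auto simp: is_pushout_def)
  note U = p[unfolded is_pushout_def, THEN conjunct2, THEN conjunct2, THEN conjunct2, THEN conjunct2,
      THEN conjunct2, THEN conjunct2, THEN conjunct2, THEN conjunct2, THEN conjunct2, rule_format, OF
          conjI, OF _ conjI, OF _ _ conjI]
  note U' = p'[unfolded is_pushout_def, THEN conjunct2, THEN conjunct2, THEN conjunct2, THEN conjunct2,
      THEN conjunct2, THEN conjunct2, THEN conjunct2, THEN conjunct2, THEN conjunct2, rule_format, OF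
          conjI, OF _ conjI, OF _ _ conjI]
  obtain u where u: "hyp_hom K K' u" "hyp_seq G i u = i'" "hyp_seq H j u = j'"
    using U[OF o(2) h(3,4) eq(2)] by blast
  obtain v where v: "hyp_hom K' K v" "hyp_seq G i' v = i" "hyp_seq H j' v = j"
    using U'[OF o(1) h(1,2) eq(1)] by blast
  have "hyp_hom K K (hyp_seq K u v)" "hyp_seq G i (hyp_seq K u v) = i" "hyp_seq H j (hyp_seq K u v) = j"
    using hyp_hom_seq[OF o(1) u(1) v(1)] u v
        by (simp_all flip: hyp_seq_assoc[OF h(1)] hyp_seq_assoc[OF h(2)])
  then have 1: "hyp_seq K u v = hyp_id K"
    using U[OF o(1) h(1,2) eq(1)] hyp_hom_id[OF o(1)] hyp_seq_id[OF h(1)] hyp_seq_id[OF h(2)] by blast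
  have "hyp_hom K' K' (hyp_seq K' v u)" "hyp_seq G i' (hyp_seq K' v u) = i'"
      "hyp_seq H j' (hyp_seq K' v u) = j'"
    using hyp_hom_seq[OF o(2) v(1) u(1)] u v
        by (simp_all flip: hyp_seq_assoc[OF h(3)] hyp_seq_assoc[OF h(4)])
  then have 2: "hyp_seq K' v u = hyp_id K'"
    using U'[OF o(2) h(3,4) eq(2)] hyp_hom_id[OF o(2)] hyp_seq_id[OF h(3)] hyp_seq_id[OF h(4)] by blast
  show ?thesis using 1 2 u v unfolding hyp_inverse_def by blast
qed

lemma pushout_iso:
  assumes p: "is_pushout \<Sigma> M G H f g K i j" and uv: "hyp_inverse K K' u v" and K': "hypergraph_over \<Sigma> K'"
  shows "is_pushout \<Sigma> M G H f g K' (hyp_seq G i u) (hyp_seq H j u)"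
proof -
  have o: "hypergraph_over \<Sigma> K" "hypergraph_over \<Sigma> G" "hypergraph_over \<Sigma> H"
    and h: "hyp_hom G K i" "hyp_hom H K j" "hyp_hom M G f" "hyp_hom M H g"
    and eq: "hyp_seq M f i = hyp_seq M g j"
    using p by (auto simp: is_pushout_def)
  have hu: "hyp_hom K K' u" "hyp_hom K' K v" "hyp_seq K u v = hyp_id K" "hyp_seq K' v u = hyp_id K'"
    using uv by (auto simp: hyp_inverse_def)
  have "\<exists>!w. hyp_hom K' L w \<and> hyp_seq G (hyp_seq G i u) w = r \<and> hyp_seq H (hyp_seq H j u) w = q"
    if L: "hypergraph_over \<Sigma> L" "hyp_hom G L r" "hyp_hom H L q" "hyp_seq M f r = hyp_seq M g q" for L r q
  proof -
    have ex: "\<exists>!w. hyp_hom K L w \<and> hyp_seq G i w = r \<and> hyp_seq H j w = q"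
      using p L unfolding is_pushout_def by blast
    then obtain w where w: "hyp_hom K L w" "hyp_seq G i w = r" "hyp_seq H j w = q" by blast
    show ?thesis
    proof (intro ex1I[of _ "hyp_seq K' v w"] conjI)
      show "hyp_hom K' L (hyp_seq K' v w)" by (rule hyp_hom_seq[OF K' hu(2) w(1)])
      have uvw: "hyp_seq K u (hyp_seq K' v w) = w"
        using hu w by (simp add: hyp_id_seq flip: hyp_seq_assoc[OF hu(1)])
      then show "hyp_seq G (hyp_seq G i u) (hyp_seq K' v w) = r"
          "hyp_seq H (hyp_seq H j u) (hyp_seq K' v w) = q"
        using w by (simp_all add: hyp_seq_assoc[OF h(1)] hyp_seq_assoc[OF h(2)])
    next
      fix w' assume w': "hyp_hom K' L w' \<and> hyp_seq G (hyp_seq G i u) w'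
          = r \<and> hyp_seq H (hyp_seq H j u) w' = q"
      then have "hyp_hom K L (hyp_seq K u w')" "hyp_seq G i (hyp_seq K u w') = r"
          "hyp_seq H j (hyp_seq K u w') = q"
        using hyp_hom_seq[OF o(1) hu(1)] by (auto simp: hyp_seq_assoc[OF h(1)] hyp_seq_assoc[OF h(2)])
      then have "hyp_seq K u w' = w" using ex w by blast
      then show "w' = hyp_seq K' v w"
        using w' hu by (auto simp: hyp_id_seq simp flip: hyp_seq_assoc[OF hu(2)])
    qed
  qed
  moreover have "hyp_seq M f (hyp_seq G i u) = hyp_seq M g (hyp_seq H j u)"
    using eq by (simp flip: hyp_seq_assoc[OF h(3)] hyp_seq_assoc[OF h(4)])
  ultimately show ?thesis
    using p K' hyp_hom_seq[OF o(2) h(1) hu(1)] hyp_hom_seq[OF o(3) h(2) hu(1)]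
    unfolding is_pushout_def by simp
qed

text \<open>The middle object of a composite is discrete, so the pushout identifies nodes only and
  takes the disjoint union of the hyperedges. The quotient of the nodes is given from outside,
  numbered below \<open>w\<close>, so that it can come from a pushout of finite ordinals.\<close>

definition glue :: "'g hypergraph \<Rightarrow> 'g hypergraph \<Rightarrow> nat \<Rightarrow> (nat \<Rightarrow> nat) \<Rightarrow> (nat \<Rightarrow> nat) \<Rightarrow> 'g hypergraph"
    where
  "glue G H w p q = \<lparr>nodes = {..<w},
      hedges = sum_encode ` (hedges G <+> hedges H),
      sources = (\<lambda>h. case sum_decode h of Inl e \<Rightarrow> map p (sources G e) | Inr e \<Rightarrow> map q (sources H e)),
      targets = (\<lambda>h. case sum_decode h of Inl e \<Rightarrow> map p (targets G e) | Inr e \<Rightarrow> map q (targets H e)),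
      label = (\<lambda>h. case sum_decode h of Inl e \<Rightarrow> label G e | Inr e \<Rightarrow> label H e)\<rparr>"

lemma glue_pushout:
  fixes G H :: "'g hypergraph"
  assumes G: "hypergraph_over \<Sigma> G" and H: "hypergraph_over \<Sigma> H"
    and f: "\<And>j. j < m \<Longrightarrow> f j \<in> nodes G" and g: "\<And>j. j < m \<Longrightarrow> g j \<in> nodes H"
    and p: "\<And>x. x \<in> nodes G \<Longrightarrow> p x < w" and q: "\<And>x. x \<in> nodes H \<Longrightarrow> q x < w"
    and eq: "\<And>j. j < m \<Longrightarrow> p (f j) = q (g j)"
    and surj: "\<And>z. z < w \<Longrightarrow> (\<exists>x \<in> nodes G. p x = z) \<or> (\<exists>y \<in> nodes H. q y = z)"
    and fac: "\<And>\<alpha> \<beta> :: nat \<Rightarrow> nat. (\<And>j. j < m \<Longrightarrow> \<alpha> (f j) = \<beta> (g j)) \<Longrightarrow>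
      \<exists>u. (\<forall>x \<in> nodes G. u (p x) = \<alpha> x) \<and> (\<forall>y \<in> nodes H. u (q y) = \<beta> y)"
  shows "is_pushout \<Sigma> (discrete m) G H (discrete_map m f) (discrete_map m g) (glue G H w p q)
    (restrict p (nodes G), restrict (sum_encode \<circ> Inl) (hedges G))
    (restrict q (nodes H), restrict (sum_encode \<circ> Inr) (hedges H))"
    (is "is_pushout _ _ _ _ _ _ ?K ?i ?j")
proof -
  have sG: "set (sources G h) \<subseteq> nodes G" "set (targets G h) \<subseteq> nodes G" if "h \<in> hedges G" for h
    using G that by (auto simp: hypergraph_over_def)
  have sH: "set (sources H h) \<subseteq> nodes H" "set (targets H h) \<subseteq> nodes H" if "h \<in> hedges H" for h
    using H that by (auto simp: hypergraph_over_def)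
  have K: "hypergraph_over \<Sigma> ?K"
    using G H p q unfolding hypergraph_over_def by (fastforce simp: glue_def)
  have i: "hyp_hom G ?K ?i"
    using p sG by (fastforce simp: hyp_hom_def glue_def subset_eq)
  have j: "hyp_hom H ?K ?j"
    using q sH by (fastforce simp: hyp_hom_def glue_def subset_eq)
  have e: "hyp_seq (discrete m :: 'g hypergraph) (discrete_map m f) ?i
      = hyp_seq (discrete m :: 'g hypergraph) (discrete_map m g) ?j"
    unfolding hyp_seq_discrete by (rule discrete_map_cong) (simp add: f g eq)
  have "\<exists>!u. hyp_hom ?K L u \<and> hyp_seq G ?i u = r \<and> hyp_seq H ?j u = s"
    if r: "hyp_hom G L r" and s: "hyp_hom H L s"
      and rs: "hyp_seq (discrete m :: 'g hypergraph) (discrete_map m f) r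
          = hyp_seq (discrete m :: 'g hypergraph) (discrete_map m g) s" for L r s
  proof -
    have rn: "fst r x \<in> nodes L" if "x \<in> nodes G" for x using r that by (auto simp: hyp_hom_def)
    have sn: "fst s x \<in> nodes L" if "x \<in> nodes H" for x using s that by (auto simp: hyp_hom_def)
    have "fst r (f x) = fst s (g x)" if "x < m" for x
      using arg_cong[OF rs, of "\<lambda>t. fst t x"] that by (simp add: hyp_seq_discrete)
    then obtain u0 where u0: "\<And>x. x \<in> nodes G \<Longrightarrow> u0 (p x) = fst r x"
        "\<And>y. y \<in> nodes H \<Longrightarrow> u0 (q y) = fst s y"
      using fac[of "fst r" "fst s"] by blast
    let ?u = "(restrict u0 {..<w}, restrict (\<lambda>h. case_sum (snd r) (snd s) (sum_decode h)) (hedges ?K))"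
    show ?thesis
    proof (intro ex1I[of _ ?u] conjI)
      have "u0 z \<in> nodes L" if "z < w" for z using surj[OF that] u0 rn sn by metis
      then have 1: "fst ?u \<in> nodes ?K \<rightarrow>\<^sub>E nodes L" by (auto simp: glue_def)
      have 2: "snd ?u \<in> hedges ?K \<rightarrow>\<^sub>E hedges L"
        using r s by (auto simp: glue_def hyp_hom_def PiE_iff)
      have mp: "map (fst ?u \<circ> p) l = map (fst r) l" if "set l \<subseteq> nodes G" for l
        using that u0 p by auto
      have mq: "map (fst ?u \<circ> q) l = map (fst s) l" if "set l \<subseteq> nodes H" for l
        using that u0 q by auto
      have "sources L (snd ?u h) = map (fst ?u) (sources ?K h) \<and>
        targets L (snd ?u h) = map (fst ?u) (targets ?K h) \<and> label L (snd ?u h) = label ?K h"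
        if h: "h \<in> hedges ?K" for h
      proof -
        have s2: "snd ?u h = case_sum (snd r) (snd s) (sum_decode h)" using h by simp
        from h consider e where "e \<in> hedges G" "h = sum_encode (Inl e)"
          | e where "e \<in> hedges H" "h = sum_encode (Inr e)" by (auto simp: glue_def)
        then show ?thesis
        proof cases
          case (1 e)
          then show ?thesis unfolding s2 using r mp[OF sG(1)] mp[OF sG(2)]
            by (simp add: hyp_hom_def glue_def)
        next
          case (2 e)
          then show ?thesis unfolding s2 using s mq[OF sH(1)] mq[OF sH(2)]
            by (simp add: hyp_hom_def glue_def)
        qed
      qed
      then show "hyp_hom ?K L ?u" using 1 2 by (simp add: hyp_hom_def)
      show "hyp_seq G ?i ?u = r"
        using r u0 p unfolding hyp_hom_def hyp_seq_def
        by (cases r) (auto simp: compose_def fun_eq_iff PiE_iff restrict_def glue_def extensional_def)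
      show "hyp_seq H ?j ?u = s"
        using s u0 q unfolding hyp_hom_def hyp_seq_def
        by (cases s) (auto simp: compose_def fun_eq_iff PiE_iff restrict_def glue_def extensional_def)
    next
      fix u assume u: "hyp_hom ?K L u \<and> hyp_seq G ?i u = r \<and> hyp_seq H ?j u = s"
      have a: "fst u (p x) = fst r x" if "x \<in> nodes G" for x
        using u that by (auto simp: hyp_seq_def compose_def)
      have b: "fst u (q x) = fst s x" if "x \<in> nodes H" for x
        using u that by (auto simp: hyp_seq_def compose_def)
      have c: "snd u (sum_encode (Inl x)) = snd r x" if "x \<in> hedges G" for x
        using u that by (auto simp: hyp_seq_def compose_def)
      have d: "snd u (sum_encode (Inr x)) = snd s x" if "x \<in> hedges H" for x
        using u that by (auto simp: hyp_seq_def compose_def)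
      have "fst u z = u0 z" if "z < w" for z using surj[OF that] a b u0 by metis
      moreover have "fst u \<in> extensional {..<w}" "snd u \<in> extensional (hedges ?K)"
        using u by (auto simp: hyp_hom_def PiE_iff glue_def)
      moreover have "snd u h = case_sum (snd r) (snd s) (sum_decode h)" if "h \<in> hedges ?K" for h
        using that c d by (auto simp: glue_def)
      ultimately have "fst u = fst ?u" "snd u = snd ?u"
        by (auto simp: fun_eq_iff restrict_def extensional_def)
      then show "u = ?u" by (simp add: prod_eq_iff)
    qed
  qed
  moreover have "hyp_hom (discrete m) G (discrete_map m f)" "hyp_hom (discrete m) H (discrete_map m g)"
    using f g by (auto simp: hyp_hom_discrete)
  ultimately show ?thesis using G H K i j e by (simp add: is_pushout_def)
qed

section \<open>The arrow denoted by a cospan\<close>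

text \<open>A PROP sees nodes as numbered wires and hyperedges as a sequence, so a value requires a
  numbering of the nodes and an order of the hyperedges. By \<open>val_iso\<close> neither affects
  the result.\<close>

definition enumeration :: "'g hypergraph \<Rightarrow> (nat \<Rightarrow> nat) \<Rightarrow> nat \<Rightarrow> nat list \<Rightarrow> bool" where
  "enumeration G \<beta> v hs \<longleftrightarrow> bij_betw \<beta> (nodes G) {..<v} \<and> distinct hs \<and> set hs = hedges G"

lemma enumeration_exists: "hypergraph_over \<Sigma> G \<Longrightarrow> \<exists>\<beta> v hs. enumeration G \<beta> v hs"
  using ex_bij_betw_finite_nat[of "nodes G"] finite_distinct_list[of "hedges G"]
  unfolding enumeration_def hypergraph_over_def lessThan_atLeast0 by blast

lemma cospan_legs:
  fixes c :: "'g cospan"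
  assumes "is_cospan \<Sigma> c"
  shows "\<And>x. x < cdom c \<Longrightarrow> fst (in_leg c) x \<in> nodes (apex c)"
      "\<And>x. x < ccod c \<Longrightarrow> fst (out_leg c) x \<in> nodes (apex c)"
    "in_leg c = discrete_map (cdom c) (fst (in_leg c))"
        "out_leg c = discrete_map (ccod c) (fst (out_leg c))"
proof -
  obtain h h' where "in_leg c = discrete_map (cdom c) h" "\<forall>x < cdom c. h x \<in> nodes (apex c)"
    "out_leg c = discrete_map (ccod c) h'" "\<forall>x < ccod c. h' x \<in> nodes (apex c)"
    using assms unfolding is_cospan_def hyp_hom_discrete by blast
  then show "\<And>x. x < cdom c \<Longrightarrow> fst (in_leg c) x \<in> nodes (apex c)"
      "\<And>x. x < ccod c \<Longrightarrow> fst (out_leg c) x \<in> nodes (apex c)"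
    "in_leg c = discrete_map (cdom c) (fst (in_leg c))"
        "out_leg c = discrete_map (ccod c) (fst (out_leg c))"
    by (auto simp: discrete_map_def restrict_def fun_eq_iff)
qed

lemma is_composite_cospan:
  fixes a b c :: "'g cospan"
  assumes a: "is_cospan \<Sigma> a" and b: "is_cospan \<Sigma> b" and c: "is_composite \<Sigma> a b c"
  shows "is_cospan \<Sigma> c"
proof -
  obtain i j where p: "is_pushout \<Sigma> (discrete (ccod a)) (apex a) (apex b) (out_leg a) (in_leg b) (apex c)
      i j"
    and l: "in_leg c = hyp_seq (discrete (cdom a) :: 'g hypergraph) (in_leg a) i"
     "out_leg c = hyp_seq (discrete (ccod b) :: 'g hypergraph) (out_leg b) j"
    and eq: "cdom c = cdom a" "ccod c = ccod b"
    using c unfolding is_composite_def by blast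
  have "hyp_hom (apex a) (apex c) i" "hyp_hom (apex b) (apex c) j" "hypergraph_over \<Sigma> (apex c)"
    using p by (simp_all add: is_pushout_def)
  then show ?thesis
    using a b unfolding is_cospan_def l eq by (auto intro: hyp_hom_seq[of \<Sigma>])
qed

text \<open>The product of two classes in \<open>FTerm\<close> collects all composites of
  representatives; this closure property is what makes it a whole isomorphism class.\<close>

lemma is_composite_iso:
  fixes a b c d :: "'g cospan"
  assumes a: "is_cospan \<Sigma> a" and b: "is_cospan \<Sigma> b" and c: "is_composite \<Sigma> a b c" and d:
      "cospan_iso \<Sigma> c d"
  shows "is_composite \<Sigma> a b d"
proof -
  obtain i j where p: "is_pushout \<Sigma> (discrete (ccod a)) (apex a) (apex b) (out_leg a) (in_leg b) (apex c)
      i j"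
    and l: "in_leg c = hyp_seq (discrete (cdom a) :: 'g hypergraph) (in_leg a) i"
     "out_leg c = hyp_seq (discrete (ccod b) :: 'g hypergraph) (out_leg b) j"
    and eq: "cdom c = cdom a" "ccod c = ccod b" "ccod a = cdom b"
    using c unfolding is_composite_def by blast
  obtain u w where uw: "hyp_inverse (apex c) (apex d) u w" and d': "is_cospan \<Sigma> d"
    and l': "hyp_seq (discrete (cdom c) :: 'g hypergraph) (in_leg c) u = in_leg d"
      "hyp_seq (discrete (ccod c) :: 'g hypergraph) (out_leg c) u = out_leg d"
    and eq': "cdom c = cdom d" "ccod c = ccod d"
    using d unfolding cospan_iso_alt by blast
  have ab: "hyp_hom (discrete (cdom a)) (apex a) (in_leg a)"
      "hyp_hom (discrete (ccod b)) (apex b) (out_leg b)"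
    using a b by (simp_all add: is_cospan_def)
  have po: "is_pushout \<Sigma> (discrete (ccod a)) (apex a) (apex b) (out_leg a) (in_leg b) (apex d)
      (hyp_seq (apex a) i u) (hyp_seq (apex b) j u)"
    using pushout_iso[OF p uw] d' by (simp add: is_cospan_def)
  moreover have "in_leg d
      = hyp_seq (discrete (cdom a) :: 'g hypergraph) (in_leg a) (hyp_seq (apex a) i u)"
    "out_leg d = hyp_seq (discrete (ccod b) :: 'g hypergraph) (out_leg b) (hyp_seq (apex b) j u)"
    unfolding l'[symmetric] l eq hyp_seq_assoc[OF ab(1)] hyp_seq_assoc[OF ab(2)] by simp_all
  moreover have "cdom d = cdom a" "ccod d = ccod b" using eq eq' by simp_all
  ultimately show ?thesis using eq(3) unfolding is_composite_def by blast
qed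

lemma composite_unique:
  fixes a b c d :: "'g cospan"
  assumes a: "is_cospan \<Sigma> a" and b: "is_cospan \<Sigma> b" and c: "is_composite \<Sigma> a b c" and d:
      "is_composite \<Sigma> a b d"
  shows "cospan_iso \<Sigma> c d"
proof -
  have ab: "hyp_hom (discrete (cdom a)) (apex a) (in_leg a)"
      "hyp_hom (discrete (ccod b)) (apex b) (out_leg b)"
    using a b by (simp_all add: is_cospan_def)
  obtain i j i' j' where p:
      "is_pushout \<Sigma> (discrete (ccod a)) (apex a) (apex b) (out_leg a) (in_leg b) (apex c) i j"
    and l: "in_leg c = hyp_seq (discrete (cdom a) :: 'g hypergraph) (in_leg a) i"
     "out_leg c = hyp_seq (discrete (ccod b) :: 'g hypergraph) (out_leg b) j"
    and p': "is_pushout \<Sigma> (discrete (ccod a)) (apex a) (apex b) (out_leg a) (in_leg b) (apex d) i' j'"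
    and l': "in_leg d = hyp_seq (discrete (cdom a) :: 'g hypergraph) (in_leg a) i'"
     "out_leg d = hyp_seq (discrete (ccod b) :: 'g hypergraph) (out_leg b) j'"
    and eq: "cdom c = cdom a" "ccod c = ccod b" "cdom d = cdom a" "ccod d = ccod b"
    using c d unfolding is_composite_def by blast
  obtain u w where u: "hyp_inverse (apex c) (apex d) u w" "hyp_seq (apex a) i u = i'"
      "hyp_seq (apex b) j u = j'"
    using pushout_unique[OF p p'] by blast
  show ?thesis
    by (rule cospan_isoI[OF _ _ _ _ u(1)])
      (use u eq is_composite_cospan[OF a b] c d in \<open>simp_all add: l l' hyp_seq_assoc[OF ab(1)]
          hyp_seq_assoc[OF ab(2)]\<close>)
qed

lemma is_cospan_union:
  fixes a b :: "'g cospan"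
  assumes a: "is_cospan \<Sigma> a" and b: "is_cospan \<Sigma> b"
  shows "is_cospan \<Sigma> (cospan_union a b)"
proof -
  have o: "hypergraph_over \<Sigma> (apex a)" "hypergraph_over \<Sigma> (apex b)" using a b
      by (simp_all add: is_cospan_def)
  then have "hypergraph_over \<Sigma> (hyp_union (apex a) (apex b))"
    unfolding hypergraph_over_def by (fastforce simp: hyp_union_def)
  moreover have "\<forall>x < n + n'. sum_encode (if x < n then Inl (f x) else Inr (g (x - n))) \<in> nodes
      (hyp_union G H)"
    if "\<And>x. x < n \<Longrightarrow> f x \<in> nodes G" "\<And>x. x < n' \<Longrightarrow> g x \<in> nodes H"
        for n n' :: nat and f g :: "nat \<Rightarrow> nat" and G H :: "'g hypergraph"
  proof (intro allI impI)
    fix x assume "x < n + n'"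
    then show "sum_encode (if x < n then Inl (f x) else Inr (g (x - n))) \<in> nodes (hyp_union G H)"
      using that(1)[of x] that(2)[of "x - n"] by (cases "x < n") (auto simp: hyp_union_def)
  qed
  ultimately show ?thesis
    unfolding is_cospan_def hyp_hom_discrete
    using cospan_legs(1,2)[OF a] cospan_legs(1,2)[OF b] by (simp add: cospan_union_def) blast
qed

lemma enumeration_less: "enumeration G \<beta> v hs \<Longrightarrow> x \<in> nodes G \<Longrightarrow> \<beta> x < v"
  by (auto simp: enumeration_def bij_betw_def)

lemma bij_betw_sum_encode:
  fixes f g :: "nat \<Rightarrow> nat"
  assumes "bij_betw f A {..<n}" "bij_betw g B {..<m}"
  shows "bij_betw (\<lambda>x. case sum_decode x of Inl y \<Rightarrow> f y | Inr y
      \<Rightarrow> n + g y) (sum_encode ` (A <+> B)) {..<n + m}"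
    (is "bij_betw ?h _ _")
  unfolding bij_betw_def
proof
  have fg: "inj_on f A" "inj_on g B" "f ` A = {..<n}" "g ` B = {..<m}" using assms
      by (auto simp: bij_betw_def)
  have lt: "f x < n" if "x \<in> A" for x using fg that by blast
  show "inj_on ?h (sum_encode ` (A <+> B))"
  proof (rule inj_onI)
    fix x y assume xy: "x \<in> sum_encode ` (A <+> B)" "y \<in> sum_encode ` (A <+> B)" "?h x = ?h y"
    then obtain x' y' where xy': "x = sum_encode x'" "y = sum_encode y'" "x' \<in> A <+> B" "y' \<in> A <+> B"
        by blast
    have "x' = y'"
    proof (cases x'; cases y')
      fix a b assume "x' = Inl a" "y' = Inr b" then show ?thesis using xy(3) xy' lt[of a] by auto
    next
      fix a b assume "x' = Inr a" "y' = Inl b" then show ?thesis using xy(3) xy' lt[of b] by auto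
    qed (use xy(3) xy' fg in \<open>auto dest: inj_onD\<close>)
    then show "x = y" using xy' by simp
  qed
  have "?h ` sum_encode ` (A <+> B) = f ` A \<union> (\<lambda>y. n + g y) ` B" 
    unfolding image_image Plus_def image_Un by simp
  also have "(\<lambda>y. n + g y) ` B = (+) n ` {..<m}" unfolding fg(4)[symmetric] by auto
  also have "f ` A \<union> \<dots> = {..<n + m}"
    unfolding fg(3) lessThan_atLeast0 image_add_atLeastLessThan by auto
  finally show "?h ` sum_encode ` (A <+> B) = {..<n + m}" .
qed

text \<open>Kept abstract because it is instantiated twice, by the coproduct and by the matrices;
  \<open>val_image\<close> compares the two instances.\<close>

locale frob_interp = frob_prop P mu eta delta eps
    for P :: "'a prop_struct" (structure) and mu eta delta eps +
  fixes \<Sigma> :: "'g signature" and \<gamma> :: "'g \<Rightarrow> 'a"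
  assumes \<gamma>: "g \<in> gens \<Sigma> \<Longrightarrow> \<gamma> g \<in> arr P (arity \<Sigma> g) (coarity \<Sigma> g)"
begin

definition edge_of :: "'g hypergraph \<Rightarrow> (nat \<Rightarrow> nat) \<Rightarrow> nat \<Rightarrow> nat list \<times> 'a \<times> nat list" where
  "edge_of G \<beta> h = (map \<beta> (sources G h), \<gamma> (label G h), map \<beta> (targets G h))"

definition val :: "'g cospan \<Rightarrow> (nat \<Rightarrow> nat) \<Rightarrow> nat \<Rightarrow> nat list \<Rightarrow> 'a" where
  "val c \<beta> v hs = nf (cdom c) (ccod c) v (\<lambda>x. \<beta> (fst (in_leg c) x)) (map (edge_of (apex c) \<beta>) hs)
     (\<lambda>x. \<beta> (fst (out_leg c) x))"

lemma edge_of_ok: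
  assumes "hypergraph_over \<Sigma> G" "h \<in> hedges G" "\<And>x. x \<in> nodes G \<Longrightarrow> \<beta> x < v"
  shows "edge_ok v (edge_of G \<beta> h)"
  using assms \<gamma>[of "label G h"] unfolding hypergraph_over_def edge_of_def
  by (auto simp: edge_ok.simps arr_iff)

lemma val_ok:
  assumes c: "is_cospan \<Sigma> c" and e: "enumeration (apex c) \<beta> v hs"
  shows "maps (cdom c) v (\<lambda>x. \<beta> (fst (in_leg c) x))" "maps (ccod c) v (\<lambda>x. \<beta> (fst (out_leg c) x))"
    "edges_ok v (map (edge_of (apex c) \<beta>) hs)"
  using cospan_legs[OF c] enumeration_less[OF e] edge_of_ok c e
  by (auto simp: maps_def is_cospan_def enumeration_def)

lemma val_arr: "is_cospan \<Sigma> c \<Longrightarrow> enumeration (apex c) \<beta> v hs \<Longrightarrow> val c \<beta> v hs \<in> arr P (cdom c) (ccod c)"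
  using ty_nf[OF val_ok] by (simp add: arr_iff val_def)

text \<open>An isomorphism of cospans and a change of enumeration have the same effect, a
  renumbering of the wires together with a permutation of the hyperedges, so \<open>nf_iso\<close>
  handles both at once.\<close>

lemma val_iso:
  assumes cd: "cospan_iso \<Sigma> c d" and e: "enumeration (apex c) \<beta> v hs" and e':
      "enumeration (apex d) \<beta>' v' hs'"
  shows "val c \<beta> v hs = val d \<beta>' v' hs'"
proof -
  let ?G = "apex c" and ?H = "apex d"
  obtain u w where uw: "hyp_hom ?G ?H u" "hyp_hom ?H ?G w" "hyp_seq ?G u w = hyp_id ?G"
      "hyp_seq ?H w u = hyp_id ?H"
    and l: "hyp_seq (discrete (cdom c) :: 'g hypergraph) (in_leg c) u = in_leg d"
      "hyp_seq (discrete (ccod c) :: 'g hypergraph) (out_leg c) u = out_leg d"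
    and c: "is_cospan \<Sigma> c" and d: "is_cospan \<Sigma> d" and eq: "cdom c = cdom d" "ccod c = ccod d"
    using cd unfolding cospan_iso_alt hyp_inverse_def by blast
  have o: "hypergraph_over \<Sigma> ?G" "hypergraph_over \<Sigma> ?H" using c d by (simp_all add: is_cospan_def)
  have u: "fst u x \<in> nodes ?H" if "x \<in> nodes ?G" for x using uw(1) that by (auto simp: hyp_hom_def)
  have w: "fst w x \<in> nodes ?G" if "x \<in> nodes ?H" for x using uw(2) that by (auto simp: hyp_hom_def)
  have wu: "fst w (fst u x) = x" if "x \<in> nodes ?G" for x
    using fun_cong[OF arg_cong[OF uw(3), of fst], of x] that
        by (simp add: hyp_seq_def hyp_id_def compose_def)
  have uw': "fst u (fst w x) = x" if "x \<in> nodes ?H" for x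
    using fun_cong[OF arg_cong[OF uw(4), of fst], of x] that
        by (simp add: hyp_seq_def hyp_id_def compose_def)
  have wu2: "snd w (snd u x) = x" if "x \<in> hedges ?G" for x
    using fun_cong[OF arg_cong[OF uw(3), of snd], of x] that
        by (simp add: hyp_seq_def hyp_id_def compose_def)
  have uw2: "snd u (snd w x) = x" if "x \<in> hedges ?H" for x
    using fun_cong[OF arg_cong[OF uw(4), of snd], of x] that
        by (simp add: hyp_seq_def hyp_id_def compose_def)
  have bij: "bij_betw (snd u) (hedges ?G) (hedges ?H)"
    by (rule bij_betwI[where g = "snd w"]) (use uw wu2 uw2 in \<open>auto simp: hyp_hom_def\<close>)
  define b where "b = inv_into (nodes ?G) \<beta>"
  define b' where "b' = inv_into (nodes ?H) \<beta>'"
  have \<beta>: "bij_betw \<beta> (nodes ?G) {..<v}" and \<beta>': "bij_betw \<beta>' (nodes ?H) {..<v'}"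
    using e e' by (auto simp: enumeration_def)
  have b: "b x \<in> nodes ?G" "\<beta> (b x) = x" if "x < v" for x
    using \<beta> that bij_betw_inv_into_right[OF \<beta>] bij_betw_apply[OF bij_betw_inv_into[OF \<beta>]]
        by (auto simp: b_def)
  have b': "b' x \<in> nodes ?H" "\<beta>' (b' x) = x" if "x < v'" for x
    using \<beta>' that bij_betw_inv_into_right[OF \<beta>'] bij_betw_apply[OF bij_betw_inv_into[OF \<beta>']]
        by (auto simp: b'_def)
  have b\<beta>: "b (\<beta> x) = x" if "x \<in> nodes ?G" for x using bij_betw_inv_into_left[OF \<beta> that]
      by (simp add: b_def)
  have b\<beta>': "b' (\<beta>' x) = x" if "x \<in> nodes ?H" for x using bij_betw_inv_into_left[OF \<beta>' that]
      by (simp add: b'_def)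
  note lt = enumeration_less[OF e] and lt' = enumeration_less[OF e']
  \<comment> \<open>The renumbering: from wires back to nodes of \<open>c\<close>, along the
    isomorphism, and through the enumeration of \<open>d\<close>.\<close>
  define h where "h x = \<beta>' (fst u (b x))" for x
  define h' where "h' x = \<beta> (fst w (b' x))" for x
  have h: "maps v v' h" "maps v' v h'" "\<And>x. x < v \<Longrightarrow> h' (h x) = x" "\<And>x. x < v' \<Longrightarrow> h (h' x) = x"
    using b b' u w lt lt' wu uw' by (simp_all add: maps_def h_def h'_def b\<beta> b\<beta>')
  have h\<beta>: "h (\<beta> x) = \<beta>' (fst u x)" if "x \<in> nodes ?G" for x using that by (simp add: h_def b\<beta>)
  have edge: "edge_of ?H \<beta>' (snd u x) = edge_map h (edge_of ?G \<beta> x)" if x: "x \<in> hedges ?G" for x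
  proof -
    have "set (sources ?G x) \<subseteq> nodes ?G" "set (targets ?G x) \<subseteq> nodes ?G"
      using o x by (auto simp: hypergraph_over_def)
    then show ?thesis using uw(1) x h\<beta> by (auto simp: hyp_hom_def edge_of_def subset_eq)
  qed
  have hs: "set hs = hedges ?G" "distinct hs" "set hs' = hedges ?H" "distinct hs'"
    using e e' by (auto simp: enumeration_def)
  have "mset hs' = mset (map (snd u) hs)"
    using hs bij by (intro set_eq_iff_mset_eq_distinct[THEN iffD1])
        (auto simp: distinct_map bij_betw_def)
  then have "mset (map (edge_of ?H \<beta>') hs') = mset (map (edge_of ?H \<beta>') (map (snd u) hs))"
    by (simp only: mset_map)
  also have "map (edge_of ?H \<beta>') (map (snd u) hs) = map (edge_map h) (map (edge_of ?G \<beta>) hs)"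
    using edge hs by auto
  finally have es: "mset (map (edge_of ?H \<beta>') hs') = mset (map (edge_map h) (map (edge_of ?G \<beta>) hs))" .
  have leg: "h (\<beta> (fst (in_leg c) x)) = \<beta>' (fst (in_leg d) x)" if "x < cdom c" for x
    unfolding l[symmetric] using cospan_legs(1)[OF c that] that
    by (subst cospan_legs(3)[OF c]) (simp add: hyp_seq_discrete h\<beta>)
  have leg': "h (\<beta> (fst (out_leg c) x)) = \<beta>' (fst (out_leg d) x)" if "x < ccod c" for x
    unfolding l[symmetric] using cospan_legs(2)[OF c that] that
    by (subst cospan_legs(4)[OF c]) (simp add: hyp_seq_discrete h\<beta>)
  have "val c \<beta> v hs = nf (cdom c) (ccod c) v' (\<lambda>x. h (\<beta> (fst (in_leg c) x))) (map (edge_of ?H \<beta>') hs')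
      (\<lambda>x. h (\<beta> (fst (out_leg c) x)))"
    unfolding val_def by (rule nf_iso[OF val_ok[OF c e] h es, symmetric])
  also have "\<dots> = val d \<beta>' v' hs'"
    unfolding val_def eq[symmetric] by (rule nf_cong) (use leg leg' in auto)
  finally show ?thesis .
qed

definition den :: "'g cospan \<Rightarrow> 'a" where
  "den c = (SOME a. \<exists>\<beta> v hs. enumeration (apex c) \<beta> v hs \<and> a = val c \<beta> v hs)"

text \<open>The instance of \<open>val_iso\<close> for the identity isomorphism compares any two
  enumerations of one cospan.\<close>

lemma den_eq:
  assumes c: "is_cospan \<Sigma> c" and e: "enumeration (apex c) \<beta> v hs"
  shows "den c = val c \<beta> v hs"
proof -
  have "\<exists>\<beta> v hs. enumeration (apex c) \<beta> v hs \<and> den c = val c \<beta> v hs"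
    unfolding den_def by (rule someI) (use e in blast)
  then obtain \<beta>' v' hs' where "enumeration (apex c) \<beta>' v' hs'" "den c = val c \<beta>' v' hs'" by blast
  then show ?thesis using val_iso[OF cospan_iso_refl[OF c] _ e] by simp
qed

lemma den_arr: "is_cospan \<Sigma> c \<Longrightarrow> den c \<in> arr P (cdom c) (ccod c)"
  using enumeration_exists[of \<Sigma> "apex c"] den_eq val_arr by (metis is_cospan_def)

lemma den_iso:
  assumes "cospan_iso \<Sigma> c d"
  shows "den c = den d"
proof -
  have cd: "is_cospan \<Sigma> c" "is_cospan \<Sigma> d" using assms by (auto simp: cospan_iso_def)
  obtain \<beta> v hs \<beta>' v' hs' where "enumeration (apex c) \<beta> v hs" "enumeration (apex d) \<beta>' v' hs'"
    using cd enumeration_exists unfolding is_cospan_def by metis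
  then show ?thesis using val_iso[OF assms] den_eq cd by metis
qed

text \<open>Existence of composites and their values come together: one pushout of finite ordinals
  serves as the node set of the glued hypergraph and as the Beck--Chevalley square of
  \<open>nf_seq\<close>.\<close>

lemma composite_ex:
  assumes a: "is_cospan \<Sigma> a" and b: "is_cospan \<Sigma> b" and m: "ccod a = cdom b"
  shows "\<exists>c. is_composite \<Sigma> a b c \<and> den c = den a \<Zsemi> den b"
proof -
  let ?G = "apex a" and ?H = "apex b" and ?m = "cdom b"
  have o: "hypergraph_over \<Sigma> ?G" "hypergraph_over \<Sigma> ?H" using a b by (simp_all add: is_cospan_def)
  obtain \<beta> v hs \<beta>' v' hs' where e: "enumeration ?G \<beta> v hs" and e': "enumeration ?H \<beta>' v' hs'"
    using o enumeration_exists by metis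
  note ok = val_ok[OF a e] and ok' = val_ok[OF b e']
  note la = cospan_legs[OF a] and lb = cospan_legs[OF b]
  \<comment> \<open>The legs are transported to the enumerations; \<open>costar_star_ex\<close> is
    used here for the pushout that it constructs.\<close>
  obtain w p q where po:
      "fun_pushout ?m v v' w (\<lambda>x. \<beta> (fst (out_leg a) x)) (\<lambda>x. \<beta>' (fst (in_leg b) x)) p q"
    using costar_star_ex[OF ok(2)[unfolded m] ok'(1)] by blast
  then have pq: "maps v w p" "maps v' w q"
      "\<And>j. j < ?m \<Longrightarrow> p (\<beta> (fst (out_leg a) j)) = q (\<beta>' (fst (in_leg b) j))"
    "\<And>z. z < w \<Longrightarrow> (\<exists>x < v. p x = z) \<or> (\<exists>y < v'. q y = z)"
    by (simp_all add: fun_pushout_def)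
  have \<beta>: "bij_betw \<beta> (nodes ?G) {..<v}" and \<beta>': "bij_betw \<beta>' (nodes ?H) {..<v'}"
    using e e' by (auto simp: enumeration_def)
  let ?p = "\<lambda>x. p (\<beta> x)" and ?q = "\<lambda>x. q (\<beta>' x)"
  let ?K = "glue ?G ?H w ?p ?q"
  let ?i = "(restrict ?p (nodes ?G), restrict (sum_encode \<circ> Inl) (hedges ?G))"
  let ?j = "(restrict ?q (nodes ?H), restrict (sum_encode \<circ> Inr) (hedges ?H))"
  have po': "is_pushout \<Sigma> (discrete ?m) ?G ?H (discrete_map ?m (fst (out_leg a)))
      (discrete_map ?m (fst (in_leg b))) ?K ?i ?j"
  proof (rule glue_pushout[OF o])
    show "?p x < w" if "x \<in> nodes ?G" for x using pq enumeration_less[OF e that] by (simp add: maps_def)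
    show "?q x < w" if "x \<in> nodes ?H" for x using pq enumeration_less[OF e' that] by (simp add: maps_def)
    show "(\<exists>x \<in> nodes ?G. ?p x = z) \<or> (\<exists>x \<in> nodes ?H. ?q x = z)" if z: "z < w" for z
    proof -
      have "\<exists>y \<in> nodes ?G. \<beta> y = x" if "x < v" for x using \<beta> that
          by (auto simp: bij_betw_def image_iff dest!: equalityD2)
      moreover have "\<exists>y \<in> nodes ?H. \<beta>' y = x" if "x < v'" for x using \<beta>' that
          by (auto simp: bij_betw_def image_iff dest!: equalityD2)
      ultimately show ?thesis using pq(4)[OF z] by metis
    qed
    fix f g :: "nat \<Rightarrow> nat" assume fg: "\<And>j. j < ?m \<Longrightarrow> f (fst (out_leg a) j) = g (fst (in_leg b) j)"
    have inv: "inv_into (nodes ?G) \<beta> (\<beta> x) = x" if "x \<in> nodes ?G" for x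
        using bij_betw_inv_into_left[OF \<beta> that] .
    have inv': "inv_into (nodes ?H) \<beta>' (\<beta>' x) = x" if "x \<in> nodes ?H" for x
        using bij_betw_inv_into_left[OF \<beta>' that] .
    obtain u where u: "\<And>x. x < v \<Longrightarrow> u (p x) = f (inv_into (nodes ?G) \<beta> x)"
        "\<And>x. x < v' \<Longrightarrow> u (q x) = g (inv_into (nodes ?H) \<beta>' x)"
      using fun_pushout_factor[OF po, of "\<lambda>x. f (inv_into (nodes ?G) \<beta> x)"
          "\<lambda>x. g (inv_into (nodes ?H) \<beta>' x)"]
        fg la(2) lb(1) inv inv' m by auto
    show "\<exists>u. (\<forall>x \<in> nodes ?G. u (?p x) = f x) \<and> (\<forall>y \<in> nodes ?H. u (?q y) = g y)"
      by (intro exI[of _ u]) (use u inv inv' enumeration_less[OF e] enumeration_less[OF e'] in auto)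
  qed (use la lb m pq in auto)
  define c where "c = \<lparr>cdom = cdom a, ccod = ccod b, apex = ?K, in_leg
      = hyp_seq (discrete (cdom a) :: 'g hypergraph) (in_leg a) ?i,
     out_leg = hyp_seq (discrete (ccod b) :: 'g hypergraph) (out_leg b) ?j\<rparr>"
  have sel: "cdom c = cdom a" "ccod c = ccod b" "apex c = ?K" by (simp_all add: c_def)
  have comp: "is_composite \<Sigma> a b c"
    using po' m la(4) lb(3) unfolding is_composite_def sel by (auto simp: c_def)
  then have c: "is_cospan \<Sigma> c" by (rule is_composite_cospan[OF a b])
  let ?hs = "map (sum_encode \<circ> Inl) hs @ map (sum_encode \<circ> Inr) hs'"
  have inj: "inj (sum_encode \<circ> Inl)" "inj (sum_encode \<circ> Inr)" by (auto simp: inj_on_def sum_encode_eq)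
  \<comment> \<open>The nodes of the glued hypergraph are already the numbers below
    \<open>w\<close>, so they enumerate themselves.\<close>
  have ec: "enumeration (apex c) (\<lambda>x. x) w ?hs"
    using e e' inj unfolding enumeration_def sel
    by (auto simp: glue_def bij_betw_def distinct_map sum_encode_eq intro: inj_on_subset)
  have i: "fst (in_leg c) x = p (\<beta> (fst (in_leg a) x))" if "x < cdom a" for x
    using la(1)[OF that] that by (simp add: c_def, subst la(3)) (simp add: hyp_seq_discrete)
  have j: "fst (out_leg c) x = q (\<beta>' (fst (out_leg b) x))" if "x < ccod b" for x
    using lb(2)[OF that] that by (simp add: c_def, subst lb(4)) (simp add: hyp_seq_discrete)
  have es: "map (edge_of (apex c) (\<lambda>x. x)) ?hs
      = map (edge_map p) (map (edge_of ?G \<beta>) hs) @ map (edge_map q) (map (edge_of ?H \<beta>') hs')"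
    by (simp add: sel edge_of_def glue_def)
  have "den c = val c (\<lambda>x. x) w ?hs" by (rule den_eq[OF c ec])
  also have "\<dots> = nf (cdom a) (ccod b) w (\<lambda>x. p (\<beta> (fst (in_leg a) x)))
      (map (edge_map p) (map (edge_of ?G \<beta>) hs) @ map (edge_map q) (map (edge_of ?H \<beta>') hs'))
          (\<lambda>x. q (\<beta>' (fst (out_leg b) x)))"
    unfolding val_def es unfolding sel by (rule nf_cong) (use i j in auto)
  also have "\<dots> = val a \<beta> v hs \<Zsemi> val b \<beta>' v' hs'"
    unfolding val_def m by (rule nf_seq[symmetric]) (use ok ok' po m in auto)
  also have "\<dots> = den a \<Zsemi> den b" using den_eq[OF a e] den_eq[OF b e'] by simp
  finally show ?thesis using comp by blast
qed

text \<open>Composites are unique up to isomorphism, which \<open>den\<close> does not see, so the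
  composite built in \<open>composite_ex\<close> speaks for all.\<close>

lemma den_composite:
  assumes a: "is_cospan \<Sigma> a" and b: "is_cospan \<Sigma> b" and c: "is_composite \<Sigma> a b c"
  shows "den c = den a \<Zsemi> den b"
proof -
  have "ccod a = cdom b" using c by (simp add: is_composite_def)
  from composite_ex[OF a b this] obtain d where d: "is_composite \<Sigma> a b d" "den d = den a \<Zsemi> den b"
      by blast
  then show ?thesis using den_iso[OF composite_unique[OF a b c d(1)]] by simp
qed

lemma den_union:
  assumes a: "is_cospan \<Sigma> a" and b: "is_cospan \<Sigma> b"
  shows "den (cospan_union a b) = den a \<oplus> den b"
proof -
  let ?G = "apex a" and ?H = "apex b" and ?c = "cospan_union a b"
  have o: "hypergraph_over \<Sigma> ?G" "hypergraph_over \<Sigma> ?H" using a b by (simp_all add: is_cospan_def)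
  obtain \<beta> v hs \<beta>' v' hs' where e: "enumeration ?G \<beta> v hs" and e': "enumeration ?H \<beta>' v' hs'"
    using o enumeration_exists by metis
  note ok = val_ok[OF a e] and ok' = val_ok[OF b e']
  let ?\<beta> = "\<lambda>x. case sum_decode x of Inl y \<Rightarrow> \<beta> y | Inr y \<Rightarrow> v + \<beta>' y"
  let ?hs = "map (sum_encode \<circ> Inl) hs @ map (sum_encode \<circ> Inr) hs'"
  have inj: "inj (sum_encode \<circ> Inl)" "inj (sum_encode \<circ> Inr)" by (auto simp: inj_on_def sum_encode_eq)
  have bij: "bij_betw ?\<beta> (nodes (apex ?c)) {..<v + v'}"
    using bij_betw_sum_encode[of \<beta> "nodes ?G" v \<beta>' "nodes ?H" v'] e e'
    by (simp add: enumeration_def cospan_union_def hyp_union_def)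
  have ec: "enumeration (apex ?c) ?\<beta> (v + v') ?hs"
    using e e' inj bij unfolding enumeration_def
    by (auto simp: cospan_union_def hyp_union_def distinct_map sum_encode_eq intro: inj_on_subset)
  have es: "map (edge_of (apex ?c) ?\<beta>) ?hs
      = map (edge_of ?G \<beta>) hs @ map (edge_map ((+) v)) (map (edge_of ?H \<beta>') hs')"
    by (simp add: edge_of_def cospan_union_def hyp_union_def comp_def)
  have "den ?c = val ?c ?\<beta> (v + v') ?hs" by (rule den_eq[OF is_cospan_union[OF a b] ec])
  also have "\<dots> = nf (cdom a + cdom b) (ccod a + ccod b) (v + v')
      (par_fun (cdom a) v (\<lambda>x. \<beta> (fst (in_leg a) x)) (\<lambda>x. \<beta>' (fst (in_leg b) x)))
      (map (edge_of ?G \<beta>) hs @ map (edge_map ((+) v)) (map (edge_of ?H \<beta>') hs'))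
      (par_fun (ccod a) v (\<lambda>x. \<beta> (fst (out_leg a) x)) (\<lambda>x. \<beta>' (fst (out_leg b) x)))"
    unfolding val_def es by (simp add: cospan_union_def, rule nf_cong) (simp_all add: par_fun_def)
  also have "\<dots> = val a \<beta> v hs \<oplus> val b \<beta>' v' hs'"
    unfolding val_def by (rule nf_par[symmetric]) (use ok ok' in auto)
  also have "\<dots> = den a \<oplus> den b" using den_eq[OF a e] den_eq[OF b e'] by simp
  finally show ?thesis .
qed

lemma enumeration_discrete: "enumeration (discrete n) (\<lambda>x. x) n []"
  by (simp add: enumeration_def bij_betw_def)

lemma den_discrete:
  assumes c: "c = \<lparr>cdom = n, ccod = m, apex = discrete v, in_leg = discrete_map n i, out_leg
      = discrete_map m j\<rparr>"
    and ij: "maps n v i" "maps m v j"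
  shows "is_cospan \<Sigma> c" "den c = nf n m v i [] j"
proof -
  show 1: "is_cospan \<Sigma> c" using ij by (auto simp: c is_cospan_def hyp_hom_discrete maps_def)
  have "den c = val c (\<lambda>x. x) v []" by (rule den_eq[OF 1]) (simp add: c enumeration_discrete)
  also have "\<dots> = nf n m v i [] j" unfolding val_def by (simp add: c, rule nf_cong) simp_all
  finally show "den c = nf n m v i [] j" .
qed

lemma den_id: "is_cospan \<Sigma> (id_cospan n)" "den (id_cospan n) = ident P n"
  using den_discrete[of "id_cospan n" n n n id id] nf_ident[of n]
      by (simp_all add: id_cospan_def maps_def id_def)

lemma den_swap: "is_cospan \<Sigma> (swap_cospan n m)" "den (swap_cospan n m) = braid P n m"
proof -
  have 1: "swap_cospan n m = \<lparr>cdom = n + m, ccod = m + n, apex = discrete (n + m),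
     in_leg = discrete_map (n + m) (\<lambda>x. x), out_leg = discrete_map (m + n) (swap_fun m n)\<rparr>"
    unfolding swap_cospan_def swap_fun_def[abs_def] by (simp add: id_def)
  have 2: "maps (m + n) (n + m) (swap_fun m n)" by (auto simp: maps_def swap_fun_def)
  show "is_cospan \<Sigma> (swap_cospan n m)" "den (swap_cospan n m) = braid P n m"
    using den_discrete[OF 1 maps_id 2] nf_braid by simp_all
qed

definition gen_cospan :: "'g \<Rightarrow> 'g cospan" where
  "gen_cospan g = (let k = arity \<Sigma> g; l = coarity \<Sigma> g in
     \<lparr>cdom = k, ccod = l, apex = \<lparr>nodes = {..<k + l}, hedges = {0}, sources = (\<lambda>_. [0..<k]),
        targets = (\<lambda>_. [k..<k + l]), label = (\<lambda>_. g)\<rparr>,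
      in_leg = discrete_map k (\<lambda>x. x), out_leg = discrete_map l (\<lambda>x. k + x)\<rparr>)"

lemma den_gen:
  assumes g: "g \<in> gens \<Sigma>"
  shows "is_cospan \<Sigma> (gen_cospan g)" "den (gen_cospan g) = \<gamma> g"
proof -
  let ?k = "arity \<Sigma> g" and ?l = "coarity \<Sigma> g"
  show 1: "is_cospan \<Sigma> (gen_cospan g)"
    using g by (auto simp: gen_cospan_def Let_def is_cospan_def hyp_hom_discrete hypergraph_over_def)
  have "den (gen_cospan g) = val (gen_cospan g) (\<lambda>x. x) (?k + ?l) [0]"
    by (rule den_eq[OF 1]) (simp add: enumeration_def gen_cospan_def Let_def bij_betw_def)
  also have "\<dots> = nf ?k ?l (?k + ?l) (\<lambda>x. x) [([0..<?k], \<gamma> g, [?k..<?k + ?l])] (\<lambda>x. ?k + x)"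
    unfolding val_def by (simp add: gen_cospan_def Let_def edge_of_def, rule nf_cong) simp_all
  also have "\<dots> = \<gamma> g" using nf_gen \<gamma>[OF g] by (simp add: arr_iff)
  finally show "den (gen_cospan g) = \<gamma> g" .
qed

end

section \<open>The PROP of matrices\<close>

type_synonym mat = "nat \<times> nat \<times> (nat list \<Rightarrow> nat list \<Rightarrow> nat)"

definition words :: "nat set \<Rightarrow> nat \<Rightarrow> nat list set" where
  "words D n = {a. set a \<subseteq> D \<and> length a = n}"

text \<open>The dimensions are stored so that hom-sets are disjoint, and entries vanish off the
  index sets so that equality of matrices is equality in HOL.\<close>

definition mk_mat :: "nat set \<Rightarrow> nat \<Rightarrow> nat \<Rightarrow> (nat list \<Rightarrow> nat list \<Rightarrow> nat) \<Rightarrow> mat" where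
  "mk_mat D n m A = (n, m, \<lambda>a b. if a \<in> words D n \<and> b \<in> words D m then A a b else 0)"

abbreviation entry :: "mat \<Rightarrow> nat list \<Rightarrow> nat list \<Rightarrow> nat" where "entry x \<equiv> snd (snd x)"

text \<open>The object \<open>n\<close> is the \<open>n\<close>-th tensor power of the free module
  over the natural numbers with basis \<open>D\<close>; words of length \<open>n\<close> are its
  basis, \<open>par\<close> is the Kronecker product, and \<open>braid\<close> permutes tensor
  factors.\<close>

definition mat_prop :: "nat set \<Rightarrow> mat prop_struct" where
  "mat_prop D = \<lparr>
     arr = (\<lambda>n m. {x. fst x = n \<and> fst (snd x) = m \<and> (\<forall>a b. entry x a b \<noteq> 0 \<longrightarrow> a \<in> words D n \<and> b \<in> words D
         m)}),
     ident = (\<lambda>n. mk_mat D n n (\<lambda>a b. of_bool (a = b))),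
     seq = (\<lambda>x y. mk_mat D (fst x) (fst (snd y)) (\<lambda>a c. \<Sum>b \<in> words D (fst (snd x)). entry x a b * entry y
         b c)),
     par = (\<lambda>x y. mk_mat D (fst x + fst y) (fst (snd x) + fst (snd y))
       (\<lambda>a b. entry x (take (fst x) a) (take (fst (snd x)) b) * entry y (drop (fst x) a) (drop (fst (snd
           x)) b))),
     braid = (\<lambda>n m. mk_mat D (n + m) (m + n) (\<lambda>a b. of_bool (b = drop n a @ take n a)))\<rparr>"

lemma finite_words: "finite D \<Longrightarrow> finite (words D n)"
  unfolding words_def by (rule finite_lists_length_eq)

lemma words_append: "a @ b \<in> words D (n + m) \<longleftrightarrow> a \<in> words D n \<and> b \<in> words D m" if "length a = n"
  using that by (auto simp: words_def)

lemma words_splitE: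
  assumes "a \<in> words D (n + m)"
  obtains a1 a2 where "a = a1 @ a2" "a1 \<in> words D n" "a2 \<in> words D m"
  using assms that[of "take n a" "drop n a"] by (auto simp: words_def dest: in_set_takeD in_set_dropD)

lemma sum_words_append:
  "(\<Sum>b \<in> words D (n + m). f b) = (\<Sum>b1 \<in> words D n. \<Sum>b2 \<in> words D m. f (b1 @ b2))"
proof -
  have "(\<Sum>b1 \<in> words D n. \<Sum>b2 \<in> words D m. f (b1 @ b2))
      = (\<Sum>(b1, b2) \<in> words D n \<times> words D m. f (b1 @ b2))"
    by (simp add: sum.cartesian_product)
  also have "\<dots> = (\<Sum>b \<in> words D (n + m). f b)"
    by (rule sum.reindex_bij_witness[where i = "\<lambda>b. (take n b, drop n b)" and j = "\<lambda>(b1, b2). b1 @ b2"])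
      (auto simp: words_def dest: in_set_takeD in_set_dropD)
  finally show ?thesis ..
qed

lemma sum_words_eq:
  assumes "finite D" "b0 \<in> words D n"
  shows "(\<Sum>b \<in> words D n. of_bool (b = b0) * f b) = (f b0 :: nat)"
      "(\<Sum>b \<in> words D n. f b * of_bool (b = b0)) = (f b0 :: nat)"
    "(\<Sum>b \<in> words D n. of_bool (b0 = b) * f b) = (f b0 :: nat)"
        "(\<Sum>b \<in> words D n. f b * of_bool (b0 = b)) = (f b0 :: nat)"
  using assms finite_words[of D n] sum.delta[of "words D n" b0 f] sum.delta'[of "words D n" b0 f]
  by (simp_all add: of_bool_def if_distrib[of "\<lambda>x. x * _"] if_distrib[of "\<lambda>x. _ * x"] cong: if_cong)

lemma ent_mk [simp]: "a \<in> words D n \<Longrightarrow> b \<in> words D m \<Longrightarrow> entry (mk_mat D n m A) a b = A a b"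
  by (simp add: mk_mat_def)

lemma mk_arr [simp]: "mk_mat D n m A \<in> arr (mat_prop D) n' m' \<longleftrightarrow> n = n' \<and> m = m'"
  by (auto simp: mk_mat_def mat_prop_def)

lemma mat_ext:
  assumes "x \<in> arr (mat_prop D) n m" "y \<in> arr (mat_prop D) n m"
    and "\<And>a b. a \<in> words D n \<Longrightarrow> b \<in> words D m \<Longrightarrow> entry x a b = entry y a b"
  shows "x = y"
proof -
  have 0: "entry z a b = 0" if "z \<in> arr (mat_prop D) n m" "\<not> (a \<in> words D n \<and> b \<in> words D m)" for z a b
    using that by (auto simp: mat_prop_def)
  have "entry x a b = entry y a b" for a b
    using assms(3) 0[OF assms(1)] 0[OF assms(2)] by (cases "a \<in> words D n \<and> b \<in> words D m") auto
  then have "entry x = entry y" by blast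
  moreover have "fst x = fst y" "fst (snd x) = fst (snd y)" using assms(1,2) by (auto simp: mat_prop_def)
  ultimately show ?thesis by (simp add: prod_eq_iff)
qed

lemma mat_dim: "x \<in> arr (mat_prop D) n m \<Longrightarrow> fst x = n \<and> fst (snd x) = m"
  by (auto simp: mat_prop_def)

lemma mat_seq_arr: "x \<in> arr (mat_prop D) n m \<Longrightarrow> y \<in> arr (mat_prop D) m k
    \<Longrightarrow> x \<Zsemi>\<^bsub>mat_prop D\<^esub> y \<in> arr (mat_prop D) n k"
  by (simp add: mat_prop_def mk_mat_def)

lemma mat_par_arr:
  "x \<in> arr (mat_prop D) n m \<Longrightarrow> y \<in> arr (mat_prop D) n' m'
      \<Longrightarrow> x \<oplus>\<^bsub>mat_prop D\<^esub> y \<in> arr (mat_prop D) (n + n') (m + m')"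
  by (simp add: mat_prop_def mk_mat_def)

lemma mat_ident_arr: "ident (mat_prop D) n \<in> arr (mat_prop D) n n"
  and mat_braid_arr: "braid (mat_prop D) n m \<in> arr (mat_prop D) (n + m) (m + n)"
  by (simp_all add: mat_prop_def mk_mat_def)

lemma ent_seq:
  assumes "x \<in> arr (mat_prop D) n m" "y \<in> arr (mat_prop D) m k" "a \<in> words D n" "c \<in> words D k"
  shows "entry (x \<Zsemi>\<^bsub>mat_prop D\<^esub> y) a c = (\<Sum>b \<in> words D m. entry x a b * entry y b c)"
  using assms(3,4) mat_dim[OF assms(1)] mat_dim[OF assms(2)] by (simp add: mat_prop_def)

lemma ent_par:
  assumes "x \<in> arr (mat_prop D) n m" "y \<in> arr (mat_prop D) n' m'"
    "a \<in> words D n" "b \<in> words D m" "a' \<in> words D n'" "b' \<in> words D m'"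
  shows "entry (x \<oplus>\<^bsub>mat_prop D\<^esub> y) (a @ a') (b @ b') = entry x a b * entry y a' b'"
proof -
  have "length a = n" "length b = m" using assms by (auto simp: words_def)
  then show ?thesis
    using assms(3-) mat_dim[OF assms(1)] mat_dim[OF assms(2)] by (simp add: mat_prop_def words_append)
qed

lemma ent_ident: "a \<in> words D n \<Longrightarrow> b \<in> words D n \<Longrightarrow> entry (ident (mat_prop D) n) a b = of_bool (a = b)"
  by (simp add: mat_prop_def)

lemma ent_braid:
  assumes "a \<in> words D n" "b \<in> words D m" "a' \<in> words D n" "b' \<in> words D m"
  shows "entry (braid (mat_prop D) n m) (a @ b) (b' @ a') = of_bool (a = a') * of_bool (b = b')"
proof -
  have "length a = n" "length b = m" "length a' = n" "length b' = m" using assms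
      by (auto simp: words_def)
  then show ?thesis using assms by (auto simp: mat_prop_def words_append)
qed

lemma words_0 [simp]: "words D 0 = {[]}" by (auto simp: words_def)

lemma ent_ident_par:
  assumes "x \<in> arr (mat_prop D) n m" "a \<in> words D n" "b \<in> words D m"
  shows "entry (ident (mat_prop D) 0 \<oplus>\<^bsub>mat_prop D\<^esub> x) a b = entry x a b"
    "entry (x \<oplus>\<^bsub>mat_prop D\<^esub> ident (mat_prop D) 0) a b = entry x a b"
  using ent_par[OF mat_ident_arr assms(1), of "[]" 0 "[]" a b]
      ent_par[OF assms(1) mat_ident_arr, of a b "[]" 0 "[]"] assms
  by (simp_all add: ent_ident)

text \<open>Each law is checked entrywise after splitting the index words into blocks. Composition
  sums over words, and the sum over an infinite set is 0 by convention, so finiteness of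
  \<open>D\<close> is what makes the identity laws hold.\<close>

lemma is_prop_mat:
  assumes D: "finite D"
  shows "is_prop (mat_prop D)"
proof
  let ?M = "mat_prop D"
  note I = mat_ident_arr mat_seq_arr mat_par_arr mat_braid_arr
  fix n m n' m' k l n'' m'' k' f g h f' g'
  note eq = sum_words_eq[OF D]
  show "f \<in> arr ?M n m \<Longrightarrow> f \<in> arr ?M n' m' \<Longrightarrow> n = n' \<and> m = m'" by (auto simp: mat_prop_def)
  show "ident ?M n \<in> arr ?M n n" "braid ?M n m \<in> arr ?M (n + m) (m + n)" by (rule I)+
  show "f \<in> arr ?M n m \<Longrightarrow> g \<in> arr ?M m k \<Longrightarrow> f \<Zsemi>\<^bsub>?M\<^esub> g \<in> arr ?M n k" by (rule I)
  show "f \<in> arr ?M n m \<Longrightarrow> g \<in> arr ?M n' m' \<Longrightarrow> f \<oplus>\<^bsub>?M\<^esub> g \<in> arr ?M (n + n') (m + m')" by (rule I)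
  show "(f \<Zsemi>\<^bsub>?M\<^esub> g) \<Zsemi>\<^bsub>?M\<^esub> h = f \<Zsemi>\<^bsub>?M\<^esub> (g \<Zsemi>\<^bsub>?M\<^esub> h)"
    if t: "f \<in> arr ?M n m" "g \<in> arr ?M m k" "h \<in> arr ?M k l"
  proof (rule mat_ext)
    fix a d assume ad: "a \<in> words D n" "d \<in> words D l"
    have "entry ((f \<Zsemi>\<^bsub>?M\<^esub> g) \<Zsemi>\<^bsub>?M\<^esub> h) a d
        = (\<Sum>c \<in> words D k. \<Sum>b \<in> words D m. entry f a b * entry g b c * entry h c d)"
      using ent_seq[OF I(2)[OF t(1,2)] t(3) ad] ent_seq[OF t(1,2) ad(1)] by (simp add: sum_distrib_right)
    moreover have "entry (f \<Zsemi>\<^bsub>?M\<^esub> (g \<Zsemi>\<^bsub>?M\<^esub> h)) a d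
        = (\<Sum>b \<in> words D m. \<Sum>c \<in> words D k. entry f a b * entry g b c * entry h c d)"
      using ent_seq[OF t(1) I(2)[OF t(2,3)] ad] ent_seq[OF t(2,3) _ ad(2)]
          by (simp add: sum_distrib_left mult.assoc)
    ultimately show "entry ((f \<Zsemi>\<^bsub>?M\<^esub> g) \<Zsemi>\<^bsub>?M\<^esub> h) a d = entry (f \<Zsemi>\<^bsub>?M\<^esub> (g \<Zsemi>\<^bsub>?M\<^esub> h)) a d"
      by (simp add: sum.swap[of _ "words D k"])
  qed (use I(2)[OF I(2)[OF t(1,2)] t(3)] I(2)[OF t(1) I(2)[OF t(2,3)]] in simp_all)
  show "ident ?M n \<Zsemi>\<^bsub>?M\<^esub> f = f" if t: "f \<in> arr ?M n m"
    by (rule mat_ext[OF I(2)[OF I(1) t] t]) (simp add: ent_seq[OF I(1) t] ent_ident eq)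
  show "f \<Zsemi>\<^bsub>?M\<^esub> ident ?M m = f" if t: "f \<in> arr ?M n m"
    by (rule mat_ext[OF I(2)[OF t I(1)] t]) (simp add: ent_seq[OF t I(1)] ent_ident eq)
  show "(f \<oplus>\<^bsub>?M\<^esub> g) \<oplus>\<^bsub>?M\<^esub> h = f \<oplus>\<^bsub>?M\<^esub> (g \<oplus>\<^bsub>?M\<^esub> h)"
    if t: "f \<in> arr ?M n m" "g \<in> arr ?M n' m'" "h \<in> arr ?M n'' m''"
  proof (rule mat_ext[of _ _ "n + n' + n''" "m + m' + m''"])
    fix a b assume "a \<in> words D (n + n' + n'')" "b \<in> words D (m + m' + m'')"
    then obtain a1 a2 a3 b1 b2 b3 where "a = (a1 @ a2) @ a3" "b = (b1 @ b2) @ b3" and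
      w: "a1 \<in> words D n" "a2 \<in> words D n'" "a3 \<in> words D n''" "b1 \<in> words D m" "b2 \<in> words D m'"
          "b3 \<in> words D m''"
      by (metis words_splitE)
    moreover have "a1 @ a2 \<in> words D (n + n')" "a2 @ a3 \<in> words D (n' + n'')"
        "b1 @ b2 \<in> words D (m + m')" "b2 @ b3 \<in> words D (m' + m'')"
      using w by (auto simp: words_def)
    ultimately show "entry ((f \<oplus>\<^bsub>?M\<^esub> g) \<oplus>\<^bsub>?M\<^esub> h) a b = entry (f \<oplus>\<^bsub>?M\<^esub> (g \<oplus>\<^bsub>?M\<^esub> h)) a b"
      using ent_par[OF I(3)[OF t(1,2)] t(3), of "a1 @ a2" "b1 @ b2" a3 b3]
        ent_par[OF t(1) I(3)[OF t(2,3)], of a1 b1 "a2 @ a3" "b2 @ b3"]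
      by (simp add: ent_par[OF t(1,2)] ent_par[OF t(2,3)])
  qed (use I(3)[OF I(3)[OF t(1,2)] t(3)] I(3)[OF t(1) I(3)[OF t(2,3)]] in \<open>simp_all add: add.assoc\<close>)
  show "ident ?M 0 \<oplus>\<^bsub>?M\<^esub> f = f" "f \<oplus>\<^bsub>?M\<^esub> ident ?M 0 = f" if t: "f \<in> arr ?M n m"
    using I(3)[OF I(1)[of D 0] t] I(3)[OF t I(1)[of D 0]] t ent_ident_par[OF t] by (auto intro!: mat_ext)
  show "(f \<oplus>\<^bsub>?M\<^esub> g) \<Zsemi>\<^bsub>?M\<^esub> (f' \<oplus>\<^bsub>?M\<^esub> g') = (f \<Zsemi>\<^bsub>?M\<^esub> f') \<oplus>\<^bsub>?M\<^esub> (g \<Zsemi>\<^bsub>?M\<^esub> g')"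
    if t: "f \<in> arr ?M n m" "f' \<in> arr ?M m k" "g \<in> arr ?M n' m'" "g' \<in> arr ?M m' k'"
  proof (rule mat_ext[of _ _ "n + n'" "k + k'"])
    fix a b assume "a \<in> words D (n + n')" "b \<in> words D (k + k')"
    then obtain a1 a2 b1 b2 where ab: "a = a1 @ a2" "b = b1 @ b2" and
      w: "a1 \<in> words D n" "a2 \<in> words D n'" "b1 \<in> words D k" "b2 \<in> words D k'"
      by (metis words_splitE)
    have ab': "a \<in> words D (n + n')" "b \<in> words D (k + k')" by fact+
    have "entry ((f \<oplus>\<^bsub>?M\<^esub> g) \<Zsemi>\<^bsub>?M\<^esub> (f' \<oplus>\<^bsub>?M\<^esub> g')) a b =
       (\<Sum>c1 \<in> words D m. \<Sum>c2 \<in> words D m'. entry f a1 c1 * entry g a2 c2 * (entry f' c1 b1 * entry g' c2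
           b2))"
      unfolding ent_seq[OF I(3)[OF t(1,3)] I(3)[OF t(2,4)] ab'] sum_words_append unfolding ab
      by (intro sum.cong) (simp_all add: ent_par[OF t(1,3)] ent_par[OF t(2,4)] w)
    also have "\<dots> = (\<Sum>c1 \<in> words D m. entry f a1 c1 * entry f' c1 b1) * (\<Sum>c2 \<in> words D m'. entry g a2 c2 *
        entry g' c2 b2)"
      unfolding sum_product by (intro sum.cong) simp_all
    also have "\<dots> = entry ((f \<Zsemi>\<^bsub>?M\<^esub> f') \<oplus>\<^bsub>?M\<^esub> (g \<Zsemi>\<^bsub>?M\<^esub> g')) a b"
      unfolding ab ent_par[OF I(2)[OF t(1,2)] I(2)[OF t(3,4)] w(1,3,2,4)]
      by (simp add: ent_seq[OF t(1,2)] ent_seq[OF t(3,4)] w)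
    finally show "entry ((f \<oplus>\<^bsub>?M\<^esub> g) \<Zsemi>\<^bsub>?M\<^esub> (f' \<oplus>\<^bsub>?M\<^esub> g')) a b = entry ((f \<Zsemi>\<^bsub>?M\<^esub> f') \<oplus>\<^bsub>?M\<^esub> (g \<Zsemi>\<^bsub>?M\<^esub> g')) a b" .
  qed (use I(2)[OF I(3)[OF t(1,3)] I(3)[OF t(2,4)]] I(3)[OF I(2)[OF t(1,2)] I(2)[OF t(3,4)]] in simp_all)
  show "ident ?M n \<oplus>\<^bsub>?M\<^esub> ident ?M m = ident ?M (n + m)"
  proof (rule mat_ext[of _ _ "n + m" "n + m"])
    fix a b assume ab': "a \<in> words D (n + m)" "b \<in> words D (n + m)"
    then obtain a1 a2 b1 b2 where ab: "a = a1 @ a2" "b = b1 @ b2" and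
      w: "a1 \<in> words D n" "a2 \<in> words D m" "b1 \<in> words D n" "b2 \<in> words D m"
      by (metis words_splitE)
    have "length a1 = n" "length b1 = n" using w by (auto simp: words_def)
    then show "entry (ident ?M n \<oplus>\<^bsub>?M\<^esub> ident ?M m) a b = entry (ident ?M (n + m)) a b"
      unfolding ent_ident[OF ab'] unfolding ab using w by (simp add: ent_par[OF I(1) I(1)] ent_ident)
  qed (use I(3)[OF I(1)[of D n] I(1)[of D m]] I(1)[of D "n + m"] in simp_all)
  show "(f \<oplus>\<^bsub>?M\<^esub> g) \<Zsemi>\<^bsub>?M\<^esub> braid ?M m m' = braid ?M n n' \<Zsemi>\<^bsub>?M\<^esub> (g \<oplus>\<^bsub>?M\<^esub> f)"
    if t: "f \<in> arr ?M n m" "g \<in> arr ?M n' m'"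
  proof (rule mat_ext[of _ _ "n + n'" "m' + m"])
    fix a b assume ab': "a \<in> words D (n + n')" "b \<in> words D (m' + m)"
    then obtain a1 a2 b1 b2 where ab: "a = a1 @ a2" "b = b2 @ b1" and
      w: "a1 \<in> words D n" "a2 \<in> words D n'" "b1 \<in> words D m" "b2 \<in> words D m'"
      by (metis words_splitE)
    have "entry ((f \<oplus>\<^bsub>?M\<^esub> g) \<Zsemi>\<^bsub>?M\<^esub> braid ?M m m') a b =
       (\<Sum>c1 \<in> words D m. \<Sum>c2 \<in> words D m'. entry f a1 c1 * of_bool (c1 = b1) * (entry g a2 c2 * of_bool
           (c2 = b2)))"
      unfolding ent_seq[OF I(3)[OF t] I(4) ab'] sum_words_append unfolding ab
      by (intro sum.cong) (simp_all add: ent_par[OF t] ent_braid w)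
    also have "\<dots> = entry f a1 b1 * entry g a2 b2"
      unfolding sum_product[symmetric] by (simp add: eq w)
    moreover have "entry (braid ?M n n' \<Zsemi>\<^bsub>?M\<^esub> (g \<oplus>\<^bsub>?M\<^esub> f)) a b =
       (\<Sum>c1 \<in> words D n'. \<Sum>c2 \<in> words D n. of_bool (a2 = c1) * entry g c1 b2 * (of_bool (a1 = c2) * entry
           f c2 b1))"
      unfolding ent_seq[OF I(4) I(3)[OF t(2,1)] ab'] sum_words_append unfolding ab
      by (intro sum.cong) (simp_all add: ent_par[OF t(2,1)] ent_braid w)
    moreover have "\<dots> = entry g a2 b2 * entry f a1 b1"
      unfolding sum_product[symmetric] by (simp add: eq w)
    ultimately show "entry ((f \<oplus>\<^bsub>?M\<^esub> g) \<Zsemi>\<^bsub>?M\<^esub> braid ?M m m') a b = entry (braid ?M n n' \<Zsemi>\<^bsub>?M\<^esub> (g \<oplus>\<^bsub>?M\<^esub> f)) a b"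
        by simp
  qed (use I(2)[OF I(3)[OF t] I(4)] I(2)[OF I(4) I(3)[OF t(2,1)]] in simp_all)
  show "braid ?M n m \<Zsemi>\<^bsub>?M\<^esub> braid ?M m n = ident ?M (n + m)"
  proof (rule mat_ext[of _ _ "n + m" "n + m"])
    fix a b assume ab': "a \<in> words D (n + m)" "b \<in> words D (n + m)"
    then obtain a1 a2 b1 b2 where ab: "a = a1 @ a2" "b = b1 @ b2" and
      w: "a1 \<in> words D n" "a2 \<in> words D m" "b1 \<in> words D n" "b2 \<in> words D m"
      by (metis words_splitE)
    have l: "length a1 = n" "length b1 = n" using w by (auto simp: words_def)
    have "entry (braid ?M n m \<Zsemi>\<^bsub>?M\<^esub> braid ?M m n) a b =
       (\<Sum>c1 \<in> words D m. \<Sum>c2 \<in> words D n. of_bool (a2 = c1) * of_bool (c1 = b2) * (of_bool (a1 = c2) *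
           of_bool (c2 = b1)))"
      unfolding ent_seq[OF I(4) I(4) ab'] sum_words_append unfolding ab
      by (intro sum.cong) (simp_all add: ent_braid w)
    also have "\<dots> = of_bool (a2 = b2) * of_bool (a1 = b1)"
      unfolding sum_product[symmetric] by (simp only: eq w)
    finally show "entry (braid ?M n m \<Zsemi>\<^bsub>?M\<^esub> braid ?M m n) a b = entry (ident ?M (n + m)) a b"
      unfolding ent_ident[OF ab'] unfolding ab using l by auto
  qed (use I(2)[OF I(4)[of D n m] I(4)[of D m n]] I(1)[of D "n + m"] in simp_all)
  show "braid ?M n (m + k) = (braid ?M n m \<oplus>\<^bsub>?M\<^esub> ident ?M k) \<Zsemi>\<^bsub>?M\<^esub> (ident ?M m \<oplus>\<^bsub>?M\<^esub> braid ?M n k)"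
  proof -
    have t: "braid ?M n m \<oplus>\<^bsub>?M\<^esub> ident ?M k \<in> arr ?M (n + (m + k)) (m + (n + k))"
      "ident ?M m \<oplus>\<^bsub>?M\<^esub> braid ?M n k \<in> arr ?M (m + (n + k)) (m + k + n)"
      using I(3)[OF I(4)[of D n m] I(1)[of D k]] I(3)[OF I(1)[of D m] I(4)[of D n k]]
          by (simp_all add: ac_simps)
    show ?thesis
    proof (rule mat_ext[OF I(4) I(2)[OF t]])
      fix a b assume ab': "a \<in> words D (n + (m + k))" "b \<in> words D (m + k + n)"
      then obtain a1 a2 a3 b1 b2 b3 where ab: "a = a1 @ a2 @ a3" "b = (b2 @ b3) @ b1" and
        w: "a1 \<in> words D n" "a2 \<in> words D m" "a3 \<in> words D k" "b1 \<in> words D n" "b2 \<in> words D m"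
            "b3 \<in> words D k"
        by (metis words_splitE)
      have l: "length a2 = length b2" using w by (auto simp: words_def)
      have x: "c1 @ c2 \<in> words D (p + q)" if "c1 \<in> words D p" "c2 \<in> words D q" for c1 c2 p q
        using that by (auto simp: words_def)
      have e1: "entry (braid ?M n m \<oplus>\<^bsub>?M\<^esub> ident ?M k) a (c1 @ c2 @ c3) = of_bool (a1 = c2) * of_bool (a2
          = c1) * of_bool (a3 = c3)"
        if "c1 \<in> words D m" "c2 \<in> words D n" "c3 \<in> words D k" for c1 c2 c3
        using ent_par[OF I(4)[of D n m] I(1)[of D k] x[OF w(1,2)] x[OF that(1,2)] w(3) that(3)] that w
        by (simp add: ab ent_braid ent_ident)
      have e2: "entry (ident ?M m \<oplus>\<^bsub>?M\<^esub> braid ?M n k) (c1 @ c2 @ c3) b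
          = of_bool (c1 = b2) * (of_bool (c2 = b1) * of_bool (c3 = b3))"
        if "c1 \<in> words D m" "c2 \<in> words D n" "c3 \<in> words D k" for c1 c2 c3
        using ent_par[OF I(1)[of D m] I(4)[of D n k] that(1) w(5) x[OF that(2,3)] x[OF w(6,4)]] that w
        by (simp add: ab ent_braid ent_ident)
      have "entry ((braid ?M n m \<oplus>\<^bsub>?M\<^esub> ident ?M k) \<Zsemi>\<^bsub>?M\<^esub> (ident ?M m \<oplus>\<^bsub>?M\<^esub> braid ?M n k)) a b
        = (\<Sum>c1 \<in> words D m. \<Sum>c2 \<in> words D n. \<Sum>c3 \<in> words D k.
            (of_bool (a2 = c1) * of_bool (c1 = b2)) *
                ((of_bool (a1 = c2) * of_bool (c2 = b1)) * (of_bool (a3 = c3) * of_bool (c3 = b3))))"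
        unfolding ent_seq[OF t ab'] sum_words_append
        by (intro sum.cong) (simp_all only: e1 e2 ac_simps)
      also have "\<dots> = of_bool (a2 = b2) * (of_bool (a1 = b1) * of_bool (a3 = b3))"
        unfolding sum_product[symmetric] sum_distrib_left[symmetric] by (simp only: eq w mult.assoc)
      also have "\<dots> = entry (braid ?M n (m + k)) a b"
        unfolding ab ent_braid[OF w(1) x[OF w(2,3)] w(4) x[OF w(5,6)]] using l by auto
      finally show "entry (braid ?M n (m + k)) a b
        = entry ((braid ?M n m \<oplus>\<^bsub>?M\<^esub> ident ?M k) \<Zsemi>\<^bsub>?M\<^esub> (ident ?M m \<oplus>\<^bsub>?M\<^esub> braid ?M n k)) a b" ..
    qed
  qed
  show "braid ?M n 0 = ident ?M n"
  proof (rule mat_ext[of _ _ n n])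
    fix a b assume "a \<in> words D n" "b \<in> words D n"
    then show "entry (braid ?M n 0) a b = entry (ident ?M n) a b"
      using ent_braid[of a D n "[]" 0 b "[]"] by (simp add: ent_ident)
  qed (use I(4)[of D n 0] I(1)[of D n] in simp_all)
qed

section \<open>Frobenius structure on matrices\<close>

lemma prop_morphism_op: "prop_morphism P R H \<Longrightarrow> prop_morphism (op_prop P) (op_prop R) H"
  unfolding prop_morphism_def by (auto intro: is_prop.is_prop_op)

locale prop_mor = dom: is_prop P + cod: is_prop R for P :: "'a prop_struct" and R :: "'b prop_struct" +
  fixes H :: "'a \<Rightarrow> 'b"
  assumes mor: "prop_morphism P R H"
begin

lemma H_arr: "f \<in> arr P n m \<Longrightarrow> H f \<in> arr R n m"
  using mor by (simp add: prop_morphism_def)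

lemma H_ty [simp]: "dom.is_arr f \<Longrightarrow> cod.is_arr (H f)" "dom.is_arr f \<Longrightarrow> prop_dom R (H f) = prop_dom P f"
  "dom.is_arr f \<Longrightarrow> prop_cod R (H f) = prop_cod P f"
  using H_arr[of f "prop_dom P f" "prop_cod P f"] by (auto simp: dom.arr_iff cod.arr_iff)

lemma H_ident [simp]: "H (ident P n) = ident R n" and H_braid [simp]: "H (braid P n m) = braid R n m"
  using mor by (simp_all add: prop_morphism_def)

lemma H_seq: "dom.is_arr f \<Longrightarrow> dom.is_arr g \<Longrightarrow> prop_cod P f = prop_dom P g \<Longrightarrow> H (f \<Zsemi>\<^bsub>P\<^esub> g) = H f \<Zsemi>\<^bsub>R\<^esub> H g"
  using mor unfolding prop_morphism_def dom.is_arr_def by metis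

lemma H_par: "dom.is_arr f \<Longrightarrow> dom.is_arr g \<Longrightarrow> H (f \<oplus>\<^bsub>P\<^esub> g) = H f \<oplus>\<^bsub>R\<^esub> H g"
  using mor unfolding prop_morphism_def dom.is_arr_def by metis

end

lemma prop_morI: "prop_morphism P R H \<Longrightarrow> prop_mor P R H"
  unfolding prop_mor_def prop_mor_axioms_def by (simp add: prop_morphism_def)

context
  fixes P :: "'a prop_struct" and R :: "'b prop_struct" and H mu eta
  assumes mor: "prop_morphism P R H" and cm: "comm_monoid_prop P mu eta"
begin

interpretation comm_monoid_prop P mu eta by (rule cm)
interpretation prop_mor P R H using mor by (rule prop_morI)

lemma comm_monoid_image: "comm_monoid_prop R (H mu) (H eta)"
proof
  show "H mu \<in> arr R 2 1" "H eta \<in> arr R 0 1" using mu_arr eta_arr H_arr by blast+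
  show "(H mu \<oplus>\<^bsub>R\<^esub> ident R 1) \<Zsemi>\<^bsub>R\<^esub> H mu = (ident R 1 \<oplus>\<^bsub>R\<^esub> H mu) \<Zsemi>\<^bsub>R\<^esub> H mu"
    using arg_cong[OF mu_assoc, of H] by (simp add: H_seq H_par)
  show "(H eta \<oplus>\<^bsub>R\<^esub> ident R 1) \<Zsemi>\<^bsub>R\<^esub> H mu = ident R 1" "(ident R 1 \<oplus>\<^bsub>R\<^esub> H eta) \<Zsemi>\<^bsub>R\<^esub> H mu = ident R 1"
    using arg_cong[OF mu_unit_left, of H] arg_cong[OF mu_unit_right, of H] by (simp_all add: H_seq H_par)
  show "braid R 1 1 \<Zsemi>\<^bsub>R\<^esub> H mu = H mu"
    using arg_cong[OF mu_comm, of H] by (simp add: H_seq)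
qed

interpretation img: comm_monoid_prop R "H mu" "H eta" by (rule comm_monoid_image)

lemma mult_at_image: "x < m \<Longrightarrow> H (mult_at m x) = img.mult_at m x"
proof (induction m)
  case (Suc m)
  then show ?case
    by (cases "x = m") (simp_all add: mult_at_last img.mult_at_last mult_at_less[of x m]
        img.mult_at_less[of x m] H_par H_seq)
qed simp

lemma etas_image: "H (etas m) = img.etas m"
  by (induction m) (simp_all add: H_par)

text \<open>The action is built from the monoid and the PROP structure alone. This serves both for
  morphisms out of the coproduct and for transposition of matrices, which computes
  \<open>costar\<close> from \<open>star\<close>.\<close>

lemma star_image: "maps n m f \<Longrightarrow> H (star n m f) = img.star n m f"
  by (induction n) (simp_all add: star.simps img.star.simps etas_image H_seq H_par maps_Suc
      mult_at_image)

end

definition mat_transpose :: "mat \<Rightarrow> mat" where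
  "mat_transpose x = (fst (snd x), fst x, \<lambda>a b. entry x b a)"

lemma mat_transpose_mk: "mat_transpose (mk_mat D n m A) = mk_mat D m n (\<lambda>a b. A b a)"
  by (auto simp: mat_transpose_def mk_mat_def fun_eq_iff)

lemma mat_transpose_transpose [simp]: "mat_transpose (mat_transpose x) = x"
    by (simp add: mat_transpose_def)

lemma mat_transpose_sel [simp]: "entry (mat_transpose x) a b = entry x b a"
    "fst (mat_transpose x) = fst (snd x)" "fst (snd (mat_transpose x)) = fst x"
  by (simp_all add: mat_transpose_def)

lemma mat_transpose_arr: "x \<in> arr (mat_prop D) n m \<Longrightarrow> mat_transpose x \<in> arr (mat_prop D) m n"
  by (auto simp: mat_prop_def mat_transpose_def)

text \<open>Transposition identifies the matrix PROP with its opposite, so the comonoid of matrices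
  and its laws are the images of the monoid and its laws.\<close>

lemma mat_transpose_morphism:
  assumes D: "finite D"
  shows "prop_morphism (mat_prop D) (op_prop (mat_prop D)) mat_transpose"
  unfolding prop_morphism_def
proof (intro conjI allI ballI)
  show "is_prop (mat_prop D)" "is_prop (op_prop (mat_prop D))"
    using is_prop_mat[OF D] is_prop.is_prop_op by blast+
  fix n m show "mat_transpose (braid (mat_prop D) n m) = braid (op_prop (mat_prop D)) n m"
    unfolding op_prop_simps
  proof (rule mat_ext[of _ _ "m + n" "n + m"])
    fix a b assume "a \<in> words D (m + n)" "b \<in> words D (n + m)"
    then obtain a1 a2 b1 b2 where ab: "a = a1 @ a2" "b = b1 @ b2" and
      w: "a1 \<in> words D m" "a2 \<in> words D n" "b1 \<in> words D n" "b2 \<in> words D m"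
      by (metis words_splitE)
    show "entry (mat_transpose (braid (mat_prop D) n m)) a b = entry (braid (mat_prop D) m n) a b"
      unfolding ab using ent_braid[OF w(3,4,2,1)] ent_braid[OF w(1,2,4,3)]
          by (auto simp: mat_transpose_def)
  qed (use mat_transpose_arr[OF mat_braid_arr[of D n m]] mat_braid_arr[of D m n] in simp_all)
next
  fix n m x assume "x \<in> arr (mat_prop D) n m"
  then show "mat_transpose x \<in> arr (op_prop (mat_prop D)) n m"
      by (auto simp: mat_prop_def mat_transpose_def)
next
  show "mat_transpose (ident (mat_prop D) n) = ident (op_prop (mat_prop D)) n" for n
    by (auto simp: mat_prop_def mat_transpose_def mk_mat_def fun_eq_iff)
  show "mat_transpose (x \<Zsemi>\<^bsub>mat_prop D\<^esub> y) = mat_transpose x \<Zsemi>\<^bsub>op_prop (mat_prop D)\<^esub> mat_transpose y"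
    if "x \<in> arr (mat_prop D) n m" "y \<in> arr (mat_prop D) m k" for x y n m k
    using mat_dim[OF that(1)] mat_dim[OF that(2)]
        by (simp add: mat_prop_def mat_transpose_mk mult.commute)
  show "mat_transpose (x \<oplus>\<^bsub>mat_prop D\<^esub> y) = mat_transpose x \<oplus>\<^bsub>op_prop (mat_prop D)\<^esub> mat_transpose y" for x y
    by (simp add: mat_prop_def mat_transpose_mk)
qed

section \<open>Matrices of functions between finite ordinals\<close>

definition pull :: "nat \<Rightarrow> (nat \<Rightarrow> nat) \<Rightarrow> nat list \<Rightarrow> nat list" where
  "pull n f b = map (\<lambda>i. b ! f i) [0..<n]"

lemma pull_words: "maps n m f \<Longrightarrow> b \<in> words D m \<Longrightarrow> pull n f b \<in> words D n"
  using nth_mem[of _ b] by (fastforce simp: pull_def words_def maps_def)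

lemma pull_pull: "maps n m f \<Longrightarrow> pull n f (pull m g c) = pull n (\<lambda>x. g (f x)) c"
  by (auto simp: pull_def maps_def)

lemma pull_id: "b \<in> words D n \<Longrightarrow> pull n (\<lambda>x. x) b = b"
  by (auto simp: pull_def words_def intro: nth_equalityI)

lemma length_pull [simp]: "length (pull n f b) = n" by (simp add: pull_def)

lemma pull_cong: "(\<And>x. x < n \<Longrightarrow> f x = g x) \<Longrightarrow> pull n f b = pull n g b"
  by (simp add: pull_def)

lemma pull_append:
  assumes "maps n m f" "length b = m"
  shows "pull (n + n') (par_fun n m f g) (b @ b') = pull n f b @ pull n' g b'"
proof (rule nth_equalityI)
  fix i assume "i < length (pull (n + n') (par_fun n m f g) (b @ b'))"
  then show "pull (n + n') (par_fun n m f g) (b @ b') ! i = (pull n f b @ pull n' g b') ! i"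
    using assms by (auto simp: pull_def par_fun_def nth_append maps_def)
qed simp

text \<open>Rows are labellings of the \<open>n\<close> inputs, columns labellings of the
  \<open>m\<close> outputs; the entry tests whether the input labelling is the output labelling
  composed with \<open>f\<close>.\<close>

definition graph_mat :: "nat set \<Rightarrow> nat \<Rightarrow> nat \<Rightarrow> (nat \<Rightarrow> nat) \<Rightarrow> mat" where
  "graph_mat D n m f = mk_mat D n m (\<lambda>a b. of_bool (a = pull n f b))"

lemma graph_arr: "graph_mat D n m f \<in> arr (mat_prop D) n m" by (simp add: graph_mat_def)

lemma ent_graph: "a \<in> words D n \<Longrightarrow> b \<in> words D m \<Longrightarrow> entry (graph_mat D n m f) a b
    = of_bool (a = pull n f b)"
  by (simp add: graph_mat_def)

lemma graph_cong: "(\<And>x. x < n \<Longrightarrow> f x = g x) \<Longrightarrow> graph_mat D n m f = graph_mat D n m g"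
  unfolding graph_mat_def using pull_cong[of n f g] by metis

lemma graph_seq:
  assumes D: "finite D" and fg: "maps n m f" "maps m k g"
  shows "graph_mat D n m f \<Zsemi>\<^bsub>mat_prop D\<^esub> graph_mat D m k g = graph_mat D n k (\<lambda>x. g (f x))"
proof (rule mat_ext[OF mat_seq_arr[OF graph_arr graph_arr] graph_arr])
  fix a c assume w: "a \<in> words D n" "c \<in> words D k"
  show "entry (graph_mat D n m f \<Zsemi>\<^bsub>mat_prop D\<^esub> graph_mat D m k g) a c
      = entry (graph_mat D n k (\<lambda>x. g (f x))) a c"
    using fg by (simp only: ent_seq[OF graph_arr graph_arr w] ent_graph[OF w] ent_graph w cong: sum.cong)
      (simp add: sum_words_eq(2)[OF D pull_words[OF fg(2) w(2)]] pull_pull)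
qed

lemma graph_par:
  assumes fg: "maps n m f" "maps n' m' g"
  shows "graph_mat D n m f \<oplus>\<^bsub>mat_prop D\<^esub> graph_mat D n' m' g
      = graph_mat D (n + n') (m + m') (par_fun n m f g)"
proof (rule mat_ext[OF mat_par_arr[OF graph_arr graph_arr] graph_arr])
  fix a b assume ab': "a \<in> words D (n + n')" "b \<in> words D (m + m')"
  then obtain a1 a2 b1 b2 where ab: "a = a1 @ a2" "b = b1 @ b2" and
    w: "a1 \<in> words D n" "a2 \<in> words D n'" "b1 \<in> words D m" "b2 \<in> words D m'"
    by (metis words_splitE)
  have l: "length b1 = m" "length a1 = n" using w by (auto simp: words_def)
  show "entry (graph_mat D n m f \<oplus>\<^bsub>mat_prop D\<^esub> graph_mat D n' m' g) a b
      = entry (graph_mat D (n + n') (m + m') (par_fun n m f g)) a b"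
    unfolding ent_graph[OF ab'] unfolding ab ent_par[OF graph_arr graph_arr w(1,3,2,4)]
    using pull_append[OF fg(1) l(1)] l by (auto simp: ent_graph w)
qed

lemma graph_id: "graph_mat D n n (\<lambda>x. x) = ident (mat_prop D) n"
  by (rule mat_ext[OF graph_arr mat_ident_arr]) (simp add: ent_graph ent_ident pull_id)

lemma graph_swap: "graph_mat D (n + m) (m + n) (swap_fun n m) = braid (mat_prop D) n m"
proof (rule mat_ext[OF graph_arr mat_braid_arr])
  fix a b assume ab': "a \<in> words D (n + m)" "b \<in> words D (m + n)"
  then obtain a1 a2 b1 b2 where ab: "a = a1 @ a2" "b = b2 @ b1" and
    w: "a1 \<in> words D n" "a2 \<in> words D m" "b1 \<in> words D n" "b2 \<in> words D m"
    by (metis words_splitE)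
  have l: "length b1 = n" "length a1 = n" "length b2 = m" using w by (auto simp: words_def)
  have "pull (n + m) (swap_fun n m) (b2 @ b1) = b1 @ b2"
    using l by (intro nth_equalityI) (auto simp: pull_def swap_fun_def nth_append)
  then show "entry (graph_mat D (n + m) (m + n) (swap_fun n m)) a b = entry (braid (mat_prop D) n m) a b"
    unfolding ent_graph[OF ab'] unfolding ab ent_braid[OF w(1,2,3,4)] using l by auto
qed

lemma graph_to_1: "maps n 1 f \<Longrightarrow> maps n 1 g \<Longrightarrow> graph_mat D n 1 f = graph_mat D n 1 g"
  by (rule graph_cong) (simp add: maps_def)

definition "mat_mu D = graph_mat D 2 1 (\<lambda>_. 0)"
definition "mat_eta D = graph_mat D 0 1 (\<lambda>x. x)"

text \<open>By functoriality of \<open>graph_mat\<close> both sides of each law are matrices of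
  functions into a one-element set, and such functions agree.\<close>

lemma comm_monoid_mat:
  assumes D: "finite D"
  shows "comm_monoid_prop (mat_prop D) (mat_mu D) (mat_eta D)"
  unfolding mat_mu_def mat_eta_def
proof (intro comm_monoid_prop.intro comm_monoid_prop_axioms.intro is_prop_mat[OF D] graph_arr)
  let ?M = "mat_prop D" and ?mu = "graph_mat D 2 1 (\<lambda>_. 0)" and ?eta = "graph_mat D 0 1 (\<lambda>x. x)"
  have m: "maps 2 1 (\<lambda>_. 0)" "maps 0 1 (\<lambda>x. x)" "maps (1 + 1) (1 + 1) (swap_fun 1 1)"
      by (auto simp: maps_def swap_fun_def)
  note S = graph_id[of D 1, symmetric] graph_swap[of D 1 1, symmetric]
  have two: "1 + 1 = (2 :: nat)" by simp
  have seq: "graph_mat D n k f \<Zsemi>\<^bsub>?M\<^esub> ?mu = graph_mat D n 1 (\<lambda>_. 0)" if "maps n k f" "k = 2" for n k f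
    using graph_seq[OF D that(1)[unfolded that(2)] m(1)] that(2) by simp
  have id: "graph_mat D 1 1 (\<lambda>_. 0) = graph_mat D 1 1 (\<lambda>x. x)"
      by (rule graph_to_1) (simp_all add: maps_def)
  show "(?mu \<oplus>\<^bsub>?M\<^esub> ident ?M 1) \<Zsemi>\<^bsub>?M\<^esub> ?mu = (ident ?M 1 \<oplus>\<^bsub>?M\<^esub> ?mu) \<Zsemi>\<^bsub>?M\<^esub> ?mu"
    unfolding S graph_par[OF m(1) maps_id] graph_par[OF maps_id m(1)]
      seq[OF maps_par_fun[OF m(1) maps_id] two] seq[OF maps_par_fun[OF maps_id m(1)] two]
    by (simp only: add.commute)
  show "(?eta \<oplus>\<^bsub>?M\<^esub> ident ?M 1) \<Zsemi>\<^bsub>?M\<^esub> ?mu = ident ?M 1"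
    unfolding S graph_par[OF m(2) maps_id] seq[OF maps_par_fun[OF m(2) maps_id] two] using id by simp
  show "(ident ?M 1 \<oplus>\<^bsub>?M\<^esub> ?eta) \<Zsemi>\<^bsub>?M\<^esub> ?mu = ident ?M 1"
    unfolding S graph_par[OF maps_id m(2)] seq[OF maps_par_fun[OF maps_id m(2)] two] using id by simp
  show "braid ?M 1 1 \<Zsemi>\<^bsub>?M\<^esub> ?mu = ?mu"
    unfolding S seq[OF m(3) two] by (simp only: two)
qed

definition "mat_delta D = mat_transpose (mat_mu D)"
definition "mat_eps D = mat_transpose (mat_eta D)"

lemma words_Suc: "a \<in> words D (Suc n) \<longleftrightarrow> (\<exists>x a'. a = x # a' \<and> x \<in> D \<and> a' \<in> words D n)"
  by (cases a) (auto simp: words_def)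

text \<open>Both sides of the left Frobenius law have entry 1 exactly if all four labels agree. The
  right law is the transpose of the left one, and the special law holds because a label has just one
  pair of equal copies.\<close>

lemma frob_mat:
  assumes D: "finite D"
  shows "frob_prop (mat_prop D) (mat_mu D) (mat_eta D) (mat_delta D) (mat_eps D)"
  unfolding mat_delta_def mat_eps_def mat_mu_def mat_eta_def
proof (intro frob_prop.intro frob_prop_axioms.intro comm_monoid_mat[OF D, unfolded mat_mu_def
    mat_eta_def]
    comm_monoid_image[OF mat_transpose_morphism[OF D] comm_monoid_mat[OF D, unfolded mat_mu_def
        mat_eta_def]])
  let ?M = "mat_prop D" and ?mu = "graph_mat D 2 1 (\<lambda>_. 0)" and ?eta = "graph_mat D 0 1 (\<lambda>x. x)"
  let ?delta = "mat_transpose ?mu" and ?eps = "mat_transpose ?eta"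
  note t = mat_transpose_morphism[OF D, unfolded prop_morphism_def op_prop_simps, THEN conjunct2, THEN
      conjunct2, THEN conjunct2]
  note tarr = mat_transpose_arr[OF graph_arr]
  have m: "maps 2 1 (\<lambda>_. 0)" by (simp add: maps_def)
  have tid: "mat_transpose (ident ?M n) = ident ?M n" for n using t by blast
  have tseq: "mat_transpose (x \<Zsemi>\<^bsub>?M\<^esub> y) = mat_transpose y \<Zsemi>\<^bsub>?M\<^esub> mat_transpose x"
      if "x \<in> arr ?M n m" "y \<in> arr ?M m k" for x y n m k
    using t that by blast
  have tpar: "mat_transpose (x \<oplus>\<^bsub>?M\<^esub> y) = mat_transpose x \<oplus>\<^bsub>?M\<^esub> mat_transpose y"
      if "x \<in> arr ?M n m" "y \<in> arr ?M n' m'" for x y n m n' m'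
    using t that by blast
  have d1: "?delta \<oplus>\<^bsub>?M\<^esub> ident ?M 1 = mat_transpose (graph_mat D 3 2 (par_fun 2 1 (\<lambda>_. 0) (\<lambda>x. x)))"
    using tpar[OF graph_arr mat_ident_arr, of 2 1 "\<lambda>_. 0" 1] graph_par[OF m maps_id[of 1]]
    by (simp only: tid graph_id) (simp add: numeral_2_eq_2 numeral_3_eq_3)
  have d2: "ident ?M 1 \<oplus>\<^bsub>?M\<^esub> ?mu = graph_mat D 3 2 (par_fun 1 1 (\<lambda>x. x) (\<lambda>_. 0))"
    using graph_par[OF maps_id[of 1] m]
        by (simp only: graph_id) (simp add: numeral_2_eq_2 numeral_3_eq_3)
  have ar: "(?delta \<oplus>\<^bsub>?M\<^esub> ident ?M 1) \<in> arr ?M 2 3" "ident ?M 1 \<oplus>\<^bsub>?M\<^esub> ?mu \<in> arr ?M 3 2"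
    unfolding d1 d2 by (intro tarr graph_arr)+
  show fl: "(?delta \<oplus>\<^bsub>?M\<^esub> ident ?M 1) \<Zsemi>\<^bsub>?M\<^esub> (ident ?M 1 \<oplus>\<^bsub>?M\<^esub> ?mu) = ?mu \<Zsemi>\<^bsub>?M\<^esub> ?delta"
  proof (rule mat_ext[OF mat_seq_arr[OF ar] mat_seq_arr[OF graph_arr tarr]])
    fix a c assume w: "a \<in> words D 2" "c \<in> words D 2"
    obtain x y u v where ac: "a = [x, y]" "c = [u, v]" and D': "x \<in> D" "y \<in> D" "u \<in> D" "v \<in> D"
      using w by (auto simp: numeral_2_eq_2 words_Suc)
    have pw: "pull 3 (par_fun 1 1 (\<lambda>x. x) (\<lambda>_. 0)) c \<in> words D 3"
      by (rule pull_words[OF _ w(2)]) (auto simp: maps_def par_fun_def)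
    have "entry ((?delta \<oplus>\<^bsub>?M\<^esub> ident ?M 1) \<Zsemi>\<^bsub>?M\<^esub> (ident ?M 1 \<oplus>\<^bsub>?M\<^esub> ?mu)) a c
      = (\<Sum>b \<in> words D 3. of_bool (b = pull 3 (par_fun 2 1 (\<lambda>_. 0) (\<lambda>x. x)) a) * of_bool (b = pull 3
          (par_fun 1 1 (\<lambda>x. x) (\<lambda>_. 0)) c))"
      unfolding ent_seq[OF ar w] unfolding d1 d2
          by (intro sum.cong) (simp_all only: mat_transpose_sel(1) ent_graph w)
    also have "\<dots> = of_bool (pull 3 (par_fun 1 1 (\<lambda>x. x) (\<lambda>_. 0)) c
        = pull 3 (par_fun 2 1 (\<lambda>_. 0) (\<lambda>x. x)) a)"
      by (rule sum_words_eq(2)[OF D pw])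
    also have "\<dots> = of_bool (u = x \<and> v = x \<and> v = y)"
      unfolding ac by (simp add: pull_def par_fun_def upt_rec[of _ 3] upt_rec[of _ "Suc _"]
          numeral_3_eq_3)
    finally have 1: "entry ((?delta \<oplus>\<^bsub>?M\<^esub> ident ?M 1) \<Zsemi>\<^bsub>?M\<^esub> (ident ?M 1 \<oplus>\<^bsub>?M\<^esub> ?mu)) a c
        = of_bool (u = x \<and> v = x \<and> v = y)" .
    have p2: "pull 2 (\<lambda>_. 0) [z] = [z, z]" for z by (simp add: pull_def numeral_2_eq_2)
    have x1: "[x] \<in> words D 1" using D' by (simp add: words_def)
    have "entry (?mu \<Zsemi>\<^bsub>?M\<^esub> ?delta) a c = (\<Sum>b \<in> words D 1. of_bool (a = pull 2 (\<lambda>_. 0) b) * of_bool (c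
        = pull 2 (\<lambda>_. 0) b))"
      unfolding ent_seq[OF graph_arr tarr w]
          by (intro sum.cong) (simp_all only: mat_transpose_sel(1) ent_graph w)
    also have "\<dots> = (\<Sum>b \<in> words D 1. of_bool (b = [x]) * (of_bool (a = pull 2 (\<lambda>_. 0) b) * of_bool (c
        = pull 2 (\<lambda>_. 0) b)))"
      by (rule sum.cong) (auto simp: words_Suc p2 ac)
    also have "\<dots> = of_bool (u = x \<and> v = x \<and> v = y)"
      unfolding sum_words_eq(1)[OF D x1] by (auto simp: p2 ac)
    finally show "entry ((?delta \<oplus>\<^bsub>?M\<^esub> ident ?M 1) \<Zsemi>\<^bsub>?M\<^esub> (ident ?M 1 \<oplus>\<^bsub>?M\<^esub> ?mu)) a c
      = entry (?mu \<Zsemi>\<^bsub>?M\<^esub> ?delta) a c" using 1 by simp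
  qed
  show "?mu \<Zsemi>\<^bsub>?M\<^esub> ?delta = (ident ?M 1 \<oplus>\<^bsub>?M\<^esub> ?delta) \<Zsemi>\<^bsub>?M\<^esub> (?mu \<oplus>\<^bsub>?M\<^esub> ident ?M 1)"
    using arg_cong[OF fl, of mat_transpose]
    unfolding tseq[OF ar] tseq[OF graph_arr tarr] tpar[OF tarr mat_ident_arr]
        tpar[OF mat_ident_arr graph_arr] tid mat_transpose_transpose
    by (rule HOL.sym)
  show "?delta \<Zsemi>\<^bsub>?M\<^esub> ?mu = ident ?M 1"
  proof (rule mat_ext[OF mat_seq_arr[OF tarr graph_arr] mat_ident_arr])
    fix a c assume w: "a \<in> words D 1" "c \<in> words D 1"
    have "entry (?delta \<Zsemi>\<^bsub>?M\<^esub> ?mu) a c = (\<Sum>b \<in> words D 2. of_bool (b = pull 2 (\<lambda>_. 0) a) * of_bool (b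
        = pull 2 (\<lambda>_. 0) c))"
      unfolding ent_seq[OF tarr graph_arr w]
          by (intro sum.cong) (simp_all only: mat_transpose_sel(1) ent_graph w)
    also have "\<dots> = of_bool (pull 2 (\<lambda>_. 0) c = pull 2 (\<lambda>_. 0) a)"
      by (rule sum_words_eq(2)[OF D pull_words[OF m w(2)]])
    also have "\<dots> = of_bool (a = c)"
      using w by (auto simp: words_Suc pull_def numeral_2_eq_2)
    finally show "entry (?delta \<Zsemi>\<^bsub>?M\<^esub> ?mu) a c = entry (ident ?M 1) a c" by (simp only: ent_ident w)
  qed
qed

section \<open>State sums: the entries of normal forms in the matrix PROP\<close>

locale mat_frob =
  fixes D :: "nat set"
  assumes fin: "finite D"
begin

sublocale frob_prop "mat_prop D" "mat_mu D" "mat_eta D" "mat_delta D" "mat_eps D"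
  by (rule frob_mat[OF fin])

lemma mult_at_graph: "x < m \<Longrightarrow> mult_at m x = graph_mat D (Suc m) m (\<lambda>i. if i = m then x else i)"
proof (induction m)
  case (Suc m)
  have m2: "maps 2 1 (\<lambda>_. 0)" by (simp add: maps_def)
  show ?case
  proof (cases "x = m")
    case True
    have "mult_at (Suc m) x = graph_mat D m m (\<lambda>x. x) \<oplus>\<^bsub>mat_prop D\<^esub> mat_mu D"
      using True by (simp add: mult_at_last graph_id)
    also have "\<dots> = graph_mat D (Suc (Suc m)) (Suc m) (par_fun m m (\<lambda>x. x) (\<lambda>_. 0))"
      using graph_par[OF maps_id m2] by (simp add: mat_mu_def)
    also have "\<dots> = graph_mat D (Suc (Suc m)) (Suc m) (\<lambda>i. if i = Suc m then x else i)"
      by (rule graph_cong) (use True in \<open>auto simp: par_fun_def\<close>)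
    finally show ?thesis .
  next
    case False
    with Suc have x: "x < m" and IH: "mult_at m x = graph_mat D (Suc m) m (\<lambda>i. if i = m then x else i)"
        by auto
    have mm: "maps (Suc m) m (\<lambda>i. if i = m then x else i)" using x by (auto simp: maps_def)
    have sf: "maps 2 2 (swap_fun 1 1)" by (auto simp: maps_def swap_fun_def)
    let ?f = "par_fun m m (\<lambda>x. x) (swap_fun 1 1)" and ?g =
        "par_fun (Suc m) m (\<lambda>i. if i = m then x else i) (\<lambda>x. x)"
    have 1: "ident (mat_prop D) m \<oplus>\<^bsub>mat_prop D\<^esub> sw = graph_mat D (Suc (Suc m)) (Suc (Suc m)) ?f"
      using graph_par[OF maps_id[of m] sf, of D] graph_swap[of D 1 1]
          by (simp add: graph_id numeral_2_eq_2)
    have 2: "mult_at m x \<oplus>\<^bsub>mat_prop D\<^esub> w = graph_mat D (Suc (Suc m)) (Suc m) ?g"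
      using graph_par[OF mm maps_id[of 1], of D] graph_id[of D 1] by (simp add: IH)
    have fg: "maps (Suc (Suc m)) (Suc (Suc m)) ?f" "maps (Suc (Suc m)) (Suc m) ?g"
      using maps_par_fun[OF maps_id[of m] sf] maps_par_fun[OF mm maps_id[of 1]] by simp_all
    have "mult_at (Suc m) x = graph_mat D (Suc (Suc m)) (Suc m) (\<lambda>i. ?g (?f i))"
      unfolding mult_at_less[OF x] 1 2 by (rule graph_seq[OF fin fg])
    also have "\<dots> = graph_mat D (Suc (Suc m)) (Suc m) (\<lambda>i. if i = Suc m then x else i)"
      by (rule graph_cong) (use x in \<open>auto simp: par_fun_def swap_fun_def\<close>)
    finally show ?thesis .
  qed
qed simp

lemma etas_graph: "etas m = graph_mat D 0 m f"
proof (induction m arbitrary: f)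
  case 0
  have "ident (mat_prop D) 0 = graph_mat D 0 0 f"
    unfolding graph_id[of D 0, symmetric] by (rule graph_cong) simp
  then show ?case by simp
next
  case (Suc m)
  have "etas (Suc m) = graph_mat D 0 m (\<lambda>x. x) \<oplus>\<^bsub>mat_prop D\<^esub> mat_eta D" using Suc by simp
  also have "\<dots> = graph_mat D 0 (Suc m) (par_fun 0 m (\<lambda>x. x) (\<lambda>x. x))"
    using graph_par[of 0 m "\<lambda>x. x" 0 1 "\<lambda>x. x" D] by (simp add: maps_def mat_eta_def)
  also have "\<dots> = graph_mat D 0 (Suc m) f" by (rule graph_cong) simp
  finally show ?case .
qed

lemma star_graph: "maps n m f \<Longrightarrow> star n m f = graph_mat D n m f"
proof (induction n)
  case 0
  then show ?case using etas_graph[of m f] by (simp add: star.simps)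
next
  case (Suc n)
  then have f: "maps n m f" and z: "f n < m" by (simp_all add: maps_Suc)
  have p: "maps (Suc n) (Suc m) (par_fun n m f (\<lambda>x. x))" using maps_par_fun[OF f maps_id[of 1]] by simp
  have q: "maps (Suc m) m (\<lambda>i. if i = m then f n else i)" using z by (auto simp: maps_def)
  have "star (Suc n) m f
      = graph_mat D (Suc n) (Suc m) (par_fun n m f (\<lambda>x. x)) \<Zsemi>\<^bsub>mat_prop D\<^esub> graph_mat D (Suc m) m
          (\<lambda>i. if i = m then f n else i)"
    using Suc.IH[OF f] graph_par[OF f maps_id[of 1], of D] graph_id[of D 1] z
        by (simp add: star.simps mult_at_graph)
  also have "\<dots> = graph_mat D (Suc n) m f"
    unfolding graph_seq[OF fin p q]
        by (rule graph_cong) (use f in \<open>auto simp: par_fun_def maps_def less_Suc_eq\<close>)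
  finally show ?case .
qed

lemma costar_graph: "maps n m f \<Longrightarrow> costar n m f = mat_transpose (graph_mat D n m f)"
  using star_image[OF mat_transpose_morphism[OF fin] comm_monoid_mat[OF fin], of n m f] star_graph
      by (simp add: mat_delta_def mat_eps_def)

text \<open>The matrices of \<open>star\<close> and \<open>costar\<close> are delta functions, so
  both sums collapse to the word that lists the labels of all nodes followed by those of the
  sources, respectively the targets. A hyperedge thus acts diagonally on labellings.\<close>

lemma ent_attach:
  assumes e: "edge_ok v (s, \<gamma>, t)" and w: "a \<in> words D v" "c \<in> words D v"
  shows "entry (attach v s \<gamma> t) a c = of_bool (a = c) * entry \<gamma> (map ((!) a) s) (map ((!) a) t)"
proof -
  let ?M = "mat_prop D" and ?n = "v + length s" and ?m = "v + length t"
  have st: "set s \<subseteq> {..<v}" "set t \<subseteq> {..<v}" and g: "\<gamma> \<in> arr ?M (length s) (length t)"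
    using e by (auto simp: edge_ok.simps arr_iff)
  have word: "map ((!) a) s \<in> words D (length s)" if "a \<in> words D v" "set s \<subseteq> {..<v}" for a s
    using that by (auto simp: words_def subset_eq)
  have pull: "pull (v + length s) (copair v s) a = a @ map ((!) a) s" if "a \<in> words D v" "set s \<subseteq> {..<v}"
      for a s
    using that by (intro nth_equalityI) (auto simp: pull_def copair_def nth_append words_def)
  have ig: "ident ?M v \<oplus>\<^bsub>?M\<^esub> \<gamma> \<in> arr ?M ?n ?m" by (rule mat_par_arr[OF mat_ident_arr g])
  have cm: "maps ?n v (copair v s)" "maps ?m v (copair v t)" using st by simp_all
  have pa: "a @ map ((!) a) s \<in> words D ?n" and pc: "c @ map ((!) c) t \<in> words D ?m"
    using pull_words[OF cm(1) w(1)] pull_words[OF cm(2) w(2)] pull[OF w(1) st(1)] pull[OF w(2) st(2)]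
        by simp_all
  have "entry (attach v s \<gamma> t) a c = (\<Sum>b \<in> words D ?n. of_bool (b = a @ map ((!) a) s) *
     (\<Sum>b' \<in> words D ?m. entry (ident ?M v \<oplus>\<^bsub>?M\<^esub> \<gamma>) b b' * of_bool (b' = c @ map ((!) c) t)))"
    unfolding attach_def star_graph[OF cm(2)] costar_graph[OF cm(1)]
      ent_seq[OF mat_transpose_arr[OF graph_arr] mat_seq_arr[OF ig graph_arr] w]
    by (intro sum.cong arg_cong2[where f = "(*)"])
      (simp_all add: ent_seq[OF ig graph_arr] ent_graph w pull st)
  also have "\<dots> = entry (ident ?M v \<oplus>\<^bsub>?M\<^esub> \<gamma>) (a @ map ((!) a) s) (c @ map ((!) c) t)"
    by (simp only: sum_words_eq[OF fin pa] sum_words_eq[OF fin pc])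
  also have "\<dots> = of_bool (a = c) * entry \<gamma> (map ((!) a) s) (map ((!) a) t)"
    using ent_par[OF mat_ident_arr g w word[OF w(1) st(1)] word[OF w(2) st(2)]] w
        by (cases "a = c") (simp_all add: ent_ident)
  finally show ?thesis .
qed

lemma arr_attaches: "edges_ok v es \<Longrightarrow> attaches v es \<in> arr (mat_prop D) v v"
  by (simp add: arr_iff)

lemma ent_attaches:
  assumes "edges_ok v es" "a \<in> words D v" "c \<in> words D v"
  shows "entry (attaches v es) a c
      = of_bool (a = c) * (\<Prod>(s, \<gamma>, t) \<leftarrow> es. entry \<gamma> (map ((!) a) s) (map ((!) a) t))"
  using assms
proof (induction es arbitrary: a)
  case (Cons e es)
  obtain s \<gamma> t where e: "e = (s, \<gamma>, t)" by (cases e)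
  have ok: "edge_ok v (s, \<gamma>, t)" "edges_ok v es" using Cons.prems by (simp_all add: e)
  have at: "attach v s \<gamma> t \<in> arr (mat_prop D) v v" using ok by (simp add: arr_iff)
  have "entry (attaches v (e # es)) a c = (\<Sum>b \<in> words D v. of_bool (a = b) *
     (entry \<gamma> (map ((!) a) s) (map ((!) a) t) * entry (attaches v es) b c))"
    unfolding attaches.simps e fst_conv snd_conv ent_seq[OF at arr_attaches[OF ok(2)] Cons.prems(2,3)]
    by (intro sum.cong) (simp_all only: ent_attach[OF ok(1)] Cons.prems mult.assoc)
  also have "\<dots> = entry \<gamma> (map ((!) a) s) (map ((!) a) t) * entry (attaches v es) a c"
    by (rule sum_words_eq(3)[OF fin Cons.prems(2)])
  finally show ?case using Cons.IH[OF ok(2) Cons.prems(2,3)] by (simp add: e)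
qed (simp add: ent_ident)

text \<open>Hyperedges being diagonal, a single sum over labellings of the nodes survives: a state
  sum with the legs as boundary condition.\<close>

lemma ent_nf:
  assumes ok: "maps n v i" "maps m v j" "edges_ok v es" and w: "x \<in> words D n" "y \<in> words D m"
  shows "entry (nf n m v i es j) x y = (\<Sum>a \<in> words D v. of_bool (x = pull n i a) * of_bool (y
      = pull m j a) *
    (\<Prod>(s, \<gamma>, t) \<leftarrow> es. entry \<gamma> (map ((!) a) s) (map ((!) a) t)))"
proof -
  let ?p = "\<lambda>a. \<Prod>(s, \<gamma>, t) \<leftarrow> es. entry \<gamma> (map ((!) a) s) (map ((!) a) t)"
  note A = arr_attaches[OF ok(3)]
  note T = mat_transpose_arr[OF graph_arr[of D m v j]]
  have "entry (nf n m v i es j) x y = (\<Sum>a \<in> words D v. of_bool (x = pull n i a) *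
    (\<Sum>b \<in> words D v. of_bool (a = b) * (?p a * of_bool (y = pull m j b))))"
    unfolding nf_def star_graph[OF ok(1)] costar_graph[OF ok(2)]
        ent_seq[OF graph_arr mat_seq_arr[OF A T] w]
    by (intro sum.cong arg_cong2[where f = "(*)"])
      (simp_all only: ent_seq[OF A T] ent_graph w ent_attaches[OF ok(3)] mat_transpose_sel(1) mult.assoc
          cong: sum.cong)
  also have "\<dots> = (\<Sum>a \<in> words D v. of_bool (x = pull n i a) * of_bool (y = pull m j a) * ?p a)"
    by (intro sum.cong) (simp_all only: sum_words_eq(3)[OF fin] mult.assoc mult.commute
        mult.left_commute)
  finally show ?thesis .
qed

end

section \<open>Counting homomorphisms\<close>

definition homs :: "'g cospan \<Rightarrow> 'g hypergraph \<Rightarrow> nat list \<Rightarrow> nat list \<Rightarrow> hmap set" where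
  "homs c X x y = {h. hyp_hom (apex c) X h \<and> map (\<lambda>i. fst h (fst (in_leg c) i)) [0..<cdom c] = x \<and>
     map (\<lambda>i. fst h (fst (out_leg c) i)) [0..<ccod c] = y}"

text \<open>With these weights the product over the hyperedges of a hypergraph counts the ways to
  extend a given map of nodes to a homomorphism into \<open>X\<close>.\<close>

definition weight :: "'g signature \<Rightarrow> 'g hypergraph \<Rightarrow> 'g \<Rightarrow> mat" where
  "weight \<Sigma> X g = mk_mat (nodes X) (arity \<Sigma> g) (coarity \<Sigma> g)
     (\<lambda>s t. card {e \<in> hedges X. label X e = g \<and> sources X e = s \<and> targets X e = t})"

lemma frob_interp_mat:
  assumes X: "hypergraph_over \<Sigma> X"
  shows "frob_interp (mat_prop (nodes X)) (mat_mu (nodes X)) (mat_eta (nodes X)) (mat_delta (nodes X))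
    (mat_eps (nodes X)) \<Sigma> (weight \<Sigma> X)"
proof -
  have "finite (nodes X)" using X by (simp add: hypergraph_over_def)
  then interpret mat_frob "nodes X" by unfold_locales
  show ?thesis by unfold_locales (simp add: weight_def)
qed

text \<open>Once the map of nodes is fixed, the images of the hyperedges are chosen independently of
  each other.\<close>

lemma homs_Sigma:
  "homs c X x y = Sigma {\<nu> \<in> nodes (apex c) \<rightarrow>\<^sub>E nodes X. map (\<lambda>i. \<nu> (fst (in_leg c) i)) [0..<cdom c] = x \<and>
      map (\<lambda>i. \<nu> (fst (out_leg c) i)) [0..<ccod c] = y}
    (\<lambda>\<nu>. \<Pi>\<^sub>E h \<in> hedges (apex c). {e \<in> hedges X. label X e = label (apex c) h \<and>
      sources X e = map \<nu> (sources (apex c) h) \<and> targets X e = map \<nu> (targets (apex c) h)})"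
  unfolding homs_def hyp_hom_def by (auto simp: PiE_iff extensional_def)

lemma finite_homs:
  assumes "hypergraph_over \<Sigma> (apex c)" "hypergraph_over \<Sigma> X"
  shows "finite (homs c X x y)"
proof -
  have "homs c X x y \<subseteq> (nodes (apex c) \<rightarrow>\<^sub>E nodes X) \<times> (hedges (apex c) \<rightarrow>\<^sub>E hedges X)"
    unfolding homs_def hyp_hom_def by auto
  moreover have "finite \<dots>" using assms unfolding hypergraph_over_def by (auto intro!: finite_PiE)
  ultimately show ?thesis by (rule finite_subset)
qed

lemma words_bij:
  assumes \<beta>: "bij_betw \<beta> A {..<v}"
  shows "bij_betw (\<lambda>a. \<lambda>z \<in> A. a ! \<beta> z) (words D v) (A \<rightarrow>\<^sub>E D)"
proof (rule bij_betwI[where g = "\<lambda>\<nu>. map (\<lambda>i. \<nu> (inv_into A \<beta> i)) [0..<v]"])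
  have b: "\<beta> z < v" if "z \<in> A" for z using \<beta> that by (auto simp: bij_betw_def)
  have i: "inv_into A \<beta> i \<in> A" "\<beta> (inv_into A \<beta> i) = i" if "i < v" for i
    using bij_betw_inv_into_right[OF \<beta>, of i] bij_betw_apply[OF bij_betw_inv_into[OF \<beta>], of i] that
        by auto
  show "(\<lambda>a. \<lambda>z \<in> A. a ! \<beta> z) \<in> words D v \<rightarrow> (A \<rightarrow>\<^sub>E D)"
    using b by (auto simp: words_def subset_eq)
  show "(\<lambda>\<nu>. map (\<lambda>i. \<nu> (inv_into A \<beta> i)) [0..<v]) \<in> (A \<rightarrow>\<^sub>E D) \<rightarrow> words D v"
    using i by (auto simp: words_def PiE_iff)
  show "map (\<lambda>i. (\<lambda>z \<in> A. a ! \<beta> z) (inv_into A \<beta> i)) [0..<v] = a" if "a \<in> words D v" for a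
    using that i by (intro nth_equalityI) (auto simp: words_def)
  show "(\<lambda>z \<in> A. map (\<lambda>i. \<nu> (inv_into A \<beta> i)) [0..<v] ! \<beta> z) = \<nu>" if "\<nu> \<in> A \<rightarrow>\<^sub>E D" for \<nu>
    using that b bij_betw_inv_into_left[OF \<beta>]
    by (auto simp: fun_eq_iff PiE_iff extensional_def)
qed

text \<open>
  The functor to matrices determined by \<open>X\<close> counts the homomorphisms into \<open>X\<close> with prescribed
  restrictions along the legs.
\<close>

lemma ent_val:
  assumes X: "hypergraph_over \<Sigma> X" and c: "is_cospan \<Sigma> c" and e: "enumeration (apex c) \<beta> v hs"
    and w: "x \<in> words (nodes X) (cdom c)" "y \<in> words (nodes X) (ccod c)"
  shows "entry (frob_interp.val (mat_prop (nodes X)) (mat_mu (nodes X)) (mat_eta (nodes X))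
      (mat_delta (nodes X))
    (mat_eps (nodes X)) (weight \<Sigma> X) c \<beta> v hs) x y = card (homs c X x y)"
proof -
  let ?D = "nodes X" and ?G = "apex c"
  have fD: "finite ?D" using X by (simp add: hypergraph_over_def)
  then interpret mat_frob ?D by unfold_locales
  interpret frob_interp "mat_prop ?D" "mat_mu ?D" "mat_eta ?D" "mat_delta ?D" "mat_eps ?D" \<Sigma> "weight \<Sigma> X"
    by (rule frob_interp_mat[OF X])
  have G: "hypergraph_over \<Sigma> ?G" using c by (simp add: is_cospan_def)
  have fG: "finite (nodes ?G)" "finite (hedges ?G)" using G by (simp_all add: hypergraph_over_def)
  have \<beta>: "bij_betw \<beta> (nodes ?G) {..<v}" and hs: "distinct hs" "set hs = hedges ?G" using e
      by (auto simp: enumeration_def)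
  define E where "E \<nu> h = {e \<in> hedges X. label X e = label ?G h \<and>
      sources X e = map \<nu> (sources ?G h) \<and> targets X e = map \<nu> (targets ?G h)}" for \<nu> h
  define C where "C \<nu> \<longleftrightarrow> map (\<lambda>i. \<nu> (fst (in_leg c) i)) [0..<cdom c] = x \<and>
      map (\<lambda>i. \<nu> (fst (out_leg c) i)) [0..<ccod c] = y" for \<nu> :: "nat \<Rightarrow> nat"
  define W where "W \<nu> = of_bool (C \<nu>) * (\<Prod>h \<in> hedges ?G. card (E \<nu> h))" for \<nu>
  let ?N = "nodes ?G \<rightarrow>\<^sub>E ?D"
  have fN: "finite ?N" using fG fD by (auto intro: finite_PiE)
  have "card (homs c X x y) = (\<Sum>\<nu> \<in> {\<nu> \<in> ?N. C \<nu>}. card (PiE (hedges ?G) (E \<nu>)))"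
    unfolding homs_Sigma C_def E_def
    by (rule card_SigmaI) (use fN fG X in \<open>auto simp: hypergraph_over_def intro!: finite_PiE\<close>)
  also have "\<dots> = (\<Sum>\<nu> \<in> {\<nu> \<in> ?N. C \<nu>}. W \<nu>)"
    by (rule sum.cong) (simp_all add: card_PiE fG W_def)
  also have "\<dots> = (\<Sum>\<nu> \<in> ?N. W \<nu>)"
    by (rule sum.mono_neutral_left) (use fN in \<open>auto simp: W_def\<close>)
  also have "\<dots> = (\<Sum>a \<in> words ?D v. W (\<lambda>z \<in> nodes ?G. a ! \<beta> z))"
    by (rule sum.reindex_bij_betw[OF words_bij[OF \<beta>], symmetric])
  also have "\<dots> = entry (val c \<beta> v hs) x y"
    unfolding val_def ent_nf[OF val_ok[OF c e] w]
  proof (rule sum.cong[OF HOL.refl])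
    fix a assume a: "a \<in> words ?D v"
    let ?\<nu> = "\<lambda>z \<in> nodes ?G. a ! \<beta> z"
    have aD: "a ! \<beta> z \<in> ?D" if "z \<in> nodes ?G" for z
      using a enumeration_less[OF e that] by (auto simp: words_def subset_eq)
    have "(\<Prod>(s, \<gamma>, t) \<leftarrow> map (edge_of ?G \<beta>) hs. entry \<gamma> (map ((!) a) s) (map ((!) a) t))
      = (\<Prod>h \<leftarrow> hs. card (E ?\<nu> h))"
      unfolding map_map
    proof (intro arg_cong[where f = prod_list] map_cong HOL.refl)
      fix h assume "h \<in> set hs"
      then have h: "h \<in> hedges ?G" using hs by simp
      then have s: "set (sources ?G h) \<subseteq> nodes ?G" "set (targets ?G h) \<subseteq> nodes ?G"
        "length (sources ?G h) = arity \<Sigma> (label ?G h)" "length (targets ?G h) = coarity \<Sigma> (label ?G h)"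
        using G by (simp_all add: hypergraph_over_def)
      have m: "map ((!) a) (map \<beta> l) = map ?\<nu> l" if "set l \<subseteq> nodes ?G" for l
        using that by auto
      have mw: "map ?\<nu> l \<in> words ?D (length l)" if "set l \<subseteq> nodes ?G" for l
        using that aD by (auto simp: words_def)
      show "((\<lambda>(s, \<gamma>, t). entry \<gamma> (map ((!) a) s) (map ((!) a) t)) \<circ> edge_of ?G \<beta>) h = card (E ?\<nu> h)"
        using mw[OF s(1)] mw[OF s(2)] s(3,4)
        by (simp only: comp_apply edge_of_def prod.case m[OF s(1)] m[OF s(2)] weight_def ent_mk E_def)
    qed
    also have "\<dots> = (\<Prod>h \<in> hedges ?G. card (E ?\<nu> h))"
      by (simp only: prod.distinct_set_conv_list[OF hs(1)] flip: hs(2))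
    finally have 1: "(\<Prod>(s, \<gamma>, t) \<leftarrow> map (edge_of ?G \<beta>) hs. entry \<gamma> (map ((!) a) s) (map ((!) a) t))
      = (\<Prod>h \<in> hedges ?G. card (E ?\<nu> h))" .
    have "map (\<lambda>i. ?\<nu> (fst (in_leg c) i)) [0..<cdom c] = pull (cdom c) (\<lambda>x. \<beta> (fst (in_leg c) x)) a"
      "map (\<lambda>i. ?\<nu> (fst (out_leg c) i)) [0..<ccod c] = pull (ccod c) (\<lambda>x. \<beta> (fst (out_leg c) x)) a"
      using cospan_legs(1,2)[OF c] by (simp_all add: pull_def)
    then have "of_bool (C ?\<nu>) = (of_bool (x = pull (cdom c) (\<lambda>x. \<beta> (fst (in_leg c) x)) a) *
        of_bool (y = pull (ccod c) (\<lambda>x. \<beta> (fst (out_leg c) x)) a) :: nat)"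
      unfolding C_def by auto
    then show "W ?\<nu> = of_bool (x = pull (cdom c) (\<lambda>x. \<beta> (fst (in_leg c) x)) a) *
        of_bool (y = pull (ccod c) (\<lambda>x. \<beta> (fst (out_leg c) x)) a) *
        (\<Prod>(s, \<gamma>, t) \<leftarrow> map (edge_of ?G \<beta>) hs. entry \<gamma> (map ((!) a) s) (map ((!) a) t))"
      unfolding W_def 1 by simp
  qed
  finally show ?thesis ..
qed

section \<open>From homomorphism counts to isomorphisms\<close>

definition surjs :: "'g cospan \<Rightarrow> 'g hypergraph \<Rightarrow> nat list \<Rightarrow> nat list \<Rightarrow> nat set \<times> nat set \<Rightarrow> hmap set"
    where
  "surjs c X x y S = {h \<in> homs c X x y. (fst h ` nodes (apex c), snd h ` hedges (apex c)) = S}"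

abbreviation sub_hyp :: "'g hypergraph \<Rightarrow> nat set \<times> nat set \<Rightarrow> 'g hypergraph" where
  "sub_hyp X S \<equiv> X\<lparr>nodes := fst S, hedges := snd S\<rparr>"

text \<open>Homomorphisms into the restriction are sorted by their image. The index set has all
  pairs of subsets; those that are not closed under endpoints contribute nothing, by
  \<open>surjs_sub_hyp\<close>.\<close>

lemma homs_sub_hyp:
  assumes "fst S \<subseteq> nodes X" "snd S \<subseteq> hedges X"
  shows "homs c (sub_hyp X S) x y = (\<Union>S' \<in> Pow (fst S) \<times> Pow (snd S). surjs c X x y S')"
  using assms unfolding homs_def surjs_def hyp_hom_def
  by (fastforce simp: PiE_iff subset_eq)

text \<open>The image of a homomorphism contains the sources and targets of its hyperedges, since
  these are images of sources and targets.\<close>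

lemma surjs_sub_hyp:
  assumes X: "hypergraph_over \<Sigma> X" and c: "is_cospan \<Sigma> c" and h: "h \<in> surjs c X x y S"
  shows "hypergraph_over \<Sigma> (sub_hyp X S)"
proof -
  have G: "hypergraph_over \<Sigma> (apex c)" using c by (simp add: is_cospan_def)
  have hom: "hyp_hom (apex c) X h" and S: "S = (fst h ` nodes (apex c), snd h ` hedges (apex c))"
    using h by (auto simp: surjs_def homs_def)
  have "fst h x \<in> nodes X" if "x \<in> nodes (apex c)" for x using hom that by (auto simp: hyp_hom_def)
  moreover have "snd h x \<in> hedges X" if "x \<in> hedges (apex c)" for x using hom that
      by (auto simp: hyp_hom_def)
  ultimately show ?thesis
    using G X hom unfolding S hypergraph_over_def hyp_hom_def by (auto 0 3)
qed

text \<open>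
  Lov\'asz's argument: hom counts determine, by induction over subhypergraphs, the number of
  surjective homomorphisms.
\<close>

lemma card_surjs_eq:
  assumes c: "is_cospan \<Sigma> c" and d: "is_cospan \<Sigma> d"
    and eq: "\<And>X x y. hypergraph_over \<Sigma> X \<Longrightarrow> card (homs c X x y) = card (homs d X x y)"
    and X: "hypergraph_over \<Sigma> X" and S: "fst S \<subseteq> nodes X" "snd S \<subseteq> hedges X"
  shows "card (surjs c X x y S) = card (surjs d X x y S)"
  using S
proof (induction "card (fst S) + card (snd S)" arbitrary: S rule: less_induct)
  case less
  have fS: "finite (fst S)" "finite (snd S)"
    using less.prems X unfolding hypergraph_over_def by (auto intro: finite_subset)
  show ?case
  proof (cases "hypergraph_over \<Sigma> (sub_hyp X S)")
    \<comment> \<open>The hypothesis \<open>eq\<close> says nothing about a pair \<open>S\<close>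
      that is not closed under endpoints, but such a pair is not the image of any
      homomorphism.\<close>
    case False
    then have "surjs c X x y S = {}" "surjs d X x y S = {}" using surjs_sub_hyp[OF X] c d by blast+
    then show ?thesis by simp
  next
    case True
    let ?I = "Pow (fst S) \<times> Pow (snd S)"
    have fI: "finite ?I" using fS by simp
    have SI: "S \<in> ?I" by (cases S) simp
    have sum: "card (homs c' (sub_hyp X S) x y)
        = card (surjs c' X x y S) + (\<Sum>S' \<in> ?I - {S}. card (surjs c' X x y S'))"
      if c': "is_cospan \<Sigma> c'" for c'
    proof -
      have fin: "finite (homs c' X x y)" using finite_homs X c' unfolding is_cospan_def by blast
      have "card (homs c' (sub_hyp X S) x y) = (\<Sum>S' \<in> ?I. card (surjs c' X x y S'))"
        unfolding homs_sub_hyp[OF less.prems]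
      proof (rule card_UN_disjoint[OF fI])
        show "\<forall>S' \<in> ?I. finite (surjs c' X x y S')"
          using finite_subset[OF _ fin] by (auto simp: surjs_def)
        show "\<forall>A \<in> ?I. \<forall>B \<in> ?I. A \<noteq> B \<longrightarrow> surjs c' X x y A \<inter> surjs c' X x y B = {}"
          by (auto simp: surjs_def)
      qed
      also have "\<dots> = card (surjs c' X x y S) + (\<Sum>S' \<in> ?I - {S}. card (surjs c' X x y S'))"
        by (rule sum.remove[OF fI SI])
      finally show ?thesis .
    qed
    have "(\<Sum>S' \<in> ?I - {S}. card (surjs c X x y S')) = (\<Sum>S' \<in> ?I - {S}. card (surjs d X x y S'))"
    proof (rule sum.cong[OF HOL.refl])
      fix S' assume S': "S' \<in> ?I - {S}"
      then have sub_hyp: "fst S' \<subseteq> fst S" "snd S' \<subseteq> snd S" and ne: "S' \<noteq> S" by auto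
      have le: "card (fst S') \<le> card (fst S)" "card (snd S') \<le> card (snd S)"
        using sub_hyp fS by (auto intro: card_mono)
      have "card (fst S') < card (fst S) \<or> card (snd S') < card (snd S)"
      proof (rule ccontr)
        assume "\<not> ?thesis"
        then have "card (fst S') = card (fst S)" "card (snd S') = card (snd S)" using le by auto
        then have "fst S' = fst S" "snd S' = snd S" using sub_hyp fS card_subset_eq by blast+
        then show False using ne by (simp add: prod_eq_iff)
      qed
      then have "card (fst S') + card (snd S') < card (fst S) + card (snd S)" using le by linarith
      then show "card (surjs c X x y S') = card (surjs d X x y S')"
        using less.hyps[of S'] sub_hyp less.prems by blast
    qed
    then show ?thesis using sum[OF c] sum[OF d] eq[OF True, of x y] by simp
  qed
qed

lemma bij_hom_inverse:
  assumes G: "hypergraph_over \<Sigma> G" and H: "hypergraph_over \<Sigma> H" and u: "hyp_hom G H u"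
    and b: "bij_betw (fst u) (nodes G) (nodes H)" "bij_betw (snd u) (hedges G) (hedges H)"
  shows "\<exists>v. hyp_inverse G H u v"
proof
  let ?f = "inv_into (nodes G) (fst u)" and ?g = "inv_into (hedges G) (snd u)"
  let ?v = "(restrict ?f (nodes H), restrict ?g (hedges H))"
  have f: "?f x \<in> nodes G" "fst u (?f x) = x" if "x \<in> nodes H" for x
    using bij_betw_inv_into_right[OF b(1) that] bij_betw_apply[OF bij_betw_inv_into[OF b(1)] that]
        by auto
  have g: "?g x \<in> hedges G" "snd u (?g x) = x" if "x \<in> hedges H" for x
    using bij_betw_inv_into_right[OF b(2) that] bij_betw_apply[OF bij_betw_inv_into[OF b(2)] that]
        by auto
  have f': "?f (fst u x) = x" if "x \<in> nodes G" for x using bij_betw_inv_into_left[OF b(1) that] .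
  have g': "?g (snd u x) = x" if "x \<in> hedges G" for x using bij_betw_inv_into_left[OF b(2) that] .
  have un: "fst u x \<in> nodes H" if "x \<in> nodes G" for x using u that by (auto simp: hyp_hom_def)
  have ue: "snd u x \<in> hedges H" if "x \<in> hedges G" for x using u that by (auto simp: hyp_hom_def)
  have "hyp_hom H G ?v"
    unfolding hyp_hom_def
  proof (intro conjI ballI)
    fix h assume h: "h \<in> hedges H"
    let ?k = "?g h"
    have k: "?k \<in> hedges G" "snd u ?k = h" using g[OF h] by auto
    have s: "set (sources G ?k) \<subseteq> nodes G" "set (targets G ?k) \<subseteq> nodes G"
      using G k(1) by (simp_all add: hypergraph_over_def)
    have H': "sources H h = map (fst u) (sources G ?k)" "targets H h = map (fst u) (targets G ?k)"
        "label H h = label G ?k"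
      using u k by (auto simp: hyp_hom_def)
    have m: "map (restrict ?f (nodes H)) (map (fst u) l) = l" if "set l \<subseteq> nodes G" for l
      using that f' un by (auto intro!: map_idI)
    show "sources G (snd ?v h) = map (fst ?v) (sources H h)"
        "targets G (snd ?v h) = map (fst ?v) (targets H h)"
      "label G (snd ?v h) = label H h"
      using h H' m[OF s(1)] m[OF s(2)] by simp_all
  qed (use f g in auto)
  then show "hyp_inverse G H u ?v"
    unfolding hyp_inverse_def using u f g f' g' un ue
    by (auto simp: hyp_seq_def hyp_id_def compose_def fun_eq_iff restrict_def)
qed

text \<open>The identity of a cospan is a surjection onto its apex compatible with the legs, so the
  number of these is positive; equal counts then provide such surjections between \<open>c\<close>
  and \<open>d\<close> in both directions, and finiteness makes them isomorphisms.\<close>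

lemma cospan_iso_of_counts:
  fixes c d :: "'g cospan"
  assumes c: "is_cospan \<Sigma> c" and d: "is_cospan \<Sigma> d" and dc: "cdom c = cdom d" "ccod c = ccod d"
    and eq: "\<And>X x y. hypergraph_over \<Sigma> X \<Longrightarrow> card (homs c X x y) = card (homs d X x y)"
  shows "cospan_iso \<Sigma> c d"
proof -
  have surj: "\<exists>u. hyp_hom (apex a) (apex b) u \<and> fst u ` nodes (apex a)
      = nodes (apex b) \<and> snd u ` hedges (apex a) = hedges (apex b)
    \<and> (\<forall>i < cdom b. fst u (fst (in_leg a) i) = fst (in_leg b) i) \<and>
        (\<forall>i < ccod b. fst u (fst (out_leg a) i) = fst (out_leg b) i)"
    if a: "is_cospan \<Sigma> a" and b: "is_cospan \<Sigma> b" and ab: "cdom a = cdom b" "ccod a = ccod b"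
      and eq: "\<And>X x y. hypergraph_over \<Sigma> X \<Longrightarrow> card (homs a X x y) = card (homs b X x y)"
          for a b :: "'g cospan"
  proof -
    \<comment> \<open>The prescribed restrictions are the legs of \<open>b\<close> themselves, so a
      homomorphism counted here commutes with the legs.\<close>
    let ?x = "map (fst (in_leg b)) [0..<cdom b]" and ?y = "map (fst (out_leg b)) [0..<ccod b]"
    let ?S = "(nodes (apex b), hedges (apex b))"
    have o: "hypergraph_over \<Sigma> (apex b)" using b by (simp add: is_cospan_def)
    have "hyp_id (apex b) \<in> surjs b (apex b) ?x ?y ?S"
      unfolding surjs_def homs_def using hyp_hom_id[OF o] cospan_legs(1,2)[OF b]
          by (auto simp: hyp_id_def)
    moreover have "finite (surjs b (apex b) ?x ?y ?S)"
      by (rule finite_subset[OF _ finite_homs[OF o o]]) (auto simp: surjs_def)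
    ultimately have "card (surjs b (apex b) ?x ?y ?S) > 0" using card_gt_0_iff by blast
    then have "card (surjs a (apex b) ?x ?y ?S) > 0" using card_surjs_eq[OF a b eq o, of ?S] by simp
    then have "surjs a (apex b) ?x ?y ?S \<noteq> {}" by (auto simp: card_gt_0_iff)
    then obtain u where u: "u \<in> surjs a (apex b) ?x ?y ?S" by blast
    then have "map (\<lambda>i. fst u (fst (in_leg a) i)) [0..<cdom b] = ?x"
        "map (\<lambda>i. fst u (fst (out_leg a) i)) [0..<ccod b] = ?y"
      using ab by (auto simp: surjs_def homs_def)
    then have "\<forall>i < cdom b. fst u (fst (in_leg a) i) = fst (in_leg b) i"
        "\<forall>i < ccod b. fst u (fst (out_leg a) i) = fst (out_leg b) i"
      by (simp_all add: map_eq_conv)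
    then show ?thesis using u by (intro exI[of _ u]) (auto simp: surjs_def homs_def)
  qed
  let ?G = "apex c" and ?H = "apex d"
  have o: "hypergraph_over \<Sigma> ?G" "hypergraph_over \<Sigma> ?H" using c d by (simp_all add: is_cospan_def)
  have fin: "finite (nodes ?G)" "finite (hedges ?G)" "finite (nodes ?H)" "finite (hedges ?H)"
    using o by (simp_all add: hypergraph_over_def)
  obtain u where u: "hyp_hom ?G ?H u" "fst u ` nodes ?G = nodes ?H" "snd u ` hedges ?G = hedges ?H"
    "\<And>i. i < cdom d \<Longrightarrow> fst u (fst (in_leg c) i) = fst (in_leg d) i"
        "\<And>i. i < ccod d \<Longrightarrow> fst u (fst (out_leg c) i) = fst (out_leg d) i"
    using surj[OF c d dc eq] by blast
  obtain v where v: "fst v ` nodes ?H = nodes ?G" "snd v ` hedges ?H = hedges ?G"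
    using surj[OF d c dc[symmetric] eq[symmetric]] by blast
  \<comment> \<open>Surjections in both directions leave no room for a drop in cardinality, so
    \<open>u\<close> is injective.\<close>
  have cards: "card (fst u ` nodes ?G) = card (nodes ?G)" "card (snd u ` hedges ?G) = card (hedges ?G)"
    using card_image_le[OF fin(1), of "fst u"] card_image_le[OF fin(2), of "snd u"]
      card_image_le[OF fin(3), of "fst v"] card_image_le[OF fin(4), of "snd v"] u(2,3) v by simp_all
  have "inj_on (fst u) (nodes ?G)" "inj_on (snd u) (hedges ?G)"
    using eq_card_imp_inj_on[OF fin(1) cards(1)] eq_card_imp_inj_on[OF fin(2) cards(2)] .
  then have "bij_betw (fst u) (nodes ?G) (nodes ?H)" "bij_betw (snd u) (hedges ?G) (hedges ?H)"
    using u(2,3) by (simp_all add: bij_betw_def)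
  then obtain w where w: "hyp_inverse ?G ?H u w" using bij_hom_inverse[OF o u(1)] by blast
  have leg: "hyp_seq (discrete n :: 'g hypergraph) l u = l'"
    if "l = discrete_map n f" "l' = discrete_map n f'" "\<And>i. i < n \<Longrightarrow> fst u (fst l i) = fst l' i"
        for l l' n f f'
    unfolding that(1,2) hyp_seq_discrete by (rule discrete_map_cong) (use that in simp)
  obtain f f' g g' where l: "in_leg c = discrete_map (cdom c) f" "in_leg d = discrete_map (cdom d) f'"
    "out_leg c = discrete_map (ccod c) g" "out_leg d = discrete_map (ccod d) g'"
    using c d unfolding is_cospan_def hyp_hom_discrete by blast
  show ?thesis
    by (rule cospan_isoI[OF c d dc w])
      (use leg[OF l(1)] leg[OF l(3)] l u(4,5) dc in auto)
qed

section \<open>Morphisms of PROPs preserve values of cospans\<close>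

context
  fixes P :: "'a prop_struct" and R :: "'b prop_struct" and H mu eta delta eps
  assumes mor: "prop_morphism P R H" and fp: "frob_prop P mu eta delta eps"
begin

interpretation frob_prop P mu eta delta eps by (rule fp)
interpretation prop_mor P R H using mor by (rule prop_morI)

lemma frob_image: "frob_prop R (H mu) (H eta) (H delta) (H eps)"
proof (intro frob_prop.intro frob_prop_axioms.intro)
  show "comm_monoid_prop R (H mu) (H eta)"
    by (rule comm_monoid_image[OF mor comm_monoid_prop_axioms])
  show "comm_monoid_prop (op_prop R) (H delta) (H eps)"
    by (rule comm_monoid_image[OF prop_morphism_op[OF mor] com.comm_monoid_prop_axioms])
  show "(H delta \<oplus>\<^bsub>R\<^esub> ident R 1) \<Zsemi>\<^bsub>R\<^esub> (ident R 1 \<oplus>\<^bsub>R\<^esub> H mu) = H mu \<Zsemi>\<^bsub>R\<^esub> H delta"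
    using arg_cong[OF frob_left, of H] by (simp add: H_seq H_par)
  show "H mu \<Zsemi>\<^bsub>R\<^esub> H delta = (ident R 1 \<oplus>\<^bsub>R\<^esub> H delta) \<Zsemi>\<^bsub>R\<^esub> (H mu \<oplus>\<^bsub>R\<^esub> ident R 1)"
    using arg_cong[OF frob_right, of H] by (simp add: H_seq H_par)
  show "H delta \<Zsemi>\<^bsub>R\<^esub> H mu = ident R 1"
    using arg_cong[OF special, of H] by (simp add: H_seq H_par)
qed

interpretation img: frob_prop R "H mu" "H eta" "H delta" "H eps" by (rule frob_image)

lemma star_H: "maps n m f \<Longrightarrow> H (star n m f) = img.star n m f"
  by (rule star_image[OF mor comm_monoid_prop_axioms])

lemma costar_H: "maps n m f \<Longrightarrow> H (costar n m f) = img.costar n m f"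
  by (rule star_image[OF prop_morphism_op[OF mor] com.comm_monoid_prop_axioms])

lemma attach_image: "edge_ok v (s, \<gamma>, t) \<Longrightarrow> H (attach v s \<gamma> t) = img.attach v s (H \<gamma>) t"
  by (simp add: attach_def img.attach_def H_seq H_par star_H costar_H edge_ok.simps)

lemma attaches_image:
    "edges_ok v es \<Longrightarrow> H (attaches v es) = img.attaches v (map (\<lambda>(s, \<gamma>, t). (s, H \<gamma>, t)) es)"
proof (induction es)
  case (Cons e es)
  obtain s \<gamma> t where e: "e = (s, \<gamma>, t)" by (cases e)
  show ?case using Cons by (simp add: e H_seq attach_image)
qed simp

lemma nf_image:
  "maps n v i \<Longrightarrow> maps m v j \<Longrightarrow> edges_ok v es \<Longrightarrow>
    H (nf n m v i es j) = img.nf n m v i (map (\<lambda>(s, \<gamma>, t). (s, H \<gamma>, t)) es) j"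
  by (simp add: nf_def img.nf_def H_seq star_H costar_H attaches_image)

end

text \<open>Values are built from the Frobenius structure, the interpreted generators and the PROP
  operations. This links \<open>den\<close> in the coproduct with the state sums.\<close>

lemma val_image:
  assumes mor: "prop_morphism P R H" and P: "frob_interp P mu eta delta eps \<Sigma> \<gamma>"
    and \<gamma>: "\<And>g. g \<in> gens \<Sigma> \<Longrightarrow> H (\<gamma> g) = \<gamma>' g"
    and c: "is_cospan \<Sigma> c" and e: "enumeration (apex c) \<beta> v hs"
  shows "H (frob_interp.val P mu eta delta eps \<gamma> c \<beta> v hs)
    = frob_interp.val R (H mu) (H eta) (H delta) (H eps) \<gamma>' c \<beta> v hs"
proof -
  interpret P: frob_interp P mu eta delta eps \<Sigma> \<gamma> by (rule P)
  interpret R: frob_prop R "H mu" "H eta" "H delta" "H eps"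
      by (rule frob_image[OF mor P.frob_prop_axioms])
  interpret mm: prop_mor P R H using mor by (rule prop_morI)
  have \<gamma>R: "\<gamma>' g \<in> arr R (arity \<Sigma> g) (coarity \<Sigma> g)" if "g \<in> gens \<Sigma>" for g
    using mm.H_arr[OF P.\<gamma>[OF that]] \<gamma>[OF that] by simp
  interpret R: frob_interp R "H mu" "H eta" "H delta" "H eps" \<Sigma> \<gamma>'
    by unfold_locales (rule \<gamma>R)
  have "label (apex c) h \<in> gens \<Sigma>" if "h \<in> set hs" for h
    using c e that by (auto simp: is_cospan_def hypergraph_over_def enumeration_def)
  then have eq: "map (\<lambda>(s, \<gamma>, t). (s, H \<gamma>, t)) (map (P.edge_of (apex c) \<beta>) hs)
      = map (R.edge_of (apex c) \<beta>) hs"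
    by (simp add: P.edge_of_def R.edge_of_def \<gamma>)
  show ?thesis
    unfolding P.val_def R.val_def nf_image[OF mor P.frob_prop_axioms P.val_ok[OF c e]] eq ..
qed

section \<open>The isomorphism\<close>

text \<open>
  The laws of a PROP are reflected along maps that are injective on hom-sets, so \<open>P\<close> need not be known
  to be a PROP.
\<close>

lemma isomorphic_propsI:
  fixes P :: "'a prop_struct" and Q :: "'b prop_struct"
  assumes Q: "is_prop Q"
    and F: "\<And>f n m. f \<in> arr P n m \<Longrightarrow> F f \<in> arr Q n m"
    and inj: "\<And>f g n m. f \<in> arr P n m \<Longrightarrow> g \<in> arr P n m \<Longrightarrow> F f = F g \<Longrightarrow> f = g"
    and surj: "\<And>q n m. q \<in> arr Q n m \<Longrightarrow> \<exists>f \<in> arr P n m. F f = q"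
    and id: "\<And>n. ident P n \<in> arr P n n" "\<And>n. F (ident P n) = ident Q n"
    and br: "\<And>n m. braid P n m \<in> arr P (n + m) (m + n)" "\<And>n m. F (braid P n m) = braid Q n m"
    and sq: "\<And>f g n m k. f \<in> arr P n m \<Longrightarrow> g \<in> arr P m k \<Longrightarrow> f \<Zsemi>\<^bsub>P\<^esub> g \<in> arr P n k"
      "\<And>f g n m k. f \<in> arr P n m \<Longrightarrow> g \<in> arr P m k \<Longrightarrow> F (f \<Zsemi>\<^bsub>P\<^esub> g) = F f \<Zsemi>\<^bsub>Q\<^esub> F g"
    and pr: "\<And>f g n m n' m'. f \<in> arr P n m \<Longrightarrow> g \<in> arr P n' m' \<Longrightarrow> f \<oplus>\<^bsub>P\<^esub> g \<in> arr P (n + n') (m + m')"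
      "\<And>f g n m n' m'. f \<in> arr P n m \<Longrightarrow> g \<in> arr P n' m' \<Longrightarrow> F (f \<oplus>\<^bsub>P\<^esub> g) = F f \<oplus>\<^bsub>Q\<^esub> F g"
  shows "P \<cong>\<^sub>P Q"
proof -
  interpret Q: is_prop Q by (rule Q)
  have P: "is_prop P"
  proof
    fix f g h f' g' n m n' m' k l n'' m'' k'
    show "f \<in> arr P n m \<Longrightarrow> f \<in> arr P n' m' \<Longrightarrow> n = n' \<and> m = m'" using F Q.arr_disjoint by blast
    show "ident P n \<in> arr P n n" "braid P n m \<in> arr P (n + m) (m + n)" by (rule id br)+
    show "f \<in> arr P n m \<Longrightarrow> g \<in> arr P m k \<Longrightarrow> f \<Zsemi>\<^bsub>P\<^esub> g \<in> arr P n k" by (rule sq)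
    show "f \<in> arr P n m \<Longrightarrow> g \<in> arr P n' m' \<Longrightarrow> f \<oplus>\<^bsub>P\<^esub> g \<in> arr P (n + n') (m + m')" by (rule pr)
    show "(f \<Zsemi>\<^bsub>P\<^esub> g) \<Zsemi>\<^bsub>P\<^esub> h = f \<Zsemi>\<^bsub>P\<^esub> (g \<Zsemi>\<^bsub>P\<^esub> h)"
      if t: "f \<in> arr P n m" "g \<in> arr P m k" "h \<in> arr P k l"
      by (rule inj[OF sq(1)[OF sq(1)[OF t(1,2)] t(3)] sq(1)[OF t(1) sq(1)[OF t(2,3)]]])
        (simp add: sq(2)[OF sq(1)[OF t(1,2)] t(3)] sq(2)[OF t(1) sq(1)[OF t(2,3)]] sq(2)[OF t(1,2)]
            sq(2)[OF t(2,3)]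
          Q.seq_assoc[OF F[OF t(1)] F[OF t(2)] F[OF t(3)]])
    show "ident P n \<Zsemi>\<^bsub>P\<^esub> f = f" if t: "f \<in> arr P n m"
      by (rule inj[OF sq(1)[OF id(1) t] t]) (simp add: sq(2)[OF id(1) t] id Q.ident_seq[OF F[OF t]])
    show "f \<Zsemi>\<^bsub>P\<^esub> ident P m = f" if t: "f \<in> arr P n m"
      by (rule inj[OF sq(1)[OF t id(1)] t]) (simp add: sq(2)[OF t id(1)] id Q.seq_ident[OF F[OF t]])
    show "(f \<oplus>\<^bsub>P\<^esub> g) \<oplus>\<^bsub>P\<^esub> h = f \<oplus>\<^bsub>P\<^esub> (g \<oplus>\<^bsub>P\<^esub> h)"
      if t: "f \<in> arr P n m" "g \<in> arr P n' m'" "h \<in> arr P n'' m''"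
      by (rule inj[OF pr(1)[OF pr(1)[OF t(1,2)] t(3)] pr(1)[OF t(1) pr(1)[OF t(2,3)], folded add.assoc]])
        (simp add: pr(2)[OF pr(1)[OF t(1,2)] t(3)] pr(2)[OF t(1) pr(1)[OF t(2,3)]] pr(2)[OF t(1,2)]
            pr(2)[OF t(2,3)]
          Q.par_assoc[OF F[OF t(1)] F[OF t(2)] F[OF t(3)]])
    show "ident P 0 \<oplus>\<^bsub>P\<^esub> f = f" if t: "f \<in> arr P n m"
      by (rule inj[OF pr(1)[OF id(1) t, of 0, unfolded add_0] t])
          (simp add: pr(2)[OF id(1) t] id Q.ident_par[OF F[OF t]])
    show "f \<oplus>\<^bsub>P\<^esub> ident P 0 = f" if t: "f \<in> arr P n m"
      by (rule inj[OF pr(1)[OF t id(1), of 0, unfolded add_0_right] t])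
          (simp add: pr(2)[OF t id(1)] id Q.par_ident[OF F[OF t]])
    show "(f \<oplus>\<^bsub>P\<^esub> g) \<Zsemi>\<^bsub>P\<^esub> (f' \<oplus>\<^bsub>P\<^esub> g') = (f \<Zsemi>\<^bsub>P\<^esub> f') \<oplus>\<^bsub>P\<^esub> (g \<Zsemi>\<^bsub>P\<^esub> g')"
      if t: "f \<in> arr P n m" "f' \<in> arr P m k" "g \<in> arr P n' m'" "g' \<in> arr P m' k'"
      by (rule inj[OF sq(1)[OF pr(1)[OF t(1,3)] pr(1)[OF t(2,4)]] pr(1)[OF sq(1)[OF t(1,2)] sq(1)[OF
          t(3,4)]]])
        (simp add: sq(2)[OF pr(1)[OF t(1,3)] pr(1)[OF t(2,4)]] pr(2)[OF sq(1)[OF t(1,2)] sq(1)[OF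
            t(3,4)]]
          pr(2)[OF t(1,3)] pr(2)[OF t(2,4)] sq(2)[OF t(1,2)] sq(2)[OF t(3,4)]
          Q.interchange[OF F[OF t(1)] F[OF t(2)] F[OF t(3)] F[OF t(4)]])
    show "ident P n \<oplus>\<^bsub>P\<^esub> ident P m = ident P (n + m)"
      by (rule inj[OF pr(1)[OF id(1) id(1)] id(1)])
          (simp add: pr(2)[OF id(1) id(1)] id Q.ident_par_ident)
    show "(f \<oplus>\<^bsub>P\<^esub> g) \<Zsemi>\<^bsub>P\<^esub> braid P m m' = braid P n n' \<Zsemi>\<^bsub>P\<^esub> (g \<oplus>\<^bsub>P\<^esub> f)"
      if t: "f \<in> arr P n m" "g \<in> arr P n' m'"
      by (rule inj[OF sq(1)[OF pr(1)[OF t] br(1)] sq(1)[OF br(1) pr(1)[OF t(2,1)]]])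
        (simp add: sq(2)[OF pr(1)[OF t] br(1)] sq(2)[OF br(1) pr(1)[OF t(2,1)]] pr(2)[OF t] pr(2)[OF
            t(2,1)] br
          Q.braid_natural[OF F[OF t(1)] F[OF t(2)]])
    show "braid P n m \<Zsemi>\<^bsub>P\<^esub> braid P m n = ident P (n + m)"
      by (rule inj[OF sq(1)[OF br(1) br(1)] id(1)]) (simp add: sq(2)[OF br(1) br(1)] br id Q.braid_braid)
    have t: "braid P n m \<oplus>\<^bsub>P\<^esub> ident P k \<in> arr P (n + (m + k)) (m + (n + k))"
      "ident P m \<oplus>\<^bsub>P\<^esub> braid P n k \<in> arr P (m + (n + k)) (m + k + n)"
      using pr(1)[OF br(1)[of n m] id(1)[of k]] pr(1)[OF id(1)[of m] br(1)[of n k]]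
          by (simp_all add: ac_simps)
    show "braid P n (m + k) = (braid P n m \<oplus>\<^bsub>P\<^esub> ident P k) \<Zsemi>\<^bsub>P\<^esub> (ident P m \<oplus>\<^bsub>P\<^esub> braid P n k)"
      by (rule inj[OF br(1) sq(1)[OF t]])
        (simp add: sq(2)[OF t] br id pr(2)[OF br(1)[of n m] id(1)[of k]] pr(2)[OF id(1)[of m] br(1)[of n
            k]] Q.braid_hexagon)
    show "braid P n 0 = ident P n"
      by (rule inj[OF br(1)[of n 0, unfolded add_0 add_0_right] id(1)]) (simp add: br id Q.braid_unit)
  qed
  have morF: "prop_morphism P Q F"
    unfolding prop_morphism_def
    by (intro conjI allI ballI P Q id br; (rule F sq(2) pr(2); assumption))
  \<comment> \<open>\<open>F\<close> is injective on each hom-set only, so the preimage is chosen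
    within the hom-set of \<open>q\<close>.\<close>
  define G where "G q = (SOME f. f \<in> arr P (prop_dom Q q) (prop_cod Q q) \<and> F f = q)" for q
  have G: "G q \<in> arr P n m" "F (G q) = q" if q: "q \<in> arr Q n m" for q n m
  proof -
    have "G q \<in> arr P (prop_dom Q q) (prop_cod Q q) \<and> F (G q) = q"
      unfolding G_def by (rule someI_ex) (use surj[OF q] prop_dom_eq[OF Q q] in blast)
    then show "G q \<in> arr P n m" "F (G q) = q" using prop_dom_eq[OF Q q] by auto
  qed
  have GF: "G (F f) = f" if f: "f \<in> arr P n m" for f n m
    using inj[OF G(1)[OF F[OF f]] f G(2)[OF F[OF f]]] .
  have morG: "prop_morphism Q P G"
    unfolding prop_morphism_def
  proof (intro conjI allI ballI P Q)
    show "G (ident Q n) = ident P n" for n using GF[OF id(1)] id(2) by simp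
    show "G (braid Q n m) = braid P n m" for n m using GF[OF br(1)] br(2) by simp
    show "G f \<in> arr P n m" if "f \<in> arr Q n m" for f n m using G(1)[OF that] .
    show "G (f \<Zsemi>\<^bsub>Q\<^esub> g) = G f \<Zsemi>\<^bsub>P\<^esub> G g" if t: "f \<in> arr Q n m" "g \<in> arr Q m k" for f g n m k
      using GF[OF sq(1)[OF G(1)[OF t(1)] G(1)[OF t(2)]]] sq(2)[OF G(1)[OF t(1)] G(1)[OF t(2)]]
          by (simp add: G(2)[OF t(1)] G(2)[OF t(2)])
    show "G (f \<oplus>\<^bsub>Q\<^esub> g) = G f \<oplus>\<^bsub>P\<^esub> G g" if t: "f \<in> arr Q n m" "g \<in> arr Q n' m'" for f g n m n' m'
      using GF[OF pr(1)[OF G(1)[OF t(1)] G(1)[OF t(2)]]] pr(2)[OF G(1)[OF t(1)] G(1)[OF t(2)]]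
          by (simp add: G(2)[OF t(1)] G(2)[OF t(2)])
  qed
  have "eq_on_arrows P (G \<circ> F) id" unfolding eq_on_arrows_def using GF by auto
  moreover have "eq_on_arrows Q (F \<circ> G) id" unfolding eq_on_arrows_def using G(2) by auto
  ultimately show ?thesis unfolding isomorphic_props_def using morF morG by blast
qed

section \<open>The presentation of \<open>Frob\<close> and its universal property\<close>

primrec tdom :: "'g signature \<Rightarrow> 'g sterm \<Rightarrow> nat" where
  "tdom \<Sigma> (Gen g) = arity \<Sigma> g"
| "tdom \<Sigma> (Idn n) = n"
| "tdom \<Sigma> (Swap n m) = n + m"
| "tdom \<Sigma> (s \<^bold>; t) = tdom \<Sigma> s"
| "tdom \<Sigma> (s \<^bold>\<oplus> t) = tdom \<Sigma> s + tdom \<Sigma> t"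

primrec tcod :: "'g signature \<Rightarrow> 'g sterm \<Rightarrow> nat" where
  "tcod \<Sigma> (Gen g) = coarity \<Sigma> g"
| "tcod \<Sigma> (Idn n) = n"
| "tcod \<Sigma> (Swap n m) = m + n"
| "tcod \<Sigma> (s \<^bold>; t) = tcod \<Sigma> t"
| "tcod \<Sigma> (s \<^bold>\<oplus> t) = tcod \<Sigma> s + tcod \<Sigma> t"

text \<open>A computable counterpart of \<open>has_type\<close>, by which the simplifier can check
  the types of concrete equations.\<close>

primrec well_typed :: "'g signature \<Rightarrow> 'g sterm \<Rightarrow> bool" where
  "well_typed \<Sigma> (Gen g) \<longleftrightarrow> g \<in> gens \<Sigma>"
| "well_typed \<Sigma> (Idn n) \<longleftrightarrow> True"
| "well_typed \<Sigma> (Swap n m) \<longleftrightarrow> True"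
| "well_typed \<Sigma> (s \<^bold>; t) \<longleftrightarrow> well_typed \<Sigma> s \<and> well_typed \<Sigma> t \<and> tcod \<Sigma> s = tdom \<Sigma> t"
| "well_typed \<Sigma> (s \<^bold>\<oplus> t) \<longleftrightarrow> well_typed \<Sigma> s \<and> well_typed \<Sigma> t"

lemma well_typed_has_type: "well_typed \<Sigma> t \<Longrightarrow> has_type \<Sigma> t (tdom \<Sigma> t) (tcod \<Sigma> t)"
  by (induction t) (auto intro: has_type.intros)

abbreviation gen_class :: "'g signature \<Rightarrow> ('g sterm \<times> 'g sterm) set \<Rightarrow> 'g \<Rightarrow> 'g sterm set" where
  "gen_class \<Sigma> E g \<equiv> term_class \<Sigma> E (Gen g)"

text \<open>Interpreting the generators of a presentation by their own classes evaluates a term to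
  its class, so the equations of the presentation become equations between arrows.\<close>

lemma eval_presented:
  "has_type \<Sigma> t n m \<Longrightarrow> eval_term (presented_prop \<Sigma> E) (gen_class \<Sigma> E) t = term_class \<Sigma> E t"
  by (induction rule: has_type.induct)
      (simp_all add: presented_ident presented_braid presented_seq presented_par)

lemma eval_presented_eq:
  assumes "(s, t) \<in> E" "well_typed \<Sigma> s" "well_typed \<Sigma> t" "tdom \<Sigma> s = tdom \<Sigma> t" "tcod \<Sigma> s = tcod \<Sigma> t"
  shows "eval_term (presented_prop \<Sigma> E) (gen_class \<Sigma> E) s
      = eval_term (presented_prop \<Sigma> E) (gen_class \<Sigma> E) t"
  using term_class_eq[OF term_eq.equation[OF assms(1) well_typed_has_type[OF assms(2)]]]
    eval_presented[OF well_typed_has_type] well_typed_has_type assms(2-) by metis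

abbreviation "fgen \<equiv> gen_class frob_sig frob_eqs"

lemma gen_arr: "g \<in> gens \<Sigma> \<Longrightarrow> gen_class \<Sigma> E g \<in> arr (presented_prop \<Sigma> E) (arity \<Sigma> g) (coarity \<Sigma> g)"
  by (auto simp: presented_arr_iff intro: has_type.Gen)

lemma frob_sig_simps [simp]:
  "gens frob_sig = UNIV"
  "arity frob_sig Mu = 2" "arity frob_sig Eta = 0" "arity frob_sig Delta = 1" "arity frob_sig Eps = 1"
  "coarity frob_sig Mu = 1" "coarity frob_sig Eta = 1" "coarity frob_sig Delta = 2"
      "coarity frob_sig Eps = 0"
  by (simp_all add: frob_sig_def)

lemma frob_prop_Frob: "frob_prop Frob (fgen Mu) (fgen Eta) (fgen Delta) (fgen Eps)"
proof -
  let ?i = "Idn 1"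
  have F: "is_prop Frob" unfolding Frob_def by (rule is_prop_presented_prop)
  have a: "fgen Mu \<in> arr Frob 2 1" "fgen Eta \<in> arr Frob 0 1" "fgen Delta \<in> arr Frob 1 2"
      "fgen Eps \<in> arr Frob 1 0"
    using gen_arr[of Mu frob_sig frob_eqs] gen_arr[of Eta frob_sig frob_eqs]
        gen_arr[of Delta frob_sig frob_eqs] gen_arr[of Eps frob_sig frob_eqs]
    by (simp_all add: Frob_def)
  have e: "eval_term Frob fgen s = eval_term Frob fgen t"
    if "(s, t) \<in> frob_eqs"
        "well_typed frob_sig s \<and> well_typed frob_sig t \<and> tdom frob_sig s
            = tdom frob_sig t \<and> tcod frob_sig s = tcod frob_sig t" for s t
    unfolding Frob_def using eval_presented_eq that by blast
  have eqs:
    "eval_term Frob fgen ((Gen Mu \<^bold>\<oplus> ?i) \<^bold>; Gen Mu) = eval_term Frob fgen ((?i \<^bold>\<oplus> Gen Mu) \<^bold>; Gen Mu)"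
    "eval_term Frob fgen ((Gen Eta \<^bold>\<oplus> ?i) \<^bold>; Gen Mu) = eval_term Frob fgen ?i"
    "eval_term Frob fgen ((?i \<^bold>\<oplus> Gen Eta) \<^bold>; Gen Mu) = eval_term Frob fgen ?i"
    "eval_term Frob fgen (Swap 1 1 \<^bold>; Gen Mu) = eval_term Frob fgen (Gen Mu)"
    "eval_term Frob fgen (Gen Delta \<^bold>; (Gen Delta \<^bold>\<oplus> ?i))
        = eval_term Frob fgen (Gen Delta \<^bold>; (?i \<^bold>\<oplus> Gen Delta))"
    "eval_term Frob fgen (Gen Delta \<^bold>; (Gen Eps \<^bold>\<oplus> ?i)) = eval_term Frob fgen ?i"
    "eval_term Frob fgen (Gen Delta \<^bold>; (?i \<^bold>\<oplus> Gen Eps)) = eval_term Frob fgen ?i"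
    "eval_term Frob fgen (Gen Delta \<^bold>; Swap 1 1) = eval_term Frob fgen (Gen Delta)"
    "eval_term Frob fgen ((Gen Delta \<^bold>\<oplus> ?i) \<^bold>; (?i \<^bold>\<oplus> Gen Mu)) = eval_term Frob fgen (Gen Mu \<^bold>; Gen Delta)"
    "eval_term Frob fgen (Gen Mu \<^bold>; Gen Delta) = eval_term Frob fgen ((?i \<^bold>\<oplus> Gen Delta) \<^bold>; (Gen Mu \<^bold>\<oplus> ?i))"
    "eval_term Frob fgen (Gen Delta \<^bold>; Gen Mu) = eval_term Frob fgen ?i"
    by (rule e; simp add: frob_eqs_def Let_def)+
  note eqs = eqs[unfolded eval_term.simps]
  show ?thesis
    by (intro frob_prop.intro comm_monoid_prop.intro comm_monoid_prop_axioms.intro frob_prop_axioms.intro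
        is_prop.is_prop_op F)
      (simp_all only: op_prop_simps a eqs)
qed

lemma frob_extend:
  assumes R: "frob_prop R mu eta delta eps"
  shows "\<exists>G. prop_morphism Frob R G \<and> G (fgen Mu) = mu \<and> G (fgen Eta) = eta \<and> G (fgen Delta)
      = delta \<and> G (fgen Eps) = eps"
proof -
  interpret frob_prop R mu eta delta eps by (rule R)
  let ?v = "case_frob_gen mu eta delta eps"
  have v: "?v g \<in> arr R (arity frob_sig g) (coarity frob_sig g)" for g
    by (cases g) (simp_all add: arr_iff)
  have E: "eval_term R ?v s = eval_term R ?v t" if "(s, t) \<in> frob_eqs" for s t
    using that mu_assoc mu_unit_left mu_unit_right mu_comm
      com.mu_assoc[unfolded op_simps] com.mu_unit_left[unfolded op_simps]
          com.mu_unit_right[unfolded op_simps] com.mu_comm[unfolded op_simps]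
      frob_left frob_right special
    unfolding frob_eqs_def Let_def by auto
  obtain G where G: "prop_morphism (presented_prop frob_sig frob_eqs) R G"
    "\<forall>g \<in> gens frob_sig. G (fgen g) = ?v g"
    using presented_prop_extend[OF is_prop_axioms v, of frob_eqs] E by blast
  then have "G (fgen g) = ?v g" for g by simp
  then show ?thesis using G(1) unfolding Frob_def by (intro exI[of _ G]) simp
qed

section \<open>The coproduct as an interpretation, and faithfulness\<close>

context
  fixes \<Sigma> :: "'g signature"
begin

abbreviation "SF \<equiv> S_prop \<Sigma> +\<^sub>P Frob"
abbreviation "inl \<equiv> coproduct_inl (S_prop \<Sigma>) Frob"
abbreviation "inr \<equiv> coproduct_inr (S_prop \<Sigma>) Frob"
abbreviation "sgen \<equiv> \<lambda>g. inl (gen_class \<Sigma> {} g)"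

lemma is_prop_S: "is_prop (S_prop \<Sigma>)" and is_prop_Frob: "is_prop Frob" and is_prop_SF: "is_prop SF"
  unfolding S_prop_def Frob_def coproduct_prop_def by (rule is_prop_presented_prop)+

lemmas SF_coproduct = prop_coproduct[OF is_prop_S is_prop_Frob]

lemma inl_morphism: "prop_morphism (S_prop \<Sigma>) SF inl" and inr_morphism: "prop_morphism Frob SF inr"
  using SF_coproduct unfolding is_prop_coproduct_def by blast+

lemma SF_interp: "frob_interp SF (inr (fgen Mu)) (inr (fgen Eta)) (inr (fgen Delta)) (inr (fgen Eps)) \<Sigma>
    sgen"
proof (intro frob_interp.intro frob_interp_axioms.intro)
  show "frob_prop SF (inr (fgen Mu)) (inr (fgen Eta)) (inr (fgen Delta)) (inr (fgen Eps))"
    by (rule frob_image[OF inr_morphism frob_prop_Frob])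
  show "sgen g \<in> arr SF (arity \<Sigma> g) (coarity \<Sigma> g)" if "g \<in> gens \<Sigma>" for g
    using prop_mor.H_arr[OF prop_morI[OF inl_morphism] gen_arr[OF that, of "{}", folded S_prop_def]]
        by simp
qed

interpretation frob_interp SF "inr (fgen Mu)" "inr (fgen Eta)" "inr (fgen Delta)" "inr (fgen Eps)" \<Sigma> sgen
  by (rule SF_interp)

text \<open>Three universal properties combined: of the free PROP on \<open>\<Sigma>\<close>, of
  \<open>Frob\<close>, and of their coproduct tested on the type of arrows of
  \<open>R\<close>.\<close>

lemma SF_extend:
  assumes R: "frob_interp (R :: 'd prop_struct) mu eta delta eps \<Sigma> \<gamma>"
  shows "\<exists>H. prop_morphism SF R H \<and> H (inr (fgen Mu)) = mu \<and> H (inr (fgen Eta)) = eta \<and>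
    H (inr (fgen Delta)) = delta \<and> H (inr (fgen Eps)) = eps \<and> (\<forall>g \<in> gens \<Sigma>. H (sgen g) = \<gamma> g)"
proof -
  interpret R: frob_interp R mu eta delta eps \<Sigma> \<gamma> by (rule R)
  obtain G where G: "prop_morphism Frob R G" "G (fgen Mu) = mu" "G (fgen Eta) = eta"
      "G (fgen Delta) = delta" "G (fgen Eps) = eps"
    using frob_extend[OF R.frob_prop_axioms] by blast
  obtain F where F: "prop_morphism (S_prop \<Sigma>) R F" "\<forall>g \<in> gens \<Sigma>. F (gen_class \<Sigma> {} g) = \<gamma> g"
    using presented_prop_extend[OF R.is_prop_axioms R.\<gamma>, of "{}"] unfolding S_prop_def by blast
  obtain H where H: "prop_morphism SF R H" "eq_on_arrows (S_prop \<Sigma>) (H \<circ> inl) F"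
      "eq_on_arrows Frob (H \<circ> inr) G"
    using SF_coproduct[where ?'d = 'd] F(1) G(1) unfolding is_prop_coproduct_def by blast
  have "H (sgen g) = \<gamma> g" if "g \<in> gens \<Sigma>" for g
    using H(2) gen_arr[OF that, of "{}", folded S_prop_def] F(2) that unfolding eq_on_arrows_def by auto
  moreover have "H (inr (fgen g)) = G (fgen g)" for g
    using H(3) gen_arr[of g frob_sig frob_eqs, folded Frob_def] unfolding eq_on_arrows_def by auto
  ultimately show ?thesis using H(1) G by auto
qed

text \<open>Each hypergraph \<open>X\<close> yields a morphism \<open>H\<close> out of the coproduct
  that sends \<open>den a\<close> to the matrix of numbers of homomorphisms from the apex of
  \<open>a\<close> to \<open>X\<close> with given restrictions to the legs. Equal values thus give
  equal counts for every \<open>X\<close>.\<close>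

lemma den_inj:
  assumes c: "is_cospan \<Sigma> c" and d: "is_cospan \<Sigma> d" and eq: "den c = den d"
  shows "cospan_iso \<Sigma> c d"
proof (rule cospan_iso_of_counts[OF c d])
  show dc: "cdom c = cdom d" "ccod c = ccod d" using den_arr[OF c] den_arr[OF d] eq arr_disjoint
      by metis+
  fix X :: "'g hypergraph" and x y assume X: "hypergraph_over \<Sigma> X"
  note M = frob_interp_mat[OF X]
  obtain H where H: "prop_morphism SF (mat_prop (nodes X)) H" "H (inr (fgen Mu)) = mat_mu (nodes X)"
    "H (inr (fgen Eta)) = mat_eta (nodes X)" "H (inr (fgen Delta)) = mat_delta (nodes X)"
    "H (inr (fgen Eps)) = mat_eps (nodes X)" "\<And>g. g \<in> gens \<Sigma> \<Longrightarrow> H (sgen g) = weight \<Sigma> X g"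
    using SF_extend[OF M] by blast
  have count: "entry (H (den a)) x y = card (homs a X x y)"
    if a: "is_cospan \<Sigma> a" and w: "x \<in> words (nodes X) (cdom a)" "y \<in> words (nodes X) (ccod a)" for a
  proof -
    obtain \<beta> v hs where e: "enumeration (apex a) \<beta> v hs"
      using a enumeration_exists unfolding is_cospan_def by metis
    have "H (den a) = frob_interp.val (mat_prop (nodes X)) (mat_mu (nodes X)) (mat_eta (nodes X))
        (mat_delta (nodes X))
      (mat_eps (nodes X)) (weight \<Sigma> X) a \<beta> v hs"
      unfolding den_eq[OF a e] using val_image[OF H(1) SF_interp H(6) a e] H(2-5) by simp
    then show ?thesis using ent_val[OF X a e w] by simp
  qed
  \<comment> \<open>At words of the wrong length or over foreign labels the matrix entry carries no
    information, but there are no homomorphisms to count either.\<close>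
  have word: "x \<in> words (nodes X) (cdom a) \<and> y \<in> words (nodes X) (ccod a)"
    if "is_cospan \<Sigma> a" "h \<in> homs a X x y" for a h
    using that cospan_legs(1,2)[OF that(1)] unfolding homs_def hyp_hom_def
        by (auto simp: words_def PiE_iff)
  show "card (homs c X x y) = card (homs d X x y)"
  proof (cases "x \<in> words (nodes X) (cdom c) \<and> y \<in> words (nodes X) (ccod c)")
    case True
    then show ?thesis using count[OF c] count[OF d] eq dc by simp
  next
    case False
    then have "homs c X x y = {}" "homs d X x y = {}" using word[OF c] word[OF d] dc by auto
    then show ?thesis by simp
  qed
qed

section \<open>Fullness: every arrow of the coproduct is the value of a cospan\<close>

definition denoted :: "nat \<Rightarrow> nat \<Rightarrow> ('g sterm set + frob_gen sterm set) sterm set set" where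
  "denoted n m = {den c | c. is_cospan \<Sigma> c \<and> cdom c = n \<and> ccod c = m}"

lemma denotedI: "is_cospan \<Sigma> c \<Longrightarrow> den c = q \<Longrightarrow> cdom c = n \<Longrightarrow> ccod c = m \<Longrightarrow> q \<in> denoted n m"
  by (auto simp: denoted_def)

lemma denoted_seq:
  assumes "p \<in> denoted n m" "q \<in> denoted m k"
  shows "p \<Zsemi>\<^bsub>SF\<^esub> q \<in> denoted n k"
proof -
  obtain a b where a: "is_cospan \<Sigma> a" "p = den a" "cdom a = n" "ccod a = m"
    and b: "is_cospan \<Sigma> b" "q = den b" "cdom b = m" "ccod b = k"
    using assms by (auto simp: denoted_def)
  obtain c where c: "is_composite \<Sigma> a b c" "den c = den a \<Zsemi>\<^bsub>SF\<^esub> den b"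
    using composite_ex[OF a(1) b(1)] a b by auto
  then show ?thesis
    using is_composite_cospan[OF a(1) b(1) c(1)] a b
        by (intro denotedI[of c]) (auto simp: is_composite_def)
qed

lemma denoted_par:
  assumes "p \<in> denoted n m" "q \<in> denoted n' m'"
  shows "p \<oplus>\<^bsub>SF\<^esub> q \<in> denoted (n + n') (m + m')"
proof -
  obtain a b where a: "is_cospan \<Sigma> a" "p = den a" "cdom a = n" "ccod a = m"
    and b: "is_cospan \<Sigma> b" "q = den b" "cdom b = n'" "ccod b = m'"
    using assms by (auto simp: denoted_def)
  then show ?thesis
    using is_cospan_union[OF a(1) b(1)] den_union[OF a(1) b(1)]
    by (intro denotedI[of "cospan_union a b"]) (auto simp: cospan_union_def)
qed

lemma denoted_ident: "ident SF n \<in> denoted n n"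
  using den_id[of n] by (intro denotedI[of "id_cospan n"]) (auto simp: id_cospan_def)

lemma denoted_braid: "braid SF n m \<in> denoted (n + m) (m + n)"
  using den_swap[of n m] by (intro denotedI[of "swap_cospan n m"]) (auto simp: swap_cospan_def)

text \<open>One induction on terms serves three presentations: those of
  \<open>S_prop \<Sigma>\<close> and \<open>Frob\<close>, with \<open>K\<close> an injection into
  the coproduct, and that of the coproduct, with \<open>K\<close> the identity.\<close>

lemma denoted_presented:
  assumes PP: "PP = presented_prop \<Sigma>' E" and K: "prop_morphism PP SF K"
    and gen: "\<And>g. g \<in> gens \<Sigma>' \<Longrightarrow> K (gen_class \<Sigma>' E g) \<in> denoted (arity \<Sigma>' g) (coarity \<Sigma>' g)"
    and f: "f \<in> arr PP n m"
  shows "K f \<in> denoted n m"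
proof -
  have "K (term_class \<Sigma>' E t) \<in> denoted n m" if "has_type \<Sigma>' t n m" for t n m
    using that
  proof (induction rule: has_type.induct)
    case (Gen g)
    then show ?case by (rule gen)
  next
    case (Idn n)
    then show ?case using K denoted_ident by (simp add: prop_morphism_def PP flip: presented_ident)
  next
    case (Swap n m)
    then show ?case using K denoted_braid by (simp add: prop_morphism_def PP flip: presented_braid)
  next
    case (Seq s n m t k)
    have "term_class \<Sigma>' E s \<in> arr PP n m" "term_class \<Sigma>' E t \<in> arr PP m k"
      using Seq.hyps by (auto simp: PP presented_arr_iff)
    then have "K (term_class \<Sigma>' E s \<Zsemi>\<^bsub>PP\<^esub> term_class \<Sigma>' E t)
        = K (term_class \<Sigma>' E s) \<Zsemi>\<^bsub>SF\<^esub> K (term_class \<Sigma>' E t)"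
      using K unfolding prop_morphism_def by blast
    then show ?case using denoted_seq[OF Seq.IH] unfolding PP presented_seq[OF Seq.hyps] by simp
  next
    case (Par s n m t n' m')
    have "term_class \<Sigma>' E s \<in> arr PP n m" "term_class \<Sigma>' E t \<in> arr PP n' m'"
      using Par.hyps by (auto simp: PP presented_arr_iff)
    then have "K (term_class \<Sigma>' E s \<oplus>\<^bsub>PP\<^esub> term_class \<Sigma>' E t)
        = K (term_class \<Sigma>' E s) \<oplus>\<^bsub>SF\<^esub> K (term_class \<Sigma>' E t)"
      using K unfolding prop_morphism_def by blast
    then show ?case using denoted_par[OF Par.IH] unfolding PP presented_par[OF Par.hyps] by simp
  qed
  then show ?thesis using f by (auto simp: PP presented_arr_iff)
qed

lemma denoted_inl: "f \<in> arr (S_prop \<Sigma>) n m \<Longrightarrow> inl f \<in> denoted n m"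
proof (rule denoted_presented[OF S_prop_def inl_morphism])
  fix g assume "g \<in> gens \<Sigma>"
  then show "sgen g \<in> denoted (arity \<Sigma> g) (coarity \<Sigma> g)"
    using den_gen by (intro denotedI[of "gen_cospan g"]) (auto simp: gen_cospan_def Let_def)
qed

lemma denoted_nf:
  assumes "maps n v i" "maps m v j" "nf n m v i [] j = q"
  shows "q \<in> denoted n m"
  using den_discrete[OF HOL.refl assms(1,2)] assms(3)
  by (intro denotedI[of "\<lparr>cdom = n, ccod = m, apex = discrete v, in_leg = discrete_map n i, out_leg
      = discrete_map m j\<rparr>"]) auto

lemma denoted_inr: "f \<in> arr Frob n m \<Longrightarrow> inr f \<in> denoted n m"
proof (rule denoted_presented[OF Frob_def inr_morphism])
  fix g
  show "inr (fgen g) \<in> denoted (arity frob_sig g) (coarity frob_sig g)"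
  proof (cases g)
    case Mu then show ?thesis using denoted_nf[OF _ _ nf_mu] by (simp add: maps_def)
  next
    case Eta then show ?thesis using denoted_nf[OF _ _ nf_eta] by (simp add: maps_def)
  next
    case Delta then show ?thesis using denoted_nf[OF _ _ nf_delta] by (simp add: maps_def)
  next
    case Eps then show ?thesis using denoted_nf[OF _ _ nf_eps] by (simp add: maps_def)
  qed
qed

text \<open>Terms occur on two levels: the generators of the coproduct are arrows of the two
  summands, which are classes of terms in turn. The inner level is settled by
  \<open>denoted_inl\<close> and \<open>denoted_inr\<close>.\<close>

lemma den_surj: "q \<in> arr SF n m \<Longrightarrow> q \<in> denoted n m"
proof -
  let ?S = "coproduct_sig (S_prop \<Sigma>) Frob" and ?E = "coproduct_eqs (S_prop \<Sigma>) Frob"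
  assume q: "q \<in> arr SF n m"
  have "prop_morphism SF SF id" using is_prop_SF unfolding prop_morphism_def by simp
  then have "id q \<in> denoted n m"
  proof (rule denoted_presented[OF coproduct_prop_def _ _ q])
    fix g assume g: "g \<in> gens ?S"
    show "id (gen_class ?S ?E g) \<in> denoted (arity ?S g) (coarity ?S g)"
    proof (cases g)
      case (Inl f)
      then obtain k l where "f \<in> arr (S_prop \<Sigma>) k l" using g by (auto simp: coproduct_sig_def)
      then show ?thesis using denoted_inl prop_dom_eq[OF is_prop_S] Inl
          by (auto simp: coproduct_sig_def coproduct_inl_def)
    next
      case (Inr f)
      then obtain k l where "f \<in> arr Frob k l" using g by (auto simp: coproduct_sig_def)
      then show ?thesis using denoted_inr prop_dom_eq[OF is_prop_Frob] Inr
          by (auto simp: coproduct_sig_def coproduct_inr_def)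
    qed
  qed
  then show ?thesis by simp
qed

text \<open>Independence of representatives is read off from values: \<open>den_inj\<close> turns
  equality in the coproduct back into isomorphism of cospans, which avoids comparing pushouts of
  isomorphic diagrams.\<close>

lemma FTerm_seq:
  assumes a: "is_cospan \<Sigma> a" and b: "is_cospan \<Sigma> b" and c: "is_composite \<Sigma> a b c"
  shows "cospan_class \<Sigma> a \<Zsemi>\<^bsub>FTerm \<Sigma>\<^esub> cospan_class \<Sigma> b = cospan_class \<Sigma> c"
proof (intro set_eqI iffI)
  fix d assume "d \<in> cospan_class \<Sigma> a \<Zsemi>\<^bsub>FTerm \<Sigma>\<^esub> cospan_class \<Sigma> b"
  then obtain a' b' where ab': "cospan_iso \<Sigma> a a'" "cospan_iso \<Sigma> b b'" and d: "is_composite \<Sigma> a' b' d"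
    by (auto simp: FTerm_def cospan_class_def)
  have co: "is_cospan \<Sigma> a'" "is_cospan \<Sigma> b'" using ab' by (simp_all add: cospan_iso_def)
  have "den c = den d"
    using den_composite[OF a b c] den_composite[OF co d] den_iso[OF ab'(1)] den_iso[OF ab'(2)] by simp
  then show "d \<in> cospan_class \<Sigma> c"
    using den_inj is_composite_cospan[OF a b c] is_composite_cospan[OF co d]
        by (simp add: cospan_class_def)
next
  fix d assume "d \<in> cospan_class \<Sigma> c"
  then have "is_composite \<Sigma> a b d" using is_composite_iso[OF a b c] by (simp add: cospan_class_def)
  then show "d \<in> cospan_class \<Sigma> a \<Zsemi>\<^bsub>FTerm \<Sigma>\<^esub> cospan_class \<Sigma> b"
    using cospan_class_self[OF a] cospan_class_self[OF b] by (auto simp: FTerm_def)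
qed

text \<open>As for composition, \<open>den_union\<close> and \<open>den_inj\<close> replace the
  construction of an isomorphism between disjoint unions.\<close>

lemma FTerm_par:
  assumes a: "is_cospan \<Sigma> a" and b: "is_cospan \<Sigma> b"
  shows "cospan_class \<Sigma> a \<oplus>\<^bsub>FTerm \<Sigma>\<^esub> cospan_class \<Sigma> b = cospan_class \<Sigma> (cospan_union a b)"
proof -
  have eq: "cospan_class \<Sigma> (cospan_union a' b') = cospan_class \<Sigma> (cospan_union a b)"
    if ab': "a' \<in> cospan_class \<Sigma> a" "b' \<in> cospan_class \<Sigma> b" for a' b'
  proof -
    have iso: "cospan_iso \<Sigma> a a'" "cospan_iso \<Sigma> b b'" using ab' by (simp_all add: cospan_class_def)
    then have co: "is_cospan \<Sigma> a'" "is_cospan \<Sigma> b'" by (simp_all add: cospan_iso_def)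
    have "den (cospan_union a' b') = den (cospan_union a b)"
      using den_union[OF a b] den_union[OF co] den_iso[OF iso(1)] den_iso[OF iso(2)] by simp
    then show ?thesis using cospan_class_eq den_inj is_cospan_union[OF a b] is_cospan_union[OF co]
        by blast
  qed
  have "cospan_class \<Sigma> a \<oplus>\<^bsub>FTerm \<Sigma>\<^esub> cospan_class \<Sigma> b
    = (\<Union>a' \<in> cospan_class \<Sigma> a. \<Union>b' \<in> cospan_class \<Sigma> b. cospan_class \<Sigma> (cospan_union a' b'))"
    by (simp add: FTerm_def)
  also have "\<dots> = (\<Union>a' \<in> cospan_class \<Sigma> a. \<Union>b' \<in> cospan_class \<Sigma> b. cospan_class \<Sigma> (cospan_union a b))"
    by (intro SUP_cong HOL.refl eq)
  also have "\<dots> = cospan_class \<Sigma> (cospan_union a b)"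
    using cospan_class_self[OF a] cospan_class_self[OF b] by blast
  finally show ?thesis .
qed

lemma FTerm_iso: "FTerm \<Sigma> \<cong>\<^sub>P SF"
proof (rule isomorphic_propsI[OF is_prop_SF])
  \<comment> \<open>By \<open>den_iso\<close> the chosen representative does not affect the
    value.\<close>
  let ?F = "\<lambda>A. den (SOME c. c \<in> A)"
  have F: "?F (cospan_class \<Sigma> c) = den c" if c: "is_cospan \<Sigma> c" for c
  proof -
    have "(SOME d. d \<in> cospan_class \<Sigma> c) \<in> cospan_class \<Sigma> c"
        by (rule someI) (rule cospan_class_self[OF c])
    then show ?thesis using den_iso by (simp add: cospan_class_def)
  qed
  have arrE: "\<exists>c. A = cospan_class \<Sigma> c \<and> is_cospan \<Sigma> c \<and> cdom c = n \<and> ccod c = m"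
      if "A \<in> arr (FTerm \<Sigma>) n m" for A n m
    using that by (auto simp: FTerm_def)
  have arrI: "cospan_class \<Sigma> c \<in> arr (FTerm \<Sigma>) n m" if "is_cospan \<Sigma> c" "cdom c = n" "ccod c = m"
      for c n m
    using that by (auto simp: FTerm_def)
  have seq: "\<exists>c. A \<Zsemi>\<^bsub>FTerm \<Sigma>\<^esub> B = cospan_class \<Sigma> c \<and> is_cospan \<Sigma> c \<and> cdom c = n \<and> ccod c = k \<and> den c
      = ?F A \<Zsemi>\<^bsub>SF\<^esub> ?F B"
    if AB: "A \<in> arr (FTerm \<Sigma>) n m" "B \<in> arr (FTerm \<Sigma>) m k" for A B n m k
  proof -
    obtain a b where a: "A = cospan_class \<Sigma> a" "is_cospan \<Sigma> a" "cdom a = n" "ccod a = m"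
      and b: "B = cospan_class \<Sigma> b" "is_cospan \<Sigma> b" "cdom b = m" "ccod b = k"
      using arrE[OF AB(1)] arrE[OF AB(2)] by blast
    obtain c where c: "is_composite \<Sigma> a b c" "den c = den a \<Zsemi>\<^bsub>SF\<^esub> den b"
      using composite_ex[OF a(2) b(2)] a b by auto
    then show ?thesis
      using FTerm_seq[OF a(2) b(2) c(1)] is_composite_cospan[OF a(2) b(2) c(1)] a b
      by (intro exI[of _ c]) (auto simp: is_composite_def F)
  qed
  have par: "\<exists>c. A \<oplus>\<^bsub>FTerm \<Sigma>\<^esub> B = cospan_class \<Sigma> c \<and> is_cospan \<Sigma> c \<and> cdom c = n + n' \<and> ccod c
      = m + m' \<and> den c = ?F A \<oplus>\<^bsub>SF\<^esub> ?F B"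
    if AB: "A \<in> arr (FTerm \<Sigma>) n m" "B \<in> arr (FTerm \<Sigma>) n' m'" for A B n m n' m'
  proof -
    obtain a b where a: "A = cospan_class \<Sigma> a" "is_cospan \<Sigma> a" "cdom a = n" "ccod a = m"
      and b: "B = cospan_class \<Sigma> b" "is_cospan \<Sigma> b" "cdom b = n'" "ccod b = m'"
      using arrE[OF AB(1)] arrE[OF AB(2)] by blast
    show ?thesis
      using FTerm_par[OF a(2) b(2)] is_cospan_union[OF a(2) b(2)] den_union[OF a(2) b(2)] a b
      by (intro exI[of _ "cospan_union a b"]) (auto simp: cospan_union_def F)
  qed
  fix n m
  show "?F A \<in> arr SF n m" if "A \<in> arr (FTerm \<Sigma>) n m" for A
    using arrE[OF that] F den_arr by fastforce
  show "A = B" if "A \<in> arr (FTerm \<Sigma>) n m" "B \<in> arr (FTerm \<Sigma>) n m" "?F A = ?F B" for A B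
    using arrE[OF that(1)] arrE[OF that(2)] that(3) F cospan_class_eq den_inj by metis
  show "\<exists>A \<in> arr (FTerm \<Sigma>) n m. ?F A = q" if "q \<in> arr SF n m" for q
    using den_surj[OF that] F arrI unfolding denoted_def by blast
  show "ident (FTerm \<Sigma>) n \<in> arr (FTerm \<Sigma>) n n" "?F (ident (FTerm \<Sigma>) n) = ident SF n"
    using arrI[OF den_id(1)[of n]] F[OF den_id(1)[of n]] den_id(2)[of n]
        by (simp_all add: FTerm_def id_cospan_def)
  show "braid (FTerm \<Sigma>) n m \<in> arr (FTerm \<Sigma>) (n + m) (m + n)" "?F (braid (FTerm \<Sigma>) n m) = braid SF n m"
    using arrI[OF den_swap(1)[of n m]] F[OF den_swap(1)[of n m]] den_swap(2)[of n m]
        by (simp_all add: FTerm_def swap_cospan_def)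
  show "A \<Zsemi>\<^bsub>FTerm \<Sigma>\<^esub> B \<in> arr (FTerm \<Sigma>) n k" "?F (A \<Zsemi>\<^bsub>FTerm \<Sigma>\<^esub> B) = ?F A \<Zsemi>\<^bsub>SF\<^esub> ?F B"
    if "A \<in> arr (FTerm \<Sigma>) n m" "B \<in> arr (FTerm \<Sigma>) m k" for A B k
    using seq[OF that] arrI F by metis+
  show "A \<oplus>\<^bsub>FTerm \<Sigma>\<^esub> B \<in> arr (FTerm \<Sigma>) (n + n') (m + m')" "?F (A \<oplus>\<^bsub>FTerm \<Sigma>\<^esub> B) = ?F A \<oplus>\<^bsub>SF\<^esub> ?F B"
    if "A \<in> arr (FTerm \<Sigma>) n m" "B \<in> arr (FTerm \<Sigma>) n' m'" for A B n' m'
    using par[OF that] arrI F by metis+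
qed

end

theorem theorem3p3:
  fixes \<Sigma> :: "'g signature"
  shows "FTerm \<Sigma> \<cong>\<^sub>P S_prop \<Sigma> +\<^sub>P Frob"
  by (rule FTerm_iso)

end
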